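(* The initial data $u_0\in H^{1/2}_+$ of traveling waves for the cubic Szegő equation are given by $$u_0(z)=\begin{cases}\displaystyle \alpha\prod_{j=1}^N\frac{z-\overline{p_j}}{1-p_jz}\ \text{ for } \alpha\in\mathbb C,\ |p_j|<1,\ N\ge1, & \text{if } c=0,\\[2mm] \displaystyle \alpha\,\frac{z^\ell}{1-p^Nz^N}\ \text{ for } \alpha\in\mathbb C,\ N\ge1,\ 0\le\ell\le N-1, & \text{if } c\neq0,\end{cases}$$ where $c$ denotes the velocity of the traveling wave.
   Context: $\mathbb S^1$ is the unit circle in $\mathbb C$. $H^{1/2}_+$ is the space of $u\in H^{1/2}(\mathbb S^1)$ whose Fourier coefficients satisfy $\hat u(k)=0$ for all $k<0$; $L^2_+$ is defined likewise from $L^2(\mathbb S^1)$, and $\Pi:L^2(\mathbb S^1)\to L^2_+$ is the orthogonal projector. The cubic Szegő equation is $i\partial_tu=\Pi(|u|^2u)$. A solution $u$ is a traveling wave if there exist $\omega,c\in\mathbb R$ such that $u(t,z)=e^{-i\omega t}u(0,e^{-ict}z)$ for every $t\in\mathbb R$; $\omega$ is called the pulsation and $c$ the velocity of $u$. Equivalently, $u_0=u(0)$ satisfies $cDu_0+\omega u_0=\Pi(|u_0|^2u_0)$ with $D=-i\partial_\theta=z\partial_z$. Here $N$ and $\ell$ are integers, and $p$, $p_1,\dots,p_N$ are complex numbers.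
   Formalization: In the case c=0 the constants (N=0) are added to the list, since a nonzero constant is a traveling wave of velocity 0 but is not of the printed form with N≥1; and |p|<1 is written out for c≠0, as membership in H^{1/2}_+ requires. *)

theory Defs
  imports "HOL-Analysis.Analysis"
begin

text \<open>
  Functions on the unit circle are represented by functions on \<open>complex\<close>; only their values on
  \<open>sphere 0 1\<close> matter, and they are identified when they agree almost everywhere for the
  normalized arc length \<open>d\<theta> / (2 * pi)\<close>.
\<close>

definition circle_measure :: "complex measure" where
  "circle_measure =
     distr (uniform_measure lborel {0..<2 * pi}) (restrict_space borel (sphere 0 1)) cis"

lemma cis_measurable_circle:
  "cis \<in> measurable (uniform_measure lborel {0..<2 * pi}) (restrict_space borel (sphere 0 1))"
proof -
  have "cis \<in> borel_measurable borel"
    by (intro borel_measurable_continuous_onI continuous_intros)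
  then show ?thesis
    by (intro measurable_restrict_space2) auto
qed

lemma emeasure_circle_measure: "emeasure circle_measure (sphere 0 1) = 1"
proof -
  have "emeasure circle_measure (sphere 0 1) =
      emeasure (uniform_measure lborel {0..<2 * pi}) (cis -` sphere 0 1 \<inter> UNIV)"
    unfolding circle_measure_def
    by (subst emeasure_distr[OF cis_measurable_circle]) (auto simp: sets_restrict_space)
  also have "cis -` sphere 0 1 \<inter> UNIV = UNIV"
    by auto
  finally show ?thesis
    by (simp add: emeasure_uniform_measure ennreal_divide_self)
qed

definition L2_circle :: "(complex \<Rightarrow> complex) set" where
  "L2_circle = {f \<in> borel_measurable circle_measure.
                  integrable circle_measure (\<lambda>z. (cmod (f z))\<^sup>2)}"

definition L2_inner :: "(complex \<Rightarrow> complex) \<Rightarrow> (complex \<Rightarrow> complex) \<Rightarrow> complex" where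
  "L2_inner f g = (\<integral>z. f z * cnj (g z) \<partial>circle_measure)"

definition L2_norm :: "(complex \<Rightarrow> complex) \<Rightarrow> real" where
  "L2_norm f = sqrt (\<integral>z. (cmod (f z))\<^sup>2 \<partial>circle_measure)"

definition fourier_coeff :: "(complex \<Rightarrow> complex) \<Rightarrow> int \<Rightarrow> complex" where
  "fourier_coeff f k = (\<integral>z. f z * z powi (- k) \<partial>circle_measure)"

definition sobolev :: "real \<Rightarrow> (complex \<Rightarrow> complex) set" where
  "sobolev s = {f \<in> L2_circle.
     (\<lambda>k::int. (1 + (real_of_int k)\<^sup>2) powr s * (cmod (fourier_coeff f k))\<^sup>2) summable_on UNIV}"

definition sobolev_norm :: "real \<Rightarrow> (complex \<Rightarrow> complex) \<Rightarrow> real" where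
  "sobolev_norm s f =
     sqrt (\<Sum>\<^sub>\<infinity>k::int. (1 + (real_of_int k)\<^sup>2) powr s * (cmod (fourier_coeff f k))\<^sup>2)"

definition L2_plus :: "(complex \<Rightarrow> complex) set" where
  "L2_plus = {f \<in> L2_circle. \<forall>k<0. fourier_coeff f k = 0}"

definition H_half_plus :: "(complex \<Rightarrow> complex) set" where
  "H_half_plus = {f \<in> sobolev (1/2). \<forall>k<0. fourier_coeff f k = 0}"

text \<open>
  \<open>szego_projection f g\<close> says that \<open>g\<close> represents the orthogonal projection of \<open>f\<close> onto
  \<open>L2_plus\<close>.  It is a relation because the projection is determined only almost everywhere.
\<close>

definition szego_projection :: "(complex \<Rightarrow> complex) \<Rightarrow> (complex \<Rightarrow> complex) \<Rightarrow> bool" where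
  "szego_projection f g \<longleftrightarrow>
     f \<in> L2_circle \<and> g \<in> L2_plus \<and> (\<forall>h\<in>L2_plus. L2_inner (\<lambda>z. f z - g z) h = 0)"

text \<open>
  A solution is a continuous curve in \<open>H_half_plus\<close>, defined for all times, for which the equation
  holds with the time derivative taken in \<open>L2_circle\<close>.  For such curves \<open>|u|\<^sup>2 u\<close> is continuous
  in time with values in \<open>L2_circle\<close>, because the Sobolev space of order 1/2 embeds into every
  Lebesgue space of finite exponent; hence this agrees with the distributional meaning of the
  equation.
\<close>

definition szego_solution :: "(real \<Rightarrow> complex \<Rightarrow> complex) \<Rightarrow> bool" where
  "szego_solution u \<longleftrightarrow>
     (\<forall>t. u t \<in> H_half_plus) \<and>
     (\<forall>t. ((\<lambda>s. sobolev_norm (1/2) (\<lambda>z. u s z - u t z)) \<longlongrightarrow> 0) (at t)) \<and>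
     (\<forall>t. \<exists>g. szego_projection (\<lambda>z. complex_of_real ((cmod (u t z))\<^sup>2) * u t z) g \<and>
        ((\<lambda>h. L2_norm (\<lambda>z. \<i> * ((u (t + h) z - u t z) / complex_of_real h) - g z)) \<longlongrightarrow> 0) (at 0))"

definition traveling_wave :: "(real \<Rightarrow> complex \<Rightarrow> complex) \<Rightarrow> real \<Rightarrow> real \<Rightarrow> bool" where
  "traveling_wave u \<omega> c \<longleftrightarrow>
     szego_solution u \<and>
     (\<forall>t. AE z in circle_measure.
        u t z = exp (- \<i> * of_real \<omega> * of_real t) * u 0 (exp (- \<i> * of_real c * of_real t) * z))"

text \<open>
  The same traveling wave may have several velocities: a wave with initial datum \<open>\<alpha> * z ^ l\<close>
  has every real number as a velocity.
\<close>

definition traveling_wave_datum :: "real \<Rightarrow> (complex \<Rightarrow> complex) \<Rightarrow> bool" where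
  "traveling_wave_datum c u0 \<longleftrightarrow> (\<exists>u \<omega>. traveling_wave u \<omega> c \<and> u 0 = u0)"

end

theory Submission
  imports Defs "HOL-Complex_Analysis.Complex_Analysis"
begin

text \<open>
  Fourier coefficients turn traveling waves with velocity \<open>c\<close> and pulsation \<open>\<omega>\<close> into solutions of
  \<open>c D u + \<omega> u = \<Pi>(|u|\<^sup>2 u)\<close>. Conversely, for the listed data \<open>|u|\<^sup>2 u - c D u - \<omega> u\<close> is antianalytic.

  For \<open>c = 0\<close>, pairing the equation with \<open>z\<^sup>n u\<close> gives \<open>(|u|\<^sup>2 - \<omega>) |u|\<^sup>2 = 0\<close>, and a nonzero element of
  the Hardy space vanishes only on a null set, so \<open>|u|\<^sup>2 = \<omega>\<close>. As \<open>k |u_k|\<^sup>2\<close> is summable, a dimension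
  count then forces a linear recurrence on the coefficients, so \<open>u\<close> is rational; a rational function of
  constant modulus on the circle without poles in the closed disc is a multiple of a Blaschke product.

  For \<open>c \<noteq> 0\<close>, the equation makes the coefficients of \<open>u\<close> absolutely summable. Consider, for \<open>s = 0, 1\<close>,
  the Hankel operators \<open>H_s f = \<Pi>(z\<^sup>-\<^sup>s u cnj f)\<close> and the symmetric operators
  \<open>A_s = c D - T + (H_s\<^sup>2 + \<omega>) / 2\<close>, where \<open>T\<close> is the Toeplitz operator of \<open>|u|\<^sup>2\<close>. The equation gives
  \<open>A_s H_s + H_s A_s = - c s H_s\<close>, so \<open>A_s\<close> acts on the eigenspaces of \<open>H_s\<^sup>2\<close>. There the backward shift
  lowers the eigenvalues of \<open>A_s\<close> by \<open>c\<close>, except at the eigenvalue of the projection of \<open>u\<close>. Comparing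
  these finite ladders shows that \<open>u\<close> and its shift are eigenvectors, which makes the coefficients of
  \<open>u\<close> a geometric progression.
\<close>

section \<open>Weighted summable sequences\<close>

text \<open>For nonzero velocity the whole argument runs on absolutely summable coefficient
  sequences \<open>a\<close>: once \<open>k * a k\<close> is summable the Hankel matrix is
  absolutely summable, and pointwise limits under a summable majorant supply the compactness from
  which eigenvectors are obtained. The squared Hankel operators for \<open>s = 0\<close> and
  \<open>s = 1\<close> differ by a rank one operator built from \<open>a\<close>. Eigenvalues whose
  eigenspace is not orthogonal to \<open>a\<close> lie among \<open>\<omega> + c * l\<close> with
  \<open>l \<ge> 0\<close> for \<open>s = 0\<close> and among \<open>\<omega> - c * (j + 1)\<close>
  with \<open>j \<ge> 0\<close> for \<open>s = 1\<close>. These two progressions lie on opposite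
  sides of \<open>\<omega>\<close>, whereas a rank one perturbation makes spectra interlace. That
  conflict excludes a second such eigenvalue for \<open>s = 0\<close>, and it excludes negative
  velocities unless \<open>hank 1 a = 0\<close>, which is the case of monomials. For zero velocity
  the half derivative has another use: it makes the squared \<open>L2\<close> distances of
  \<open>u\<close> to its partial sums summable, and a sum of such distances below
  \<open>\<omega>\<close> is the contraction that ends the dimension count.\<close>

lemma summable_on_complex_comparison:
  fixes f :: "'a \<Rightarrow> complex"
  assumes "g summable_on A" "\<And>x. x \<in> A \<Longrightarrow> norm (f x) \<le> g x"
  shows "f summable_on A"
proof -
  have "(\<lambda>x. norm (f x)) summable_on A"
    by (rule summable_on_comparison_test[OF assms(1)]) (use assms(2) in auto)
  then show ?thesis
    by (rule abs_summable_summable)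
qed

lemma summable_on_norm:
  fixes f :: "'a \<Rightarrow> complex"
  shows "f summable_on A \<Longrightarrow> (\<lambda>x. norm (f x)) summable_on A"
  by (rule summable_on_iff_abs_summable_on_complex[THEN iffD1])

text \<open>Tonelli in the shape used for matrices: absolutely convergent rows whose sums have a
  summable majorant \<open>g\<close>, so that the row sums need not be computed.\<close>

lemma summable_on_prodI:
  fixes f :: "'a \<Rightarrow> 'b \<Rightarrow> complex"
  assumes "\<And>x. x \<in> A \<Longrightarrow> (\<lambda>y. norm (f x y)) summable_on B"
    and "\<And>x. x \<in> A \<Longrightarrow> infsum (\<lambda>y. norm (f x y)) B \<le> g x" and "g summable_on A"
  shows "(\<lambda>(x, y). f x y) summable_on A \<times> B"
proof -
  have "(\<lambda>x. norm (\<Sum>\<^sub>\<infinity>y\<in>B. norm (f x y))) summable_on A"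
    using summable_on_comparison_test[OF assms(3)] assms(2) by (simp add: infsum_nonneg)
  then have "(\<lambda>p. norm (case p of (x, y) \<Rightarrow> f x y)) summable_on Sigma A (\<lambda>_. B)"
    by (subst Infinite_Sum.abs_summable_on_Sigma_iff) (use assms(1) in simp)
  then show ?thesis
    by (rule abs_summable_summable)
qed

text \<open>Selecting terms injectively cannot enlarge a nonnegative series. The set
  \<open>P\<close> accounts for natural subtraction: in Toeplitz sums the index map is injective
  only where the subtraction is not truncated.\<close>

lemma infsum_partial_reindex_le:
  fixes h :: "'b \<Rightarrow> real"
  assumes h: "h summable_on UNIV" "\<And>n. 0 \<le> h n" and inj: "inj_on \<phi> P"
  shows "(\<lambda>i. if i \<in> P then h (\<phi> i) else 0) summable_on UNIV"
    and "(\<Sum>\<^sub>\<infinity>i. if i \<in> P then h (\<phi> i) else 0) \<le> infsum h UNIV"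
proof -
  have 1: "h summable_on \<phi> ` P"
    using h(1) by (rule summable_on_subset) auto
  then have "(h \<circ> \<phi>) summable_on P"
    using summable_on_reindex[OF inj] by blast
  then have "(\<lambda>i. if i \<in> P then h (\<phi> i) else 0) summable_on P"
    by (rule summable_on_cong[THEN iffD1, rotated]) auto
  then show "(\<lambda>i. if i \<in> P then h (\<phi> i) else 0) summable_on UNIV"
    by (rule summable_on_cong_neutral[THEN iffD1, rotated -1]) auto
  have "(\<Sum>\<^sub>\<infinity>i. if i \<in> P then h (\<phi> i) else 0) = infsum (h \<circ> \<phi>) P"
    by (rule infsum_cong_neutral) auto
  also have "\<dots> = infsum h (\<phi> ` P)"
    using infsum_reindex[OF inj] by metis
  also have "\<dots> \<le> infsum h UNIV"
    by (rule infsum_mono2) (use 1 h in auto)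
  finally show "(\<Sum>\<^sub>\<infinity>i. if i \<in> P then h (\<phi> i) else 0) \<le> infsum h UNIV" .
qed

text \<open>The weight uses \<open>Suc k\<close> so that it does not vanish at 0. Each unit of
  \<open>p\<close> pays for one application of \<open>D\<close>.\<close>

definition weighted_l1 :: "nat \<Rightarrow> (nat \<Rightarrow> complex) \<Rightarrow> bool" where
  "weighted_l1 p f \<longleftrightarrow> (\<lambda>k. real (Suc k) ^ p * norm (f k)) summable_on UNIV"

lemma weighted_l1_0: "weighted_l1 0 f \<longleftrightarrow> f summable_on UNIV"
  by (simp add: weighted_l1_def summable_on_iff_abs_summable_on_complex)

lemma weighted_l1_mono:
  assumes "weighted_l1 q f" "p \<le> q" shows "weighted_l1 p f"
  using assms unfolding weighted_l1_def
  by (elim summable_on_comparison_test) (auto intro!: mult_right_mono power_increasing)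

lemma weighted_l1_summable: "weighted_l1 p f \<Longrightarrow> f summable_on UNIV"
  using weighted_l1_mono[of p f 0] by (simp add: weighted_l1_0)

lemma weighted_l1_bounded:
  assumes "weighted_l1 p f"
  obtains B where "B \<ge> 0" "\<And>k. norm (f k) \<le> B"
proof
  have s: "(\<lambda>k. norm (f k)) summable_on UNIV"
    using assms by (intro summable_on_norm weighted_l1_summable)
  show "infsum (\<lambda>k. norm (f k)) UNIV \<ge> 0"
    by (intro infsum_nonneg) auto
  show "norm (f k) \<le> infsum (\<lambda>k. norm (f k)) UNIV" for k
    using finite_sum_le_infsum[OF s, of "{k}"] by simp
qed

lemma weighted_l1_lincomb:
  assumes "weighted_l1 p f" "weighted_l1 p g"
  shows "weighted_l1 p (\<lambda>k. x * f k + y * g k)"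
proof -
  have "(\<lambda>k. norm x * (real (Suc k) ^ p * norm (f k)) + norm y * (real (Suc k) ^ p * norm (g k))) summable_on UNIV"
    using assms unfolding weighted_l1_def
    by (intro summable_on_add summable_on_cmult_right) auto
  then show ?thesis
    unfolding weighted_l1_def
  proof (rule summable_on_comparison_test)
    fix k :: nat
    have "real (Suc k) ^ p * norm (x * f k + y * g k) \<le> real (Suc k) ^ p * (norm x * norm (f k) + norm y * norm (g k))"
      by (intro mult_left_mono) (metis norm_mult norm_triangle_ineq, simp)
    then show "real (Suc k) ^ p * norm (x * f k + y * g k) \<le>
        norm x * (real (Suc k) ^ p * norm (f k)) + norm y * (real (Suc k) ^ p * norm (g k))"
      by (simp add: algebra_simps)
  qed auto
qed

lemma weighted_l1_cmult: "weighted_l1 p f \<Longrightarrow> weighted_l1 p (\<lambda>k. x * f k)"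
  using weighted_l1_lincomb[of p f f x 0] by simp

lemma weighted_l1_comparison:
  assumes "weighted_l1 p f" "\<And>k. norm (g k) \<le> C * norm (f k)"
  shows "weighted_l1 p g"
proof -
  have "(\<lambda>k. C * (real (Suc k) ^ p * norm (f k))) summable_on UNIV"
    using assms(1) unfolding weighted_l1_def by (rule summable_on_cmult_right)
  then show ?thesis
    unfolding weighted_l1_def
  proof (rule summable_on_comparison_test)
    fix k
    have "real (Suc k) ^ p * norm (g k) \<le> real (Suc k) ^ p * (C * norm (f k))"
      by (intro mult_left_mono assms) simp
    then show "real (Suc k) ^ p * norm (g k) \<le> C * (real (Suc k) ^ p * norm (f k))"
      by (simp add: algebra_simps)
  qed auto
qed

lemma weighted_l1_Suc:
  "weighted_l1 (Suc p) f \<longleftrightarrow> weighted_l1 p (\<lambda>k. of_nat (Suc k) * f k)"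
  unfolding weighted_l1_def
  by (simp add: norm_mult mult_ac del: of_nat_Suc)

lemma weighted_l1_shift:
  assumes "weighted_l1 p f" shows "weighted_l1 p (\<lambda>k. f (k + s))"
proof -
  have "((\<lambda>k. real (Suc k) ^ p * norm (f k)) \<circ> (\<lambda>k. k + s)) summable_on UNIV"
    using assms unfolding weighted_l1_def
    by (subst summable_on_reindex[symmetric]) (auto intro: summable_on_subset)
  then show ?thesis
    unfolding weighted_l1_def
    by (rule summable_on_comparison_test) (auto intro!: mult_right_mono power_mono)
qed

lemma weighted_l1_Suc_shift: "weighted_l1 p f \<Longrightarrow> weighted_l1 p (\<lambda>k. f (Suc k))"
  using weighted_l1_shift[of p f 1] by simp

lemma weighted_l1_of_nat_mult: 
  assumes "weighted_l1 (Suc p) f" shows "weighted_l1 p (\<lambda>k. of_nat k * f k)"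
  using assms unfolding weighted_l1_Suc
proof (rule weighted_l1_comparison)
  show "norm (of_nat k * f k) \<le> 1 * norm (of_nat (Suc k) * f k)" for k
    by (simp add: norm_mult mult_right_mono del: of_nat_Suc)
qed

lemma summable_on_mult_bounded:
  fixes f g :: "'a \<Rightarrow> complex"
  assumes "f summable_on A" "\<And>k. k \<in> A \<Longrightarrow> norm (g k) \<le> B"
  shows "(\<lambda>k. f k * g k) summable_on A" "(\<lambda>k. g k * f k) summable_on A"
proof -
  have "(\<lambda>k. norm (f k) * B) summable_on A"
    by (intro summable_on_cmult_left summable_on_norm assms)
  then show "(\<lambda>k. f k * g k) summable_on A"
    by (rule summable_on_complex_comparison)
       (use assms(2) in \<open>auto simp: norm_mult intro!: mult_left_mono\<close>)
  then show "(\<lambda>k. g k * f k) summable_on A"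
    by (simp add: mult.commute)
qed

section \<open>The inner product of sequences\<close>

definition seq_inner :: "(nat \<Rightarrow> complex) \<Rightarrow> (nat \<Rightarrow> complex) \<Rightarrow> complex" where
  "seq_inner f g = (\<Sum>\<^sub>\<infinity>k. f k * cnj (g k))"

lemma summable_seq_inner:
  assumes "weighted_l1 p f" "weighted_l1 q g"
  shows "(\<lambda>k. f k * cnj (g k)) summable_on UNIV"
proof -
  obtain B where "\<And>k. norm (g k) \<le> B" 
    using weighted_l1_bounded[OF assms(2)] by metis
  then show ?thesis
    by (intro summable_on_mult_bounded weighted_l1_summable[OF assms(1)]) auto
qed

lemma seq_inner_cnj: "seq_inner g f = cnj (seq_inner f g)"
  unfolding seq_inner_def infsum_cnj[symmetric] by (simp add: mult.commute)

lemma seq_inner_lincomb_left: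
  assumes "weighted_l1 0 f" "weighted_l1 0 g" "weighted_l1 0 h"
  shows "seq_inner (\<lambda>k. x * f k + y * g k) h = x * seq_inner f h + y * seq_inner g h"
proof -
  have "seq_inner (\<lambda>k. x * f k + y * g k) h = (\<Sum>\<^sub>\<infinity>k. x * (f k * cnj (h k)) + y * (g k * cnj (h k)))"
    unfolding seq_inner_def by (simp add: algebra_simps)
  also have "\<dots> = (\<Sum>\<^sub>\<infinity>k. x * (f k * cnj (h k))) + (\<Sum>\<^sub>\<infinity>k. y * (g k * cnj (h k)))"
    by (intro infsum_add summable_on_cmult_right summable_seq_inner[of 0 _ 0] assms)
  finally show ?thesis
    by (simp add: seq_inner_def infsum_cmult_right')
qed

lemma seq_inner_lincomb_right:
  assumes "weighted_l1 0 f" "weighted_l1 0 g" "weighted_l1 0 h"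
  shows "seq_inner h (\<lambda>k. x * f k + y * g k) = cnj x * seq_inner h f + cnj y * seq_inner h g"
  using seq_inner_lincomb_left[OF assms, of x y]
  by (subst (1 2 3) seq_inner_cnj) simp

lemma seq_inner_cmult_left: "seq_inner (\<lambda>k. x * f k) h = x * seq_inner f h"
  by (simp add: seq_inner_def infsum_cmult_right' mult.assoc)

lemma seq_inner_cmult_right: "seq_inner h (\<lambda>k. x * f k) = cnj x * seq_inner h f"
  by (subst (1 2) seq_inner_cnj) (simp add: seq_inner_cmult_left)

definition seq_norm :: "(nat \<Rightarrow> complex) \<Rightarrow> real" where
  "seq_norm f = sqrt (\<Sum>\<^sub>\<infinity>k. (norm (f k))\<^sup>2)"

lemma summable_norm_square:
  assumes "weighted_l1 p f" shows "(\<lambda>k. (norm (f k))\<^sup>2) summable_on UNIV"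
proof -
  have "(\<lambda>k. norm (f k * cnj (f k))) summable_on UNIV"
    by (intro summable_on_norm summable_seq_inner[OF assms assms])
  then show ?thesis
    by (simp add: norm_mult power2_eq_square)
qed

lemma seq_inner_self:
  assumes "weighted_l1 p f" shows "seq_inner f f = of_real ((seq_norm f)\<^sup>2)"
proof -
  have "seq_inner f f = (\<Sum>\<^sub>\<infinity>k. complex_of_real ((norm (f k))\<^sup>2))"
    unfolding seq_inner_def by (simp only: complex_norm_square)
  also have "\<dots> = complex_of_real (\<Sum>\<^sub>\<infinity>k. (norm (f k))\<^sup>2)"
    by (intro infsumI has_sum_of_real has_sum_infsum summable_norm_square[OF assms])
  finally show ?thesis
    by (simp add: seq_norm_def infsum_nonneg)
qed

lemma norm_le_seq_norm:
  assumes "weighted_l1 p f" shows "norm (f k) \<le> seq_norm f"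
proof -
  have "(norm (f k))\<^sup>2 \<le> (\<Sum>\<^sub>\<infinity>k. (norm (f k))\<^sup>2)"
    using finite_sum_le_infsum[OF summable_norm_square[OF assms], of "{k}"] by simp
  then show ?thesis
    unfolding seq_norm_def using real_le_rsqrt by blast
qed

lemma seq_norm_nonneg: "seq_norm f \<ge> 0"
  by (simp add: seq_norm_def infsum_nonneg)

lemma seq_norm_pos:
  assumes "weighted_l1 p f" "f k \<noteq> 0" shows "seq_norm f > 0"
proof -
  have "0 < norm (f k)"
    using assms(2) by simp
  also have "\<dots> \<le> seq_norm f"
    by (rule norm_le_seq_norm[OF assms(1)])
  finally show ?thesis .
qed

lemma seq_norm_eq_0:
  assumes "weighted_l1 p f" "seq_norm f = 0" shows "f = (\<lambda>_. 0)"
proof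
  show "f k = 0" for k
    using norm_le_seq_norm[OF assms(1), of k] assms(2) by simp
qed

lemma seq_inner_self_eq_0:
  assumes "weighted_l1 p f" "seq_inner f f = 0" shows "f = (\<lambda>_. 0)"
  using assms by (intro seq_norm_eq_0[OF assms(1)]) (simp add: seq_inner_self[OF assms(1)])

lemma seq_inner_le_norm:
  assumes "weighted_l1 0 f" "weighted_l1 0 g"
  shows "Re (seq_inner f g) \<le> seq_norm f * seq_norm g"
proof (cases "seq_norm g = 0")
  case True
  then have "g = (\<lambda>_. 0)"
    using seq_norm_eq_0 assms by blast
  then show ?thesis
    using True by (simp add: seq_inner_def)
next
  case False
  define A where "A = (seq_norm g)\<^sup>2"
  define R where "R = Re (seq_inner f g)"
  \<comment> \<open>The usual \<open>f - (R / A) * g\<close> multiplied by \<open>A\<close>, which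
    avoids a division.\<close>
  define h where "h = (\<lambda>k. complex_of_real A * f k + complex_of_real (- R) * g k)"
  have A: "A > 0"
    using False by (simp add: A_def)
  have h: "weighted_l1 0 h"
    unfolding h_def by (intro weighted_l1_lincomb assms)
  have "seq_inner h h = of_real A * seq_inner f h + of_real (- R) * seq_inner g h"
    by (subst h_def, intro seq_inner_lincomb_left assms h)
  also have "seq_inner f h = cnj A * seq_inner f f + cnj (- R) * seq_inner f g"
    unfolding h_def by (subst seq_inner_lincomb_right) (use assms in auto)
  also have "seq_inner g h = cnj A * seq_inner g f + cnj (- R) * seq_inner g g"
    unfolding h_def by (subst seq_inner_lincomb_right) (use assms in auto)
  finally have "seq_inner h h = A * (A * seq_inner f f - R * seq_inner f g) - R * (A * cnj (seq_inner f g) - R * A)"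
    by (simp add: seq_inner_cnj[of g f] seq_inner_self[OF assms(2)] A_def)
  then have "Re (seq_inner h h) = A * (A * (seq_norm f)\<^sup>2 - R * R) - R * (A * R - R * A)"
    by (simp add: seq_inner_self[OF assms(1)] R_def)
  moreover have "Re (seq_inner h h) \<ge> 0"
    by (simp add: seq_inner_self[OF h])
  ultimately have "A * (A * (seq_norm f)\<^sup>2 - R * R) \<ge> 0"
    by simp
  then have "A * (seq_norm f)\<^sup>2 - R * R \<ge> 0"
    using A by (simp add: zero_le_mult_iff)
  then have "R\<^sup>2 \<le> (seq_norm f * seq_norm g)\<^sup>2"
    by (simp add: A_def power2_eq_square mult_ac)
  then show ?thesis
    unfolding R_def[symmetric]
    by (rule power2_le_imp_le) (simp add: seq_norm_nonneg)
qed

lemma infsum_split_initial: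
  fixes g :: "nat \<Rightarrow> complex"
  assumes "g summable_on UNIV"
  shows "infsum g UNIV = (\<Sum>i<n. g i) + (\<Sum>\<^sub>\<infinity>i. g (i + n))"
proof -
  have "infsum g UNIV = infsum g ({..<n} \<union> {n..})"
    by (rule arg_cong[where f = "infsum g"]) auto
  also have "\<dots> = infsum g {..<n} + infsum g {n..}"
    by (rule infsum_Un_disjoint) (use assms in \<open>auto intro: summable_on_subset\<close>)
  also have "infsum g {n..} = (\<Sum>\<^sub>\<infinity>i. g (i + n))"
    by (rule infsum_reindex_bij_witness[of _ "\<lambda>i. i + n" "\<lambda>i. i - n"]) auto
  finally show ?thesis by simp
qed

lemma infsum_split_0:
  fixes g :: "nat \<Rightarrow> complex"
  assumes "g summable_on UNIV"
  shows "infsum g UNIV = g 0 + (\<Sum>\<^sub>\<infinity>i. g (Suc i))"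
  using infsum_split_initial[OF assms, of 1] by simp

lemma summable_on_triple_product:
  fixes p r :: "nat \<Rightarrow> complex"
  assumes "p summable_on UNIV" "r summable_on UNIV" and B: "\<And>i j. norm (q i j) \<le> B"
  shows "(\<lambda>(i, j). p i * q i j * r j) summable_on UNIV \<times> UNIV"
proof (rule summable_on_prodI)
  have s: "(\<lambda>j. norm (p i) * B * norm (r j)) summable_on UNIV" for i
    by (intro summable_on_cmult_right summable_on_norm assms)
  have le: "norm (p i * q i j * r j) \<le> norm (p i) * B * norm (r j)" for i j
    using B[of i j] by (auto simp: norm_mult intro!: mult_right_mono mult_left_mono)
  show s': "(\<lambda>j. norm (p i * q i j * r j)) summable_on UNIV" for i
    by (rule summable_on_comparison_test[OF s le]) auto
  show "(\<Sum>\<^sub>\<infinity>j. norm (p i * q i j * r j)) \<le> norm (p i) * (B * (\<Sum>\<^sub>\<infinity>j. norm (r j)))" for i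
    using infsum_mono[OF s' s le] by (simp add: infsum_cmult_right' mult.assoc)
  show "(\<lambda>i. norm (p i) * (B * (\<Sum>\<^sub>\<infinity>j. norm (r j)))) summable_on UNIV"
    by (intro summable_on_cmult_left summable_on_norm assms)
qed

text \<open>Fubini for a merely bounded kernel \<open>q\<close>, summability coming from the two
  outer factors. It moves Hankel and Toeplitz matrices across inner products and composes
  them.\<close>

lemma infsum_triple_product:
  fixes p r :: "nat \<Rightarrow> complex"
  assumes "p summable_on UNIV" "r summable_on UNIV" and B: "\<And>i j. norm (q i j) \<le> B"
  shows "(\<Sum>\<^sub>\<infinity>i. p i * (\<Sum>\<^sub>\<infinity>j. q i j * r j)) = (\<Sum>\<^sub>\<infinity>j. r j * (\<Sum>\<^sub>\<infinity>i. p i * q i j))"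
  using infsum_swap_banach[OF summable_on_triple_product[OF assms]]
  by (simp add: infsum_cmult_right'[symmetric] mult_ac)

section \<open>Hankel operators with a decaying symbol\<close>

text \<open>Kept apart from \<open>hankel\<close> because at first only absolute summability of the
  coefficients is known. The Toeplitz operator, bounded already at this level, is then used to gain
  the weight that \<open>hankel\<close> assumes.\<close>

locale summable_symbol =
  fixes a :: "nat \<Rightarrow> complex"
  assumes a0: "weighted_l1 0 a"
begin

lemma a_summable: "(\<lambda>k. a (k + s)) summable_on UNIV"
  using weighted_l1_shift[OF a0, of s] by (simp add: weighted_l1_0)

lemma a_summable': "(\<lambda>k. a (s + k)) summable_on UNIV"
  using a_summable[of s] by (simp add: add.commute)

definition sup_a :: real where "sup_a = (SUP k. norm (a k))"

lemma a_le: "norm (a k) \<le> sup_a"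
proof -
  obtain B where B: "\<And>k. norm (a k) \<le> B"
    using weighted_l1_bounded[OF a0] by metis
  show ?thesis
    unfolding sup_a_def by (rule cSUP_upper) (use B in \<open>auto intro!: bdd_aboveI2\<close>)
qed

lemma sup_a_nonneg: "sup_a \<ge> 0"
  using a_le[of 0] norm_ge_zero order_trans by blast

end

text \<open>In the matrix \<open>a (k + j)\<close> the entry \<open>a n\<close> occurs
  \<open>n + 1\<close> times, so weight one is exactly absolute summability of the whole
  matrix.\<close>

locale hankel =
  fixes a :: "nat \<Rightarrow> complex"
  assumes decay: "weighted_l1 1 a"

sublocale hankel \<subseteq> summable_symbol
  by standard (rule weighted_l1_mono[OF decay], simp)

context hankel
begin

definition hank :: "nat \<Rightarrow> (nat \<Rightarrow> complex) \<Rightarrow> nat \<Rightarrow> complex" where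
  "hank s f k = (\<Sum>\<^sub>\<infinity>j. a (k + j + s) * cnj (f j))"

text \<open>Absolute row sums of the Hankel matrix. Every \<open>hank s f\<close> with bounded
  \<open>f\<close> is dominated by a multiple of \<open>tail\<close>, so the summability of
  \<open>tail\<close> plays the role of compactness.\<close>

definition tail :: "nat \<Rightarrow> real" where
  "tail k = (\<Sum>\<^sub>\<infinity>j. norm (a (k + j)))"

lemma summable_tail_pair: "(\<lambda>(k, j). norm (a (k + j))) summable_on UNIV \<times> UNIV"
proof -
  have "(\<lambda>p. norm (a (fst p))) summable_on Sigma UNIV (\<lambda>n. {..n})"
  proof (rule summable_on_SigmaI)
    show "((\<lambda>k. norm (a (fst (n, k)))) has_sum real (Suc n) * norm (a n)) {..n}" for n
      by (auto simp: has_sum_finite_iff)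
    show "(\<lambda>n. real (Suc n) * norm (a n)) summable_on UNIV"
      using decay by (simp add: weighted_l1_def)
  qed auto
  also have "?this \<longleftrightarrow> (\<lambda>(k, j). norm (a (k + j))) summable_on UNIV \<times> UNIV"
    by (rule summable_on_reindex_bij_witness[of _ "\<lambda>(k, j). (k + j, k)" "\<lambda>(n, k). (k, n - k)"]) auto
  finally show ?thesis .
qed

lemma tail_summable: "tail summable_on UNIV"
  using summable_on_Sigma_banach[OF summable_tail_pair] by (simp add: tail_def[abs_def])

lemma tail_nonneg: "tail k \<ge> 0"
  by (auto simp: tail_def intro: infsum_nonneg)

lemma hank_summable:
  assumes "\<And>j. norm (f j) \<le> B"
  shows "(\<lambda>j. a (k + j + s) * cnj (f j)) summable_on UNIV"
  by (intro summable_on_mult_bounded[where B = B]) 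
     (use assms a_summable'[of "k + s"] in \<open>auto simp: add_ac\<close>)

lemma hank_summable_l1: "weighted_l1 p f \<Longrightarrow> (\<lambda>j. a (k + j + s) * cnj (f j)) summable_on UNIV"
  by (metis hank_summable weighted_l1_bounded)

lemma hank_bound:
  assumes B: "\<And>j. norm (f j) \<le> B"
  shows "norm (hank s f k) \<le> B * tail k"
proof -
  have B0: "B \<ge> 0"
    using B[of 0] by (meson norm_ge_zero order_trans)
  have s: "(\<lambda>j. norm (a (k + j + s))) summable_on UNIV"
    using summable_on_norm[OF a_summable'[of "k + s"]] by (simp add: add_ac)
  have s0: "(\<lambda>j. norm (a (k + j))) summable_on UNIV"
    using summable_on_norm[OF a_summable'[of k]] .
  have "norm (hank s f k) \<le> (\<Sum>\<^sub>\<infinity>j. norm (a (k + j + s) * cnj (f j)))"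
    unfolding hank_def by (intro norm_infsum_bound summable_on_norm hank_summable[OF B])
  also have "\<dots> \<le> (\<Sum>\<^sub>\<infinity>j. norm (a (k + j + s)) * B)"
    by (intro infsum_mono summable_on_norm hank_summable[OF B] summable_on_cmult_left s)
       (auto simp: norm_mult intro!: mult_left_mono B)
  also have "\<dots> = B * (\<Sum>\<^sub>\<infinity>j. norm (a (k + j + s)))"
    by (simp add: infsum_cmult_right' mult.commute)
  also have "(\<Sum>\<^sub>\<infinity>j. norm (a (k + j + s))) \<le> tail k"
    using infsum_partial_reindex_le(2)[OF s0, of "\<lambda>j. j + s" UNIV] by (simp add: tail_def add_ac)
  finally show ?thesis
    using B0 by (simp add: mult_left_mono)
qed

text \<open>The output index never exceeds the index of the symbol, so the weight can be put on
  \<open>a\<close>. Hence eigenvectors of \<open>hank2 s\<close> for nonzero eigenvalues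
  automatically lie in the domain of \<open>D\<close>.\<close>

lemma hank_w1:
  assumes f: "weighted_l1 0 f" shows "weighted_l1 1 (hank s f)"
proof -
  define S where "S = (\<Sum>\<^sub>\<infinity>n. real (Suc n) ^ 1 * norm (a n))"
  have h: "(\<lambda>n. real (Suc n) ^ 1 * norm (a n)) summable_on UNIV"
    using decay by (simp add: weighted_l1_def)
  have le: "norm (of_nat (Suc k) * (a (k + j + s) * cnj (f j)))
      \<le> norm (f j) * (real (Suc (k + j + s)) ^ 1 * norm (a (k + j + s)))" for j k
  proof -
    have "norm (of_nat (Suc k) * (a (k + j + s) * cnj (f j))) = norm (f j) * (real (Suc k) * norm (a (k + j + s)))"
      by (simp add: norm_mult mult_ac del: of_nat_Suc)
    also have "\<dots> \<le> norm (f j) * (real (Suc (k + j + s)) ^ 1 * norm (a (k + j + s)))"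
      by (intro mult_left_mono mult_right_mono) auto
    finally show ?thesis .
  qed
  have r: "(\<lambda>k. real (Suc (k + j + s)) ^ 1 * norm (a (k + j + s))) summable_on UNIV"
      "(\<Sum>\<^sub>\<infinity>k. real (Suc (k + j + s)) ^ 1 * norm (a (k + j + s))) \<le> S" for j
    using infsum_partial_reindex_le[OF h, of "\<lambda>k. k + j + s" UNIV] by (auto simp: S_def inj_on_def)
  have "(\<lambda>(j, k). of_nat (Suc k) * (a (k + j + s) * cnj (f j))) summable_on UNIV \<times> UNIV"
  proof (rule summable_on_prodI)
    show s: "(\<lambda>k. norm (of_nat (Suc k) * (a (k + j + s) * cnj (f j)))) summable_on UNIV" for j
      by (rule summable_on_comparison_test[OF summable_on_cmult_right[OF r(1)] le]) auto
    show "(\<Sum>\<^sub>\<infinity>k. norm (of_nat (Suc k) * (a (k + j + s) * cnj (f j)))) \<le> norm (f j) * S" for j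
      using infsum_mono[OF s summable_on_cmult_right[OF r(1)] le] r(2)[of j]
      by (subst (asm) infsum_cmult_right') (meson mult_left_mono norm_ge_zero order_trans)
    show "(\<lambda>j. norm (f j) * S) summable_on UNIV"
      using f by (intro summable_on_cmult_left summable_on_norm) (simp add: weighted_l1_0)
  qed
  then have "(\<lambda>(k, j). of_nat (Suc k) * (a (k + j + s) * cnj (f j))) summable_on UNIV \<times> UNIV"
    by (subst summable_on_swap) simp
  from summable_on_Sigma_banach[OF this]
  have "(\<lambda>k. of_nat (Suc k) * hank s f k) summable_on UNIV"
    by (simp add: hank_def infsum_cmult_right' del: of_nat_Suc)
  then show ?thesis
    by (simp add: weighted_l1_Suc weighted_l1_0 del: of_nat_Suc)
qed

lemma hank_lincomb:
  assumes "weighted_l1 0 f" "weighted_l1 0 g"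
  shows "hank s (\<lambda>k. x * f k + y * g k) = (\<lambda>k. cnj x * hank s f k + cnj y * hank s g k)"
proof
  fix k
  have "hank s (\<lambda>k. x * f k + y * g k) k =
     (\<Sum>\<^sub>\<infinity>j. cnj x * (a (k + j + s) * cnj (f j)) + cnj y * (a (k + j + s) * cnj (g j)))"
    unfolding hank_def by (simp add: algebra_simps)
  also have "\<dots> = (\<Sum>\<^sub>\<infinity>j. cnj x * (a (k + j + s) * cnj (f j))) + (\<Sum>\<^sub>\<infinity>j. cnj y * (a (k + j + s) * cnj (g j)))"
    by (intro infsum_add summable_on_cmult_right hank_summable_l1[of 0] assms)
  finally show "hank s (\<lambda>k. x * f k + y * g k) k = cnj x * hank s f k + cnj y * hank s g k"
    by (simp add: hank_def infsum_cmult_right')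
qed

lemma hank_cmult: "hank s (\<lambda>k. x * f k) = (\<lambda>k. cnj x * hank s f k)"
  by (rule ext) (simp add: hank_def infsum_cmult_right'[symmetric] mult_ac)

text \<open>The matrix is symmetric and the operator antilinear, so exchanging \<open>f\<close> and
  \<open>g\<close> takes the place of the adjoint relation. In consequence \<open>hank2 s\<close> is
  linear, symmetric and nonnegative.\<close>

lemma hank_symmetric:
  assumes f: "weighted_l1 0 f" and g: "weighted_l1 0 g"
  shows "seq_inner (hank s f) g = seq_inner (hank s g) f"
proof -
  have "seq_inner (hank s f) g = (\<Sum>\<^sub>\<infinity>k. cnj (g k) * (\<Sum>\<^sub>\<infinity>j. a (k + j + s) * cnj (f j)))"
    by (simp add: seq_inner_def hank_def mult.commute)
  also have "\<dots> = (\<Sum>\<^sub>\<infinity>j. cnj (f j) * (\<Sum>\<^sub>\<infinity>k. cnj (g k) * a (k + j + s)))"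
    by (rule infsum_triple_product[where B = sup_a]) (use f g a_le in \<open>auto simp: weighted_l1_0\<close>)
  also have "\<dots> = seq_inner (hank s g) f"
    by (simp add: seq_inner_def hank_def mult_ac add_ac)
  finally show ?thesis .
qed

abbreviation hank2 :: "nat \<Rightarrow> (nat \<Rightarrow> complex) \<Rightarrow> nat \<Rightarrow> complex" where
  "hank2 s f \<equiv> hank s (hank s f)"

lemma hank_w0: "weighted_l1 0 f \<Longrightarrow> weighted_l1 0 (hank s f)"
  by (rule weighted_l1_mono[OF hank_w1]) auto

lemma hank2_w1: "weighted_l1 0 f \<Longrightarrow> weighted_l1 1 (hank2 s f)"
  by (intro hank_w1 hank_w0)

lemma hank2_lincomb:
  assumes "weighted_l1 0 f" "weighted_l1 0 g"
  shows "hank2 s (\<lambda>k. x * f k + y * g k) = (\<lambda>k. x * hank2 s f k + y * hank2 s g k)"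
  using assms by (simp add: hank_lincomb hank_w0)

lemma hank2_cmult: "hank2 s (\<lambda>k. x * f k) = (\<lambda>k. x * hank2 s f k)"
  by (simp add: hank_cmult)

lemma hank2_inner:
  assumes f: "weighted_l1 0 f" and g: "weighted_l1 0 g"
  shows "seq_inner (hank2 s f) g = seq_inner (hank s g) (hank s f)"
  by (intro hank_symmetric hank_w0 assms)

lemma hank2_symmetric:
  assumes f: "weighted_l1 0 f" and g: "weighted_l1 0 g"
  shows "seq_inner (hank2 s f) g = seq_inner f (hank2 s g)"
  by (metis hank2_inner f g seq_inner_cnj)

lemma hank2_nonneg:
  assumes f: "weighted_l1 0 f"
  shows "seq_inner (hank2 s f) f = of_real ((seq_norm (hank s f))\<^sup>2)"
  using hank2_inner[OF f f] seq_inner_self[OF hank_w0[OF f]] by metis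

lemma shift_hank0: "hank 0 f (Suc k) = hank 1 f k"
  by (simp add: hank_def add_ac)

lemma hank0_decomp:
  assumes f: "weighted_l1 0 f"
  shows "hank 0 f = (\<lambda>k. cnj (f 0) * a k + 1 * hank 1 (\<lambda>k. f (Suc k)) k)"
proof
  fix k
  show "hank 0 f k = cnj (f 0) * a k + 1 * hank 1 (\<lambda>k. f (Suc k)) k"
    using infsum_split_0[OF hank_summable_l1[OF f, of k 0]] by (simp add: hank_def add_ac)
qed

text \<open>The backward shift turns \<open>hank 0\<close> into \<open>hank 1\<close>, and splitting
  off the entry \<open>f 0\<close> turns \<open>hank 0 f\<close> into \<open>hank 1\<close> of the
  shifted \<open>f\<close> plus a multiple of \<open>a\<close>. So the shift carries eigenvectors
  for \<open>s = 0\<close> with \<open>f 0 = 0\<close> to solutions of the eigenvalue equation for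
  \<open>s = 1\<close>.\<close>

lemma shift_hank2:
  assumes f: "weighted_l1 0 f"
  shows "hank2 0 f (Suc k) = hank2 1 (\<lambda>k. f (Suc k)) k + f 0 * hank 1 a k"
  by (subst shift_hank0, subst hank0_decomp[OF f], subst hank_lincomb)
     (auto simp: a0 intro!: hank_w0 weighted_l1_Suc_shift f)

lemma hank0_at_0: "hank 0 f 0 = seq_inner a f"
  by (simp add: hank_def seq_inner_def)

text \<open>As \<open>hank 0 f (Suc j) = hank 1 f j\<close>, the two sums differ only in the summand
  of index 0, which is governed by \<open>hank 0 f 0 = seq_inner a f\<close>. This relation links
  the two spectra.\<close>

lemma hank2_rank_one:
  assumes f: "weighted_l1 0 f"
  shows "hank2 1 f = (\<lambda>k. hank2 0 f k - seq_inner f a * a k)"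
proof
  fix k
  have "hank2 0 f k = a k * cnj (hank 0 f 0) + (\<Sum>\<^sub>\<infinity>j. a (k + Suc j + 0) * cnj (hank 0 f (Suc j)))"
    by (subst hank_def, subst infsum_split_0) 
       (use hank_summable_l1[OF hank_w0[OF f], of k 0] in auto)
  also have "(\<Sum>\<^sub>\<infinity>j. a (k + Suc j + 0) * cnj (hank 0 f (Suc j))) = hank2 1 f k"
    unfolding hank_def[of 1 "hank 1 f" k] shift_hank0 by (simp add: add_ac)
  finally show "hank2 1 f k = hank2 0 f k - seq_inner f a * a k"
    by (simp add: hank0_at_0 seq_inner_cnj[of f])
qed

end

section \<open>Limits under the Hankel operators and eigenvectors by power iteration\<close>

lemma infsum_tendsto_dominated:
  fixes g :: "nat \<Rightarrow> nat \<Rightarrow> complex"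
  assumes lim: "\<And>k. (\<lambda>n. g n k) \<longlonglongrightarrow> h k" and bd: "\<And>n k. norm (g n k) \<le> M k"
    and M: "M summable_on UNIV"
  shows "(\<lambda>n. infsum (g n) UNIV) \<longlonglongrightarrow> infsum h UNIV"
proof -
  have hb: "norm (h k) \<le> M k" for k
    by (rule tendsto_upperbound[OF tendsto_norm[OF lim]]) (use bd in auto)
  have eq: "infsum f UNIV = suminf f" if "\<And>k. norm (f k) \<le> M k" for f :: "nat \<Rightarrow> complex"
    using summable_on_complex_comparison[OF M, of f] that has_sum_imp_sums has_sum_infsum sums_unique
    by blast
  have "(\<lambda>n. suminf (\<lambda>k. g n k)) \<longlonglongrightarrow> suminf h"
    using tannerys_theorem[of "\<lambda>k n. g n k" h sequentially M] lim bd summable_on_imp_summable[OF M]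
    by (auto intro!: always_eventually)
  then show ?thesis
    by (simp add: eq[OF bd] eq[OF hb])
qed

context hankel
begin

definition tail_sum :: real where "tail_sum = infsum tail UNIV"

lemma tail_le: "tail k \<le> tail_sum"
  using finite_sum_le_infsum[OF tail_summable, of "{k}"] tail_nonneg by (simp add: tail_sum_def)

lemma tail_sum_nonneg: "tail_sum \<ge> 0"
  by (auto simp: tail_sum_def intro!: infsum_nonneg tail_nonneg)

lemma hank_bound':
  assumes "\<And>j. norm (f j) \<le> B" shows "norm (hank s f k) \<le> B * tail_sum"
proof -
  have "B \<ge> 0"
    using assms[of 0] by (meson norm_ge_zero order_trans)
  then show ?thesis
    using hank_bound[of f B s k] assms tail_le[of k] by (meson mult_left_mono order_trans)
qed

lemma hank_tendsto:
  assumes lim: "\<And>k. (\<lambda>n. fs n k) \<longlonglongrightarrow> f k" and bd: "\<And>n k. norm (fs n k) \<le> M"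
  shows "(\<lambda>n. hank s (fs n) k) \<longlonglongrightarrow> hank s f k"
  unfolding hank_def
proof (rule infsum_tendsto_dominated[where M = "\<lambda>j. norm (a (k + j + s)) * M"])
  show "(\<lambda>n. a (k + j + s) * cnj (fs n j)) \<longlonglongrightarrow> a (k + j + s) * cnj (f j)" for j
    by (intro tendsto_intros lim)
  show "norm (a (k + j + s) * cnj (fs n j)) \<le> norm (a (k + j + s)) * M" for n j
    by (auto simp: norm_mult intro!: mult_left_mono bd)
  show "(\<lambda>j. norm (a (k + j + s)) * M) summable_on UNIV"
    using summable_on_norm[OF a_summable'[of "k + s"]] by (intro summable_on_cmult_left) (simp add: add_ac)
qed

lemma hank2_tendsto:
  assumes lim: "\<And>k. (\<lambda>n. fs n k) \<longlonglongrightarrow> f k" and bd: "\<And>n k. norm (fs n k) \<le> M"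
  shows "(\<lambda>n. hank2 s (fs n) k) \<longlonglongrightarrow> hank2 s f k"
  by (rule hank_tendsto[OF hank_tendsto[OF lim bd] hank_bound'[OF bd]])

lemma hank2_bound:
  assumes f: "weighted_l1 0 f"
  shows "norm (hank2 s f k) \<le> seq_norm f * tail_sum * tail k"
  by (intro hank_bound hank_bound' norm_le_seq_norm[OF f])

text \<open>Square summability of \<open>tail\<close> gives boundedness in the quadratic norm; it
  keeps the ratios of the power iteration bounded.\<close>

lemma hank2_norm_bound:
  obtains C where "C \<ge> 0" "\<And>f. weighted_l1 0 f \<Longrightarrow> seq_norm (hank2 s f) \<le> C * seq_norm f"
proof
  have t2: "(\<lambda>k. (tail k)\<^sup>2) summable_on UNIV"
    by (rule summable_on_comparison_test[OF summable_on_cmult_right[OF tail_summable, of tail_sum]])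
       (auto simp: power2_eq_square intro!: mult_right_mono tail_nonneg tail_le)
  show "tail_sum * sqrt (\<Sum>\<^sub>\<infinity>k. (tail k)\<^sup>2) \<ge> 0"
    by (simp add: tail_sum_nonneg infsum_nonneg)
  fix f assume f: "weighted_l1 0 f"
  have "(\<Sum>\<^sub>\<infinity>k. (norm (hank2 s f k))\<^sup>2) \<le> (\<Sum>\<^sub>\<infinity>k. (seq_norm f * tail_sum)\<^sup>2 * (tail k)\<^sup>2)"
  proof (rule infsum_mono)
    show "(\<lambda>k. (norm (hank2 s f k))\<^sup>2) summable_on UNIV"
      by (intro summable_norm_square[OF hank2_w1] f)
    show "(\<lambda>k. (seq_norm f * tail_sum)\<^sup>2 * (tail k)\<^sup>2) summable_on UNIV"
      by (intro summable_on_cmult_right t2)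
    show "(norm (hank2 s f k))\<^sup>2 \<le> (seq_norm f * tail_sum)\<^sup>2 * (tail k)\<^sup>2" for k
      unfolding power_mult_distrib[symmetric] by (intro power_mono hank2_bound f) auto
  qed
  then have "seq_norm (hank2 s f) \<le> sqrt ((seq_norm f * tail_sum)\<^sup>2 * (\<Sum>\<^sub>\<infinity>k. (tail k)\<^sup>2))"
    by (simp add: seq_norm_def infsum_cmult_right')
  then show "seq_norm (hank2 s f) \<le> tail_sum * sqrt (\<Sum>\<^sub>\<infinity>k. (tail k)\<^sup>2) * seq_norm f"
    by (simp add: real_sqrt_mult seq_norm_nonneg tail_sum_nonneg mult_ac)
qed

text \<open>
  Power iteration: the normalized iterates of \<open>v\<close> have a pointwise limit point, which by
  domination is a unit eigenvector; rescaled, it is the projection of \<open>v\<close> onto the eigenspace.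
\<close>

proposition hank2_eigenvector:
  assumes v: "weighted_l1 0 v" and nz: "hank2 s v \<noteq> (\<lambda>_. 0)"
  obtains x \<rho> where "\<rho> > 0" "weighted_l1 0 x" "x \<noteq> (\<lambda>_. 0)"
    "hank2 s x = (\<lambda>k. of_real \<rho> * x k)" "seq_norm (hank2 s v) \<le> \<rho> * seq_norm v"
    "\<And>z. weighted_l1 0 z \<Longrightarrow> hank2 s z = (\<lambda>k. of_real \<rho> * z k) \<Longrightarrow> seq_inner x z = seq_inner v z"
proof -
  define T where "T = hank2 s"
  define t where "t = (\<lambda>n. (T ^^ n) v)"
  define N where "N = (\<lambda>n. seq_norm (t n))"
  have t_Suc: "t (Suc n) = T (t n)" for n by (simp add: t_def)
  have T0: "weighted_l1 0 (T f)" if "weighted_l1 0 f" for f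
    unfolding T_def by (intro hank_w0 that)
  have t0: "weighted_l1 0 (t n)" for n
    by (induction n) (simp add: t_def v, simp add: t_Suc T0)
  have Tsym: "seq_inner (T f) g = seq_inner f (T g)" if "weighted_l1 0 f" "weighted_l1 0 g" for f g
    unfolding T_def by (intro hank2_symmetric that)
  have inner_N: "seq_inner (t (Suc (Suc n))) (t n) = of_real ((N (Suc n))\<^sup>2)" for n
    using Tsym[OF t0[of "Suc n"] t0[of n]] seq_inner_self[OF t0[of "Suc n"]] by (simp add: t_Suc N_def)
  \<comment> \<open>Symmetry of \<open>T\<close> identifies the inner product of
    \<open>t (n + 2)\<close> and \<open>t n\<close> with the squared norm of
    \<open>t (n + 1)\<close>; Cauchy-Schwarz then makes the norms log-convex, so their ratios
    increase.\<close>
  have N_step: "(N (Suc n))\<^sup>2 \<le> N (Suc (Suc n)) * N n" for n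
    using seq_inner_le_norm[OF t0[of "Suc (Suc n)"] t0[of n]] by (simp add: inner_N N_def)
  have N_nonneg: "N n \<ge> 0" for n by (simp add: N_def seq_norm_nonneg)
  have N1: "N 1 > 0"
    using nz seq_norm_pos[OF T0[OF v]] by (auto simp: N_def t_def T_def)
  have N0: "N 0 > 0"
  proof (rule ccontr)
    assume "\<not> ?thesis"
    then have "v = (\<lambda>_. 0)"
      using N_nonneg[of 0] seq_norm_eq_0[OF v] by (simp add: N_def t_def)
    then show False using nz hank2_cmult[of s 0 v] by simp
  qed
  have N_pos: "N n > 0 \<and> N (Suc n) > 0" for n
  proof (induction n)
    case (Suc n)
    have "0 < (N (Suc n))\<^sup>2" using Suc by simp
    then have "0 < N (Suc (Suc n)) * N n" using N_step[of n] by linarith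
    then show ?case using Suc by (simp add: zero_less_mult_iff)
  qed (use N0 N1 in simp)
  then have Np: "N n > 0" for n by simp
  define r where "r = (\<lambda>n. N (Suc n) / N n)"
  have r_inc: "incseq r"
    by (rule incseq_SucI) (use N_step Np in \<open>simp add: r_def field_simps power2_eq_square\<close>)
  obtain C where C: "C \<ge> 0" "\<And>f. weighted_l1 0 f \<Longrightarrow> seq_norm (T f) \<le> C * seq_norm f"
    using hank2_norm_bound[of s] unfolding T_def by metis
  have "r n \<le> C" for n
    using C(2)[OF t0[of n]] Np[of n] by (simp add: r_def N_def t_Suc field_simps)
  then obtain \<rho> where \<rho>: "r \<longlonglongrightarrow> \<rho>" "\<And>n. r n \<le> \<rho>"
    using incseq_convergent[OF r_inc, of C] by blast
  have r_pos: "r n > 0" for n using Np by (simp add: r_def)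
  have \<rho>_pos: "\<rho> > 0" using r_pos[of 0] \<rho>(2)[of 0] by linarith
  have r0: "r 0 \<le> r n" for n using r_inc by (simp add: incseq_def)
  define y where "y = (\<lambda>n k. of_real (1 / N n) * t n k)"
  have y0: "weighted_l1 0 (y n)" for n unfolding y_def by (intro weighted_l1_cmult t0)
  have yy: "seq_inner (y n) (y n) = 1" for n
    using Np[of n] unfolding y_def seq_inner_cmult_left seq_inner_cmult_right seq_inner_self[OF t0]
    by (simp add: N_def power2_eq_square)
  \<comment> \<open>The image under \<open>T\<close> of a unit vector is dominated by a fixed
    multiple of \<open>tail\<close>; division by the smallest ratio \<open>r 0\<close> gives one
    majorant for all \<open>y (Suc n)\<close>. The start \<open>y 0\<close> is not an image under
    \<open>T\<close>, hence the index \<open>Suc\<close>.\<close>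
  define e where "e = (\<lambda>k. tail_sum / r 0 * tail k)"
  have e: "e summable_on UNIV" unfolding e_def by (intro summable_on_cmult_right tail_summable)
  have ye: "norm (y (Suc n) k) \<le> e k" for n k
  proof -
    have "norm (t (Suc n) k) \<le> N n * tail_sum * tail k"
      using hank2_bound[OF t0[of n], of s k] by (simp add: t_Suc T_def N_def)
    then have "norm (y (Suc n) k) \<le> N n * tail_sum * tail k / N (Suc n)"
      using Np[of "Suc n"] by (simp add: y_def norm_mult norm_divide divide_right_mono)
    also have "\<dots> = tail_sum * tail k / r n"
      by (simp add: r_def)
    also have "\<dots> \<le> tail_sum * tail k / r 0"
      by (intro divide_left_mono r0 mult_nonneg_nonneg tail_sum_nonneg tail_nonneg mult_pos_pos r_pos)
    finally show ?thesis by (simp add: e_def)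
  qed
  define M where "M = tail_sum / r 0 * tail_sum"
  have eM: "e k \<le> M" for k
    unfolding e_def M_def using tail_sum_nonneg r_pos[of 0] tail_le
    by (intro mult_left_mono) auto
  have yM: "norm (y (Suc n) k) \<le> M" for n k using ye[of n k] eM[of k] by linarith
  obtain \<phi> where \<phi>: "strict_mono (\<phi> :: nat \<Rightarrow> nat)" "\<And>k. \<exists>l. (\<lambda>n. y (Suc (\<phi> n)) k) \<longlonglongrightarrow> l"
    using function_convergent_subsequence[of UNIV "\<lambda>n. y (Suc n)" M] yM by (metis UNIV_I countableI_type)
  then obtain x where x: "\<And>k. (\<lambda>n. y (Suc (\<phi> n)) k) \<longlonglongrightarrow> x k"
    by metis
  have xe: "norm (x k) \<le> e k" for k
    by (rule tendsto_upperbound[OF tendsto_norm[OF x]]) (use ye in auto)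
  have x0: "weighted_l1 0 x"
    unfolding weighted_l1_0 by (rule summable_on_complex_comparison[OF e xe])
  have lim_inner: "(\<lambda>n. seq_inner (y (Suc (\<phi> n))) z) \<longlonglongrightarrow> seq_inner x z" if z: "weighted_l1 0 z" for z
    unfolding seq_inner_def
  proof (rule infsum_tendsto_dominated[where M = "\<lambda>k. M * norm (z k)"])
    show "(\<lambda>k. M * norm (z k)) summable_on UNIV"
      using z by (intro summable_on_cmult_right summable_on_norm) (simp add: weighted_l1_0)
    show "norm (y (Suc (\<phi> n)) k * cnj (z k)) \<le> M * norm (z k)" for n k
      by (auto simp: norm_mult intro!: mult_right_mono yM)
  qed (intro tendsto_intros x)
  have "(\<lambda>n. seq_inner (y (Suc (\<phi> n))) (y (Suc (\<phi> n)))) \<longlonglongrightarrow> seq_inner x x"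
    unfolding seq_inner_def
  proof (rule infsum_tendsto_dominated[where M = "\<lambda>k. e k * M"])
    show "(\<lambda>k. e k * M) summable_on UNIV" by (intro summable_on_cmult_left e)
    have e0: "e k \<ge> 0" for k using xe[of k] norm_ge_zero order_trans by blast
    show "norm (y (Suc (\<phi> n)) k * cnj (y (Suc (\<phi> n)) k)) \<le> e k * M" for n k
      by (auto simp: norm_mult intro!: mult_mono yM ye e0)
  qed (intro tendsto_intros x)
  then have xx: "seq_inner x x = 1"
    using LIMSEQ_unique[OF _ tendsto_const] unfolding yy by blast
  have TTlim: "(\<lambda>n. T (T (y (Suc (\<phi> n)))) k) \<longlonglongrightarrow> T (T x) k" for k
    unfolding T_def
    by (intro hank2_tendsto[where M = "M * tail_sum * tail_sum"] hank2_tendsto[where M = M] x hank_bound' yM)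
  \<comment> \<open>The squared norm of \<open>T (T y) - \<rho>\<^sup>2 y\<close> at
    \<open>y = y m\<close>, expanded. The second power of \<open>T\<close> is taken because its
    cross term with \<open>y\<close> is exactly \<open>(r m)\<^sup>2\<close>.\<close>
  define E where "E = (\<lambda>m. (r m * r (Suc m))\<^sup>2 - 2 * \<rho>\<^sup>2 * (r m)\<^sup>2 + (\<rho>\<^sup>2)\<^sup>2)"
  have E_lim: "E \<longlonglongrightarrow> 0"
  proof -
    have "E \<longlonglongrightarrow> (\<rho> * \<rho>)\<^sup>2 - 2 * \<rho>\<^sup>2 * \<rho>\<^sup>2 + (\<rho>\<^sup>2)\<^sup>2"
      unfolding E_def by (intro tendsto_intros \<rho>(1) LIMSEQ_Suc)
    then show ?thesis by (simp add: power2_eq_square algebra_simps)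
  qed
  have gE: "norm (T (T (y m)) k - of_real (\<rho>\<^sup>2) * y m k) \<le> sqrt (E m)" for m k
  proof -
    have g: "T (T (y m)) = (\<lambda>k. of_real (1 / N m) * t (Suc (Suc m)) k)"
      unfolding T_def y_def hank2_cmult t_Suc ..
    define w where "w = (\<lambda>k. 1 * T (T (y m)) k + (- of_real (\<rho>\<^sup>2)) * y m k)"
    have w0: "weighted_l1 0 w" unfolding w_def by (intro weighted_l1_lincomb T0 y0)
    have gg: "seq_inner (T (T (y m))) (T (T (y m))) = of_real ((r m * r (Suc m))\<^sup>2)"
      using Np[of m] Np[of "Suc m"] 
      unfolding g seq_inner_cmult_left seq_inner_cmult_right seq_inner_self[OF t0]
      by (simp add: r_def N_def power2_eq_square)
    have gy: "seq_inner (T (T (y m))) (y m) = of_real ((r m)\<^sup>2)"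
      unfolding g unfolding y_def seq_inner_cmult_left seq_inner_cmult_right inner_N
      by (simp add: r_def power2_eq_square)
    have yT: "seq_inner (y m) (T (T (y m))) = of_real ((r m)\<^sup>2)"
      unfolding seq_inner_cnj[of "y m"] gy by simp
    have "seq_inner w w = 1 * seq_inner (T (T (y m))) w + (- of_real (\<rho>\<^sup>2)) * seq_inner (y m) w"
      by (subst w_def, intro seq_inner_lincomb_left T0 y0 w0)
    also have "seq_inner (T (T (y m))) w = of_real ((r m * r (Suc m))\<^sup>2) - of_real (\<rho>\<^sup>2) * of_real ((r m)\<^sup>2)"
      unfolding w_def by (subst seq_inner_lincomb_right) (auto intro!: T0 y0 simp: gg gy)
    also have "seq_inner (y m) w = of_real ((r m)\<^sup>2) - of_real (\<rho>\<^sup>2)"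
      unfolding w_def by (subst seq_inner_lincomb_right) 
        (auto intro!: T0 y0 simp: yy yT)
    finally have "complex_of_real ((seq_norm w)\<^sup>2) = of_real (E m)"
      by (simp add: seq_inner_self[OF w0] E_def algebra_simps power2_eq_square)
    then have "(seq_norm w)\<^sup>2 = E m" using of_real_eq_iff by blast
    then have "seq_norm w = sqrt (E m)" using seq_norm_nonneg real_sqrt_unique by metis
    then show ?thesis using norm_le_seq_norm[OF w0, of k] by (simp add: w_def)
  qed
  have TTx: "T (T x) k = of_real (\<rho>\<^sup>2) * x k" for k
  proof -
    have "(\<lambda>n. sqrt (E (Suc (\<phi> n)))) \<longlonglongrightarrow> sqrt 0"
      using LIMSEQ_subseq_LIMSEQ[OF LIMSEQ_Suc[OF E_lim] \<phi>(1)] 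
      by (intro tendsto_real_sqrt) (simp add: o_def)
    then have "(\<lambda>n. T (T (y (Suc (\<phi> n)))) k - of_real (\<rho>\<^sup>2) * y (Suc (\<phi> n)) k) \<longlonglongrightarrow> 0"
      by (intro Lim_null_comparison[OF always_eventually[OF allI[OF gE]]]) simp
    moreover have "(\<lambda>n. T (T (y (Suc (\<phi> n)))) k - of_real (\<rho>\<^sup>2) * y (Suc (\<phi> n)) k) \<longlonglongrightarrow> T (T x) k - of_real (\<rho>\<^sup>2) * x k"
      by (intro tendsto_intros TTlim x)
    ultimately have "0 = T (T x) k - of_real (\<rho>\<^sup>2) * x k" by (rule LIMSEQ_unique)
    then show ?thesis by simp
  qed
  \<comment> \<open>Descent from the second power of \<open>T\<close> to \<open>T\<close>: the
    defect \<open>w\<close> satisfies the eigenvalue equation for \<open>- \<rho>\<close>, so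
    nonnegativity of \<open>T\<close> makes it zero.\<close>
  define w where "w = (\<lambda>k. 1 * T x k + (- of_real \<rho>) * x k)"
  have w0: "weighted_l1 0 w" unfolding w_def by (intro weighted_l1_lincomb T0 x0)
  have "T w = (\<lambda>k. 1 * T (T x) k + (- of_real \<rho>) * T x k)"
    unfolding w_def unfolding T_def by (intro hank2_lincomb hank_w0 x0)
  then have Tw: "T w = (\<lambda>k. (- of_real \<rho>) * w k)"
    by (auto simp: TTx w_def algebra_simps power2_eq_square)
  have "complex_of_real ((seq_norm (hank s w))\<^sup>2) = of_real (- \<rho> * (seq_norm w)\<^sup>2)"
    using hank2_nonneg[OF w0, of s] unfolding Tw[unfolded T_def] seq_inner_cmult_left seq_inner_self[OF w0] by simp
  then have "(seq_norm (hank s w))\<^sup>2 = - \<rho> * (seq_norm w)\<^sup>2" using of_real_eq_iff by blast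
  then have "\<rho> * (seq_norm w)\<^sup>2 \<le> 0" 
    using zero_le_power2[of "seq_norm (hank s w)"] by linarith
  then have "seq_norm w = 0" using \<rho>_pos by (simp add: mult_le_0_iff)
  then have "w = (\<lambda>_. 0)" using seq_norm_eq_0 w0 by blast
  then have Tx: "T x = (\<lambda>k. of_real \<rho> * x k)"
    by (auto simp: w_def fun_eq_iff)
  \<comment> \<open>Against the eigenspace of \<open>\<rho>\<close> each application of
    \<open>T\<close> multiplies inner products by \<open>\<rho>\<close>, so those of
    \<open>y m\<close> and of \<open>v\<close> are proportional. Testing with \<open>x\<close>
    itself yields the limit of the factor.\<close>
  define \<kappa> where "\<kappa> = (\<lambda>m. complex_of_real (\<rho> ^ m / N m))"
  have ytz: "seq_inner (y m) z = \<kappa> m * seq_inner v z" 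
    if z: "weighted_l1 0 z" "T z = (\<lambda>k. of_real \<rho> * z k)" for m z
  proof -
    have "seq_inner (t m) z = of_real \<rho> ^ m * seq_inner v z"
    proof (induction m)
      case (Suc m)
      have "seq_inner (t (Suc m)) z = seq_inner (t m) (T z)"
        unfolding t_Suc by (intro Tsym t0 z)
      then show ?case using Suc by (simp add: z seq_inner_cmult_right)
    qed (simp add: t_def)
    then show ?thesis unfolding y_def seq_inner_cmult_left by (simp add: \<kappa>_def)
  qed
  have lim1: "(\<lambda>n. \<kappa> (Suc (\<phi> n)) * seq_inner v z) \<longlonglongrightarrow> seq_inner x z"
    if z: "weighted_l1 0 z" "T z = (\<lambda>k. of_real \<rho> * z k)" for z
    using lim_inner[OF z(1)] unfolding ytz[OF z] .
  have vx: "seq_inner v x \<noteq> 0"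
    using lim1[OF x0 Tx] xx LIMSEQ_unique[OF tendsto_const] by force
  have \<kappa>_lim: "(\<lambda>n. \<kappa> (Suc (\<phi> n))) \<longlonglongrightarrow> 1 / seq_inner v x"
    using tendsto_divide[OF lim1[OF x0 Tx] tendsto_const vx] vx xx by simp
  have xz: "seq_inner v x * seq_inner x z = seq_inner v z"
    if z: "weighted_l1 0 z" "T z = (\<lambda>k. of_real \<rho> * z k)" for z
    using LIMSEQ_unique[OF lim1[OF z] tendsto_mult_right[OF \<kappa>_lim]] vx by simp
  define X where "X = (\<lambda>k. seq_inner v x * x k)"
  show ?thesis
  proof (rule that[of \<rho> X])
    show "weighted_l1 0 X" unfolding X_def by (intro weighted_l1_cmult x0)
    show "X \<noteq> (\<lambda>_. 0)"
    proof
      assume "X = (\<lambda>_. 0)"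
      then have "x = (\<lambda>_. 0)" using vx by (auto simp: X_def fun_eq_iff)
      then show False using xx by (simp add: seq_inner_def)
    qed
    show "hank2 s X = (\<lambda>k. of_real \<rho> * X k)"
      unfolding X_def hank2_cmult using Tx by (simp add: T_def fun_eq_iff)
    show "seq_norm (hank2 s v) \<le> \<rho> * seq_norm v"
      using \<rho>(2)[of 0] Np[of 0] by (simp add: r_def N_def t_def T_def field_simps)
    show "seq_inner X z = seq_inner v z" if "weighted_l1 0 z" "hank2 s z = (\<lambda>k. of_real \<rho> * z k)" for z
      using xz[of z] that by (simp add: X_def seq_inner_cmult_left T_def)
  qed (fact \<rho>_pos)
qed

end

section \<open>The Toeplitz operator of the squared modulus\<close>

lemma infsum_sum_complex:
  fixes f :: "'i \<Rightarrow> 'a \<Rightarrow> complex"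
  assumes "\<And>i. i \<in> I \<Longrightarrow> f i summable_on A"
  shows "(\<Sum>\<^sub>\<infinity>x\<in>A. \<Sum>i\<in>I. f i x) = (\<Sum>i\<in>I. infsum (f i) A)"
    and "(\<lambda>x. \<Sum>i\<in>I. f i x) summable_on A"
  using assms
proof (induction I rule: infinite_finite_induct)
  case (insert i I)
  { case 1 then show ?case using insert by (simp add: infsum_add) }
  { case 2 then show ?case using insert by (simp add: summable_on_add) }
qed auto

lemma infsum_diff_complex:
  fixes f g :: "'a \<Rightarrow> complex"
  assumes "f summable_on A" "g summable_on A"
  shows "(\<Sum>\<^sub>\<infinity>x\<in>A. f x - g x) = infsum f A - infsum g A"
  using infsum_add[OF assms(1) summable_on_uminus[THEN iffD2, OF assms(2)]] by (simp add: infsum_uminus)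

context summable_symbol
begin

text \<open>The Fourier coefficient of order \<open>j - i\<close> of the squared modulus of the
  function with coefficients \<open>a\<close>. The case distinction discards the negative indices
  that truncated subtraction would send to 0.\<close>

definition toep :: "nat \<Rightarrow> nat \<Rightarrow> complex" where
  "toep j i = (\<Sum>\<^sub>\<infinity>n. if i \<le> n + j then a (n + j - i) * cnj (a n) else 0)"

definition toep_op :: "(nat \<Rightarrow> complex) \<Rightarrow> nat \<Rightarrow> complex" where
  "toep_op f j = (\<Sum>\<^sub>\<infinity>i. toep j i * f i)"

lemma toep_summable: "(\<lambda>n. if i \<le> n + j then a (n + j - i) * cnj (a n) else 0) summable_on UNIV"
  by (rule summable_on_complex_comparison[OF summable_on_cmult_right[OF summable_on_norm[OF a_summable[of 0]], of sup_a]])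
     (auto simp: norm_mult sup_a_nonneg intro!: mult_mono a_le)

lemma toep_pair_summable:
  assumes "f summable_on UNIV" "\<And>i. norm (f i) \<le> B"
  shows "(\<lambda>(n, i). (if i \<le> n + j then a (n + j - i) * cnj (a n) else 0) * f i) summable_on UNIV \<times> UNIV"
proof -
  have "(\<lambda>(n, i). cnj (a n) * (if i \<le> n + j then a (n + j - i) else 0) * f i) summable_on UNIV \<times> UNIV"
    by (rule summable_on_triple_product[where B = sup_a])
       (use a_summable[of 0] assms a_le sup_a_nonneg in auto)
  then show ?thesis
    by (rule summable_on_cong[THEN iffD1, rotated]) auto
qed

lemma toep_bound: "norm (toep j i) \<le> sup_a * (\<Sum>\<^sub>\<infinity>n. norm (a n))"
proof -
  have s: "(\<lambda>n. norm (a n)) summable_on UNIV"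
    using summable_on_norm[OF a_summable[of 0]] by simp
  have "norm (toep j i) \<le> (\<Sum>\<^sub>\<infinity>n. norm (if i \<le> n + j then a (n + j - i) * cnj (a n) else 0))"
    unfolding toep_def by (intro norm_infsum_bound summable_on_norm toep_summable)
  also have "\<dots> \<le> (\<Sum>\<^sub>\<infinity>n. sup_a * norm (a n))"
    by (intro infsum_mono summable_on_norm toep_summable summable_on_cmult_right s)
       (auto simp: norm_mult sup_a_nonneg intro!: mult_mono a_le)
  finally show ?thesis by (simp add: infsum_cmult_right')
qed

lemma toep_op_summable: "weighted_l1 p f \<Longrightarrow> (\<lambda>i. toep j i * f i) summable_on UNIV"
  by (intro summable_on_mult_bounded(2)[where B = "sup_a * (\<Sum>\<^sub>\<infinity>n. norm (a n))"] weighted_l1_summable toep_bound)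

text \<open>Three absolutely summable sequences are convolved, so their norms multiply. This
  estimate is the source of the extra regularity of traveling waves.\<close>

lemma toep_op_l1:
  assumes f: "weighted_l1 0 f" shows "weighted_l1 0 (toep_op f)"
proof -
  define S where "S = (\<Sum>\<^sub>\<infinity>n. norm (a n))"
  have s: "(\<lambda>n. norm (a n)) summable_on UNIV"
    using summable_on_norm[OF a_summable[of 0]] by simp
  have fs: "f summable_on UNIV" using f by (simp add: weighted_l1_0)
  obtain B where B: "\<And>k. norm (f k) \<le> B"
    using weighted_l1_bounded[OF f] by metis
  define g where "g = (\<lambda>(n, i) j. (if i \<le> n + j then a (n + j - i) * cnj (a n) else 0) * f i)"
  have g_norm: "norm (g (n, i) j) = (norm (a n) * norm (f i)) * (if j \<in> {j. i \<le> n + j} then norm (a (n + j - i)) else 0)" for n i j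
    by (simp add: g_def norm_mult)
  have inj: "inj_on (\<lambda>j. n + j - i) {j. i \<le> n + j}" for n i :: nat
    by (auto simp: inj_on_def)
  \<comment> \<open>For fixed \<open>n\<close> and \<open>i\<close> the untruncated indices
    \<open>n + j - i\<close> are distinct, so the sum over \<open>j\<close> costs at most the full
    norm of \<open>a\<close>.\<close>
  note re = infsum_partial_reindex_le[OF s norm_ge_zero inj]
  have "(\<lambda>(p, j). g p j) summable_on (UNIV \<times> UNIV) \<times> UNIV"
  proof (rule summable_on_prodI)
    show "(\<lambda>j. norm (g p j)) summable_on UNIV" for p
      by (cases p) (auto simp only: g_norm intro!: summable_on_cmult_right re(1))
    show "(\<Sum>\<^sub>\<infinity>j. norm (g p j)) \<le> (norm (a (fst p)) * norm (f (snd p))) * S" for p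
    proof (cases p)
      case (Pair n i)
      show ?thesis
        unfolding Pair g_norm infsum_cmult_right' S_def fst_conv snd_conv
        by (intro mult_left_mono re(2)) auto
    qed
    have "(\<lambda>(n, i). a n * 1 * f i) summable_on UNIV \<times> UNIV"
      using a_summable[of 0] fs by (intro summable_on_triple_product[where B = 1]) auto
    from summable_on_cmult_left[OF summable_on_norm[OF this], of S]
    show "(\<lambda>p. norm (a (fst p)) * norm (f (snd p)) * S) summable_on UNIV \<times> UNIV"
      by (simp add: case_prod_unfold norm_mult)
  qed
  then have "(\<lambda>(j, p). g p j) summable_on UNIV \<times> (UNIV \<times> UNIV)"
    by (subst summable_on_swap) simp
  from summable_on_Sigma_banach[OF this]
  have "(\<lambda>j. \<Sum>\<^sub>\<infinity>p. g p j) summable_on UNIV" by simp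
  also have "(\<lambda>j. \<Sum>\<^sub>\<infinity>p. g p j) = toep_op f"
  proof
    fix j
    have "toep_op f j = (\<Sum>\<^sub>\<infinity>i. \<Sum>\<^sub>\<infinity>n. (if i \<le> n + j then a (n + j - i) * cnj (a n) else 0) * f i)"
      by (simp add: toep_op_def toep_def infsum_cmult_left')
    also have "\<dots> = (\<Sum>\<^sub>\<infinity>n. \<Sum>\<^sub>\<infinity>i. (if i \<le> n + j then a (n + j - i) * cnj (a n) else 0) * f i)"
      by (rule infsum_swap_banach[symmetric]) (rule toep_pair_summable[OF fs B])
    also have "\<dots> = (\<Sum>\<^sub>\<infinity>(n, i). (if i \<le> n + j then a (n + j - i) * cnj (a n) else 0) * f i)"
      using infsum_Sigma'_banach[OF toep_pair_summable[OF fs B]] by simp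
    finally show "(\<Sum>\<^sub>\<infinity>p. g p j) = toep_op f j"
      by (simp add: g_def case_prod_unfold)
  qed
  finally show ?thesis by (simp add: weighted_l1_0)
qed

end

context hankel
begin

lemma toep_Suc: "toep (Suc j) (Suc i) = toep j i"
  unfolding toep_def by (rule infsum_cong) auto

lemma toep_shift: "toep (j + m) (i + m) = toep j i"
  by (induction m) (simp_all add: toep_Suc)

lemma toep_0: "toep j 0 = hank 0 a j"
  by (simp add: toep_def hank_def add_ac)

lemma toep_cnj: "cnj (toep j i) = toep i j"
proof -
  have eq: "toep j i = (\<Sum>\<^sub>\<infinity>n\<in>{n. i \<le> n + j}. a (n + j - i) * cnj (a n))" for i j
    unfolding toep_def by (rule infsum_cong_neutral) auto
  have "cnj (toep j i) = (\<Sum>\<^sub>\<infinity>n\<in>{n. i \<le> n + j}. cnj (a (n + j - i)) * a n)"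
    by (simp add: eq flip: infsum_cnj)
  also have "\<dots> = (\<Sum>\<^sub>\<infinity>n\<in>{n. j \<le> n + i}. a (n + i - j) * cnj (a n))"
    by (rule infsum_reindex_bij_witness[of _ "\<lambda>n. n + i - j" "\<lambda>n. n + j - i"]) (auto simp: mult.commute)
  finally show ?thesis by (simp add: eq)
qed

lemma toep_op_lincomb:
  assumes "weighted_l1 0 f" "weighted_l1 0 g"
  shows "toep_op (\<lambda>k. x * f k + y * g k) = (\<lambda>k. x * toep_op f k + y * toep_op g k)"
proof
  fix k
  have "toep_op (\<lambda>k. x * f k + y * g k) k = (\<Sum>\<^sub>\<infinity>i. x * (toep k i * f i) + y * (toep k i * g i))"
    unfolding toep_op_def by (simp add: algebra_simps)
  also have "\<dots> = (\<Sum>\<^sub>\<infinity>i. x * (toep k i * f i)) + (\<Sum>\<^sub>\<infinity>i. y * (toep k i * g i))"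
    by (intro infsum_add summable_on_cmult_right toep_op_summable[of 0] assms)
  finally show "toep_op (\<lambda>k. x * f k + y * g k) k = x * toep_op f k + y * toep_op g k"
    by (simp add: toep_op_def infsum_cmult_right')
qed

lemma toep_op_symmetric:
  assumes f: "weighted_l1 0 f" and g: "weighted_l1 0 g"
  shows "seq_inner (toep_op f) g = seq_inner f (toep_op g)"
proof -
  have "seq_inner (toep_op f) g = (\<Sum>\<^sub>\<infinity>k. cnj (g k) * (\<Sum>\<^sub>\<infinity>j. toep k j * f j))"
    by (simp add: seq_inner_def toep_op_def mult.commute)
  also have "\<dots> = (\<Sum>\<^sub>\<infinity>j. f j * (\<Sum>\<^sub>\<infinity>k. cnj (g k) * toep k j))"
    by (rule infsum_triple_product[OF _ _ toep_bound]) (use f g in \<open>auto simp: weighted_l1_0\<close>)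
  also have "\<dots> = seq_inner f (toep_op g)"
    by (simp add: seq_inner_def toep_op_def toep_cnj mult.commute flip: infsum_cnj)
  finally show ?thesis .
qed

text \<open>The matrix is constant along diagonals, so the shift commutes with it up to the first
  column, whose shift is \<open>hank 1 a\<close>.\<close>

lemma shift_toep_op:
  assumes f: "weighted_l1 0 f"
  shows "toep_op f (Suc k) = toep_op (\<lambda>k. f (Suc k)) k + f 0 * hank 1 a k"
  using infsum_split_0[OF toep_op_summable[OF f, of "Suc k"]]
  by (simp add: toep_op_def toep_Suc toep_0 shift_hank0 mult.commute)

text \<open>The conjugated matrix of \<open>hank2 s\<close>, in the form in which it appears after
  one more antilinear \<open>hank s\<close> is applied.\<close>

definition corr :: "nat \<Rightarrow> nat \<Rightarrow> nat \<Rightarrow> complex" where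
  "corr s m j = (\<Sum>\<^sub>\<infinity>i. cnj (a (m + i + s)) * a (i + j + s))"

lemma corr_summable: "(\<lambda>i. cnj (a (m + i + s)) * a (i + j + s)) summable_on UNIV"
  by (intro summable_on_mult_bounded(2)[where B = sup_a])
     (use a_summable[of "j + s"] a_le in \<open>auto simp: add_ac\<close>)

lemma corr_bound: "norm (corr s m j) \<le> sup_a * (\<Sum>\<^sub>\<infinity>n. norm (a n))"
proof -
  have s: "(\<lambda>n. norm (a n)) summable_on UNIV"
    using summable_on_norm[OF a_summable[of 0]] by simp
  have s': "(\<lambda>i. norm (a (i + j + s))) summable_on UNIV"
    using summable_on_norm[OF a_summable[of "j + s"]] by (simp add: add_ac)
  have "norm (corr s m j) \<le> (\<Sum>\<^sub>\<infinity>i. norm (cnj (a (m + i + s)) * a (i + j + s)))"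
    unfolding corr_def by (intro norm_infsum_bound summable_on_norm corr_summable)
  also have "\<dots> \<le> (\<Sum>\<^sub>\<infinity>i. sup_a * norm (a (i + j + s)))"
    by (intro infsum_mono summable_on_norm corr_summable summable_on_cmult_right s')
       (auto simp: norm_mult sup_a_nonneg intro!: mult_right_mono a_le)
  also have "\<dots> \<le> sup_a * (\<Sum>\<^sub>\<infinity>n. norm (a n))"
    using infsum_partial_reindex_le(2)[OF s, of "\<lambda>i. i + j + s" UNIV] sup_a_nonneg
    by (simp add: infsum_cmult_right' mult_left_mono inj_on_def)
  finally show ?thesis .
qed

text \<open>
  Both sides are coefficients of cubic expressions in \<open>a\<close>; collecting the terms with a fixed
  conjugated factor reduces the identity to a splitting of a finite convolution.
\<close>

lemma cubic_identity:
  assumes s: "s \<le> 1"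
  shows "(\<Sum>i<j + s. toep (k + j + s) i * a i) =
    (\<Sum>\<^sub>\<infinity>i. toep j i * a (i + k + s)) - (\<Sum>\<^sub>\<infinity>m. a (k + m + s) * corr s m j)"
proof -
  \<comment> \<open>Coefficients at a fixed factor \<open>cnj (a n)\<close>: \<open>P n\<close> is a
    finite convolution sum with \<open>n + j + 1\<close> terms; after reindexing, \<open>R n\<close>
    is its part below \<open>j + s\<close> and \<open>Q n\<close> the rest.\<close>
  define R where "R = (\<lambda>n. \<Sum>i<j + s. a (n + k + j + s - i) * a i)"
  define P where "P = (\<lambda>n. \<Sum>i\<le>n + j. a (n + j - i) * a (i + k + s))"
  define Q where "Q = (\<lambda>n. \<Sum>m | m + s \<le> n. a (k + m + s) * a (n - m + j))"
  have summ_a: "a summable_on UNIV" using a_summable[of 0] by simp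
  have 1: "(\<Sum>i<j + s. toep (k + j + s) i * a i) = (\<Sum>\<^sub>\<infinity>n. cnj (a n) * R n)"
  proof -
    have "toep (k + j + s) i * a i = (\<Sum>\<^sub>\<infinity>n. cnj (a n) * (a (n + k + j + s - i) * a i))" if "i < j + s" for i
      using that unfolding toep_def infsum_cmult_left'[symmetric] 
      by (intro infsum_cong) (auto simp: mult_ac add_ac)
    then have "(\<Sum>i<j + s. toep (k + j + s) i * a i) =
        (\<Sum>i<j + s. \<Sum>\<^sub>\<infinity>n. cnj (a n) * (a (n + k + j + s - i) * a i))"
      by (intro sum.cong) auto
    also have "\<dots> = (\<Sum>\<^sub>\<infinity>n. \<Sum>i<j + s. cnj (a n) * (a (n + k + j + s - i) * a i))"
    proof (rule infsum_sum_complex(1)[symmetric])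
      show "(\<lambda>n. cnj (a n) * (a (n + k + j + s - i) * a i)) summable_on UNIV" for i
        by (rule summable_on_mult_bounded(1)[where B = "sup_a * sup_a"])
           (use summ_a in \<open>auto simp: norm_mult sup_a_nonneg intro!: mult_mono a_le\<close>)
    qed
    finally show ?thesis by (simp add: R_def sum_distrib_left)
  qed
  have ps: "(\<lambda>(n, i). (if i \<le> n + j then a (n + j - i) * cnj (a n) else 0) * a (i + k + s)) summable_on UNIV \<times> UNIV"
    by (rule toep_pair_summable[where B = sup_a]) (use a_summable[of "k + s"] a_le in \<open>auto simp: add_ac\<close>)
  have inner_P: "(\<Sum>\<^sub>\<infinity>i. (if i \<le> n + j then a (n + j - i) * cnj (a n) else 0) * a (i + k + s)) = cnj (a n) * P n" for n
  proof -
    have "(\<Sum>\<^sub>\<infinity>i. (if i \<le> n + j then a (n + j - i) * cnj (a n) else 0) * a (i + k + s)) =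
      (\<Sum>\<^sub>\<infinity>i\<in>{..n + j}. cnj (a n) * (a (n + j - i) * a (i + k + s)))"
      by (rule infsum_cong_neutral) auto
    then show ?thesis by (simp add: P_def sum_distrib_left)
  qed
  have 2: "(\<Sum>\<^sub>\<infinity>i. toep j i * a (i + k + s)) = (\<Sum>\<^sub>\<infinity>n. cnj (a n) * P n)"
    unfolding inner_P[symmetric] infsum_swap_banach[OF ps] by (simp add: toep_def infsum_cmult_left')
  have s2: "(\<lambda>n. cnj (a n) * P n) summable_on UNIV"
    using summable_on_Sigma_banach[OF ps] by (simp add: inner_P)
  have qs: "(\<lambda>(m, i). a (k + m + s) * cnj (a (m + i + s)) * a (i + j + s)) summable_on UNIV \<times> UNIV"
    by (rule summable_on_triple_product[where B = sup_a])
       (use a_summable[of "k + s"] a_summable[of "j + s"] a_le in \<open>auto simp: add_ac\<close>)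
  have bij: "bij_betw (\<lambda>(n, m). (m, n - m - s)) (Sigma UNIV (\<lambda>n. {m. m + s \<le> n})) (UNIV \<times> UNIV)"
    by (rule bij_betw_byWitness[where f' = "\<lambda>(m, i). (m + i + s, m)"]) auto
  have qs': "(\<lambda>(n, m). cnj (a n) * (a (k + m + s) * a (n - m + j))) summable_on Sigma UNIV (\<lambda>n. {m. m + s \<le> n})"
    using qs unfolding summable_on_reindex_bij_betw[OF bij, symmetric]
    by (rule summable_on_cong[THEN iffD1, rotated]) (auto simp: mult_ac add_ac)
  have fin: "finite {m. m + s \<le> n}" for n
    by (rule finite_subset[of _ "{..n}"]) auto
  have "(\<Sum>\<^sub>\<infinity>m. a (k + m + s) * corr s m j) = (\<Sum>\<^sub>\<infinity>(m, i)\<in>UNIV \<times> UNIV. a (k + m + s) * cnj (a (m + i + s)) * a (i + j + s))"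
    using infsum_Sigma'_banach[OF qs] by (simp add: corr_def infsum_cmult_right' mult.assoc)
  also have "\<dots> = (\<Sum>\<^sub>\<infinity>(n, m)\<in>Sigma UNIV (\<lambda>n. {m. m + s \<le> n}). cnj (a n) * (a (k + m + s) * a (n - m + j)))"
    unfolding infsum_reindex_bij_betw[OF bij, symmetric] 
    by (rule infsum_cong) (auto simp: mult_ac add_ac)
  also have "\<dots> = (\<Sum>\<^sub>\<infinity>n. cnj (a n) * Q n)"
    unfolding infsum_Sigma'_banach[OF qs', symmetric] using fin by (simp add: Q_def sum_distrib_left)
  finally have 3: "(\<Sum>\<^sub>\<infinity>m. a (k + m + s) * corr s m j) = (\<Sum>\<^sub>\<infinity>n. cnj (a n) * Q n)" .
  have s3: "(\<lambda>n. cnj (a n) * Q n) summable_on UNIV"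
    using summable_on_Sigma_banach[OF qs'] fin by (simp add: Q_def sum_distrib_left)
  have PQR: "R n = P n - Q n" for n
  proof -
    have P: "P n = (\<Sum>i\<le>n + j. a (n + k + j + s - i) * a i)"
      unfolding P_def by (rule sum.reindex_bij_witness[of _ "\<lambda>i. n + j - i" "\<lambda>i. n + j - i"])
        (auto simp: mult_ac intro!: arg_cong2[where f = "(*)"] arg_cong[where f = a])
    have Q: "Q n = (\<Sum>i = j + s..n + j. a (n + k + j + s - i) * a i)"
      unfolding Q_def by (rule sum.reindex_bij_witness[of _ "\<lambda>i. n + j - i" "\<lambda>m. n - m + j"])
        (auto simp: mult_ac intro!: arg_cong2[where f = "(*)"] arg_cong[where f = a])
    \<comment> \<open>Here \<open>s \<le> 1\<close> enters: for \<open>n = 0\<close> the lower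
      segment must not exceed \<open>{..j}\<close>, and for \<open>s = 1\<close> the upper one is
      then empty.\<close>
    have "{..n + j} = {..<j + s} \<union> {j + s..n + j}"
      using s by auto
    then have "P n = R n + Q n"
      unfolding P Q R_def by (simp add: sum.union_disjoint ivl_disj_int)
    then show ?thesis by simp
  qed
  have "(\<Sum>\<^sub>\<infinity>n. cnj (a n) * R n) = (\<Sum>\<^sub>\<infinity>n. cnj (a n) * P n) - (\<Sum>\<^sub>\<infinity>n. cnj (a n) * Q n)"
    unfolding infsum_diff_complex[OF s2 s3, symmetric] by (simp add: PQR algebra_simps)
  then show ?thesis using 1 2 3 by simp
qed

end

lemma summable_on_triple_product_outer:
  fixes p r :: "nat \<Rightarrow> complex"
  assumes "p summable_on UNIV" "r summable_on UNIV" and B: "\<And>i j. norm (q i j) \<le> B"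
  shows "(\<lambda>j. r j * (\<Sum>\<^sub>\<infinity>i. p i * q i j)) summable_on UNIV"
proof -
  have "(\<lambda>(j, i). p i * q i j * r j) summable_on UNIV \<times> UNIV"
    using summable_on_triple_product[OF assms] by (subst summable_on_swap) simp
  from summable_on_Sigma_banach[OF this] show ?thesis
    by (simp add: infsum_cmult_left' infsum_cmult_right' mult.commute)
qed

context hankel
begin

text \<open>From the diagonal on, a row is the conjugate of \<open>hank 0 a\<close>, which is
  summable; only finitely many entries precede the diagonal.\<close>

lemma toep_row_summable: "toep k summable_on UNIV"
proof -
  have "toep k (m + k) = cnj (hank 0 a m)" for m
    using toep_shift[of 0 k m] toep_cnj[of m 0] by (simp add: toep_0)
  moreover have "(\<lambda>m. cnj (hank 0 a m)) summable_on UNIV"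
    using hank_w0[OF a0, of 0] by (simp add: weighted_l1_0)
  ultimately have "(toep k \<circ> (\<lambda>m. m + k)) summable_on UNIV"
    by (simp add: o_def)
  then have "toep k summable_on range (\<lambda>m. m + k)"
    by (subst summable_on_reindex) auto
  moreover have "range (\<lambda>m. m + k) = {k..}"
    by (auto simp: image_def intro: le_add_diff_inverse2[symmetric] exI[of _ "_ - k"])
  ultimately have "toep k summable_on ({..<k} \<union> {k..})"
    by (intro summable_on_union) auto
  then show ?thesis
    by (rule summable_on_subset) auto
qed

section \<open>Eigenspaces of the squared Hankel operators\<close>

definition eig :: "nat \<Rightarrow> real \<Rightarrow> (nat \<Rightarrow> complex) \<Rightarrow> bool" where
  "eig s \<rho> f \<longleftrightarrow> weighted_l1 1 f \<and> hank2 s f = (\<lambda>k. of_real \<rho> * f k)"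

lemma eig_w1: "eig s \<rho> f \<Longrightarrow> weighted_l1 1 f"
  by (simp add: eig_def)

lemma eig_w0: "eig s \<rho> f \<Longrightarrow> weighted_l1 0 f"
  using eig_w1 weighted_l1_mono[of 1 f 0] by simp

lemma eig_hank2: "eig s \<rho> f \<Longrightarrow> hank2 s f = (\<lambda>k. of_real \<rho> * f k)"
  by (simp add: eig_def)

text \<open>For \<open>\<rho> \<noteq> 0\<close> an eigenvector is a multiple of its own image, and
  \<open>hank2 s\<close> improves summability by one weight.\<close>

lemma eigI:
  assumes "weighted_l1 0 f" "hank2 s f = (\<lambda>k. of_real \<rho> * f k)" "\<rho> \<noteq> 0"
  shows "eig s \<rho> f"
proof -
  have "f = (\<lambda>k. of_real (1 / \<rho>) * hank2 s f k)"
    using assms by auto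
  then have "weighted_l1 1 f"
    using weighted_l1_cmult[OF hank2_w1[OF assms(1)]] by metis
  then show ?thesis using assms by (simp add: eig_def)
qed

lemma eig_lincomb:
  assumes "eig s \<rho> f" "eig s \<rho> g" shows "eig s \<rho> (\<lambda>k. x * f k + y * g k)"
  using assms hank2_lincomb[OF eig_w0 eig_w0, OF assms]
  by (auto simp: eig_def algebra_simps intro!: weighted_l1_lincomb)

lemma eig_hank:
  assumes "eig s \<rho> f" shows "eig s \<rho> (hank s f)"
  unfolding eig_def eig_hank2[OF assms] hank_cmult using hank_w1[OF eig_w0[OF assms]] by simp

text \<open>When \<open>hank2\<close> is moved across the inner product, the two terms with
  \<open>\<rho>\<close> cancel and only the rank one difference remains. So for a common value
  \<open>\<rho>\<close>, at least one of the two eigenspaces is orthogonal to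
  \<open>a\<close>.\<close>

lemma eig_inner_cross:
  assumes "eig 0 \<rho> f" "eig 1 \<rho> g" shows "seq_inner g a * seq_inner a f = 0"
proof -
  note f = eig_w0[OF assms(1)] and g = eig_w0[OF assms(2)]
  have "of_real \<rho> * seq_inner g f = seq_inner (hank2 1 g) f"
    unfolding eig_hank2[OF assms(2)] seq_inner_cmult_left ..
  also have "hank2 1 g = (\<lambda>k. 1 * hank2 0 g k + (- seq_inner g a) * a k)"
    using hank2_rank_one[OF g] by simp
  also have "seq_inner \<dots> f = 1 * seq_inner (hank2 0 g) f + (- seq_inner g a) * seq_inner a f"
    by (intro seq_inner_lincomb_left hank_w0 f g a0)
  also have "seq_inner (hank2 0 g) f = of_real \<rho> * seq_inner g f"
    by (simp add: hank2_symmetric[OF g f] eig_hank2[OF assms(1)] seq_inner_cmult_right)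
  finally show ?thesis by simp
qed

lemma eig_orthogonal_iff:
  assumes "seq_inner f a = 0" "weighted_l1 0 f" shows "eig 0 \<rho> f \<longleftrightarrow> eig 1 \<rho> f"
  using hank2_rank_one[OF assms(2)] assms(1) by (simp add: eig_def)

lemma seq_inner_eig_neq:
  assumes "eig s \<rho> f" "eig s \<sigma> g" "\<rho> \<noteq> \<sigma>" shows "seq_inner f g = 0"
proof -
  have "of_real \<rho> * seq_inner f g = of_real \<sigma> * seq_inner f g"
    using hank2_symmetric[OF eig_w0 eig_w0, OF assms(1,2), of s]
    unfolding eig_hank2[OF assms(1)] eig_hank2[OF assms(2)] seq_inner_cmult_left seq_inner_cmult_right
    by simp
  then show ?thesis using assms(3) by simp
qed

text \<open>The projection is found as a closest point of the eigenspace. There every vector is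
  \<open>1 / \<rho>\<close> times its image, so a bounded minimizing sequence has a summable
  majorant, and a pointwise limit point attains the infimum.\<close>

lemma eig_projection:
  assumes \<rho>: "\<rho> \<noteq> 0" and v: "weighted_l1 0 v"
  obtains x where "eig s \<rho> x" "\<And>z. eig s \<rho> z \<Longrightarrow> seq_inner x z = seq_inner v z"
proof -
  define Q where "Q = (\<lambda>z. seq_norm (\<lambda>k. 1 * v k + (- 1) * z k) ^ 2)"
  define D where "D = Inf (Q ` {z. eig s \<rho> z})"
  have zero: "eig s \<rho> (\<lambda>_. 0)"
    using hank2_cmult[of s 0 v] weighted_l1_cmult[of 1 a 0] decay by (simp add: eig_def)
  have bdd: "bdd_below (Q ` {z. eig s \<rho> z})"
    by (rule bdd_belowI[of _ 0]) (auto simp: Q_def)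
  have D_le: "D \<le> Q z" if "eig s \<rho> z" for z
    unfolding D_def using bdd that by (intro cINF_lower) auto
  have "\<exists>z. eig s \<rho> z \<and> Q z < D + 1 / real (Suc n)" for n
    using cINF_less_iff[of "{z. eig s \<rho> z}" Q "D + 1 / real (Suc n)"] bdd zero by (auto simp: D_def)
  then obtain zs where zs: "\<And>n. eig s \<rho> (zs n)" "\<And>n. Q (zs n) < D + 1 / real (Suc n)"
    by metis
  note zs0 = eig_w0[OF zs(1)]
  have Q_expand: "Q z = (seq_norm v)\<^sup>2 - 2 * Re (seq_inner v z) + (seq_norm z)\<^sup>2" if z: "weighted_l1 0 z" for z
  proof -
    define w where "w = (\<lambda>k. 1 * v k + (- 1) * z k)"
    have w: "weighted_l1 0 w" unfolding w_def by (intro weighted_l1_lincomb v z)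
    have "seq_inner w w = 1 * seq_inner v w + (- 1) * seq_inner z w"
      by (subst w_def, intro seq_inner_lincomb_left v z w)
    also have "seq_inner v w = cnj 1 * seq_inner v v + cnj (- 1) * seq_inner v z"
      unfolding w_def by (intro seq_inner_lincomb_right v z)
    also have "seq_inner z w = cnj 1 * seq_inner z v + cnj (- 1) * seq_inner z z"
      unfolding w_def by (intro seq_inner_lincomb_right v z)
    finally have "complex_of_real (Q z) = (seq_norm v)\<^sup>2 - seq_inner v z - cnj (seq_inner v z) + (seq_norm z)\<^sup>2"
      unfolding seq_inner_self[OF w] seq_inner_self[OF v] seq_inner_self[OF z] seq_inner_cnj[of z v]
      by (simp add: Q_def w_def)
    then have "Re (complex_of_real (Q z)) = Re ((seq_norm v)\<^sup>2 - seq_inner v z - cnj (seq_inner v z) + (seq_norm z)\<^sup>2)"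
      by simp
    then show ?thesis by (simp add: power2_eq_square)
  qed
  \<comment> \<open>If a norm \<open>t\<close> exceeded \<open>K\<close>, then
    \<open>t * (t - 2 * seq_norm v)\<close> would be at least \<open>\<bar>D\<bar> + 1\<close>,
    while closeness to the infimum keeps it below.\<close>
  define K where "K = 2 * seq_norm v + \<bar>D\<bar> + 1"
  have zK: "seq_norm (zs n) \<le> K" for n
  proof (rule ccontr)
    assume "\<not> ?thesis"
    then have gt: "seq_norm (zs n) > K" by simp
    have "Q (zs n) < \<bar>D\<bar> + 1"
      using zs(2)[of n] by (smt (verit) divide_le_eq_1 of_nat_Suc of_nat_0_le_iff)
    moreover have "Re (seq_inner v (zs n)) \<le> seq_norm v * seq_norm (zs n)"
      by (intro seq_inner_le_norm v zs0)
    moreover define P where "P = seq_norm (zs n) * (seq_norm (zs n) - 2 * seq_norm v)"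
    ultimately have "(seq_norm v)\<^sup>2 + P < \<bar>D\<bar> + 1"
      unfolding Q_expand[OF zs0] by (simp add: power2_eq_square algebra_simps)
    moreover have "1 * (\<bar>D\<bar> + 1) \<le> P"
      using gt seq_norm_nonneg[of v] unfolding K_def P_def by (intro mult_mono) auto
    ultimately show False
      by (metis add_increasing leD mult_1 zero_le_power2)
  qed
  define e where "e = (\<lambda>k. K * tail_sum / \<bar>\<rho>\<bar> * tail k)"
  have e: "e summable_on UNIV" unfolding e_def by (intro summable_on_cmult_right tail_summable)
  have ze: "norm (zs n k) \<le> e k" for n k
  proof -
    have "\<bar>\<rho>\<bar> * norm (zs n k) = norm (hank2 s (zs n) k)"
      by (simp add: eig_hank2[OF zs(1)] norm_mult)
    also have "\<dots> \<le> seq_norm (zs n) * tail_sum * tail k"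
      by (intro hank2_bound zs0)
    also have "\<dots> \<le> K * tail_sum * tail k"
      by (intro mult_right_mono zK tail_sum_nonneg tail_nonneg)
    finally show ?thesis using \<rho> by (simp add: e_def field_simps)
  qed
  have K0: "K \<ge> 0" using seq_norm_nonneg[of v] by (simp add: K_def)
  define M where "M = K * tail_sum / \<bar>\<rho>\<bar> * tail_sum"
  have eM: "e k \<le> M" for k
    unfolding e_def M_def using tail_sum_nonneg tail_le K0 by (intro mult_left_mono) auto
  have zM: "norm (zs n k) \<le> M" for n k using ze[of n k] eM[of k] by linarith
  obtain \<phi> where \<phi>: "strict_mono (\<phi> :: nat \<Rightarrow> nat)" "\<And>k. \<exists>l. (\<lambda>n. zs (\<phi> n) k) \<longlonglongrightarrow> l"
    using function_convergent_subsequence[of UNIV zs M] zM by (metis UNIV_I countableI_type)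
  then obtain x where x: "\<And>k. (\<lambda>n. zs (\<phi> n) k) \<longlonglongrightarrow> x k" by metis
  have xe: "norm (x k) \<le> e k" for k
    by (rule tendsto_upperbound[OF tendsto_norm[OF x]]) (use ze in auto)
  have x0: "weighted_l1 0 x"
    unfolding weighted_l1_0 by (rule summable_on_complex_comparison[OF e xe])
  have "hank2 s x k = of_real \<rho> * x k" for k
  proof (rule LIMSEQ_unique)
    show "(\<lambda>n. hank2 s (zs (\<phi> n)) k) \<longlonglongrightarrow> hank2 s x k"
      by (rule hank2_tendsto[OF x zM])
    show "(\<lambda>n. hank2 s (zs (\<phi> n)) k) \<longlonglongrightarrow> of_real \<rho> * x k"
      unfolding eig_hank2[OF zs(1)] by (intro tendsto_intros x)
  qed
  then have eig_x: "eig s \<rho> x" using eigI[OF x0 _ \<rho>] by blast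
  have l1: "(\<lambda>n. seq_inner v (zs (\<phi> n))) \<longlonglongrightarrow> seq_inner v x"
    unfolding seq_inner_def
  proof (rule infsum_tendsto_dominated[where M = "\<lambda>k. norm (v k) * M"])
    show "(\<lambda>k. norm (v k) * M) summable_on UNIV"
      using v by (intro summable_on_cmult_left summable_on_norm) (simp add: weighted_l1_0)
    show "norm (v k * cnj (zs (\<phi> n) k)) \<le> norm (v k) * M" for n k
      by (auto simp: norm_mult intro!: mult_left_mono zM)
  qed (intro tendsto_intros x)
  have l2: "(\<lambda>n. seq_inner (zs (\<phi> n)) (zs (\<phi> n))) \<longlonglongrightarrow> seq_inner x x"
    unfolding seq_inner_def
  proof (rule infsum_tendsto_dominated[where M = "\<lambda>k. e k * M"])
    show "(\<lambda>k. e k * M) summable_on UNIV" by (intro summable_on_cmult_left e)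
    have e0: "e k \<ge> 0" for k using xe[of k] norm_ge_zero order_trans by blast
    show "norm (zs (\<phi> n) k * cnj (zs (\<phi> n) k)) \<le> e k * M" for n k
      by (auto simp: norm_mult intro!: mult_mono zM ze e0)
  qed (intro tendsto_intros x)
  have Q_eq: "Q z = (seq_norm v)\<^sup>2 - 2 * Re (seq_inner v z) + Re (seq_inner z z)" if "weighted_l1 0 z" for z
    using Q_expand[OF that] seq_inner_self[OF that] by simp
  have "(\<lambda>n. Q (zs (\<phi> n))) \<longlonglongrightarrow> Q x"
    unfolding Q_eq[OF zs0] Q_eq[OF x0] by (intro tendsto_intros l1 l2)
  moreover have "(\<lambda>n. D + 1 / real (Suc (\<phi> n))) \<longlonglongrightarrow> D + 0"
    using LIMSEQ_subseq_LIMSEQ[OF LIMSEQ_inverse_real_of_nat \<phi>(1)]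
    by (intro tendsto_intros) (simp add: o_def inverse_eq_divide)
  ultimately have "Q x \<le> D + 0"
    by (rule LIMSEQ_le) (use zs(2) less_imp_le in blast)
  then have min: "Q x \<le> Q z" if "eig s \<rho> z" for z
    using D_le[OF that] by simp
  have orth: "seq_inner x z = seq_inner v z" if z: "eig s \<rho> z" for z
  proof (rule ccontr)
    assume ne: "seq_inner x z \<noteq> seq_inner v z"
    define d where "d = seq_inner v z - seq_inner x z"
    have z0: "weighted_l1 0 z" by (rule eig_w0[OF z])
    have znz: "seq_norm z \<noteq> 0"
    proof
      assume "seq_norm z = 0"
      then have "z = (\<lambda>_. 0)" using seq_norm_eq_0 z0 by blast
      then show False using ne by (simp add: seq_inner_def)
    qed
    \<comment> \<open>The optimal step from \<open>x\<close> in the direction \<open>z\<close>; it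
      lowers the squared distance by the squared norm of \<open>\<zeta> z\<close>.\<close>
    define \<zeta> where "\<zeta> = d / of_real ((seq_norm z)\<^sup>2)"
    have d_eq: "d = \<zeta> * of_real ((seq_norm z)\<^sup>2)"
      using znz by (simp add: \<zeta>_def)
    define x' where "x' = (\<lambda>k. 1 * x k + \<zeta> * z k)"
    have x'0: "weighted_l1 0 x'" unfolding x'_def by (intro weighted_l1_lincomb x0 z0)
    have eig_x': "eig s \<rho> x'" unfolding x'_def by (intro eig_lincomb eig_x z)
    have vx': "seq_inner v x' = seq_inner v x + cnj \<zeta> * seq_inner v z"
      unfolding x'_def by (subst seq_inner_lincomb_right) (use v x0 z0 in auto)
    have "seq_inner x' x' = 1 * seq_inner x x' + \<zeta> * seq_inner z x'"
      by (subst x'_def, intro seq_inner_lincomb_left x0 z0 x'0)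
    also have "seq_inner x x' = seq_inner x x + cnj \<zeta> * seq_inner x z"
      unfolding x'_def by (subst seq_inner_lincomb_right) (use x0 z0 in auto)
    also have "seq_inner z x' = seq_inner z x + cnj \<zeta> * seq_inner z z"
      unfolding x'_def by (subst seq_inner_lincomb_right) (use x0 z0 in auto)
    finally have xx': "seq_inner x' x' = seq_inner x x + cnj \<zeta> * seq_inner x z + \<zeta> * cnj (seq_inner x z) + \<zeta> * cnj \<zeta> * of_real ((seq_norm z)\<^sup>2)"
      by (simp add: seq_inner_cnj[of z x] seq_inner_self[OF z0] algebra_simps)
    have "Q x' - Q x = Re (cnj \<zeta> * seq_inner x z + \<zeta> * cnj (seq_inner x z) + \<zeta> * cnj \<zeta> * of_real ((seq_norm z)\<^sup>2)) - 2 * Re (cnj \<zeta> * seq_inner v z)"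
      unfolding Q_eq[OF x0] Q_eq[OF x'0] vx' xx' by simp
    also have "\<dots> = Re (\<zeta> * cnj \<zeta> * of_real ((seq_norm z)\<^sup>2)) - 2 * Re (cnj \<zeta> * d)"
      unfolding d_def by (simp add: algebra_simps)
    also have "cnj \<zeta> * d = \<zeta> * cnj \<zeta> * of_real ((seq_norm z)\<^sup>2)"
      by (subst d_eq) (simp add: mult_ac)
    also have "\<zeta> * cnj \<zeta> * of_real ((seq_norm z)\<^sup>2) = complex_of_real ((norm \<zeta>)\<^sup>2 * (seq_norm z)\<^sup>2)"
      by (simp only: complex_norm_square of_real_mult)
    finally have "Q x' - Q x = - ((norm \<zeta>)\<^sup>2 * (seq_norm z)\<^sup>2)"
      by simp
    moreover have "\<zeta> \<noteq> 0" using ne znz by (simp add: \<zeta>_def d_def)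
    moreover have "(norm \<zeta>)\<^sup>2 * (seq_norm z)\<^sup>2 > 0" if "\<zeta> \<noteq> 0"
      using that znz by simp
    ultimately have "Q x' < Q x" by auto
    then show False using min[OF eig_x'] by simp
  qed
  show ?thesis by (rule that[OF eig_x orth])
qed

end

section \<open>Solutions of the stationary equation and the operators commuting with the squared
  Hankel operators\<close>

locale szego_sequence = hankel +
  fixes \<omega> c :: real
  assumes toep_op_a: "toep_op a k = (of_real \<omega> + of_real c * of_nat k) * a k"
begin

text \<open>With \<open>T\<close> for \<open>toep_op\<close> and \<open>H\<close> for
  \<open>hank s\<close>, the equation yields
  \<open>T H + H T - H^3 = \<omega> H + c (D H + H D + s H)\<close>. Dividing \<open>H^3\<close> and
  \<open>\<omega> H\<close> evenly between the two orders of composition produces the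
  halves.\<close>

definition Aop :: "nat \<Rightarrow> (nat \<Rightarrow> complex) \<Rightarrow> nat \<Rightarrow> complex" where
  "Aop s f k = of_real c * (of_nat k * f k) - toep_op f k + hank2 s f k / 2 + of_real (\<omega> / 2) * f k"

lemma hank_zero: "hank s (\<lambda>_. 0) = (\<lambda>_. 0)"
  using hank_cmult[of s 0 a] by simp

lemma Aop_alt: "Aop s f = (\<lambda>k. 1 * (of_real c * (of_nat k * f k) + of_real (\<omega> / 2) * f k) 
    + 1 * ((- 1) * toep_op f k + (1 / 2) * hank2 s f k))"
  by (auto simp: Aop_def)

lemma nat_mult_l1: "weighted_l1 1 f \<Longrightarrow> weighted_l1 0 (\<lambda>k. of_nat k * f k)"
  by (rule weighted_l1_of_nat_mult) simp

lemma w1_w0: "weighted_l1 1 f \<Longrightarrow> weighted_l1 0 f"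
  by (erule weighted_l1_mono) simp

lemma Aop_l1:
  assumes f: "weighted_l1 1 f" shows "weighted_l1 0 (Aop s f)"
  unfolding Aop_alt by (intro weighted_l1_lincomb nat_mult_l1 toep_op_l1 hank_w0 w1_w0 f)

lemma Aop_lincomb:
  assumes "weighted_l1 1 f" "weighted_l1 1 g"
  shows "Aop s (\<lambda>k. x * f k + y * g k) = (\<lambda>k. x * Aop s f k + y * Aop s g k)"
  unfolding Aop_def[abs_def] toep_op_lincomb[OF assms[THEN w1_w0]] hank2_lincomb[OF assms[THEN w1_w0]]
  by (auto simp: algebra_simps add_divide_distrib)

lemma Aop_symmetric:
  assumes f: "weighted_l1 1 f" and g: "weighted_l1 1 g"
  shows "seq_inner (Aop s f) g = seq_inner f (Aop s g)"
proof -
  note f0 = w1_w0[OF f] and g0 = w1_w0[OF g]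
  have nat: "seq_inner (\<lambda>k. of_nat k * f k) g = seq_inner f (\<lambda>k. of_nat k * g k)"
    by (simp add: seq_inner_def mult_ac)
  have "seq_inner (Aop s f) g = 1 * (of_real c * seq_inner (\<lambda>k. of_nat k * f k) g + of_real (\<omega> / 2) * seq_inner f g)
      + 1 * ((- 1) * seq_inner (toep_op f) g + (1 / 2) * seq_inner (hank2 s f) g)"
    unfolding Aop_alt
    by (subst seq_inner_lincomb_left; (intro weighted_l1_lincomb nat_mult_l1 toep_op_l1 hank_w0 f f0 g0)?)+ (rule refl)
  also have "\<dots> = cnj 1 * (cnj (of_real c) * seq_inner f (\<lambda>k. of_nat k * g k) + cnj (of_real (\<omega> / 2)) * seq_inner f g)
      + cnj 1 * (cnj (- 1) * seq_inner f (toep_op g) + cnj (1 / 2) * seq_inner f (hank2 s g))"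
    by (simp add: nat toep_op_symmetric[OF f0 g0] hank2_symmetric[OF f0 g0])
  also have "\<dots> = seq_inner f (Aop s g)"
    unfolding Aop_alt
    by (subst seq_inner_lincomb_right; (intro weighted_l1_lincomb nat_mult_l1 toep_op_l1 hank_w0 g f0 g0)?)+ (rule refl)
  finally show ?thesis .
qed

lemma Aop_a: "Aop s a = (\<lambda>k. hank2 s a k / 2 - of_real (\<omega> / 2) * a k)"
  by (auto simp: Aop_def toep_op_a algebra_simps)

text \<open>\<open>D\<close> contributes the extra \<open>c\<close>. The term
  \<open>f 0 * hank 1 a\<close> enters with factor minus one through \<open>toep_op\<close> and with
  factor one half through \<open>hank2\<close>, which leaves minus one half.\<close>

lemma shift_Aop:
  assumes f: "weighted_l1 1 f"
  shows "Aop 0 f (Suc k) = Aop 1 (\<lambda>k. f (Suc k)) k + of_real c * f (Suc k) - f 0 / 2 * hank 1 a k"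
  unfolding Aop_def shift_hank2[OF w1_w0[OF f]] shift_toep_op[OF w1_w0[OF f]]
  by (simp add: algebra_simps add_divide_distrib)

text \<open>The equation is read at the index \<open>k + j + s\<close> and its sum is cut at
  \<open>j + s\<close>: the far part is a shifted Toeplitz row, the near part is evaluated by
  \<open>cubic_identity\<close>.\<close>

lemma toep_commutator:
  assumes s: "s \<le> 1"
  shows "(\<Sum>\<^sub>\<infinity>i. toep k i * a (i + j + s)) + (\<Sum>\<^sub>\<infinity>i. a (k + i + s) * toep j i) - (\<Sum>\<^sub>\<infinity>m. a (k + m + s) * corr s m j)
    = (of_real \<omega> + of_real c * of_nat (k + j + s)) * a (k + j + s)"
proof -
  have "(of_real \<omega> + of_real c * of_nat (k + j + s)) * a (k + j + s) = (\<Sum>\<^sub>\<infinity>i. toep (k + j + s) i * a i)"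
    using toep_op_a[of "k + j + s"] by (simp add: toep_op_def)
  also have "\<dots> = (\<Sum>i<j + s. toep (k + j + s) i * a i) + (\<Sum>\<^sub>\<infinity>i. toep (k + j + s) (i + (j + s)) * a (i + (j + s)))"
    by (rule infsum_split_initial[OF toep_op_summable[OF a0]])
  also have "(\<lambda>i. toep (k + j + s) (i + (j + s))) = toep k"
    using toep_shift[of k "j + s"] by (simp add: add_ac)
  finally show ?thesis
    unfolding cubic_identity[OF s] by (simp add: fun_eq_iff add_ac mult_ac)
qed

lemma Aop_hank:
  assumes f: "weighted_l1 1 f" and s: "s \<le> 1"
  shows "Aop s (hank s f) k = - hank s (Aop s f) k - of_real (c * real s) * hank s f k"
proof -
  define X1 where "X1 = (\<lambda>j. \<Sum>\<^sub>\<infinity>i. toep k i * a (i + j + s))"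
  define X2 where "X2 = (\<lambda>j. \<Sum>\<^sub>\<infinity>i. a (k + i + s) * toep j i)"
  define X3 where "X3 = (\<lambda>j. \<Sum>\<^sub>\<infinity>m. a (k + m + s) * corr s m j)"
  note f0 = w1_w0[OF f]
  have cf: "(\<lambda>j. cnj (f j)) summable_on UNIV" and ff: "f summable_on UNIV"
    using f0 by (simp_all add: weighted_l1_0)
  have as: "(\<lambda>i. a (k + i + s)) summable_on UNIV" for k
    using a_summable[of "k + s"] by (simp add: add_ac)
  note T1 = toep_row_summable[of k] cf a_le[of "_ + _ + s"]
  have TH: "toep_op (hank s f) k = (\<Sum>\<^sub>\<infinity>j. cnj (f j) * X1 j)"
    unfolding toep_op_def hank_def X1_def by (rule infsum_triple_product[OF T1])
  have TH': "(\<lambda>j. cnj (f j) * X1 j) summable_on UNIV"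
    unfolding X1_def by (rule summable_on_triple_product_outer[OF T1])
  have b2: "norm (toep j i) \<le> sup_a * (\<Sum>\<^sub>\<infinity>n. norm (a n))" for i j by (rule toep_bound)
  have HT: "hank s (toep_op f) k = (\<Sum>\<^sub>\<infinity>j. cnj (f j) * X2 j)"
    unfolding toep_op_def hank_def X2_def infsum_cnj[symmetric] complex_cnj_mult toep_cnj
    by (rule infsum_triple_product[OF as cf b2])
  have HT': "(\<lambda>j. cnj (f j) * X2 j) summable_on UNIV"
    unfolding X2_def by (rule summable_on_triple_product_outer[OF as cf b2])
  have hh: "hank2 s f m = (\<Sum>\<^sub>\<infinity>j. f j * cnj (corr s m j))" for m
  proof -
    have "hank2 s f m = (\<Sum>\<^sub>\<infinity>i. a (m + i + s) * (\<Sum>\<^sub>\<infinity>j. cnj (a (i + j + s)) * f j))"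
      unfolding hank_def infsum_cnj[symmetric] by simp
    also have "\<dots> = (\<Sum>\<^sub>\<infinity>j. f j * (\<Sum>\<^sub>\<infinity>i. a (m + i + s) * cnj (a (i + j + s))))"
      by (rule infsum_triple_product[OF as ff, where B = sup_a]) (simp add: a_le)
    finally show ?thesis by (simp add: corr_def flip: infsum_cnj)
  qed
  have HHH: "hank s (hank2 s f) k = (\<Sum>\<^sub>\<infinity>j. cnj (f j) * X3 j)"
  proof -
    have "hank s (hank2 s f) k = (\<Sum>\<^sub>\<infinity>m. a (k + m + s) * (\<Sum>\<^sub>\<infinity>j. corr s m j * cnj (f j)))"
      unfolding hank_def[of s "hank2 s f"] hh infsum_cnj[symmetric] by (simp add: mult.commute)
    also have "\<dots> = (\<Sum>\<^sub>\<infinity>j. cnj (f j) * X3 j)"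
      unfolding X3_def by (rule infsum_triple_product[OF as cf corr_bound])
    finally show ?thesis .
  qed
  have HHH': "(\<lambda>j. cnj (f j) * X3 j) summable_on UNIV"
    unfolding X3_def by (rule summable_on_triple_product_outer[OF as cf corr_bound])
  \<comment> \<open>All three compositions are kernels against \<open>cnj (f j)\<close>, and
    \<open>toep_commutator\<close> adds the kernels up. Its factor \<open>k + j + s\<close> splits
    into \<open>D\<close> on the left, \<open>D\<close> on the right and the constant
    \<open>s\<close>.\<close>
  have key: "toep_op (hank s f) k + hank s (toep_op f) k - hank s (hank2 s f) k =
      of_real (\<omega> + c * (real k + real s)) * hank s f k + of_real c * hank s (\<lambda>j. of_nat j * f j) k"
  proof -
    have "toep_op (hank s f) k + hank s (toep_op f) k - hank s (hank2 s f) k =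
      (\<Sum>\<^sub>\<infinity>j. (cnj (f j) * X1 j + cnj (f j) * X2 j) - cnj (f j) * X3 j)"
      unfolding TH HT HHH
      by (subst infsum_diff_complex, intro summable_on_add TH' HT', rule HHH', subst infsum_add[OF TH' HT'], rule refl)
    also have "\<dots> = (\<Sum>\<^sub>\<infinity>j. of_real (\<omega> + c * (real k + real s)) * (a (k + j + s) * cnj (f j)) +
       of_real c * (a (k + j + s) * cnj (of_nat j * f j)))"
    proof (rule infsum_cong)
      fix j
      have "(cnj (f j) * X1 j + cnj (f j) * X2 j) - cnj (f j) * X3 j = cnj (f j) * (X1 j + X2 j - X3 j)"
        by (simp add: algebra_simps)
      also have "X1 j + X2 j - X3 j = (of_real \<omega> + of_real c * of_nat (k + j + s)) * a (k + j + s)"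
        unfolding X1_def X2_def X3_def by (rule toep_commutator[OF s])
      finally show "(cnj (f j) * X1 j + cnj (f j) * X2 j) - cnj (f j) * X3 j = 
        of_real (\<omega> + c * (real k + real s)) * (a (k + j + s) * cnj (f j)) +
        of_real c * (a (k + j + s) * cnj (of_nat j * f j))"
        by (simp add: algebra_simps)
    qed
    also have "\<dots> = of_real (\<omega> + c * (real k + real s)) * hank s f k + of_real c * hank s (\<lambda>j. of_nat j * f j) k"
      unfolding hank_def infsum_cmult_right'[symmetric]
      by (intro infsum_add summable_on_cmult_right hank_summable_l1[OF f0] hank_summable_l1[OF nat_mult_l1[OF f]])
    finally show ?thesis .
  qed
  have e1: "hank s (Aop s f) k = of_real c * hank s (\<lambda>j. of_nat j * f j) k + of_real (\<omega> / 2) * hank s f k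
      - hank s (toep_op f) k + hank s (hank2 s f) k / 2"
  proof -
    have 1: "weighted_l1 0 (\<lambda>k. of_real c * (of_nat k * f k) + of_real (\<omega> / 2) * f k)"
      by (intro weighted_l1_lincomb nat_mult_l1 f f0)
    have 2: "weighted_l1 0 (\<lambda>k. (- 1) * toep_op f k + (1 / 2) * hank2 s f k)"
      by (intro weighted_l1_lincomb toep_op_l1 hank_w0 f0)
    show ?thesis
      unfolding Aop_alt hank_lincomb[OF 1 2]
      unfolding hank_lincomb[OF nat_mult_l1[OF f] f0] hank_lincomb[OF toep_op_l1[OF f0] hank_w0[OF hank_w0[OF f0]]]
      by simp
  qed
  have e2: "toep_op (hank s f) k = of_real (\<omega> + c * (real k + real s)) * hank s f k
      + of_real c * hank s (\<lambda>j. of_nat j * f j) k - hank s (toep_op f) k + hank s (hank2 s f) k"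
    using key by (simp add: algebra_simps)
  show ?thesis
    unfolding Aop_def[of s "hank s f"] e1 e2 by (simp add: field_simps)
qed

lemma hank_Aop:
  assumes f: "weighted_l1 1 f" and s: "s \<le> 1"
  shows "hank s (Aop s f) = (\<lambda>k. (- 1) * Aop s (hank s f) k + (- of_real (c * real s)) * hank s f k)"
proof
  show "hank s (Aop s f) k = (- 1) * Aop s (hank s f) k + (- of_real (c * real s)) * hank s f k" for k
    unfolding Aop_hank[OF assms] by simp
qed

text \<open>Applied twice, the anticommutation relation makes the terms with \<open>c * s\<close>
  cancel, so \<open>Aop s\<close> commutes with \<open>hank2 s\<close>.\<close>

lemma eig_Aop:
  assumes f: "eig s \<rho> f" and s: "s \<le> 1" and \<rho>: "\<rho> \<noteq> 0"
  shows "eig s \<rho> (Aop s f)"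
proof (rule eigI[OF Aop_l1[OF eig_w1[OF f]] _ \<rho>])
  note h = eig_w1[OF eig_hank[OF f]]
  have "hank2 s (Aop s f) = (\<lambda>k. (- 1) * hank s (Aop s (hank s f)) k + (- of_real (c * real s)) * hank2 s f k)"
    unfolding hank_Aop[OF eig_w1[OF f] s] hank_lincomb[OF Aop_l1[OF h] w1_w0[OF h]] by simp
  also have "hank s (Aop s (hank s f)) = (\<lambda>k. (- 1) * Aop s (hank2 s f) k + (- of_real (c * real s)) * hank2 s f k)"
    by (rule hank_Aop[OF h s])
  finally have "hank2 s (Aop s f) = Aop s (hank2 s f)"
    by (simp add: algebra_simps)
  also have "\<dots> = (\<lambda>k. of_real \<rho> * Aop s f k)"
    unfolding eig_hank2[OF f] using Aop_lincomb[OF eig_w1[OF f] eig_w1[OF f], of s "of_real \<rho>" 0] by simp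
  finally show "hank2 s (Aop s f) = (\<lambda>k. of_real \<rho> * Aop s f k)" .
qed

definition Aeig :: "nat \<Rightarrow> real \<Rightarrow> real \<Rightarrow> (nat \<Rightarrow> complex) \<Rightarrow> bool" where
  "Aeig s \<rho> \<alpha> f \<longleftrightarrow> eig s \<rho> f \<and> Aop s f = (\<lambda>k. of_real \<alpha> * f k)"

lemma Aeig_lincomb:
  assumes "Aeig s \<rho> \<alpha> f" "Aeig s \<rho> \<alpha> g" shows "Aeig s \<rho> \<alpha> (\<lambda>k. x * f k + y * g k)"
  using assms unfolding Aeig_def
  by (auto simp: eig_lincomb Aop_lincomb[OF eig_w1 eig_w1] algebra_simps)

lemma Aeig_hank:
  assumes f: "Aeig s \<rho> \<alpha> f" and s: "s \<le> 1"
  shows "Aeig s \<rho> (- \<alpha> - c * real s) (hank s f)"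
proof -
  have 1: "eig s \<rho> f" and 2: "Aop s f = (\<lambda>k. of_real \<alpha> * f k)"
    using f by (auto simp: Aeig_def)
  have "Aop s (hank s f) k = of_real (- \<alpha> - c * real s) * hank s f k" for k
    unfolding Aop_hank[OF eig_w1[OF 1] s] 2 hank_cmult by (simp add: algebra_simps)
  then show ?thesis using eig_hank[OF 1] by (auto simp: Aeig_def)
qed

lemma Aeig_orthogonal:
  assumes f: "Aeig s \<rho> \<alpha> f" and g: "Aeig s \<rho> \<beta> g" and ne: "\<alpha> \<noteq> \<beta>"
  shows "seq_inner f g = 0"
proof -
  have "seq_inner (Aop s f) g = seq_inner f (Aop s g)"
    using f g by (intro Aop_symmetric eig_w1) (auto simp: Aeig_def)
  moreover have "Aop s f = (\<lambda>k. of_real \<alpha> * f k)" "Aop s g = (\<lambda>k. of_real \<beta> * g k)"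
    using f g by (auto simp: Aeig_def)
  ultimately have "of_real \<alpha> * seq_inner f g = of_real \<beta> * seq_inner f g"
    by (simp only: seq_inner_cmult_left seq_inner_cmult_right complex_cnj_complex_of_real)
  then show ?thesis using ne by simp
qed

text \<open>The orthogonal projection of \<open>a\<close> onto the eigenspace; it is nonzero exactly
  when the eigenspace is not orthogonal to \<open>a\<close>.\<close>

definition proj_a :: "nat \<Rightarrow> real \<Rightarrow> (nat \<Rightarrow> complex) \<Rightarrow> bool" where
  "proj_a s \<rho> x \<longleftrightarrow> eig s \<rho> x \<and> (\<forall>z. eig s \<rho> z \<longrightarrow> seq_inner x z = seq_inner a z)"

text \<open>On \<open>a\<close> itself the equation reduces \<open>c D - T\<close> to
  \<open>- \<omega>\<close>, so \<open>Aop s\<close> acts there as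
  \<open>(hank2 s - \<omega>) / 2\<close>. Symmetry transfers this to the projection, where
  \<open>hank2 s\<close> is multiplication by \<open>\<rho>\<close>.\<close>

lemma Aeig_proj_a:
  assumes x: "proj_a s \<rho> x" and s: "s \<le> 1" and \<rho>: "\<rho> \<noteq> 0"
  shows "Aeig s \<rho> ((\<rho> - \<omega>) / 2) x"
proof -
  have ex: "eig s \<rho> x" and xz: "\<And>z. eig s \<rho> z \<Longrightarrow> seq_inner x z = seq_inner a z"
    using x by (auto simp: proj_a_def)
  define w where "w = (\<lambda>k. 1 * Aop s x k + (- of_real ((\<rho> - \<omega>) / 2)) * x k)"
  note eA = eig_Aop[OF ex s \<rho>]
  have ew: "eig s \<rho> w" unfolding w_def by (intro eig_lincomb eA ex)
  have "seq_inner (Aop s x) w = seq_inner x (Aop s w)"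
    by (intro Aop_symmetric eig_w1[OF ex] eig_w1[OF ew])
  also have "\<dots> = seq_inner (Aop s a) w"
    unfolding xz[OF eig_Aop[OF ew s \<rho>]] by (intro Aop_symmetric[symmetric] decay eig_w1[OF ew])
  also have "Aop s a = (\<lambda>k. (1 / 2) * hank2 s a k + (- of_real (\<omega> / 2)) * a k)"
    unfolding Aop_a by auto
  also have "seq_inner \<dots> w = (1 / 2) * seq_inner (hank2 s a) w + (- of_real (\<omega> / 2)) * seq_inner a w"
    by (intro seq_inner_lincomb_left hank_w0 a0 eig_w0[OF ew])
  also have "seq_inner (hank2 s a) w = of_real \<rho> * seq_inner a w"
    unfolding hank2_symmetric[OF a0 eig_w0[OF ew]] eig_hank2[OF ew] seq_inner_cmult_right by simp
  finally have "seq_inner (Aop s x) w = of_real ((\<rho> - \<omega>) / 2) * seq_inner x w"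
    by (simp add: xz[OF ew] algebra_simps diff_divide_distrib)
  moreover have "seq_inner w w = 1 * seq_inner (Aop s x) w + (- of_real ((\<rho> - \<omega>) / 2)) * seq_inner x w"
    by (subst w_def, intro seq_inner_lincomb_left eig_w0[OF eA] eig_w0[OF ex] eig_w0[OF ew])
  ultimately have "seq_inner w w = 0" by simp
  then have "w = (\<lambda>_. 0)" using seq_inner_self_eq_0 eig_w0[OF ew] by blast
  then have "Aop s x = (\<lambda>k. of_real ((\<rho> - \<omega>) / 2) * x k)"
    by (auto simp: w_def fun_eq_iff)
  then show ?thesis using ex by (simp add: Aeig_def)
qed

end

text \<open>
  The backward shift lowers the \<open>Aop\<close>-eigenvalue by \<open>c\<close> inside an eigenspace as long as the
  condition \<open>cond\<close> holds, and \<open>cond\<close> can only fail at the eigenvalue \<open>\<kappa>\<close>.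
\<close>

locale ladder = szego_sequence +
  fixes s :: nat and \<rho> \<kappa> :: real and cond :: "(nat \<Rightarrow> complex) \<Rightarrow> bool"
  assumes cond: "\<And>f \<alpha>. Aeig s \<rho> \<alpha> f \<Longrightarrow> \<alpha> \<noteq> \<kappa> \<Longrightarrow> cond f"
    and cond_0: "\<And>f \<alpha>. Aeig s \<rho> \<alpha> f \<Longrightarrow> cond f \<Longrightarrow> f 0 = 0"
    and step: "\<And>f \<alpha>. Aeig s \<rho> \<alpha> f \<Longrightarrow> cond f \<Longrightarrow> Aeig s \<rho> (\<alpha> - c) (\<lambda>k. f (Suc k))"
begin

lemma iterate:
  assumes "Aeig s \<rho> \<alpha> f" "\<And>j. j < l \<Longrightarrow> \<alpha> - c * real j \<noteq> \<kappa>"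
  shows "(\<forall>k<l. f k = 0) \<and> Aeig s \<rho> (\<alpha> - c * real l) (\<lambda>k. f (k + l))"
  using assms(2)
proof (induction l)
  case (Suc l)
  then have IH: "\<forall>k<l. f k = 0" "Aeig s \<rho> (\<alpha> - c * real l) (\<lambda>k. f (k + l))" by auto
  have cd: "cond (\<lambda>k. f (k + l))"
    by (rule cond[OF IH(2)]) (use Suc.prems in auto)
  have "f l = 0" using cond_0[OF IH(2) cd] by simp
  moreover have "Aeig s \<rho> (\<alpha> - c * real l - c) (\<lambda>k. f (Suc k + l))"
    by (rule step[OF IH(2) cd])
  ultimately show ?case using IH(1) by (auto simp: less_Suc_eq algebra_simps)
qed (use assms(1) in simp)

text \<open>Every step taken before \<open>\<kappa>\<close> is met shows one more leading
  coefficient to vanish, so a sequence whose ladder avoids \<open>\<kappa>\<close> is zero.\<close>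

lemma reaches:
  assumes f: "Aeig s \<rho> \<alpha> f" and nz: "f \<noteq> (\<lambda>_. 0)"
  obtains l where "\<alpha> - c * real l = \<kappa>" "\<And>k. k < l \<Longrightarrow> f k = 0" "Aeig s \<rho> \<kappa> (\<lambda>k. f (k + l))"
proof -
  have ex: "\<exists>l. \<alpha> - c * real l = \<kappa>"
  proof (rule ccontr)
    assume "\<not> ?thesis"
    then have "\<forall>k<l. f k = 0" for l using iterate[OF f, of l] by auto
    then show False using nz by blast
  qed
  define l where "l = (LEAST l. \<alpha> - c * real l = \<kappa>)"
  have l: "\<alpha> - c * real l = \<kappa>" unfolding l_def using ex by (rule LeastI_ex)
  have "\<alpha> - c * real j \<noteq> \<kappa>" if "j < l" for j
    using not_less_Least that unfolding l_def by blast
  then have "(\<forall>k<l. f k = 0) \<and> Aeig s \<rho> (\<alpha> - c * real l) (\<lambda>k. f (k + l))"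
    by (intro iterate[OF f]) blast
  with l show ?thesis by (intro that[of l]) auto
qed

text \<open>One shift leads to the level \<open>\<kappa> - c\<close>, and further steps in the same
  direction never return to \<open>\<kappa>\<close>. As \<open>cond\<close> is a single linear
  equation in both uses, any two vectors at the level \<open>\<kappa>\<close> turn out to be
  proportional.\<close>

lemma vanishes:
  assumes f: "Aeig s \<rho> \<kappa> f" and cd: "cond f" and c: "c \<noteq> 0"
  shows "f = (\<lambda>_. 0)"
proof -
  have "f 0 = 0" by (rule cond_0[OF f cd])
  moreover have "(\<lambda>k. f (Suc k)) = (\<lambda>_. 0)"
  proof (rule ccontr)
    assume nz: "(\<lambda>k. f (Suc k)) \<noteq> (\<lambda>_. 0)"
    obtain l where "\<kappa> - c - c * real l = \<kappa>"
      using reaches[OF step[OF f cd] nz] by blast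
    then have "c * real (Suc l) = 0" by (simp add: algebra_simps)
    then show False using c by simp
  qed
  ultimately show ?thesis by (metis not0_implies_Suc)
qed

end

section \<open>The two ladders and the eigenvalues they allow\<close>

context szego_sequence
begin

lemma proj_a_nonzero_inner:
  assumes "proj_a s \<rho> x" "x \<noteq> (\<lambda>_. 0)" shows "seq_inner a x \<noteq> 0" "seq_inner x a \<noteq> 0"
proof -
  show "seq_inner a x \<noteq> 0"
    using assms seq_inner_self_eq_0[OF eig_w0] unfolding proj_a_def by metis
  then show "seq_inner x a \<noteq> 0" by (subst seq_inner_cnj) simp
qed

text \<open>Up to conjugation, \<open>\<mu> * f 0\<close> is the inner product of \<open>f\<close>
  with \<open>hank 0 x\<close>, which sits at the exceptional level; at every other level
  orthogonality gives \<open>f 0 = 0\<close>. The shifted \<open>f\<close> is first an eigenvector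
  for \<open>s = 1\<close>, and \<open>eig_inner_cross\<close> with \<open>x\<close> brings it back
  to \<open>s = 0\<close>.\<close>

lemma ladder_0:
  assumes x: "proj_a 0 \<mu> x" "x \<noteq> (\<lambda>_. 0)" and \<mu>: "\<mu> \<noteq> 0"
  shows "ladder a \<omega> c 0 \<mu> (- (\<mu> - \<omega>) / 2) (\<lambda>f. f 0 = 0)"
proof (rule ladder.intro[OF szego_sequence_axioms], rule ladder_axioms.intro)
  have xz: "\<And>z. eig 0 \<mu> z \<Longrightarrow> seq_inner x z = seq_inner a z" and ex: "eig 0 \<mu> x"
    using x by (auto simp: proj_a_def)
  have hx: "Aeig 0 \<mu> (- (\<mu> - \<omega>) / 2) (hank 0 x)"
    using Aeig_hank[OF Aeig_proj_a[OF x(1) _ \<mu>]] by (simp add: minus_divide_left)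
  fix f \<alpha> assume f: "Aeig 0 \<mu> \<alpha> f"
  then have ef: "eig 0 \<mu> f" by (simp add: Aeig_def)
  show "f 0 = 0" if "\<alpha> \<noteq> - (\<mu> - \<omega>) / 2"
  proof -
    have "of_real \<mu> * f 0 = hank 0 (hank 0 f) 0"
      unfolding eig_hank2[OF ef] ..
    also have "\<dots> = seq_inner x (hank 0 f)"
      unfolding hank0_at_0 xz[OF eig_hank[OF ef]] ..
    also have "\<dots> = cnj (seq_inner (hank 0 x) f)"
      using hank_symmetric[OF eig_w0[OF ef] eig_w0[OF ex], of 0] seq_inner_cnj by metis
    also have "\<dots> = 0" using Aeig_orthogonal[OF hx f] that by simp
    finally show ?thesis using \<mu> by simp
  qed
  show "Aeig 0 \<mu> (\<alpha> - c) (\<lambda>k. f (Suc k))" if f0: "f 0 = 0"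
  proof -
    have w: "weighted_l1 0 (\<lambda>k. f (Suc k))"
      by (intro weighted_l1_Suc_shift eig_w0[OF ef])
    have "hank2 1 (\<lambda>k. f (Suc k)) = (\<lambda>k. of_real \<mu> * f (Suc k))"
      using shift_hank2[OF eig_w0[OF ef]] f0 unfolding eig_hank2[OF ef] by auto
    then have e1: "eig 1 \<mu> (\<lambda>k. f (Suc k))" using eigI[OF w _ \<mu>] by blast
    have orth: "seq_inner (\<lambda>k. f (Suc k)) a = 0"
      using eig_inner_cross[OF ex e1] proj_a_nonzero_inner[OF x] by simp
    have e0: "eig 0 \<mu> (\<lambda>k. f (Suc k))"
      using eig_orthogonal_iff[OF orth w] e1 by blast
    have A01: "Aop 1 (\<lambda>k. f (Suc k)) = Aop 0 (\<lambda>k. f (Suc k))"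
      by (rule ext) (simp only: Aop_def eig_hank2[OF e0] eig_hank2[OF e1])
    have "Aop 0 (\<lambda>k. f (Suc k)) k = of_real (\<alpha> - c) * f (Suc k)" for k
      using shift_Aop[OF eig_w1[OF ef], of k] f f0 unfolding A01 by (simp add: Aeig_def algebra_simps)
    then show ?thesis using e0 by (auto simp: Aeig_def)
  qed
qed auto

text \<open>The exceptional level is that of the projection \<open>y\<close>. Orthogonality to
  \<open>a\<close> makes \<open>f\<close> an eigenvector for \<open>s = 0\<close> too; there
  \<open>\<sigma> * f 0\<close> is an inner product that \<open>eig_inner_cross\<close> with
  \<open>y\<close> annihilates, and the shift returns from \<open>s = 0\<close> to
  \<open>s = 1\<close>.\<close>

lemma ladder_1:
  assumes y: "proj_a 1 \<sigma> y" "y \<noteq> (\<lambda>_. 0)" and \<sigma>: "\<sigma> \<noteq> 0"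
  shows "ladder a \<omega> c 1 \<sigma> ((\<sigma> - \<omega>) / 2) (\<lambda>f. seq_inner f a = 0)"
proof (rule ladder.intro[OF szego_sequence_axioms], rule ladder_axioms.intro)
  have yz: "\<And>z. eig 1 \<sigma> z \<Longrightarrow> seq_inner y z = seq_inner a z" and ey: "eig 1 \<sigma> y"
    using y by (auto simp: proj_a_def)
  fix f \<alpha> assume f: "Aeig 1 \<sigma> \<alpha> f"
  then have ef: "eig 1 \<sigma> f" by (simp add: Aeig_def)
  show "seq_inner f a = 0" if "\<alpha> \<noteq> (\<sigma> - \<omega>) / 2"
  proof -
    have "seq_inner y f = 0"
      using Aeig_orthogonal[OF Aeig_proj_a[OF y(1) _ \<sigma>] f] that by simp
    then show ?thesis using yz[OF ef] seq_inner_cnj[of f a] by simp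
  qed
  { assume orth: "seq_inner f a = 0"
    have e0: "eig 0 \<sigma> f"
      using eig_orthogonal_iff[OF orth eig_w0[OF ef]] ef by blast
    have "of_real \<sigma> * f 0 = hank 0 (hank 0 f) 0"
      unfolding eig_hank2[OF e0] ..
    also have "\<dots> = seq_inner a (hank 0 f)" by (rule hank0_at_0)
    also have "\<dots> = 0"
      using eig_inner_cross[OF eig_hank[OF e0] ey] proj_a_nonzero_inner[OF y] by simp
    finally show f0: "f 0 = 0" using \<sigma> by simp
    have A01: "Aop 1 f = Aop 0 f"
      by (rule ext) (simp only: Aop_def eig_hank2[OF e0] eig_hank2[OF ef])
    have w: "weighted_l1 0 (\<lambda>k. f (Suc k))"
      by (intro weighted_l1_Suc_shift eig_w0[OF ef])
    have "hank2 1 (\<lambda>k. f (Suc k)) = (\<lambda>k. of_real \<sigma> * f (Suc k))"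
      using shift_hank2[OF eig_w0[OF e0]] f0 unfolding eig_hank2[OF e0] by auto
    then have e1: "eig 1 \<sigma> (\<lambda>k. f (Suc k))" using eigI[OF w _ \<sigma>] by blast
    have "Aop 1 (\<lambda>k. f (Suc k)) k = of_real (\<alpha> - c) * f (Suc k)" for k
      using shift_Aop[OF eig_w1[OF ef], of k] f f0 unfolding A01[symmetric] by (simp add: Aeig_def algebra_simps)
    then show "Aeig 1 \<sigma> (\<alpha> - c) (\<lambda>k. f (Suc k))" using e1 by (auto simp: Aeig_def) }
qed

text \<open>The ladder starts at the projection, at level \<open>(\<mu> - \<omega>) / 2\<close>, and
  must reach the opposite level; \<open>l\<close> is the number of steps.\<close>

lemma eigenvalue_0:
  assumes x: "proj_a 0 \<mu> x" "x \<noteq> (\<lambda>_. 0)" and \<mu>: "\<mu> \<noteq> 0"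
  obtains l :: nat where "\<mu> = \<omega> + c * real l"
proof -
  interpret ladder a \<omega> c 0 \<mu> "- (\<mu> - \<omega>) / 2" "\<lambda>f. f 0 = 0" by (rule ladder_0[OF assms])
  obtain l where "(\<mu> - \<omega>) / 2 - c * real l = - (\<mu> - \<omega>) / 2"
    using reaches[OF Aeig_proj_a[OF x(1) _ \<mu>] x(2)] by auto
  then show ?thesis using that[of l] by (simp add: field_simps)
qed

text \<open>This ladder starts at \<open>hank 1 y\<close>, whose level contains the additional
  \<open>- c\<close> of the anticommutation for \<open>s = 1\<close>; therefore the count is
  \<open>Suc j\<close>.\<close>

lemma eigenvalue_1:
  assumes y: "proj_a 1 \<sigma> y" "y \<noteq> (\<lambda>_. 0)" and \<sigma>: "\<sigma> \<noteq> 0"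
  obtains j :: nat where "\<sigma> = \<omega> - c * real (Suc j)"
proof -
  interpret ladder a \<omega> c 1 \<sigma> "(\<sigma> - \<omega>) / 2" "\<lambda>f. seq_inner f a = 0" by (rule ladder_1[OF assms])
  have ey: "eig 1 \<sigma> y" using y by (simp add: proj_a_def)
  have ky: "Aeig 1 \<sigma> (- ((\<sigma> - \<omega>) / 2) - c) (hank 1 y)"
    using Aeig_hank[OF Aeig_proj_a[OF y(1) _ \<sigma>]] by simp
  have "hank 1 y \<noteq> (\<lambda>_. 0)"
  proof
    assume "hank 1 y = (\<lambda>_. 0)"
    then have "hank2 1 y = (\<lambda>_. 0)" by (simp only: hank_zero)
    then show False using eig_hank2[OF ey] \<sigma> y(2) by (auto simp: fun_eq_iff)
  qed
  then obtain l where "- ((\<sigma> - \<omega>) / 2) - c - c * real l = (\<sigma> - \<omega>) / 2"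
    using reaches[OF ky] by auto
  then show ?thesis using that[of l] by (simp add: field_simps)
qed

end

section \<open>Classification of the sequences for nonzero velocity\<close>

context szego_sequence
begin

text \<open>Below the diagonal the Toeplitz matrix consists of entries of \<open>hank 1 a\<close>,
  and it is Hermitian: under \<open>K\<close> the squared modulus is constant.\<close>

lemma toep_off_diagonal:
  assumes K: "hank 1 a = (\<lambda>_. 0)" and "i \<noteq> k" shows "toep k i = 0"
proof -
  have *: "toep k i = 0" if "i < k" for k i
  proof -
    have "toep k i = toep (k - i) 0"
      using toep_shift[of "k - i" i 0] that by simp
    also have "\<dots> = hank 0 a (Suc (k - i - 1))"
      using that by (simp add: toep_0 Suc_diff_Suc)
    finally show ?thesis
      using K by (simp only: shift_hank0)
  qed
  show ?thesis
    using *[of i k] *[of k i] toep_cnj[of i k] assms(2) by (cases "i < k") auto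
qed

text \<open>The equation becomes scalar, and \<open>\<omega> + c * k\<close> can equal the diagonal
  value for at most one \<open>k\<close>.\<close>

lemma monomial_if_hank_1_zero:
  assumes K: "hank 1 a = (\<lambda>_. 0)" and c: "c \<noteq> 0"
  obtains l \<alpha> where "a = (\<lambda>k. if k = l then \<alpha> else 0)"
proof -
  have eq: "toep 0 0 * a k = (of_real \<omega> + of_real c * of_nat k) * a k" for k
  proof -
    have "toep_op a k = (\<Sum>\<^sub>\<infinity>i\<in>{k}. toep k i * a i)"
      unfolding toep_op_def by (rule infsum_cong_neutral) (use toep_off_diagonal[OF K] in auto)
    then have "toep_op a k = toep k k * a k" by simp
    moreover have "toep k k = toep 0 0" using toep_shift[of 0 k 0] by simp
    ultimately show ?thesis unfolding toep_op_a[of k, symmetric] by simp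
  qed
  have uniq: "k = l" if "a k \<noteq> 0" "a l \<noteq> 0" for k l
  proof -
    have "of_real \<omega> + of_real c * complex_of_nat k = of_real \<omega> + of_real c * of_nat l"
      using eq[of k, symmetric] eq[of l, symmetric] mult_right_cancel[OF that(1)] mult_right_cancel[OF that(2)]
      by metis
    then show ?thesis using c by simp
  qed
  show ?thesis
  proof (cases "\<exists>l. a l \<noteq> 0")
    case True
    then obtain l where l: "a l \<noteq> 0" by blast
    have "a k = (if k = l then a l else 0)" for k
    proof (cases "k = l")
      case False
      then have "a k = 0" using uniq[OF _ l, of k] by metis
      then show ?thesis unfolding if_not_P[OF False] .
    qed (simp only: if_True simp_thms)
    then have "a = (\<lambda>k. if k = l then a l else 0)" by (rule ext)
    then show ?thesis by (rule that)
  next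
    case False
    then have "a k = (if k = 0 then 0 else 0)" for k by simp
    then show ?thesis by (intro that[of 0 0] ext)
  qed
qed

lemma hank2_nonzero:
  assumes "weighted_l1 0 f" "hank s f \<noteq> (\<lambda>_. 0)" shows "hank2 s f \<noteq> (\<lambda>_. 0)"
proof
  assume "hank2 s f = (\<lambda>_. 0)"
  then have "seq_norm (hank s f) = 0"
    using hank2_nonneg[OF assms(1), of s] by (simp add: seq_inner_def)
  then show False
    using seq_norm_eq_0[OF hank_w0[OF assms(1)]] assms(2) by blast
qed

lemma seq_inner_a_a: "a \<noteq> (\<lambda>_. 0) \<Longrightarrow> seq_inner a a \<noteq> 0"
  using seq_inner_self_eq_0[OF a0] by auto

lemma proj_a_self: "eig s \<rho> a \<Longrightarrow> proj_a s \<rho> a"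
  by (simp add: proj_a_def)

lemma proj_a_exists:
  assumes "eig s \<rho> z" "seq_inner z a \<noteq> 0" "\<rho> \<noteq> 0"
  obtains x where "proj_a s \<rho> x" "x \<noteq> (\<lambda>_. 0)"
proof -
  obtain x where x: "eig s \<rho> x" "\<And>z. eig s \<rho> z \<Longrightarrow> seq_inner x z = seq_inner a z"
    using eig_projection[OF assms(3) a0] by blast
  have "seq_inner x z \<noteq> 0"
    using x(2)[OF assms(1)] assms(2) seq_inner_cnj[of a z] by simp
  then have "x \<noteq> (\<lambda>_. 0)" by (auto simp: seq_inner_def)
  then show ?thesis using that[of x] x by (auto simp: proj_a_def)
qed

lemma Re_hank2_le:
  assumes "weighted_l1 0 f" "seq_norm (hank2 s f) \<le> \<rho> * seq_norm f"
  shows "Re (seq_inner (hank2 s f) f) \<le> \<rho> * (seq_norm f)\<^sup>2"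
proof -
  have "Re (seq_inner (hank2 s f) f) \<le> seq_norm (hank2 s f) * seq_norm f"
    by (intro seq_inner_le_norm hank_w0 assms(1))
  also have "\<dots> \<le> \<rho> * seq_norm f * seq_norm f"
    by (intro mult_right_mono assms(2) seq_norm_nonneg)
  finally show ?thesis by (simp add: power2_eq_square mult.assoc)
qed

text \<open>For \<open>c \<le> 0\<close>, an eigenvalue \<open>\<sigma>\<close> for
  \<open>s = 1\<close> met by \<open>a\<close> is at least \<open>\<omega>\<close>. The rank one
  term lifts the Rayleigh quotient of \<open>y\<close> for \<open>s = 0\<close> above
  \<open>\<sigma>\<close>, so power iteration finds \<open>\<rho> > \<sigma>\<close> there. If its
  eigenvector \<open>x\<close> is not orthogonal to \<open>a\<close>, then
  \<open>\<rho> \<le> \<omega>\<close>; otherwise \<open>x\<close> is also an eigenvector for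
  \<open>s = 1\<close>, hence orthogonal to \<open>y\<close>, although it is the projection of
  \<open>y\<close>.\<close>

lemma c_positive:
  assumes K: "hank 1 a \<noteq> (\<lambda>_. 0)" shows "c > 0"
proof (rule ccontr)
  assume "\<not> c > 0"
  then have c: "c \<le> 0" by simp
  obtain y \<sigma> where \<sigma>: "\<sigma> > 0" and y0: "weighted_l1 0 y" and ynz: "y \<noteq> (\<lambda>_. 0)" and hy: "hank2 1 y = (\<lambda>k. of_real \<sigma> * y k)"
    and yz: "\<And>z. weighted_l1 0 z \<Longrightarrow> hank2 1 z = (\<lambda>k. of_real \<sigma> * z k) \<Longrightarrow> seq_inner y z = seq_inner a z"
    using hank2_eigenvector[OF a0 hank2_nonzero[OF a0 K]] by metis
  have ey: "eig 1 \<sigma> y" using eigI[OF y0 hy] \<sigma> by simp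
  have py: "proj_a 1 \<sigma> y"
    unfolding proj_a_def using ey yz eig_w0 eig_hank2 by blast
  obtain j :: nat where j: "\<sigma> = \<omega> - c * real (Suc j)"
    using eigenvalue_1[OF py ynz] \<sigma> by auto
  have ge: "\<sigma> \<ge> \<omega>" unfolding j using c by (simp add: mult_nonpos_nonneg)
  have ya: "seq_inner y a \<noteq> 0" by (rule proj_a_nonzero_inner(2)[OF py ynz])
  have "hank2 0 y = (\<lambda>k. of_real \<sigma> * y k + seq_inner y a * a k)"
    using hank2_rank_one[OF y0] unfolding hy by (auto simp: fun_eq_iff algebra_simps)
  then have "seq_inner (hank2 0 y) y = of_real \<sigma> * seq_inner y y + seq_inner y a * seq_inner a y"
    by (simp add: seq_inner_lincomb_left y0 a0)
  also have "seq_inner y a * seq_inner a y = complex_of_real ((norm (seq_inner y a))\<^sup>2)"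
    unfolding complex_norm_square seq_inner_cnj[of a y] ..
  finally have Re: "Re (seq_inner (hank2 0 y) y) = \<sigma> * (seq_norm y)\<^sup>2 + (norm (seq_inner y a))\<^sup>2"
    by (simp add: seq_inner_self[OF y0] del: of_real_power)
  have yn: "seq_norm y > 0"
    using ynz seq_norm_pos[OF y0] by auto
  have "hank2 0 y \<noteq> (\<lambda>_. 0)"
  proof
    assume "hank2 0 y = (\<lambda>_. 0)"
    then have "\<sigma> * (seq_norm y)\<^sup>2 + (norm (seq_inner y a))\<^sup>2 = 0"
      using Re by (simp add: seq_inner_def)
    then show False using \<sigma> yn ya by (simp add: add_nonneg_eq_0_iff)
  qed
  from hank2_eigenvector[OF y0 this]
  obtain x \<rho> where \<rho>: "\<rho> > 0" and x0: "weighted_l1 0 x" and xnz: "x \<noteq> (\<lambda>_. 0)" and hx: "hank2 0 x = (\<lambda>k. of_real \<rho> * x k)"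
    and le: "seq_norm (hank2 0 y) \<le> \<rho> * seq_norm y"
    and xz: "\<And>z. weighted_l1 0 z \<Longrightarrow> hank2 0 z = (\<lambda>k. of_real \<rho> * z k) \<Longrightarrow> seq_inner x z = seq_inner y z"
    by metis
  have "\<sigma> * (seq_norm y)\<^sup>2 < \<rho> * (seq_norm y)\<^sup>2"
    using Re_hank2_le[OF y0 le] ya unfolding Re by (smt (verit) zero_less_norm_iff zero_less_power)
  then have gt: "\<rho> > \<sigma>" using yn by simp
  have ex: "eig 0 \<rho> x" using eigI[OF x0 hx] \<rho> by simp
  have xa: "seq_inner x a = 0"
  proof (rule ccontr)
    assume ne: "seq_inner x a \<noteq> 0"
    obtain p where "proj_a 0 \<rho> p" "p \<noteq> (\<lambda>_. 0)"
      using proj_a_exists[OF ex ne] \<rho> by auto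
    then obtain l :: nat where "\<rho> = \<omega> + c * real l"
      using eigenvalue_0[of \<rho> p] \<rho> by auto
    moreover have "c * real l \<le> 0" using c by (simp add: mult_nonpos_nonneg)
    ultimately show False using gt ge by linarith
  qed
  have "eig 1 \<rho> x" using eig_orthogonal_iff[OF xa x0] ex by blast
  then have "seq_inner y x = 0"
    using seq_inner_eig_neq[OF ey] gt by blast
  then have "seq_inner x x = 0" using xz[OF x0 hx] by simp
  then show False using seq_inner_self_eq_0[OF x0] xnz by blast
qed

text \<open>Suppose \<open>a\<close> has components in two eigenspaces. A combination
  \<open>g\<close> of them orthogonal to \<open>a\<close> has the same Rayleigh quotient for both
  values of \<open>s\<close>, and it is at least \<open>\<omega>\<close>. Power iteration from
  \<open>g\<close> for \<open>s = 1\<close> gives \<open>\<sigma> \<ge> \<omega>\<close>, so by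
  \<open>eigenvalue_1\<close> its eigenvector is orthogonal to \<open>a\<close>, hence to both
  components and to \<open>g\<close>. But it is the projection of \<open>g\<close>.\<close>

lemma eigenvector_of_positive_velocity:
  assumes c: "c > 0" and nz: "a \<noteq> (\<lambda>_. 0)"
  obtains \<mu> where "\<mu> > 0" "eig 0 \<mu> a"
proof -
  have "hank 0 a 0 \<noteq> 0" using seq_inner_a_a[OF nz] by (simp add: hank0_at_0)
  then have "hank 0 a \<noteq> (\<lambda>_. 0)" by auto
  from hank2_eigenvector[OF a0 hank2_nonzero[OF a0 this]]
  obtain x0 \<mu>0 where \<mu>0: "\<mu>0 > 0" and x00: "weighted_l1 0 x0" and x0nz: "x0 \<noteq> (\<lambda>_. 0)" and hx0: "hank2 0 x0 = (\<lambda>k. of_real \<mu>0 * x0 k)"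
    and x0z: "\<And>z. weighted_l1 0 z \<Longrightarrow> hank2 0 z = (\<lambda>k. of_real \<mu>0 * z k) \<Longrightarrow> seq_inner x0 z = seq_inner a z"
    by metis
  have ex0: "eig 0 \<mu>0 x0" using eigI[OF x00 hx0] \<mu>0 by simp
  have px0: "proj_a 0 \<mu>0 x0"
    unfolding proj_a_def using ex0 x0z eig_w0 eig_hank2 by blast
  obtain l0 :: nat where "\<mu>0 = \<omega> + c * real l0"
    using eigenvalue_0[OF px0 x0nz] \<mu>0 by auto
  then have ge0: "\<mu>0 \<ge> \<omega>" using c by simp
  \<comment> \<open>Power iteration started from the rest of \<open>a\<close> produces the second
    component.\<close>
  define w where "w = (\<lambda>k. 1 * a k + (- 1) * x0 k)"
  have w0: "weighted_l1 0 w" unfolding w_def by (intro weighted_l1_lincomb a0 x00)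
  have wz: "seq_inner w z = seq_inner a z - seq_inner x0 z" if "weighted_l1 0 z" for z
    unfolding w_def by (subst seq_inner_lincomb_left) (use a0 x00 that in auto)
  have x0x0: "seq_inner a x0 = seq_inner x0 x0" "seq_inner x0 a = seq_inner x0 x0"
  proof -
    show *: "seq_inner a x0 = seq_inner x0 x0" using x0z[OF x00 hx0] by simp
    show "seq_inner x0 a = seq_inner x0 x0"
      by (subst seq_inner_cnj, subst *, subst seq_inner_cnj[symmetric]) simp
  qed
  have "w = (\<lambda>_. 0)"
  proof (rule ccontr)
    assume wnz: "w \<noteq> (\<lambda>_. 0)"
    have "hank2 0 w \<noteq> (\<lambda>_. 0)"
    proof (rule hank2_nonzero[OF w0])
      show "hank 0 w \<noteq> (\<lambda>_. 0)"
      proof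
        assume "hank 0 w = (\<lambda>_. 0)"
        then have "seq_inner a w = 0" using hank0_at_0[of w] by simp
        moreover have "seq_inner x0 w = 0"
          using wz[OF x00] seq_inner_cnj[of x0 w] x0x0 by simp
        ultimately have "seq_inner w w = 0" using wz[OF w0] by simp
        then show False using seq_inner_self_eq_0[OF w0] wnz by blast
      qed
    qed
    from hank2_eigenvector[OF w0 this]
    obtain x1 \<mu>1 where \<mu>1: "\<mu>1 > 0" and x10: "weighted_l1 0 x1" and x1nz: "x1 \<noteq> (\<lambda>_. 0)" and hx1: "hank2 0 x1 = (\<lambda>k. of_real \<mu>1 * x1 k)"
      and x1z: "\<And>z. weighted_l1 0 z \<Longrightarrow> hank2 0 z = (\<lambda>k. of_real \<mu>1 * z k) \<Longrightarrow> seq_inner x1 z = seq_inner w z"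
      by metis
    have ex1: "eig 0 \<mu>1 x1" using eigI[OF x10 hx1] \<mu>1 by simp
    have n1: "seq_inner x1 x1 \<noteq> 0" using seq_inner_self_eq_0[OF x10] x1nz by blast
    have ne: "\<mu>0 \<noteq> \<mu>1"
    proof
      assume "\<mu>0 = \<mu>1"
      then have "seq_inner x0 x1 = seq_inner a x1" using x0z[OF x10] hx1 by simp
      then show False using x1z[OF x10 hx1] wz[OF x10] n1 by simp
    qed
    have px1: "proj_a 0 \<mu>1 x1"
      unfolding proj_a_def
    proof (intro conjI allI impI ex1)
      fix z assume z: "eig 0 \<mu>1 z"
      then show "seq_inner x1 z = seq_inner a z"
        using x1z[OF eig_w0[OF z] eig_hank2[OF z]] wz[OF eig_w0[OF z]] seq_inner_eig_neq[OF ex0 z ne] by simp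
    qed
    obtain l1 :: nat where "\<mu>1 = \<omega> + c * real l1"
      using eigenvalue_0[OF px1 x1nz] \<mu>1 by auto
    then have ge1: "\<mu>1 \<ge> \<omega>" using c by simp
    define n0 where "n0 = (seq_norm x0)\<^sup>2"
    define n1 where "n1 = (seq_norm x1)\<^sup>2"
    have n0p: "n0 > 0" using x0nz seq_norm_eq_0[OF x00] by (auto simp: n0_def)
    have n1p: "n1 > 0" using x1nz seq_norm_eq_0[OF x10] by (auto simp: n1_def)
    have i00: "seq_inner x0 x0 = of_real n0" and i11: "seq_inner x1 x1 = of_real n1"
      by (simp_all only: n0_def n1_def seq_inner_self[OF x00] seq_inner_self[OF x10])
    have i01: "seq_inner x0 x1 = 0" "seq_inner x1 x0 = 0"
      using seq_inner_eig_neq[OF ex0 ex1 ne] seq_inner_eig_neq[OF ex1 ex0] ne by auto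
    have x1a: "seq_inner x1 a = of_real n1"
      using px1 ex1 i11 seq_inner_cnj[of x1 a] by (simp add: proj_a_def)
    \<comment> \<open>The weights are crossed so that the contributions \<open>n1 * n0\<close> and
      \<open>n0 * n1\<close> to the inner product with \<open>a\<close> cancel.\<close>
    define g where "g = (\<lambda>k. of_real n1 * x0 k + (- of_real n0) * x1 k)"
    have g0: "weighted_l1 0 g" unfolding g_def by (intro weighted_l1_lincomb x00 x10)
    have gz: "seq_inner g z = of_real n1 * seq_inner x0 z + (- of_real n0) * seq_inner x1 z" if "weighted_l1 0 z" for z
      unfolding g_def by (intro seq_inner_lincomb_left x00 x10 that)
    have zg: "seq_inner z g = of_real n1 * seq_inner z x0 + (- of_real n0) * seq_inner z x1" if "weighted_l1 0 z" for z
      unfolding g_def by (subst seq_inner_lincomb_right[OF x00 x10 that]) simp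
    have ga: "seq_inner g a = 0"
      unfolding gz[OF a0] x0x0 i00 x1a by simp
    have "seq_inner g g = of_real (n1 * n1 * n0 + n0 * n0 * n1)"
      unfolding gz[OF g0] zg[OF x00] zg[OF x10] i00 i11 i01 by simp
    then have gg: "(seq_norm g)\<^sup>2 = n1 * n1 * n0 + n0 * n0 * n1"
      unfolding seq_inner_self[OF g0] by (simp only: of_real_eq_iff)
    have hg: "hank2 1 g = (\<lambda>k. (of_real n1 * of_real \<mu>0) * x0 k + (- of_real n0 * of_real \<mu>1) * x1 k)"
      using hank2_rank_one[OF g0] unfolding ga
      unfolding g_def hank2_lincomb[OF x00 x10] hx0 hx1 by (simp add: mult.assoc)
    have "seq_inner (hank2 1 g) g = of_real (\<mu>0 * (n1 * n1 * n0) + \<mu>1 * (n0 * n0 * n1))"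
      unfolding hg seq_inner_lincomb_left[OF x00 x10 g0] zg[OF x00] zg[OF x10] i00 i11 i01 by simp
    then have Re: "Re (seq_inner (hank2 1 g) g) = \<mu>0 * (n1 * n1 * n0) + \<mu>1 * (n0 * n0 * n1)" by simp
    have pos: "n1 * n1 * n0 > 0" "n0 * n0 * n1 > 0" using n0p n1p by simp_all
    have "hank2 1 g \<noteq> (\<lambda>_. 0)"
    proof
      assume "hank2 1 g = (\<lambda>_. 0)"
      then have "\<mu>0 * (n1 * n1 * n0) + \<mu>1 * (n0 * n0 * n1) = 0"
        using Re by (simp add: seq_inner_def)
      moreover have "\<mu>0 * (n1 * n1 * n0) + \<mu>1 * (n0 * n0 * n1) > 0"
        by (intro add_pos_pos mult_pos_pos n0p n1p \<mu>0 \<mu>1)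
      ultimately show False by simp
    qed
    from hank2_eigenvector[OF g0 this]
    obtain y \<sigma> where \<sigma>: "\<sigma> > 0" and y0: "weighted_l1 0 y" and ynz: "y \<noteq> (\<lambda>_. 0)" and hy: "hank2 1 y = (\<lambda>k. of_real \<sigma> * y k)"
      and le: "seq_norm (hank2 1 g) \<le> \<sigma> * seq_norm g"
      and yz: "\<And>z. weighted_l1 0 z \<Longrightarrow> hank2 1 z = (\<lambda>k. of_real \<sigma> * z k) \<Longrightarrow> seq_inner y z = seq_inner g z"
      by metis
    have ey: "eig 1 \<sigma> y" using eigI[OF y0 hy] \<sigma> by simp
    have "\<omega> * (n1 * n1 * n0 + n0 * n0 * n1) \<le> \<sigma> * (n1 * n1 * n0 + n0 * n0 * n1)"
    proof -
      have "\<omega> * (n1 * n1 * n0) \<le> \<mu>0 * (n1 * n1 * n0)" "\<omega> * (n0 * n0 * n1) \<le> \<mu>1 * (n0 * n0 * n1)"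
        using ge0 ge1 pos by (intro mult_right_mono; simp)+
      then show ?thesis
        using Re_hank2_le[OF g0 le] unfolding Re gg by (simp only: distrib_left)
    qed
    then have ge: "\<sigma> \<ge> \<omega>" using pos by (simp add: mult_le_cancel_right)
    have ya: "seq_inner y a = 0"
    proof (rule ccontr)
      assume ne: "seq_inner y a \<noteq> 0"
      obtain p where "proj_a 1 \<sigma> p" "p \<noteq> (\<lambda>_. 0)"
        using proj_a_exists[OF ey ne] \<sigma> by auto
      then obtain j :: nat where "\<sigma> = \<omega> - c * real (Suc j)"
        using eigenvalue_1[of \<sigma> p] \<sigma> by auto
      moreover have "c * real (Suc j) > 0" using c by simp
      ultimately show False using ge by linarith
    qed
    have ey0: "eig 0 \<sigma> y" using eig_orthogonal_iff[OF ya y0] ey by blast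
    have orth: "seq_inner x y = 0" if "proj_a 0 \<mu> x" for x \<mu>
    proof (cases "\<mu> = \<sigma>")
      case True
      then have "seq_inner x y = seq_inner a y" using that ey0 by (simp add: proj_a_def)
      then show ?thesis using ya seq_inner_cnj[of a y] by simp
    next
      case False
      have "eig 0 \<mu> x" using that by (simp add: proj_a_def)
      then show ?thesis by (rule seq_inner_eig_neq[OF _ ey0 False])
    qed
    have "seq_inner y y = 0"
      using yz[OF y0 hy] gz[OF y0] orth[OF px0] orth[OF px1] by simp
    then show False using seq_inner_self_eq_0[OF y0] ynz by blast
  qed
  then have "a = x0" by (auto simp: w_def fun_eq_iff)
  then show ?thesis using that[OF \<mu>0] ex0 by simp
qed

lemma periodic_sequence:
  assumes rec: "\<And>k. a (k + N) = q * a k" and zero: "\<And>k. k < N \<Longrightarrow> k \<noteq> l \<Longrightarrow> a k = 0"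
    and l: "l < N"
  shows "a k = (if k mod N = l then a l * q ^ (k div N) else 0)"
proof (induction k rule: less_induct)
  case (less k)
  show ?case
  proof (cases "k < N")
    case True
    then show ?thesis using zero[of k] by auto
  next
    case False
    then have "a k = q * a (k - N)" using rec[of "k - N"] by simp
    also have "a (k - N) = (if (k - N) mod N = l then a l * q ^ ((k - N) div N) else 0)"
      using False l by (intro less) auto
    also have "(k - N) mod N = k mod N" using False by (simp add: le_mod_geq)
    also have "(k - N) div N = k div N - 1" using False l by (simp add: le_div_geq)
    finally show ?thesis using False l
      by (auto simp: div_greater_zero_iff simp flip: power_Suc)
  qed
qed

text \<open>When \<open>a\<close> is an eigenvector for both values of \<open>s\<close>, the ladder
  for \<open>s = 0\<close> makes \<open>a\<close> shifted by \<open>l\<close> a multiple of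
  \<open>hank 0 a\<close>, and the ladder for \<open>s = 1\<close> makes \<open>hank 1 a\<close>
  shifted by \<open>j\<close> a multiple of \<open>a\<close>. Eliminating the Hankel images leaves a
  recurrence of step \<open>l + 1 + j\<close>.\<close>

theorem classification:
  assumes c: "c \<noteq> 0"
  obtains N l :: nat and q :: complex where "l < N" "\<And>k. a k = (if k mod N = l then a l * q ^ (k div N) else 0)"
proof (cases "hank 1 a = (\<lambda>_. 0)")
  case True
  obtain l \<alpha> where a: "a = (\<lambda>k. if k = l then \<alpha> else 0)"
    using monomial_if_hank_1_zero[OF True c] by blast
  \<comment> \<open>A monomial is the progression of period \<open>l + 1\<close> with ratio 0, where
    \<open>0 ^ 0 = 1\<close> keeps its first term.\<close>
  have "a k = (if k mod Suc l = l then a l * 0 ^ (k div Suc l) else 0)" for k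
    by (rule periodic_sequence) (auto simp: a)
  then show ?thesis using that[of l "Suc l" 0] by blast
next
  case K: False
  have cp: "c > 0" by (rule c_positive[OF K])
  have nz: "a \<noteq> (\<lambda>_. 0)"
    using K hank_zero by metis
  obtain \<mu> where \<mu>: "\<mu> > 0" and ea: "eig 0 \<mu> a"
    using eigenvector_of_positive_velocity[OF cp nz] by blast
  define \<sigma> where "\<sigma> = \<mu> - (seq_norm a)\<^sup>2"
  have ha: "hank2 1 a = (\<lambda>k. of_real \<sigma> * a k)"
    using hank2_rank_one[OF a0] unfolding eig_hank2[OF ea] seq_inner_self[OF a0] \<sigma>_def
    by (auto simp: algebra_simps)
  have \<sigma>: "\<sigma> \<noteq> 0"
    using hank2_nonzero[OF a0 K] unfolding ha by auto
  have ea1: "eig 1 \<sigma> a" by (rule eigI[OF a0 ha \<sigma>])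
  have \<mu>0: "\<mu> \<noteq> 0" using \<mu> by simp
  define \<kappa> where "\<kappa> = - (\<mu> - \<omega>) / 2"
  interpret L0: ladder a \<omega> c 0 \<mu> \<kappa> "\<lambda>f. f 0 = 0"
    unfolding \<kappa>_def by (rule ladder_0[OF proj_a_self[OF ea] nz \<mu>0])
  obtain l where l: "\<And>k. k < l \<Longrightarrow> a k = 0" and v: "Aeig 0 \<mu> \<kappa> (\<lambda>k. a (k + l))"
    using L0.reaches[OF Aeig_proj_a[OF proj_a_self[OF ea] _ \<mu>0] nz] by auto
  have hu: "Aeig 0 \<mu> \<kappa> (hank 0 a)"
    using Aeig_hank[OF Aeig_proj_a[OF proj_a_self[OF ea] _ \<mu>0]] by (simp add: \<kappa>_def minus_divide_left)
  have hu0: "hank 0 a 0 \<noteq> 0" using seq_inner_a_a[OF nz] by (simp add: hank0_at_0)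
  \<comment> \<open>The factor of proportionality is read off at index 0, where
    \<open>hank 0 a\<close> equals the squared norm of \<open>a\<close>.\<close>
  define \<gamma> where "\<gamma> = a l / hank 0 a 0"
  have "(\<lambda>k. 1 * a (k + l) + (- \<gamma>) * hank 0 a k) = (\<lambda>_. 0)"
    by (rule L0.vanishes[OF Aeig_lincomb[OF v hu] _ c]) (use hu0 in \<open>simp add: \<gamma>_def\<close>)
  then have al: "a (k + l) = \<gamma> * hank 0 a k" for k
    by (simp add: fun_eq_iff)
  have al1: "a (k + Suc l) = \<gamma> * hank 1 a k" for k
    using al[of "Suc k"] unfolding shift_hank0 by simp
  define \<kappa>' where "\<kappa>' = (\<sigma> - \<omega>) / 2"
  interpret L1: ladder a \<omega> c 1 \<sigma> \<kappa>' "\<lambda>f. seq_inner f a = 0"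
    unfolding \<kappa>'_def by (rule ladder_1[OF proj_a_self[OF ea1] nz \<sigma>])
  have A1: "Aeig 1 \<sigma> \<kappa>' a"
    unfolding \<kappa>'_def by (rule Aeig_proj_a[OF proj_a_self[OF ea1] _ \<sigma>]) simp
  obtain j where j: "\<And>k. k < j \<Longrightarrow> hank 1 a k = 0" and g: "Aeig 1 \<sigma> \<kappa>' (\<lambda>k. hank 1 a (k + j))"
    using L1.reaches[OF Aeig_hank[OF A1] K] by auto
  define \<delta> where "\<delta> = seq_inner (\<lambda>k. hank 1 a (k + j)) a / seq_inner a a"
  have "(\<lambda>k. 1 * hank 1 a (k + j) + (- \<delta>) * a k) = (\<lambda>_. 0)"
  proof (rule L1.vanishes[OF Aeig_lincomb[OF g A1] _ c])
    have "weighted_l1 0 (\<lambda>k. hank 1 a (k + j))" by (intro weighted_l1_shift hank_w0 a0)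
    then show "seq_inner (\<lambda>k. 1 * hank 1 a (k + j) + (- \<delta>) * a k) a = 0"
      by (subst seq_inner_lincomb_left) (use a0 seq_inner_a_a[OF nz] in \<open>auto simp: \<delta>_def\<close>)
  qed
  then have gd: "hank 1 a (k + j) = \<delta> * a k" for k
    by (simp add: fun_eq_iff)
  have "a k = (if k mod (Suc l + j) = l then a l * (\<gamma> * \<delta>) ^ (k div (Suc l + j)) else 0)" for k
  proof (rule periodic_sequence)
    show "a (k + (Suc l + j)) = \<gamma> * \<delta> * a k" for k
    proof -
      have "a (k + (Suc l + j)) = a ((k + j) + Suc l)" by (simp add: add_ac)
      then show ?thesis unfolding al1 gd by simp
    qed
    show "a k = 0" if "k < Suc l + j" "k \<noteq> l" for k
    proof (cases "k < l")
      case False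
      define m where "m = k - Suc l"
      have m: "k = m + Suc l" "m < j" using that False by (auto simp: m_def)
      show ?thesis unfolding m(1) al1 using j[OF m(2)] by simp
    qed (rule l)
  qed simp
  then show ?thesis by (intro that[of l "Suc l + j" "\<gamma> * \<delta>"]) simp_all
qed

end

section \<open>The circle measure\<close>

lemma space_circle_measure [simp]: "space circle_measure = sphere 0 1"
  by (simp add: circle_measure_def space_restrict_space)

lemma sets_circle_measure: "sets circle_measure = sets (restrict_space borel (sphere 0 1))"
  by (simp add: circle_measure_def)

interpretation circle: finite_measure circle_measure
  by standard (simp add: emeasure_circle_measure)

lemma measure_circle [simp]: "measure circle_measure (sphere 0 1) = 1"
  by (simp add: measure_def emeasure_circle_measure)

lemma borel_set_circle: "A \<in> sets circle_measure \<Longrightarrow> A \<in> sets borel \<and> A \<subseteq> sphere 0 1"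
  by (auto simp: sets_circle_measure sets_restrict_space)

lemma circle_measure_sets_iff: "A \<in> sets circle_measure \<longleftrightarrow> A \<in> sets borel \<and> A \<subseteq> sphere 0 1"
  by (auto simp: sets_circle_measure sets_restrict_space)

lemma emeasure_circle_measure_eq:
  assumes "A \<in> sets borel" "A \<subseteq> sphere 0 1"
  shows "emeasure circle_measure A = emeasure lborel ({0..<2 * pi} \<inter> cis -` A) / ennreal (2 * pi)"
proof -
  have "A \<in> sets (restrict_space borel (sphere 0 1))"
    using assms circle_measure_sets_iff sets_circle_measure by blast
  then have "emeasure circle_measure A = emeasure (uniform_measure lborel {0..<2 * pi}) (cis -` A)"
    unfolding circle_measure_def by (subst emeasure_distr[OF cis_measurable_circle]) auto
  moreover have "cis \<in> borel_measurable borel"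
    by (intro borel_measurable_continuous_onI continuous_intros)
  then have "cis -` A \<in> sets borel"
    using assms(1) measurable_sets_borel by blast
  ultimately show ?thesis
    by (simp add: emeasure_uniform_measure)
qed

lemma emeasure_lborel_translate:
  fixes c :: real
  assumes "A \<in> sets borel" shows "emeasure lborel ((\<lambda>x. c + x) -` A) = emeasure lborel A"
proof -
  have "emeasure lborel A = emeasure (distr lborel borel ((+) c)) A"
    by (simp add: lborel_distr_plus)
  also have "\<dots> = emeasure lborel ((\<lambda>x. c + x) -` A)"
    by (subst emeasure_distr) (use assms in auto)
  finally show ?thesis by simp
qed

lemma emeasure_periodic_translate:
  fixes B :: "real set"
  assumes B: "B \<in> sets borel" and per: "\<And>x. x + 2 * pi \<in> B \<longleftrightarrow> x \<in> B" and s: "0 \<le> s" "s < 2 * pi"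
  shows "emeasure lborel ({0..<2 * pi} \<inter> (\<lambda>x. s + x) -` B) = emeasure lborel ({0..<2 * pi} \<inter> B)"
proof -
  have "{0..<2 * pi} \<inter> (\<lambda>x. s + x) -` B = (\<lambda>x. s + x) -` ({s..<2 * pi + s} \<inter> B)"
    by auto
  then have "emeasure lborel ({0..<2 * pi} \<inter> (\<lambda>x. s + x) -` B) = emeasure lborel ({s..<2 * pi + s} \<inter> B)"
    using emeasure_lborel_translate[of "{s..<2 * pi + s} \<inter> B" s] B by simp
  \<comment> \<open>The shifted period is cut at \<open>2 * pi\<close>, and periodicity moves the
    overhang back to \<open>{0..<s}\<close>.\<close>
  also have "{s..<2 * pi + s} \<inter> B = ({s..<2 * pi} \<inter> B) \<union> ({2 * pi..<2 * pi + s} \<inter> B)"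
    using s by auto
  also have "emeasure lborel \<dots> = emeasure lborel ({s..<2 * pi} \<inter> B) + emeasure lborel ({2 * pi..<2 * pi + s} \<inter> B)"
    by (rule plus_emeasure[symmetric]) (use B in auto)
  also have "emeasure lborel ({2 * pi..<2 * pi + s} \<inter> B) = emeasure lborel ((\<lambda>x. 2 * pi + x) -` ({2 * pi..<2 * pi + s} \<inter> B))"
    by (rule emeasure_lborel_translate[symmetric]) (use B in auto)
  also have "(\<lambda>x. 2 * pi + x) -` ({2 * pi..<2 * pi + s} \<inter> B) = {0..<s} \<inter> B"
    using per by (auto simp: add.commute)
  also have "emeasure lborel ({s..<2 * pi} \<inter> B) + emeasure lborel ({0..<s} \<inter> B) = emeasure lborel (({s..<2 * pi} \<inter> B) \<union> ({0..<s} \<inter> B))"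
    by (rule plus_emeasure) (use B in auto)
  also have "({s..<2 * pi} \<inter> B) \<union> ({0..<s} \<inter> B) = {0..<2 * pi} \<inter> B"
    using s by auto
  finally show ?thesis .
qed

lemma rotation_measurable:
  assumes "norm w = 1" shows "(\<lambda>z. w * z) \<in> measurable circle_measure circle_measure"
proof -
  have "(\<lambda>z. w * z) \<in> measurable (restrict_space borel (sphere 0 1)) (restrict_space borel (sphere 0 1))"
    by (rule measurable_restrict_space3) (use assms in \<open>auto simp: norm_mult\<close>)
  then show ?thesis
    by (simp add: measurable_def sets_circle_measure space_restrict_space)
qed

text \<open>In the angle a rotation is a translation modulo \<open>2 * pi\<close>, so translation
  invariance of Lebesgue measure and periodicity of \<open>cis\<close> suffice.\<close>

lemma rotation_invariance:
  assumes w: "norm w = 1"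
  shows "distr circle_measure circle_measure (\<lambda>z. w * z) = circle_measure"
proof (rule measure_eqI)
  fix A assume A: "A \<in> sets (distr circle_measure circle_measure (\<lambda>z. w * z))"
  then have A': "A \<in> sets borel" "A \<subseteq> sphere 0 1"
    using borel_set_circle by auto
  define s where "s = Arg2pi w"
  have s: "0 \<le> s" "s < 2 * pi" "w = cis s"
    using w Arg2pi[of w] by (auto simp: s_def cis_conv_exp mult.commute is_Arg_def)
  define B where "B = cis -` A"
  have "cis \<in> borel_measurable borel"
    by (intro borel_measurable_continuous_onI continuous_intros)
  then have B: "B \<in> sets borel"
    unfolding B_def using A'(1) measurable_sets_borel by blast
  have per: "x + 2 * pi \<in> B \<longleftrightarrow> x \<in> B" for x
    by (simp add: B_def flip: cis_mult)
  define A2 where "A2 = (\<lambda>z. w * z) -` A \<inter> sphere 0 1"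
  have A2s: "A2 \<in> sets circle_measure"
    using measurable_sets[OF rotation_measurable[OF w], of A] A by (simp add: A2_def)
  have "emeasure (distr circle_measure circle_measure (\<lambda>z. w * z)) A = emeasure circle_measure A2"
    using A by (subst emeasure_distr[OF rotation_measurable[OF w]]) (simp_all add: A2_def)
  also have "\<dots> = emeasure lborel ({0..<2 * pi} \<inter> cis -` A2) / ennreal (2 * pi)"
    using borel_set_circle[OF A2s] by (intro emeasure_circle_measure_eq) auto
  also have "cis -` A2 = (\<lambda>x. s + x) -` B"
    by (auto simp: A2_def B_def s(3) cis_mult)
  also have "emeasure lborel ({0..<2 * pi} \<inter> (\<lambda>x. s + x) -` B) = emeasure lborel ({0..<2 * pi} \<inter> B)"
    by (rule emeasure_periodic_translate[OF B per s(1,2)])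
  also have "\<dots> / ennreal (2 * pi) = emeasure circle_measure A"
    unfolding B_def by (rule emeasure_circle_measure_eq[OF A', symmetric])
  finally show "emeasure (distr circle_measure circle_measure (\<lambda>z. w * z)) A = emeasure circle_measure A" .
qed simp

lemma integral_rotation:
  fixes f :: "complex \<Rightarrow> 'b :: {banach, second_countable_topology}"
  assumes w: "norm w = 1" and f: "f \<in> borel_measurable circle_measure"
  shows "(\<integral>z. f (w * z) \<partial>circle_measure) = (\<integral>z. f z \<partial>circle_measure)"
  using integral_distr[OF rotation_measurable[OF w] f] by (simp add: rotation_invariance[OF w])

lemma integrable_rotation:
  fixes f :: "complex \<Rightarrow> 'b :: {banach, second_countable_topology}"
  assumes w: "norm w = 1" and f: "integrable circle_measure f"
  shows "integrable circle_measure (\<lambda>z. f (w * z))"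
  using integrable_distr[OF rotation_measurable[OF w], of f] f by (simp add: rotation_invariance[OF w])

lemma AE_rotation:
  assumes w: "norm w = 1" and P: "AE z in circle_measure. P z"
  shows "AE z in circle_measure. P (w * z)"
proof -
  have "AE z in distr circle_measure circle_measure (\<lambda>z. w * z). P z"
    by (subst rotation_invariance[OF w]) (rule P)
  then show ?thesis by (rule AE_distrD[OF rotation_measurable[OF w]])
qed

lemma continuous_borel_measurable_circle:
  fixes f :: "complex \<Rightarrow> 'b :: topological_space"
  assumes "continuous_on (sphere 0 1) f" shows "f \<in> borel_measurable circle_measure"
  using borel_measurable_continuous_on_restrict[OF assms]
  by (simp add: measurable_def sets_circle_measure space_restrict_space)

lemma integrable_bounded_circle:
  fixes f :: "complex \<Rightarrow> 'b :: {banach, second_countable_topology}"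
  assumes "f \<in> borel_measurable circle_measure" "\<And>z. norm z = 1 \<Longrightarrow> norm (f z) \<le> B"
  shows "integrable circle_measure f"
  by (rule circle.integrable_const_bound[of _ B]) (use assms in auto)

lemma integrable_continuous_circle:
  fixes f :: "complex \<Rightarrow> 'b :: {banach, second_countable_topology}"
  assumes "continuous_on (sphere 0 1) f" shows "integrable circle_measure f"
proof -
  have "compact (f ` sphere 0 1)"
    by (rule compact_continuous_image[OF assms]) simp
  then obtain B where "\<And>z. norm z = 1 \<Longrightarrow> norm (f z) \<le> B"
    using compact_imp_bounded[of "f ` sphere 0 1"] by (force simp: bounded_iff)
  then show ?thesis
    by (intro integrable_bounded_circle continuous_borel_measurable_circle assms)
qed

lemma integrable_mult_bounded_circle:
  fixes f g :: "complex \<Rightarrow> complex"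
  assumes f: "integrable circle_measure f" and g: "g \<in> borel_measurable circle_measure"
    and bd: "\<And>z. norm z = 1 \<Longrightarrow> norm (g z) \<le> B"
  shows "integrable circle_measure (\<lambda>z. f z * g z)"
proof (rule Bochner_Integration.integrable_bound)
  show "integrable circle_measure (\<lambda>z. B *\<^sub>R f z)" using f by simp
  have "0 \<le> B" using bd[of 1] norm_ge_zero[of "g 1"] by (simp del: norm_ge_zero)
  then show "AE z in circle_measure. norm (f z * g z) \<le> norm (B *\<^sub>R f z)"
    by (intro AE_I2) (auto simp: norm_mult mult.commute[of B] intro!: mult_left_mono bd)
qed (use f g in auto)

lemma continuous_on_powi_circle: "continuous_on (sphere 0 1) (\<lambda>z::complex. z powi k)"
  by (intro continuous_intros) auto

lemma integrable_mult_powi: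
  assumes f: "integrable circle_measure f" shows "integrable circle_measure (\<lambda>z. f z * z powi k)"
  by (rule integrable_mult_bounded_circle[OF f, where B = 1])
     (auto intro!: continuous_borel_measurable_circle continuous_on_powi_circle simp: norm_power_int)

lemma integral_powi_circle: "(\<integral>z. z powi k \<partial>circle_measure) = (if k = 0 then 1 else 0)"
proof (cases "k = 0")
  case True
  then show ?thesis by simp
next
  case False
  \<comment> \<open>The rotation that multiplies \<open>z powi k\<close> by \<open>-1\<close>;
    invariance then makes the integral equal to its negative.\<close>
  define w where "w = cis (pi / real_of_int k)"
  have w: "norm w = 1" by (simp add: w_def)
  have "w powi k = -1"
    using False by (simp add: w_def cis_power_int)
  have "(\<integral>z. z powi k \<partial>circle_measure) = (\<integral>z. (w * z) powi k \<partial>circle_measure)"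
    by (rule integral_rotation[OF w, symmetric]) (intro continuous_borel_measurable_circle continuous_on_powi_circle)
  also have "\<dots> = - (\<integral>z. z powi k \<partial>circle_measure)"
    by (simp add: power_int_mult_distrib \<open>w powi k = -1\<close>)
  finally show ?thesis using False by (simp add: eq_neg_iff_add_eq_0 flip: mult_2)
qed

lemma cnj_circle: "norm z = 1 \<Longrightarrow> cnj z = inverse z"
  using complex_norm_square[of z] by (simp add: inverse_unique[symmetric])

lemma cnj_powi_circle: "norm z = 1 \<Longrightarrow> cnj (z powi k) = z powi (- k)"
  by (simp add: cnj_circle power_int_inverse power_int_minus)

section \<open>Approximation by trigonometric polynomials\<close>

text \<open>Products, conjugates and real polynomials can then be handled by rule induction.
  Identities are claimed on the circle only, because \<open>powi\<close> is not multiplicative in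
  the exponent at 0.\<close>

inductive trig_poly :: "(complex \<Rightarrow> complex) \<Rightarrow> bool" where
  monom: "trig_poly (\<lambda>z. c * z powi k)"
| add: "trig_poly f \<Longrightarrow> trig_poly g \<Longrightarrow> trig_poly (\<lambda>z. f z + g z)"

lemma trig_poly_const: "trig_poly (\<lambda>z. c)"
  using trig_poly.monom[of c 0] by simp

lemma trig_poly_cmult: "trig_poly f \<Longrightarrow> trig_poly (\<lambda>z. c * f z)"
proof (induction rule: trig_poly.induct)
  case (monom d k)
  show ?case using trig_poly.monom[of "c * d" k] by (simp add: mult.assoc)
next
  case (add f g)
  then show ?case using trig_poly.add[OF add.IH] by (simp add: distrib_left)
qed

lemma trig_poly_mult_powi:
  assumes "trig_poly f" shows "\<exists>h. trig_poly h \<and> (\<forall>z\<in>sphere 0 1. h z = c * z powi k * f z)"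
  using assms
proof (induction rule: trig_poly.induct)
  case (monom d j)
  have "\<forall>z\<in>sphere 0 1. (c * d) * z powi (k + j) = c * z powi k * (d * z powi j)"
  proof
    fix z :: complex assume "z \<in> sphere 0 1"
    then have "z \<noteq> 0" by auto
    then show "(c * d) * z powi (k + j) = c * z powi k * (d * z powi j)"
      by (simp add: power_int_add)
  qed
  then show ?case using trig_poly.monom by blast
next
  case (add f g)
  then obtain h1 h2 where h: "trig_poly h1" "\<forall>z\<in>sphere 0 1. h1 z = c * z powi k * f z"
     "trig_poly h2" "\<forall>z\<in>sphere 0 1. h2 z = c * z powi k * g z" by blast
  have "trig_poly (\<lambda>z. h1 z + h2 z)" by (intro trig_poly.add h)
  moreover have "\<forall>z\<in>sphere 0 1. h1 z + h2 z = c * z powi k * (f z + g z)"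
    using h by (simp add: distrib_left)
  ultimately show ?case by (intro exI[of _ "\<lambda>z. h1 z + h2 z"]) simp
qed

lemma trig_poly_mult:
  assumes "trig_poly f" and g: "trig_poly g" shows "\<exists>h. trig_poly h \<and> (\<forall>z\<in>sphere 0 1. h z = f z * g z)"
  using assms(1)
proof (induction rule: trig_poly.induct)
  case (monom c k)
  then show ?case by (rule trig_poly_mult_powi[OF g])
next
  case (add f1 f2)
  then obtain h1 h2 where h: "trig_poly h1" "\<forall>z\<in>sphere 0 1. h1 z = f1 z * g z"
     "trig_poly h2" "\<forall>z\<in>sphere 0 1. h2 z = f2 z * g z" by blast
  have "trig_poly (\<lambda>z. h1 z + h2 z)" by (intro trig_poly.add h)
  moreover have "\<forall>z\<in>sphere 0 1. h1 z + h2 z = (f1 z + f2 z) * g z"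
    using h by (simp add: distrib_right)
  ultimately show ?case by (intro exI[of _ "\<lambda>z. h1 z + h2 z"]) simp
qed

lemma real_polynomial_trig_poly:
  fixes f :: "complex \<Rightarrow> real"
  assumes "real_polynomial_function f"
  shows "\<exists>h. trig_poly h \<and> (\<forall>z\<in>sphere 0 1. h z = of_real (f z))"
  using assms
proof (induction rule: real_polynomial_function.induct)
  case (linear f)
  interpret bounded_linear f by fact
  \<comment> \<open>On the circle \<open>z powi (-1)\<close> is \<open>cnj z\<close>; the two
    coefficients express the real linear map \<open>f\<close> through \<open>z\<close> and
    \<open>cnj z\<close>.\<close>
  define h where "h = (\<lambda>z. ((f 1 - \<i> * f \<i>) / 2) * z powi 1 + ((f 1 + \<i> * f \<i>) / 2) * z powi (-1))"
  have "trig_poly h" unfolding h_def by (intro trig_poly.intros)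
  moreover have "h z = of_real (f z)" if "z \<in> sphere 0 1" for z
  proof -
    have z: "norm z = 1" using that by simp
    have "f z = f (Re z *\<^sub>R 1 + Im z *\<^sub>R \<i>)"
      by (rule arg_cong[where f = f]) (simp add: complex_eq_iff)
    then have fz: "f z = Re z * f 1 + Im z * f \<i>" by (simp add: add scale)
    have "h z = ((f 1 - \<i> * f \<i>) / 2) * z + ((f 1 + \<i> * f \<i>) / 2) * cnj z"
      using cnj_circle[OF z] by (simp add: h_def power_int_minus)
    then show ?thesis unfolding fz by (simp add: complex_eq_iff field_simps)
  qed
  ultimately show ?case by blast
next
  case (const c)
  show ?case using trig_poly_const by blast
next
  case (add f g)
  then obtain h1 h2 where h: "trig_poly h1" "\<forall>z\<in>sphere 0 1. h1 z = of_real (f z)"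
     "trig_poly h2" "\<forall>z\<in>sphere 0 1. h2 z = of_real (g z)" by blast
  then show ?case by (intro exI[of _ "\<lambda>z. h1 z + h2 z"]) (simp add: trig_poly.add)
next
  case (mult f g)
  then obtain h1 h2 where h: "trig_poly h1" "\<forall>z\<in>sphere 0 1. h1 z = of_real (f z)"
     "trig_poly h2" "\<forall>z\<in>sphere 0 1. h2 z = of_real (g z)" by blast
  obtain h3 where "trig_poly h3" "\<forall>z\<in>sphere 0 1. h3 z = h1 z * h2 z"
    using trig_poly_mult[OF h(1,3)] by blast
  then show ?case using h by (intro exI[of _ h3]) simp
qed

lemma trig_poly_approximation:
  fixes f :: "complex \<Rightarrow> real"
  assumes "continuous_on (sphere 0 1) f" "e > 0"
  obtains h where "trig_poly h" "\<And>z. norm z = 1 \<Longrightarrow> norm (of_real (f z) - h z) < e"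
proof -
  obtain g where g: "real_polynomial_function g" "\<And>z. z \<in> sphere 0 1 \<Longrightarrow> \<bar>f z - g z\<bar> < e"
    using Stone_Weierstrass_real_polynomial_function[OF _ assms] by auto
  obtain h where h: "trig_poly h" "\<forall>z\<in>sphere 0 1. h z = of_real (g z)"
    using real_polynomial_trig_poly[OF g(1)] by blast
  have "norm (of_real (f z) - h z) < e" if "norm z = 1" for z
    using g(2)[of z] h(2) that by (simp flip: of_real_diff)
  then show ?thesis using that h(1) by blast
qed

text \<open>Conjugating the terms of negative order keeps their real parts. Real continuous
  functions are thus uniformly close to real parts of analytic polynomials, whose exponentials are
  zero free with controlled modulus.\<close>

lemma trig_poly_Re_poly:
  assumes "trig_poly f" shows "\<exists>p::complex poly. \<forall>z\<in>sphere 0 1. Re (f z) = Re (poly p z)"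
  using assms
proof (induction rule: trig_poly.induct)
  case (monom c k)
  show ?case
  proof (cases "k \<ge> 0")
    case True
    then show ?thesis
      by (intro exI[of _ "Polynomial.monom c (nat k)"]) (auto simp: poly_monom power_int_def)
  next
    case False
    have "Re (c * z powi k) = Re (poly (Polynomial.monom (cnj c) (nat (- k))) z)" if "z \<in> sphere 0 1" for z
    proof -
      have "poly (Polynomial.monom (cnj c) (nat (- k))) z = cnj c * z powi (- k)"
        using False by (simp add: poly_monom power_int_def)
      also have "\<dots> = cnj (c * z powi k)"
        using that cnj_powi_circle[of z k] by simp
      finally have "Re (poly (Polynomial.monom (cnj c) (nat (- k))) z) = Re (cnj (c * z powi k))"
        by (rule arg_cong)
      then show ?thesis by (simp only: cnj.simps)
    qed
    then show ?thesis by blast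
  qed
next
  case (add f g)
  then obtain p q :: "complex poly" where "\<forall>z\<in>sphere 0 1. Re (f z) = Re (poly p z)" "\<forall>z\<in>sphere 0 1. Re (g z) = Re (poly q z)"
    by blast
  then show ?case by (intro exI[of _ "p + q"]) simp
qed

lemma poly_Re_approximation:
  fixes f :: "complex \<Rightarrow> real"
  assumes "continuous_on (sphere 0 1) f" "e > 0"
  obtains p :: "complex poly" where "\<And>z. norm z = 1 \<Longrightarrow> \<bar>f z - Re (poly p z)\<bar> < e"
proof -
  obtain h where h: "trig_poly h" "\<And>z. norm z = 1 \<Longrightarrow> norm (of_real (f z) - h z) < e"
    using trig_poly_approximation[OF assms] by blast
  obtain p :: "complex poly" where p: "\<forall>z\<in>sphere 0 1. Re (h z) = Re (poly p z)"
    using trig_poly_Re_poly[OF h(1)] by blast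
  have "\<bar>f z - Re (poly p z)\<bar> < e" if "norm z = 1" for z
    using h(2)[OF that] abs_Re_le_cmod[of "of_real (f z) - h z"] p that by simp
  then show ?thesis by (rule that)
qed

section \<open>Uniqueness of Fourier coefficients\<close>

text \<open>The image of the measure in the whole plane is a finite Borel measure, for which
  approximation by compact sets is available.\<close>

lemma inner_regular_circle:
  assumes A: "A \<in> sets circle_measure"
  shows "emeasure circle_measure A = (SUP K \<in> {K. K \<subseteq> A \<and> compact K}. emeasure circle_measure K)"
proof -
  have A': "A \<in> sets borel" "A \<subseteq> sphere 0 1" using borel_set_circle[OF A] by auto
  define M where "M = distr circle_measure borel (\<lambda>z. z)"
  have meas: "(\<lambda>z. z) \<in> measurable circle_measure borel"
    by (intro continuous_borel_measurable_circle continuous_intros)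
  have em: "emeasure M B = emeasure circle_measure B" if "B \<in> sets borel" "B \<subseteq> sphere 0 1" for B
  proof -
    have "(\<lambda>z. z) -` B \<inter> sphere 0 1 = B" using that by auto
    then show ?thesis unfolding M_def using that by (subst emeasure_distr[OF meas]) auto
  qed
  have fin: "emeasure M (space M) \<noteq> \<infinity>"
  proof -
    have "emeasure M (space M) = emeasure circle_measure (sphere 0 1)"
      unfolding M_def by (subst emeasure_distr[OF meas]) auto
    then show ?thesis by (simp add: emeasure_circle_measure)
  qed
  have "emeasure M A = (SUP K \<in> {K. K \<subseteq> A \<and> compact K}. emeasure M K)"
    by (rule inner_regular) (use fin A' in \<open>auto simp: M_def\<close>)
  also have "\<dots> = (SUP K \<in> {K. K \<subseteq> A \<and> compact K}. emeasure circle_measure K)"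
    by (rule SUP_cong) (use em A'(2) in \<open>auto intro: borel_compact\<close>)
  finally show ?thesis using em[OF A'] by simp
qed

lemma compact_inner_circle:
  assumes A: "A \<in> sets circle_measure"
    and null: "\<And>K. compact K \<Longrightarrow> K \<subseteq> A \<Longrightarrow> emeasure circle_measure K = 0"
  shows "emeasure circle_measure A = 0"
  unfolding inner_regular_circle[OF A] by (rule SUP_eq_const) (use null in auto)

text \<open>A continuous substitute for the indicator of \<open>K\<close>, to which it converges for
  closed nonempty \<open>K\<close>. Distances to the empty set are 0, so \<open>K = {}\<close> is
  always treated apart.\<close>

definition bump :: "complex set \<Rightarrow> nat \<Rightarrow> complex \<Rightarrow> real" where
  "bump K n z = max 0 (1 - real n * infdist z K)"

lemma bump_range: "0 \<le> bump K n z" "bump K n z \<le> 1"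
  by (auto simp: bump_def infdist_nonneg)

lemma bump_continuous: "continuous_on S (bump K n)"
  unfolding bump_def by (intro continuous_intros)

lemma bump_tendsto:
  assumes "closed K" "K \<noteq> {}" shows "(\<lambda>n. bump K n z) \<longlonglongrightarrow> indicator K z"
proof (cases "z \<in> K")
  case True
  then show ?thesis by (simp add: bump_def)
next
  case False
  then have pos: "infdist z K > 0"
    using assms in_closed_iff_infdist_zero infdist_nonneg by (metis less_eq_real_def)
  obtain N :: nat where N: "1 / infdist z K < real N" using reals_Archimedean2 by blast
  have "bump K n z = 0" if "n \<ge> N" for n
  proof -
    have "1 < real N * infdist z K" using N pos by (simp add: field_simps)
    also have "\<dots> \<le> real n * infdist z K" using that pos by (intro mult_right_mono) auto
    finally show ?thesis by (simp add: bump_def)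
  qed
  then have "eventually (\<lambda>n. bump K n z = 0) sequentially"
    using eventually_sequentially by blast
  then show ?thesis using False by (simp add: tendsto_eventually)
qed

lemma integral_times_poly_zero:
  fixes G :: "complex \<Rightarrow> complex"
  assumes G: "integrable circle_measure G" and z: "\<And>n::nat. (\<integral>z. G z * z ^ n \<partial>circle_measure) = 0"
  shows "(\<integral>z. G z * poly p z \<partial>circle_measure) = 0" "integrable circle_measure (\<lambda>z. G z * poly p z)"
proof -
  have i: "integrable circle_measure (\<lambda>z. G z * z ^ n)" for n
    using integrable_mult_powi[OF G, of "int n"] by simp
  have eq: "(\<lambda>z. G z * poly p z) = (\<lambda>z. \<Sum>n\<le>degree p. coeff p n * (G z * z ^ n))"
    by (auto simp: poly_altdef sum_distrib_left mult_ac)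
  show "(\<integral>z. G z * poly p z \<partial>circle_measure) = 0"
    unfolding eq by (subst Bochner_Integration.integral_sum) (auto simp: i z)
  show "integrable circle_measure (\<lambda>z. G z * poly p z)"
    unfolding eq by (intro Bochner_Integration.integrable_sum integrable_mult_right i)
qed

text \<open>Since \<open>F\<close> is real, vanishing against all \<open>z ^ n\<close> with
  \<open>n \<ge> 0\<close> means vanishing against real parts of polynomials, which are uniformly
  dense among real continuous functions.\<close>

lemma real_integral_continuous_zero:
  fixes F :: "complex \<Rightarrow> real"
  assumes F: "integrable circle_measure F"
    and z: "\<And>n::nat. (\<integral>z. of_real (F z) * z ^ n \<partial>circle_measure) = (0::complex)"
    and \<phi>: "continuous_on (sphere 0 1) \<phi>"
  shows "(\<integral>z. F z * \<phi> z \<partial>circle_measure) = 0"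
proof (rule ccontr)
  assume ne: "\<not> ?thesis"
  define I where "I = (\<integral>z. \<bar>F z\<bar> \<partial>circle_measure)"
  have I0: "I \<ge> 0" by (simp add: I_def)
  \<comment> \<open>Dividing by \<open>I + 1\<close> keeps the quotient defined for
    \<open>I = 0\<close> and makes the final comparison strict.\<close>
  define e where "e = \<bar>\<integral>z. F z * \<phi> z \<partial>circle_measure\<bar> / (I + 1)"
  have e: "e > 0" using ne I0 by (simp add: e_def)
  obtain p :: "complex poly" where p: "\<And>z. norm z = 1 \<Longrightarrow> \<bar>\<phi> z - Re (poly p z)\<bar> < e"
    using poly_Re_approximation[OF \<phi> e] by blast
  have le: "\<bar>F z * (\<phi> z - Re (poly p z))\<bar> \<le> e * \<bar>F z\<bar>" if "norm z = 1" for z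
    using p[OF that] by (simp add: abs_mult mult.commute[of e] mult_left_mono)
  have cont: "continuous_on (sphere 0 1) (\<lambda>z. \<phi> z - Re (poly p z))"
    by (intro continuous_intros \<phi>)
  have Fc: "integrable circle_measure (\<lambda>z. complex_of_real (F z))" using F by simp
  note ip = integral_times_poly_zero[OF Fc z, of p]
  have iRe: "integrable circle_measure (\<lambda>z. F z * Re (poly p z))" "(\<integral>z. F z * Re (poly p z) \<partial>circle_measure) = 0"
  proof -
    have "(\<lambda>z. F z * Re (poly p z)) = (\<lambda>z. Re (complex_of_real (F z) * poly p z))" by simp
    then show "integrable circle_measure (\<lambda>z. F z * Re (poly p z))" "(\<integral>z. F z * Re (poly p z) \<partial>circle_measure) = 0"
      using ip integrable_Re[OF ip(2)] integral_Re[OF ip(2)] by auto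
  qed
  have id: "integrable circle_measure (\<lambda>z. F z * (\<phi> z - Re (poly p z)))"
  proof (rule Bochner_Integration.integrable_bound[where f = "\<lambda>z. e * F z"])
    show "(\<lambda>z. F z * (\<phi> z - Re (poly p z))) \<in> borel_measurable circle_measure"
      using continuous_borel_measurable_circle[OF cont] F by measurable
    show "AE z in circle_measure. norm (F z * (\<phi> z - Re (poly p z))) \<le> norm (e * F z)"
      using le e by (intro AE_I2) (simp add: abs_mult)
  qed (use F in simp)
  have "(\<integral>z. F z * \<phi> z \<partial>circle_measure) = (\<integral>z. F z * (\<phi> z - Re (poly p z)) + F z * Re (poly p z) \<partial>circle_measure)"
    by (simp add: algebra_simps)
  also have "\<dots> = (\<integral>z. F z * (\<phi> z - Re (poly p z)) \<partial>circle_measure)"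
    by (simp add: Bochner_Integration.integral_add[OF id iRe(1)] iRe(2))
  finally have "\<bar>\<integral>z. F z * \<phi> z \<partial>circle_measure\<bar> = \<bar>\<integral>z. F z * (\<phi> z - Re (poly p z)) \<partial>circle_measure\<bar>"
    by simp
  also have "\<dots> \<le> (\<integral>z. \<bar>F z * (\<phi> z - Re (poly p z))\<bar> \<partial>circle_measure)"
    by (rule integral_abs_bound)
  also have "\<dots> \<le> (\<integral>z. e * \<bar>F z\<bar> \<partial>circle_measure)"
    by (rule integral_mono) (use id F le in auto)
  also have "\<dots> = e * I" by (simp add: I_def)
  also have "\<dots> < e * (I + 1)" using e by simp
  also have "\<dots> = \<bar>\<integral>z. F z * \<phi> z \<partial>circle_measure\<bar>" using I0 by (simp add: e_def)
  finally show False by simp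
qed

text \<open>The integral of \<open>F\<close> over a compact subset of \<open>{F > 0}\<close> is a
  limit of integrals against bumps, hence zero, so such subsets are null; inner regularity extends
  this to the whole set.\<close>

lemma real_L1_unique_aux:
  fixes F :: "complex \<Rightarrow> real"
  assumes F: "integrable circle_measure F"
    and z: "\<And>n::nat. (\<integral>z. of_real (F z) * z ^ n \<partial>circle_measure) = (0::complex)"
  shows "AE z in circle_measure. F z \<le> 0"
proof -
  define A where "A = {z \<in> space circle_measure. F z > 0}"
  have Fm: "F \<in> borel_measurable circle_measure" using F by simp
  then have A: "A \<in> sets circle_measure" unfolding A_def by measurable
  have "emeasure circle_measure A = 0"
  proof (rule compact_inner_circle[OF A])
    fix K assume K: "compact K" "K \<subseteq> A"
    show "emeasure circle_measure K = 0"
    proof (cases "K = {}")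
      case False
      have Ks: "K \<in> sets circle_measure"
        unfolding circle_measure_sets_iff using K by (auto simp: A_def intro: borel_compact)
      have lim: "(\<lambda>n. \<integral>z. F z * bump K n z \<partial>circle_measure) \<longlonglongrightarrow> (\<integral>z. F z * indicator K z \<partial>circle_measure)"
      proof (rule integral_dominated_convergence[where w = "\<lambda>z. \<bar>F z\<bar>"])
        show "(\<lambda>z. F z * indicator K z) \<in> borel_measurable circle_measure"
          using Fm Ks by measurable
        show "(\<lambda>z. F z * bump K n z) \<in> borel_measurable circle_measure" for n
          using Fm continuous_borel_measurable_circle[OF bump_continuous, of K n] by measurable
        show "AE z in circle_measure. (\<lambda>n. F z * bump K n z) \<longlonglongrightarrow> F z * indicator K z"
          by (intro AE_I2 tendsto_intros bump_tendsto compact_imp_closed K False)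
        show "AE z in circle_measure. norm (F z * bump K n z) \<le> \<bar>F z\<bar>" for n
          using bump_range by (intro AE_I2) (auto simp: abs_mult mult_left_le)
      qed (use F in simp)
      have b0: "(\<integral>z. F z * bump K n z \<partial>circle_measure) = 0" for n
        by (rule real_integral_continuous_zero[OF F z bump_continuous])
      have zero: "(\<integral>z. F z * indicator K z \<partial>circle_measure) = 0"
        using lim unfolding b0 LIMSEQ_const_iff by simp
      have "AE z in circle_measure. F z * indicator K z = 0"
      proof (rule integral_nonneg_eq_0_iff_AE[THEN iffD1, OF _ _ zero])
        show "integrable circle_measure (\<lambda>z. F z * indicator K z)"
          using integrable_mult_indicator[OF Ks F] by (simp add: mult.commute)
        show "AE z in circle_measure. 0 \<le> F z * indicator K z"
          using K by (intro AE_I2) (auto simp: A_def indicator_def less_imp_le)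
      qed
      then have "AE z in circle_measure. z \<notin> K"
        by eventually_elim (use K in \<open>auto simp: A_def indicator_def\<close>)
      then show ?thesis using AE_iff_measurable[OF Ks, of "\<lambda>z. z \<notin> K"] K by (auto simp: A_def)
    qed simp
  qed
  moreover have "{z \<in> space circle_measure. \<not> F z \<le> 0} = A" by (auto simp: A_def)
  ultimately show ?thesis using A by (subst AE_iff_measurable) auto
qed

lemma real_L1_unique:
  fixes F :: "complex \<Rightarrow> real"
  assumes F: "integrable circle_measure F"
    and z: "\<And>n::nat. (\<integral>z. of_real (F z) * z ^ n \<partial>circle_measure) = (0::complex)"
  shows "AE z in circle_measure. F z = 0"
proof -
  have "AE z in circle_measure. F z \<le> 0" by (rule real_L1_unique_aux[OF assms])
  moreover have "AE z in circle_measure. - F z \<le> 0"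
    by (rule real_L1_unique_aux) (use F z in auto)
  ultimately show ?thesis by eventually_elim auto
qed

lemma complex_L1_unique:
  fixes G :: "complex \<Rightarrow> complex"
  assumes G: "integrable circle_measure G" and z: "\<And>k. fourier_coeff G k = 0"
  shows "AE z in circle_measure. G z = 0"
proof -
  have i: "integrable circle_measure (\<lambda>z. G z * z powi k)" for k by (rule integrable_mult_powi[OF G])
  have z': "(\<integral>z. G z * z powi k \<partial>circle_measure) = 0" for k using z[of "- k"] by (simp add: fourier_coeff_def)
  have zc: "(\<integral>z. cnj (G z) * z powi k \<partial>circle_measure) = 0" "integrable circle_measure (\<lambda>z. cnj (G z) * z powi k)" for k
  proof -
    have "(\<integral>z. cnj (G z) * z powi k \<partial>circle_measure) = (\<integral>z. cnj (G z * z powi (- k)) \<partial>circle_measure)"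
      using cnj_powi_circle[of _ "- k"] by (intro Bochner_Integration.integral_cong) auto
    then show "(\<integral>z. cnj (G z) * z powi k \<partial>circle_measure) = 0"
      by (simp add: z' del: complex_cnj_power_int complex_cnj_mult)
    have "integrable circle_measure (\<lambda>z. cnj (G z * z powi (- k)))" using i[of "- k"] by (rule integrable_cnj)
    then show "integrable circle_measure (\<lambda>z. cnj (G z) * z powi k)"
      by (rule Bochner_Integration.integrable_cong[THEN iffD1, rotated 2]) (use cnj_powi_circle[of _ "- k"] in auto)
  qed
  have "AE z in circle_measure. Re (G z) = 0"
  proof (rule real_L1_unique)
    fix n :: nat
    have "(\<integral>z. of_real (Re (G z)) * z ^ n \<partial>circle_measure) = (\<integral>z. (1 / 2) * (G z * z powi int n) + (1 / 2) * (cnj (G z) * z powi int n) \<partial>circle_measure)"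
      by (intro Bochner_Integration.integral_cong) (auto simp: complex_eq_iff field_simps)
    also have "\<dots> = (1 / 2) * (\<integral>z. G z * z powi int n \<partial>circle_measure) + (1 / 2) * (\<integral>z. cnj (G z) * z powi int n \<partial>circle_measure)"
      by (subst Bochner_Integration.integral_add) (intro integrable_mult_right i zc | simp)+
    finally show "(\<integral>z. of_real (Re (G z)) * z ^ n \<partial>circle_measure) = (0::complex)" by (simp only: z' zc) simp
  qed (use G in simp)
  moreover have "AE z in circle_measure. Im (G z) = 0"
  proof (rule real_L1_unique)
    fix n :: nat
    have "(\<integral>z. of_real (Im (G z)) * z ^ n \<partial>circle_measure) = (\<integral>z. (- \<i> / 2) * (G z * z powi int n) + (\<i> / 2) * (cnj (G z) * z powi int n) \<partial>circle_measure)"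
      by (intro Bochner_Integration.integral_cong) (auto simp: complex_eq_iff field_simps)
    also have "\<dots> = (- \<i> / 2) * (\<integral>z. G z * z powi int n \<partial>circle_measure) + (\<i> / 2) * (\<integral>z. cnj (G z) * z powi int n \<partial>circle_measure)"
      by (subst Bochner_Integration.integral_add) (intro integrable_mult_right i zc | simp)+
    finally show "(\<integral>z. of_real (Im (G z)) * z ^ n \<partial>circle_measure) = (0::complex)" by (simp only: z' zc) simp
  qed (use G in simp)
  ultimately show ?thesis by eventually_elim (simp add: complex_eq_iff)
qed

section \<open>Square integrable functions\<close>

lemma L2_circleD: "f \<in> L2_circle \<Longrightarrow> f \<in> borel_measurable circle_measure"
  "f \<in> L2_circle \<Longrightarrow> integrable circle_measure (\<lambda>z. (cmod (f z))\<^sup>2)"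
  by (auto simp: L2_circle_def)

lemma two_mult_le_squares: "2 * (x * y) \<le> x\<^sup>2 + (y::real)\<^sup>2"
  using zero_le_power2[of "x - y"] by (simp add: power2_diff)

lemma L2_circle_mult_integrable:
  assumes f: "f \<in> L2_circle" and g: "g \<in> L2_circle"
  shows "integrable circle_measure (\<lambda>z. f z * g z)"
proof (rule Bochner_Integration.integrable_bound)
  show "integrable circle_measure (\<lambda>z. (cmod (f z))\<^sup>2 + (cmod (g z))\<^sup>2)"
    using f g by (auto simp: L2_circle_def)
  show "(\<lambda>z. f z * g z) \<in> borel_measurable circle_measure"
    using L2_circleD(1)[OF f] L2_circleD(1)[OF g] by measurable
  have "cmod (f z * g z) \<le> (cmod (f z))\<^sup>2 + (cmod (g z))\<^sup>2" for z
    using two_mult_le_squares[of "cmod (f z)" "cmod (g z)"] mult_nonneg_nonneg[OF norm_ge_zero norm_ge_zero, of "f z" "g z"]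
    unfolding norm_mult by linarith
  then show "AE z in circle_measure. norm (f z * g z) \<le> norm ((cmod (f z))\<^sup>2 + (cmod (g z))\<^sup>2)"
    by (intro AE_I2) simp
qed

lemma L2_circle_continuous:
  assumes "continuous_on (sphere 0 1) f" shows "f \<in> L2_circle"
proof -
  have "continuous_on (sphere 0 1) (\<lambda>z. (cmod (f z))\<^sup>2)"
    by (intro continuous_intros assms)
  then show ?thesis
    using integrable_continuous_circle continuous_borel_measurable_circle[OF assms]
    by (auto simp: L2_circle_def)
qed

lemma L2_circle_integrable:
  assumes "f \<in> L2_circle" shows "integrable circle_measure f"
  using L2_circle_mult_integrable[OF assms L2_circle_continuous[of "\<lambda>_. 1"]] by simp

lemma L2_circle_cnj: "f \<in> L2_circle \<Longrightarrow> (\<lambda>z. cnj (f z)) \<in> L2_circle"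
  by (auto simp: L2_circle_def intro: measurable_compose[OF _ borel_measurable_continuous_onI[OF continuous_on_cnj[OF continuous_on_id]]])

lemma L2_circle_mult_bounded:
  assumes f: "f \<in> L2_circle" and g: "g \<in> borel_measurable circle_measure" "\<And>z. norm z = 1 \<Longrightarrow> norm (g z) \<le> B"
  shows "(\<lambda>z. g z * f z) \<in> L2_circle"
  unfolding L2_circle_def
proof (intro CollectI conjI)
  have [measurable]: "f \<in> borel_measurable circle_measure" "g \<in> borel_measurable circle_measure"
    using L2_circleD(1)[OF f] g(1) by auto
  show "(\<lambda>z. g z * f z) \<in> borel_measurable circle_measure" by measurable
  show "integrable circle_measure (\<lambda>z. (cmod (g z * f z))\<^sup>2)"
  proof (rule Bochner_Integration.integrable_bound[OF integrable_mult_right[OF L2_circleD(2)[OF f], of "B\<^sup>2"]])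
    have "0 \<le> B" using g(2)[of 1] norm_ge_zero[of "g 1"] by (simp del: norm_ge_zero)
    then show "AE z in circle_measure. norm ((cmod (g z * f z))\<^sup>2) \<le> norm (B\<^sup>2 * (cmod (f z))\<^sup>2)"
      using g(2) by (intro AE_I2) (auto simp: norm_mult power_mult_distrib intro!: mult_right_mono power_mono)
  qed measurable
qed

lemma L2_circle_add:
  assumes f: "f \<in> L2_circle" and g: "g \<in> L2_circle" shows "(\<lambda>z. f z + g z) \<in> L2_circle"
  unfolding L2_circle_def
proof (intro CollectI conjI)
  show m: "(\<lambda>z. f z + g z) \<in> borel_measurable circle_measure"
    using L2_circleD(1)[OF f] L2_circleD(1)[OF g] by measurable
  have i: "integrable circle_measure (\<lambda>z. 2 * (cmod (f z))\<^sup>2 + 2 * (cmod (g z))\<^sup>2)"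
    using L2_circleD(2)[OF f] L2_circleD(2)[OF g] by auto
  have le: "(cmod (f z + g z))\<^sup>2 \<le> 2 * (cmod (f z))\<^sup>2 + 2 * (cmod (g z))\<^sup>2" for z
  proof -
    have "(cmod (f z + g z))\<^sup>2 \<le> (cmod (f z) + cmod (g z))\<^sup>2"
      by (intro power_mono norm_triangle_ineq) auto
    then show ?thesis using two_mult_le_squares[of "cmod (f z)" "cmod (g z)"]
      by (simp add: power2_sum)
  qed
  show "integrable circle_measure (\<lambda>z. (cmod (f z + g z))\<^sup>2)"
  proof (rule Bochner_Integration.integrable_bound[OF i])
    show "AE z in circle_measure. norm ((cmod (f z + g z))\<^sup>2) \<le> norm (2 * (cmod (f z))\<^sup>2 + 2 * (cmod (g z))\<^sup>2)"
      using le by (intro AE_I2) simp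
  qed (use m in measurable)
qed

lemma L2_circle_cmult: "f \<in> L2_circle \<Longrightarrow> (\<lambda>z. c * f z) \<in> L2_circle"
  by (rule L2_circle_mult_bounded[where B = "norm c"]) auto

lemma L2_circle_diff: "f \<in> L2_circle \<Longrightarrow> g \<in> L2_circle \<Longrightarrow> (\<lambda>z. f z - g z) \<in> L2_circle"
  using L2_circle_add[of f "\<lambda>z. (- 1) * g z"] L2_circle_cmult[of g "- 1"] by simp

lemma L2_circle_powi_mult: "f \<in> L2_circle \<Longrightarrow> (\<lambda>z. z powi k * f z) \<in> L2_circle"
  by (rule L2_circle_mult_bounded[where B = 1])
     (auto intro!: continuous_borel_measurable_circle continuous_on_powi_circle simp: norm_power_int)

lemma L2_circle_AE_cong:
  assumes "f \<in> L2_circle" "g \<in> borel_measurable circle_measure" "AE z in circle_measure. f z = g z"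
  shows "g \<in> L2_circle"
  unfolding L2_circle_def
proof (intro CollectI conjI assms(2))
  have "AE z in circle_measure. (cmod (f z))\<^sup>2 = (cmod (g z))\<^sup>2"
    using assms(3) by eventually_elim simp
  then show "integrable circle_measure (\<lambda>z. (cmod (g z))\<^sup>2)"
    by (rule integrable_cong_AE_imp[OF L2_circleD(2)[OF assms(1)], rotated]) (use assms(2) in measurable)
qed

lemma integral_norm_le_L2_norm:
  assumes f: "f \<in> L2_circle" shows "(\<integral>z. cmod (f z) \<partial>circle_measure) \<le> L2_norm f"
proof -
  define m where "m = (\<integral>z. cmod (f z) \<partial>circle_measure)"
  have i: "integrable circle_measure (\<lambda>z. cmod (f z))" using L2_circle_integrable[OF f] by simp
  note i2 = L2_circleD(2)[OF f]
  \<comment> \<open>Nonnegativity of the variance, the total mass being 1.\<close>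
  have "0 \<le> (\<integral>z. (cmod (f z) - m)\<^sup>2 \<partial>circle_measure)" by simp
  also have "\<dots> = (\<integral>z. (cmod (f z))\<^sup>2 - 2 * m * cmod (f z) + m\<^sup>2 \<partial>circle_measure)"
    by (simp add: power2_diff algebra_simps)
  also have "\<dots> = (\<integral>z. (cmod (f z))\<^sup>2 \<partial>circle_measure) - 2 * m * m + m\<^sup>2"
    using i i2 by (simp add: m_def)
  finally have "m\<^sup>2 \<le> (\<integral>z. (cmod (f z))\<^sup>2 \<partial>circle_measure)" by (simp add: power2_eq_square)
  then show ?thesis unfolding L2_norm_def m_def[symmetric] by (rule real_le_rsqrt)
qed

lemma norm_fourier_coeff_le:
  assumes f: "f \<in> L2_circle" shows "cmod (fourier_coeff f k) \<le> L2_norm f"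
proof -
  have "cmod (fourier_coeff f k) \<le> (\<integral>z. cmod (f z * z powi (- k)) \<partial>circle_measure)"
    unfolding fourier_coeff_def by (rule integral_norm_bound)
  also have "\<dots> = (\<integral>z. cmod (f z) \<partial>circle_measure)"
    by (intro Bochner_Integration.integral_cong) (auto simp: norm_mult norm_power_int)
  also have "\<dots> \<le> L2_norm f" by (rule integral_norm_le_L2_norm[OF f])
  finally show ?thesis .
qed

lemma fourier_coeff_lincomb:
  assumes "integrable circle_measure f" "integrable circle_measure g"
  shows "fourier_coeff (\<lambda>z. x * f z + y * g z) k = x * fourier_coeff f k + y * fourier_coeff g k"
proof -
  have "fourier_coeff (\<lambda>z. x * f z + y * g z) k = (\<integral>z. x * (f z * z powi (- k)) + y * (g z * z powi (- k)) \<partial>circle_measure)"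
    by (simp add: fourier_coeff_def algebra_simps)
  then show ?thesis
    using integrable_mult_powi[OF assms(1), of "- k"] integrable_mult_powi[OF assms(2), of "- k"]
    by (simp add: fourier_coeff_def)
qed

lemma fourier_coeff_cong_AE:
  assumes "AE z in circle_measure. f z = g z" "f \<in> borel_measurable circle_measure" "g \<in> borel_measurable circle_measure"
  shows "fourier_coeff f k = fourier_coeff g k"
  unfolding fourier_coeff_def
proof (rule integral_cong_AE)
  have m: "(\<lambda>z. z powi (- k)) \<in> borel_measurable circle_measure"
    by (intro continuous_borel_measurable_circle continuous_on_powi_circle)
  show "(\<lambda>z. f z * z powi - k) \<in> borel_measurable circle_measure" "(\<lambda>z. g z * z powi - k) \<in> borel_measurable circle_measure"
    using assms(2,3) m by measurable
  show "AE z in circle_measure. f z * z powi - k = g z * z powi - k"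
    using assms(1) by eventually_elim simp
qed

lemma fourier_coeff_powi_mult: "fourier_coeff (\<lambda>z. z powi j * f z) k = fourier_coeff f (k - j)"
  unfolding fourier_coeff_def
proof (rule Bochner_Integration.integral_cong)
  fix z assume "z \<in> space circle_measure"
  then have "z \<noteq> 0" by auto
  then have "z powi (- (k - j)) = z powi j * z powi (- k)"
    by (subst power_int_add[symmetric]) (auto simp: algebra_simps)
  then show "z powi j * f z * z powi - k = f z * z powi - (k - j)" by simp
qed simp

lemma fourier_coeff_rotation:
  assumes w: "norm w = 1" and f: "f \<in> borel_measurable circle_measure"
  shows "fourier_coeff (\<lambda>z. f (w * z)) k = w powi k * fourier_coeff f k"
proof -
  have m: "(\<lambda>z. f z * z powi (- k)) \<in> borel_measurable circle_measure"
    using f continuous_borel_measurable_circle[OF continuous_on_powi_circle, of "- k"] by measurable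
  have w0: "w \<noteq> 0" using w by auto
  have "fourier_coeff (\<lambda>z. f (w * z)) k = (\<integral>z. w powi k * (f (w * z) * (w * z) powi (- k)) \<partial>circle_measure)"
    unfolding fourier_coeff_def
  proof (rule Bochner_Integration.integral_cong)
    fix z
    have "w powi k * w powi (- k) = 1" using w0 by (subst power_int_add[symmetric]) auto
    then show "f (w * z) * z powi - k = w powi k * (f (w * z) * (w * z) powi - k)"
      by (simp add: power_int_mult_distrib algebra_simps)
  qed simp
  then show ?thesis
    using integral_rotation[OF w m] by (simp add: fourier_coeff_def)
qed

section \<open>Bessel's inequality and Parseval's identity\<close>

definition trig_sum :: "int set \<Rightarrow> (int \<Rightarrow> complex) \<Rightarrow> complex \<Rightarrow> complex" where
  "trig_sum F c z = (\<Sum>k\<in>F. c k * z powi k)"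

lemma trig_sum_continuous: "continuous_on (sphere 0 1) (trig_sum F c)"
  unfolding trig_sum_def by (intro continuous_intros) auto

lemma fourier_coeff_monomial: "fourier_coeff (\<lambda>z. z powi j) k = (if j = k then 1 else 0)"
  using fourier_coeff_powi_mult[of j "\<lambda>_. 1" k] integral_powi_circle[of "j - k"]
  by (simp add: fourier_coeff_def)

lemma fourier_coeff_sum:
  assumes "\<And>j. j \<in> F \<Longrightarrow> integrable circle_measure (f j)"
  shows "fourier_coeff (\<lambda>z. \<Sum>j\<in>F. c j * f j z) k = (\<Sum>j\<in>F. c j * fourier_coeff (f j) k)"
proof -
  have "fourier_coeff (\<lambda>z. \<Sum>j\<in>F. c j * f j z) k = (\<integral>z. (\<Sum>j\<in>F. c j * (f j z * z powi (- k))) \<partial>circle_measure)"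
    by (simp add: fourier_coeff_def sum_distrib_right mult.assoc)
  also have "\<dots> = (\<Sum>j\<in>F. \<integral>z. c j * (f j z * z powi (- k)) \<partial>circle_measure)"
    by (intro Bochner_Integration.integral_sum integrable_mult_right integrable_mult_powi assms)
  finally show ?thesis by (simp add: fourier_coeff_def)
qed

lemma fourier_coeff_trig_sum:
  assumes "finite F" shows "fourier_coeff (trig_sum F c) k = (if k \<in> F then c k else 0)"
proof -
  have "fourier_coeff (trig_sum F c) k = (\<Sum>j\<in>F. c j * fourier_coeff (\<lambda>z. z powi j) k)"
    unfolding trig_sum_def[abs_def]
    by (intro fourier_coeff_sum integrable_continuous_circle continuous_on_powi_circle)
  then show ?thesis using assms by (simp add: fourier_coeff_monomial if_distrib cong: if_cong)
qed

lemma integral_mult_cnj_trig_sum: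
  assumes f: "integrable circle_measure f"
  shows "(\<integral>z. f z * cnj (trig_sum F c z) \<partial>circle_measure) = (\<Sum>k\<in>F. cnj (c k) * fourier_coeff f k)"
proof -
  have "(\<integral>z. f z * cnj (trig_sum F c z) \<partial>circle_measure) = (\<integral>z. (\<Sum>k\<in>F. cnj (c k) * (f z * z powi (- k))) \<partial>circle_measure)"
  proof (rule Bochner_Integration.integral_cong)
    fix z :: complex assume "z \<in> space circle_measure"
    then have "cnj (z powi k) = z powi (- k)" for k by (intro cnj_powi_circle) auto
    then have "cnj (trig_sum F c z) = (\<Sum>k\<in>F. cnj (c k) * z powi (- k))"
      unfolding trig_sum_def cnj_sum complex_cnj_mult by simp
    then show "f z * cnj (trig_sum F c z) = (\<Sum>k\<in>F. cnj (c k) * (f z * z powi (- k)))"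
      by (simp add: sum_distrib_left mult_ac)
  qed simp
  also have "\<dots> = (\<Sum>k\<in>F. \<integral>z. cnj (c k) * (f z * z powi (- k)) \<partial>circle_measure)"
    by (intro Bochner_Integration.integral_sum integrable_mult_right integrable_mult_powi f)
  finally show ?thesis by (simp add: fourier_coeff_def)
qed

text \<open>Pythagoras for the orthonormal system \<open>z powi k\<close>. Taking \<open>c\<close>
  to be the Fourier coefficients gives Bessel's inequality and the exact size of the remainder;
  general \<open>c\<close> shows that the partial sum is the best approximation.\<close>

lemma L2_dist_trig_sum:
  assumes f: "f \<in> L2_circle" and F: "finite F"
  shows "(\<integral>z. (cmod (f z - trig_sum F c z))\<^sup>2 \<partial>circle_measure) =
    (\<integral>z. (cmod (f z))\<^sup>2 \<partial>circle_measure) - (\<Sum>k\<in>F. (cmod (fourier_coeff f k))\<^sup>2)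
    + (\<Sum>k\<in>F. (cmod (fourier_coeff f k - c k))\<^sup>2)"
proof -
  define S where "S = trig_sum F c"
  have S: "S \<in> L2_circle" unfolding S_def by (intro L2_circle_continuous trig_sum_continuous)
  have fS: "integrable circle_measure (\<lambda>z. f z * cnj (S z))"
    by (intro L2_circle_mult_integrable f L2_circle_cnj S)
  have SS: "integrable circle_measure (\<lambda>z. S z * cnj (S z))"
    by (intro L2_circle_mult_integrable L2_circle_cnj S)
  have X: "(\<integral>z. f z * cnj (S z) \<partial>circle_measure) = (\<Sum>k\<in>F. cnj (c k) * fourier_coeff f k)"
    unfolding S_def by (rule integral_mult_cnj_trig_sum[OF L2_circle_integrable[OF f]])
  have Y: "(\<integral>z. S z * cnj (S z) \<partial>circle_measure) = (\<Sum>k\<in>F. cnj (c k) * c k)"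
    using integral_mult_cnj_trig_sum[OF L2_circle_integrable[OF S], of F c] F
    by (simp add: S_def fourier_coeff_trig_sum)
  have sq: "(cmod (x - y))\<^sup>2 = (cmod x)\<^sup>2 - 2 * Re (x * cnj y) + Re (y * cnj y)" for x y
    unfolding cmod_power2 by (simp add: power2_eq_square algebra_simps)
  have "(\<integral>z. (cmod (f z - S z))\<^sup>2 \<partial>circle_measure) =
      (\<integral>z. (cmod (f z))\<^sup>2 - 2 * Re (f z * cnj (S z)) + Re (S z * cnj (S z)) \<partial>circle_measure)"
    by (simp only: sq)
  also have "\<dots> = (\<integral>z. (cmod (f z))\<^sup>2 \<partial>circle_measure) - 2 * (\<integral>z. Re (f z * cnj (S z)) \<partial>circle_measure)
      + (\<integral>z. Re (S z * cnj (S z)) \<partial>circle_measure)"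
    using L2_circleD(2)[OF f] integrable_Re[OF fS] integrable_Re[OF SS]
    by (simp only: Bochner_Integration.integral_add Bochner_Integration.integral_diff Bochner_Integration.integrable_diff integrable_mult_right integral_mult_right_zero)
  also have "\<dots> = (\<integral>z. (cmod (f z))\<^sup>2 \<partial>circle_measure) - 2 * Re (\<Sum>k\<in>F. cnj (c k) * fourier_coeff f k) + Re (\<Sum>k\<in>F. cnj (c k) * c k)"
    by (simp only: integral_Re[OF fS] integral_Re[OF SS] X Y)
  also have "\<dots> = (\<integral>z. (cmod (f z))\<^sup>2 \<partial>circle_measure) + (\<Sum>k\<in>F. (cmod (fourier_coeff f k - c k))\<^sup>2 - (cmod (fourier_coeff f k))\<^sup>2)"
    unfolding sq Re_sum sum_distrib_left by (simp add: sum.distrib sum_subtractf mult_ac)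
  finally show ?thesis unfolding S_def by (simp add: sum_subtractf)
qed

lemma bessel_inequality:
  assumes f: "f \<in> L2_circle" and F: "finite F"
  shows "(\<Sum>k\<in>F. (cmod (fourier_coeff f k))\<^sup>2) \<le> (\<integral>z. (cmod (f z))\<^sup>2 \<partial>circle_measure)"
proof -
  have "0 \<le> (\<integral>z. (cmod (f z - trig_sum F (fourier_coeff f) z))\<^sup>2 \<partial>circle_measure)" by simp
  then show ?thesis unfolding L2_dist_trig_sum[OF assms] by simp
qed

lemma bessel_summable:
  assumes f: "f \<in> L2_circle" shows "(\<lambda>k. (cmod (fourier_coeff f k))\<^sup>2) summable_on A"
  by (rule nonneg_bdd_above_summable_on) (use bessel_inequality[OF f] in \<open>auto intro!: bdd_aboveI2\<close>)

lemma trig_poly_trig_sum: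
  assumes "trig_poly f" shows "\<exists>F c. finite F \<and> (\<forall>z\<in>sphere 0 1. f z = trig_sum F c z)"
  using assms
proof (induction rule: trig_poly.induct)
  case (monom c k)
  have "finite {k}" "\<forall>z\<in>sphere 0 1. c * z powi k = trig_sum {k} (\<lambda>_. c) z"
    by (auto simp: trig_sum_def)
  then show ?case by blast
next
  case (add f g)
  then obtain F c G d where F: "finite F" "\<forall>z\<in>sphere 0 1. f z = trig_sum F c z"
    and G: "finite G" "\<forall>z\<in>sphere 0 1. g z = trig_sum G d z" by blast
  have "trig_sum F c z + trig_sum G d z = trig_sum (F \<union> G) (\<lambda>k. (if k \<in> F then c k else 0) + (if k \<in> G then d k else 0)) z" for z
  proof -
    have "trig_sum F c z = (\<Sum>k\<in>F \<union> G. (if k \<in> F then c k else 0) * z powi k)"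
      unfolding trig_sum_def by (rule sum.mono_neutral_cong_left) (use F G in auto)
    moreover have "trig_sum G d z = (\<Sum>k\<in>F \<union> G. (if k \<in> G then d k else 0) * z powi k)"
      unfolding trig_sum_def by (rule sum.mono_neutral_cong_left) (use F G in auto)
    ultimately show ?thesis by (simp add: trig_sum_def sum.distrib distrib_right)
  qed
  then show ?case using F G by (intro exI[of _ "F \<union> G"]) auto
qed

text \<open>A set of small measure is approximated by 0. Otherwise a compact subset of nearly full
  measure and a bump for it contribute an error below \<open>e / 2\<close> each.\<close>

lemma L1_density_indicator:
  assumes A: "A \<in> sets circle_measure" and e: "e > 0"
  shows "\<exists>\<phi>::complex \<Rightarrow> real. continuous_on (sphere 0 1) \<phi> \<and> (\<integral>z. \<bar>indicator A z - \<phi> z\<bar> \<partial>circle_measure) < e"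
proof -
  have As: "A \<inter> sphere 0 1 = A" using borel_set_circle[OF A] by auto
  have small: ?thesis if "measure circle_measure A < e"
    using that A by (intro exI[of _ "\<lambda>_. 0"]) (auto simp: As)
  show ?thesis
  proof (cases "measure circle_measure A < e")
    case False
    define m where "m = measure circle_measure A"
    have m: "m > 0" "m \<ge> e" using False e by (auto simp: m_def)
    have em: "emeasure circle_measure A = ennreal m"
      unfolding m_def by (rule circle.emeasure_eq_measure)
    have "ennreal (m - e / 2) < (SUP K \<in> {K. K \<subseteq> A \<and> compact K}. emeasure circle_measure K)"
      unfolding inner_regular_circle[OF A, symmetric] em using m e by (simp add: ennreal_less_iff)
    then obtain K where K: "K \<subseteq> A" "compact K" "ennreal (m - e / 2) < emeasure circle_measure K"
      unfolding less_SUP_iff by blast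
    have Kne: "K \<noteq> {}" using K(3) by auto
    have Ks: "K \<in> sets circle_measure"
      unfolding circle_measure_sets_iff using K borel_set_circle[OF A] by (auto intro: borel_compact)
    have mK: "m - e / 2 < measure circle_measure K"
      using K(3) m e unfolding circle.emeasure_eq_measure by (simp add: ennreal_less_iff)
    have iA: "integrable circle_measure (indicator A :: complex \<Rightarrow> real)" and iK: "integrable circle_measure (indicator K :: complex \<Rightarrow> real)"
      using A Ks by (auto simp: circle.emeasure_eq_measure)
    have ib: "integrable circle_measure (bump K n)" for n
      by (intro integrable_continuous_circle bump_continuous)
    have "(\<lambda>n. \<integral>z. \<bar>indicator K z - bump K n z\<bar> \<partial>circle_measure) \<longlonglongrightarrow> (\<integral>z. 0 \<partial>circle_measure)"
    proof (rule integral_dominated_convergence[where w = "\<lambda>_. 1"])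
      show "(\<lambda>z. \<bar>indicator K z - bump K n z\<bar>) \<in> borel_measurable circle_measure" for n
        using borel_measurable_integrable[OF ib] borel_measurable_integrable[OF iK] by measurable
      show "AE z in circle_measure. (\<lambda>n. \<bar>indicator K z - bump K n z\<bar>) \<longlonglongrightarrow> 0"
      proof (intro AE_I2)
        fix z
        have "(\<lambda>n. \<bar>indicator K z - bump K n z\<bar>) \<longlonglongrightarrow> \<bar>indicator K z - indicator K z\<bar>"
          by (intro tendsto_intros bump_tendsto compact_imp_closed K Kne)
        then show "(\<lambda>n. \<bar>indicator K z - bump K n z\<bar>) \<longlonglongrightarrow> 0" by simp
      qed
      show "AE z in circle_measure. norm \<bar>indicator K z - bump K n z\<bar> \<le> 1" for n
      proof (intro AE_I2)
        fix z show "norm \<bar>indicator K z - bump K n z\<bar> \<le> 1"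
          using bump_range[of K n z] by (cases "z \<in> K") auto
      qed
    qed auto
    then have "(\<lambda>n. \<integral>z. \<bar>indicator K z - bump K n z\<bar> \<partial>circle_measure) \<longlonglongrightarrow> 0" by simp
    then have "eventually (\<lambda>n. (\<integral>z. \<bar>indicator K z - bump K n z\<bar> \<partial>circle_measure) < e / 2) sequentially"
      using e by (intro order_tendstoD) auto
    then obtain n where n: "(\<integral>z. \<bar>indicator K z - bump K n z\<bar> \<partial>circle_measure) < e / 2"
      using eventually_sequentially by auto
    have "(\<integral>z. \<bar>indicator A z - bump K n z\<bar> \<partial>circle_measure) \<le> (\<integral>z. (indicator A z - indicator K z) + \<bar>indicator K z - bump K n z\<bar> \<partial>circle_measure)"
    proof (rule integral_mono)
      show "integrable circle_measure (\<lambda>z. \<bar>indicator A z - bump K n z\<bar>)" using iA ib by auto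
      show "integrable circle_measure (\<lambda>z. (indicator A z - indicator K z) + \<bar>indicator K z - bump K n z\<bar>)"
        using iA iK ib by auto
    qed (use K in \<open>auto simp: indicator_def\<close>)
    also have "\<dots> = (m - measure circle_measure K) + (\<integral>z. \<bar>indicator K z - bump K n z\<bar> \<partial>circle_measure)"
    proof -
      have "(\<integral>z. indicator A z \<partial>circle_measure) = m" "(\<integral>z. indicator K z \<partial>circle_measure) = measure circle_measure K"
        using A Ks borel_set_circle[OF Ks] As by (simp_all add: m_def circle.emeasure_eq_measure Int_absorb2)
      moreover have "integrable circle_measure (\<lambda>z. \<bar>indicator K z - bump K n z\<bar>)" using iK ib by auto
      ultimately show ?thesis using iA iK by simp
    qed
    also have "\<dots> < e" using mK n by simp
    finally show ?thesis using bump_continuous by blast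
  qed (rule small)
qed

lemma L1_density:
  fixes f :: "complex \<Rightarrow> complex"
  assumes "integrable circle_measure f"
  shows "\<forall>e>0. \<exists>\<phi>. continuous_on (sphere 0 1) \<phi> \<and> (\<integral>z. cmod (f z - \<phi> z) \<partial>circle_measure) < e"
  using assms
proof (induction rule: integrable_induct)
  case (base A c)
  show ?case
  proof (intro allI impI)
    fix e :: real assume e: "e > 0"
    define d where "d = e / (norm c + 1)"
    have d: "d > 0" using e by (simp add: d_def add_nonneg_pos)
    obtain \<phi> :: "complex \<Rightarrow> real" where \<phi>: "continuous_on (sphere 0 1) \<phi>" "(\<integral>z. \<bar>indicator A z - \<phi> z\<bar> \<partial>circle_measure) < d"
      using L1_density_indicator[OF base(1) d] by blast
    have "(\<integral>z. cmod (indicator A z *\<^sub>R c - \<phi> z *\<^sub>R c) \<partial>circle_measure) = (\<integral>z. \<bar>indicator A z - \<phi> z\<bar> \<partial>circle_measure) * norm c"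
      by (simp flip: scaleR_diff_left)
    also have "\<dots> \<le> d * norm c" using \<phi>(2) by (intro mult_right_mono) auto
    also have "\<dots> < d * (norm c + 1)" using d by simp
    also have "\<dots> = e" by (simp add: d_def add_nonneg_eq_0_iff)
    finally show "\<exists>\<phi>. continuous_on (sphere 0 1) \<phi> \<and> (\<integral>z. cmod (indicat_real A z *\<^sub>R c - \<phi> z) \<partial>circle_measure) < e"
      using \<phi>(1) by (intro exI[of _ "\<lambda>z. \<phi> z *\<^sub>R c"]) (auto intro!: continuous_intros)
  qed
next
  case (add f g)
  show ?case
  proof (intro allI impI)
    fix e :: real assume e: "e > 0"
    obtain \<phi> where \<phi>: "continuous_on (sphere 0 1) \<phi>" "(\<integral>z. cmod (f z - \<phi> z) \<partial>circle_measure) < e / 2"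
      using add.IH(1) e by (meson half_gt_zero)
    obtain \<psi> where \<psi>: "continuous_on (sphere 0 1) \<psi>" "(\<integral>z. cmod (g z - \<psi> z) \<partial>circle_measure) < e / 2"
      using add.IH(2) e by (meson half_gt_zero)
    note i = add.hyps(1,2) integrable_continuous_circle[OF \<phi>(1)] integrable_continuous_circle[OF \<psi>(1)]
    have "(\<integral>z. cmod (f z + g z - (\<phi> z + \<psi> z)) \<partial>circle_measure) \<le> (\<integral>z. cmod (f z - \<phi> z) + cmod (g z - \<psi> z) \<partial>circle_measure)"
      using i by (intro integral_mono) (auto simp: add_diff_add norm_triangle_ineq)
    also have "\<dots> = (\<integral>z. cmod (f z - \<phi> z) \<partial>circle_measure) + (\<integral>z. cmod (g z - \<psi> z) \<partial>circle_measure)"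
      using i by simp
    also have "\<dots> < e" using \<phi>(2) \<psi>(2) by simp
    finally show "\<exists>\<phi>. continuous_on (sphere 0 1) \<phi> \<and> (\<integral>z. cmod (f z + g z - \<phi> z) \<partial>circle_measure) < e"
      using \<phi>(1) \<psi>(1) by (intro exI[of _ "\<lambda>z. \<phi> z + \<psi> z"]) (auto intro!: continuous_intros)
  qed
next
  case (lim f s)
  show ?case
  proof (intro allI impI)
    fix e :: real assume e: "e > 0"
    have "(\<lambda>i. \<integral>z. cmod (f z - s i z) \<partial>circle_measure) \<longlonglongrightarrow> (\<integral>z. 0 \<partial>circle_measure)"
    proof (rule integral_dominated_convergence[where w = "\<lambda>z. 3 * cmod (f z)"])
      show "(\<lambda>z. cmod (f z - s i z)) \<in> borel_measurable circle_measure" for i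
        using borel_measurable_integrable[OF lim.hyps(1)[of i]] borel_measurable_integrable[OF lim.hyps(4)] by measurable
      show "AE z in circle_measure. (\<lambda>i. cmod (f z - s i z)) \<longlonglongrightarrow> 0"
      proof (intro AE_I2)
        fix z assume "z \<in> space circle_measure"
        from lim.hyps(2)[OF this] have "(\<lambda>i. cmod (f z - s i z)) \<longlonglongrightarrow> cmod (f z - f z)"
          by (intro tendsto_intros)
        then show "(\<lambda>i. cmod (f z - s i z)) \<longlonglongrightarrow> 0" by simp
      qed
      show "AE z in circle_measure. norm (cmod (f z - s i z)) \<le> 3 * cmod (f z)" for i
      proof (intro AE_I2)
        fix z assume "z \<in> space circle_measure"
        from lim.hyps(3)[OF this, of i] show "norm (cmod (f z - s i z)) \<le> 3 * cmod (f z)"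
          using norm_triangle_ineq4[of "f z" "s i z"] by simp
      qed
    qed (use lim.hyps(4) in auto)
    then have "(\<lambda>i. \<integral>z. cmod (f z - s i z) \<partial>circle_measure) \<longlonglongrightarrow> 0" by simp
    then have "eventually (\<lambda>i. (\<integral>z. cmod (f z - s i z) \<partial>circle_measure) < e / 2) sequentially"
      using e by (intro order_tendstoD) auto
    then obtain i where i: "(\<integral>z. cmod (f z - s i z) \<partial>circle_measure) < e / 2"
      using eventually_sequentially by auto
    obtain \<phi> where \<phi>: "continuous_on (sphere 0 1) \<phi>" "(\<integral>z. cmod (s i z - \<phi> z) \<partial>circle_measure) < e / 2"
      using lim.IH[of i] e by (meson half_gt_zero)
    note int = lim.hyps(1)[of i] lim.hyps(4) integrable_continuous_circle[OF \<phi>(1)]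
    have tri: "cmod (f z - \<phi> z) \<le> cmod (f z - s i z) + cmod (s i z - \<phi> z)" for z
      using norm_triangle_ineq[of "f z - s i z" "s i z - \<phi> z"] by simp
    have "(\<integral>z. cmod (f z - \<phi> z) \<partial>circle_measure) \<le> (\<integral>z. cmod (f z - s i z) + cmod (s i z - \<phi> z) \<partial>circle_measure)"
      using int by (intro integral_mono) (auto intro: tri)
    also have "\<dots> = (\<integral>z. cmod (f z - s i z) \<partial>circle_measure) + (\<integral>z. cmod (s i z - \<phi> z) \<partial>circle_measure)"
      using int by simp
    also have "\<dots> < e" using i \<phi>(2) by simp
    finally show "\<exists>\<phi>. continuous_on (sphere 0 1) \<phi> \<and> (\<integral>z. cmod (f z - \<phi> z) \<partial>circle_measure) < e"
      using \<phi>(1) by blast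
  qed
qed

text \<open>Boundedness upgrades approximation in mean to quadratic approximation: once the
  approximant is projected onto a ball containing almost all values of \<open>u\<close>, the squared
  error is at most twice the radius times the original error.\<close>

lemma parseval_bounded:
  assumes u: "u \<in> L2_circle" and B: "AE z in circle_measure. cmod (u z) \<le> B" and e: "e > 0"
  shows "\<exists>F. finite F \<and> (\<integral>z. (cmod (u z))\<^sup>2 \<partial>circle_measure) - (\<Sum>k\<in>F. (cmod (fourier_coeff u k))\<^sup>2) < e"
proof -
  define M where "M = max B 1"
  have M: "M > 0" and uM: "AE z in circle_measure. cmod (u z) \<le> M"
    using B by (auto simp: M_def elim: eventually_mono)
  \<comment> \<open>This makes the quadratic error of \<open>\<psi>\<close> less than
    \<open>e / 4\<close>. With \<open>e / 8\<close> for the trigonometric sum, the total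
    \<open>2 * (e / 4) + 2 * (e / 8)\<close> stays below \<open>e\<close>.\<close>
  define d where "d = e / (8 * M)"
  have d: "d > 0" using e M by (simp add: d_def)
  obtain \<phi> where \<phi>: "continuous_on (sphere 0 1) \<phi>" "(\<integral>z. cmod (u z - \<phi> z) \<partial>circle_measure) < d"
    using L1_density[OF L2_circle_integrable[OF u]] d by blast
  define \<psi> where "\<psi> = (\<lambda>z. closest_point (cball 0 M) (\<phi> z))"
  have cb: "convex (cball (0::complex) M)" "closed (cball (0::complex) M)" "cball (0::complex) M \<noteq> {}"
    using M by auto
  have \<psi>c: "continuous_on (sphere 0 1) \<psi>"
    unfolding \<psi>_def
    by (rule continuous_on_compose2[OF continuous_on_closest_point[OF cb] \<phi>(1)]) auto
  have \<psi>M: "cmod (\<psi> z) \<le> M" for z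
    using closest_point_in_set[OF cb(2,3), of "\<phi> z"] by (simp add: \<psi>_def)
  have sq: "AE z in circle_measure. (cmod (u z - \<psi> z))\<^sup>2 \<le> 2 * M * cmod (u z - \<phi> z)"
    using uM
  proof eventually_elim
    case (elim z)
    have "closest_point (cball 0 M) (u z) = u z"
      by (rule closest_point_self) (use elim in auto)
    then have "cmod (u z - \<psi> z) \<le> cmod (u z - \<phi> z)"
      using closest_point_lipschitz[OF cb, of "u z" "\<phi> z"] by (simp add: dist_norm \<psi>_def)
    moreover have "cmod (u z - \<psi> z) \<le> 2 * M"
      using norm_triangle_ineq4[of "u z" "\<psi> z"] elim \<psi>M[of z] by linarith
    ultimately show ?case
      unfolding power2_eq_square using M by (intro mult_mono) auto
  qed
  have L2d: "(\<lambda>z. u z - \<psi> z) \<in> L2_circle"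
    by (intro L2_circle_diff u L2_circle_continuous \<psi>c)
  have i\<phi>: "integrable circle_measure (\<lambda>z. cmod (u z - \<phi> z))"
    using L2_circle_integrable[OF u] integrable_continuous_circle[OF \<phi>(1)] by auto
  have "(\<integral>z. (cmod (u z - \<psi> z))\<^sup>2 \<partial>circle_measure) \<le> (\<integral>z. 2 * M * cmod (u z - \<phi> z) \<partial>circle_measure)"
    by (rule integral_mono_AE[OF L2_circleD(2)[OF L2d] _ sq]) (use i\<phi> in simp)
  also have "\<dots> = 2 * M * (\<integral>z. cmod (u z - \<phi> z) \<partial>circle_measure)" by simp
  also have "\<dots> < 2 * M * d" using \<phi>(2) M by simp
  also have "\<dots> = e / 4" using M by (simp add: d_def)
  finally have 1: "(\<integral>z. (cmod (u z - \<psi> z))\<^sup>2 \<partial>circle_measure) < e / 4" .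
  \<comment> \<open>Real and imaginary part contribute \<open>\<eta>\<close> each, and
    \<open>(2 * \<eta>)\<^sup>2 = e / 8\<close>.\<close>
  define \<eta> where "\<eta> = sqrt (e / 32)"
  have \<eta>: "\<eta> > 0" using e by (simp add: \<eta>_def)
  obtain p where p: "trig_poly p" "\<And>z. norm z = 1 \<Longrightarrow> norm (of_real (Re (\<psi> z)) - p z) < \<eta>"
    using trig_poly_approximation[of "\<lambda>z. Re (\<psi> z)" \<eta>] \<eta> \<psi>c by (auto intro!: continuous_intros)
  obtain q where q: "trig_poly q" "\<And>z. norm z = 1 \<Longrightarrow> norm (of_real (Im (\<psi> z)) - q z) < \<eta>"
    using trig_poly_approximation[of "\<lambda>z. Im (\<psi> z)" \<eta>] \<eta> \<psi>c by (auto intro!: continuous_intros)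
  obtain F c where F: "finite F" "\<forall>z\<in>sphere 0 1. p z + \<i> * q z = trig_sum F c z"
    using trig_poly_trig_sum[OF trig_poly.add[OF p(1) trig_poly_cmult[OF q(1), of \<i>]]] by blast
  have pt: "(cmod (\<psi> z - trig_sum F c z))\<^sup>2 \<le> e / 8" if z: "z \<in> sphere 0 1" for z
  proof -
    have "\<psi> z - trig_sum F c z = (of_real (Re (\<psi> z)) - p z) + \<i> * (of_real (Im (\<psi> z)) - q z)"
      unfolding F(2)[rule_format, OF z, symmetric]
    proof -
      have "x - (P + \<i> * Q) = (X - P) + \<i> * (Y - Q)" if "x = X + \<i> * Y" for x X Y P Q :: complex
        using that by (simp add: algebra_simps)
      from this[OF complex_eq] show "\<psi> z - (p z + \<i> * q z) = (of_real (Re (\<psi> z)) - p z) + \<i> * (of_real (Im (\<psi> z)) - q z)" .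
    qed
    also have "cmod \<dots> \<le> cmod (of_real (Re (\<psi> z)) - p z) + cmod (\<i> * (of_real (Im (\<psi> z)) - q z))"
      by (rule norm_triangle_ineq)
    also have "\<dots> \<le> 2 * \<eta>" using p(2)[of z] q(2)[of z] z by (simp add: norm_mult)
    finally have "(cmod (\<psi> z - trig_sum F c z))\<^sup>2 \<le> (2 * \<eta>)\<^sup>2" by (intro power_mono) auto
    then show ?thesis using e by (simp add: \<eta>_def power_mult_distrib)
  qed
  have iT: "integrable circle_measure (\<lambda>z. (cmod (\<psi> z - trig_sum F c z))\<^sup>2)"
    by (intro integrable_continuous_circle continuous_intros \<psi>c trig_sum_continuous)
  have "(\<integral>z. (cmod (\<psi> z - trig_sum F c z))\<^sup>2 \<partial>circle_measure) \<le> (\<integral>z. e / 8 \<partial>circle_measure)"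
    by (intro integral_mono iT) (use pt in auto)
  then have 2: "(\<integral>z. (cmod (\<psi> z - trig_sum F c z))\<^sup>2 \<partial>circle_measure) \<le> e / 8" by simp
  have le2: "(cmod (u z - trig_sum F c z))\<^sup>2 \<le> 2 * (cmod (u z - \<psi> z))\<^sup>2 + 2 * (cmod (\<psi> z - trig_sum F c z))\<^sup>2" for z
  proof -
    have "cmod (u z - trig_sum F c z) \<le> cmod (u z - \<psi> z) + cmod (\<psi> z - trig_sum F c z)"
      using norm_triangle_ineq[of "u z - \<psi> z" "\<psi> z - trig_sum F c z"] by simp
    then have "(cmod (u z - trig_sum F c z))\<^sup>2 \<le> (cmod (u z - \<psi> z) + cmod (\<psi> z - trig_sum F c z))\<^sup>2"
      by (intro power_mono) auto
    then show ?thesis using two_mult_le_squares[of "cmod (u z - \<psi> z)" "cmod (\<psi> z - trig_sum F c z)"]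
      by (simp add: power2_sum)
  qed
  have "(\<lambda>z. u z - trig_sum F c z) \<in> L2_circle"
    by (intro L2_circle_diff u L2_circle_continuous trig_sum_continuous)
  then have "(\<integral>z. (cmod (u z - trig_sum F c z))\<^sup>2 \<partial>circle_measure) \<le>
     (\<integral>z. 2 * (cmod (u z - \<psi> z))\<^sup>2 + 2 * (cmod (\<psi> z - trig_sum F c z))\<^sup>2 \<partial>circle_measure)"
    using L2_circleD(2) L2d iT le2 by (intro integral_mono) auto
  also have "\<dots> = 2 * (\<integral>z. (cmod (u z - \<psi> z))\<^sup>2 \<partial>circle_measure) + 2 * (\<integral>z. (cmod (\<psi> z - trig_sum F c z))\<^sup>2 \<partial>circle_measure)"
    using L2_circleD(2)[OF L2d] iT by simp
  also have "\<dots> < e" using 1 2 e by simp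
  finally have "(\<integral>z. (cmod (u z - trig_sum F c z))\<^sup>2 \<partial>circle_measure) < e" .
  moreover have "(\<Sum>k\<in>F. (cmod (fourier_coeff u k - c k))\<^sup>2) \<ge> 0" by (intro sum_nonneg) auto
  ultimately show ?thesis
    unfolding L2_dist_trig_sum[OF u F(1)] using F(1) by (intro exI[of _ F]) auto
qed

lemma parseval_has_sum:
  assumes u: "u \<in> L2_circle" and B: "AE z in circle_measure. cmod (u z) \<le> B"
  shows "((\<lambda>k. (cmod (fourier_coeff u k))\<^sup>2) has_sum (\<integral>z. (cmod (u z))\<^sup>2 \<partial>circle_measure)) UNIV"
proof -
  define I where "I = (\<integral>z. (cmod (u z))\<^sup>2 \<partial>circle_measure)"
  note s = bessel_summable[OF u, of UNIV]
  have "infsum (\<lambda>k. (cmod (fourier_coeff u k))\<^sup>2) UNIV \<le> I"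
    by (rule infsum_le_finite_sums[OF s]) (use bessel_inequality[OF u] in \<open>auto simp: I_def\<close>)
  moreover have "I \<le> infsum (\<lambda>k. (cmod (fourier_coeff u k))\<^sup>2) UNIV"
  proof (rule field_le_epsilon)
    fix e :: real assume "e > 0"
    from parseval_bounded[OF u B this] obtain F where F: "finite F" "I - (\<Sum>k\<in>F. (cmod (fourier_coeff u k))\<^sup>2) < e"
      unfolding I_def by blast
    have "(\<Sum>k\<in>F. (cmod (fourier_coeff u k))\<^sup>2) \<le> infsum (\<lambda>k. (cmod (fourier_coeff u k))\<^sup>2) UNIV"
      by (rule finite_sum_le_infsum[OF s F(1)]) auto
    then show "I \<le> infsum (\<lambda>k. (cmod (fourier_coeff u k))\<^sup>2) UNIV + e" using F(2) by simp
  qed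
  ultimately show ?thesis using has_sum_infsum[OF s] unfolding I_def[symmetric] by simp
qed

lemma cauchy_schwarz_circle:
  assumes f: "f \<in> L2_circle" and g: "g \<in> L2_circle"
  shows "(cmod (\<integral>z. f z * g z \<partial>circle_measure))\<^sup>2 \<le> (\<integral>z. (cmod (f z))\<^sup>2 \<partial>circle_measure) * (\<integral>z. (cmod (g z))\<^sup>2 \<partial>circle_measure)"
proof -
  define A where "A = (\<integral>z. (cmod (f z))\<^sup>2 \<partial>circle_measure)"
  define C where "C = (\<integral>z. (cmod (g z))\<^sup>2 \<partial>circle_measure)"
  define R where "R = (\<integral>z. cmod (f z) * cmod (g z) \<partial>circle_measure)"
  note i = L2_circleD(2)[OF f] L2_circleD(2)[OF g]
  have i2: "integrable circle_measure (\<lambda>z. cmod (f z) * cmod (g z))"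
    using integrable_norm[OF L2_circle_mult_integrable[OF f g]] by (simp add: norm_mult)
  have R0: "R \<ge> 0" and A0: "A \<ge> 0" and C0: "C \<ge> 0" by (simp_all add: R_def A_def C_def)
  have quad: "0 \<le> s\<^sup>2 * A - 2 * s * t * R + t\<^sup>2 * C" for s t
  proof -
    have "0 \<le> (\<integral>z. (s * cmod (f z) - t * cmod (g z))\<^sup>2 \<partial>circle_measure)" by simp
    also have "\<dots> = (\<integral>z. s\<^sup>2 * (cmod (f z))\<^sup>2 - 2 * s * t * (cmod (f z) * cmod (g z)) + t\<^sup>2 * (cmod (g z))\<^sup>2 \<partial>circle_measure)"
      by (simp add: power2_diff power_mult_distrib algebra_simps)
    also have "\<dots> = s\<^sup>2 * A - 2 * s * t * R + t\<^sup>2 * C"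
      using i i2 by (simp add: A_def C_def R_def)
    finally show ?thesis .
  qed
  have "R\<^sup>2 \<le> A * C"
  proof (cases "A = 0")
    case True
    show ?thesis
    proof (rule ccontr)
      assume "\<not> ?thesis"
      then have "R > 0" using True R0 by (cases "R = 0") auto
      \<comment> \<open>For \<open>A = 0\<close> and \<open>t = 1\<close> the form is
        \<open>C - 2 * s * R\<close>, which is negative at this \<open>s\<close>.\<close>
      then show False using quad[of "(C + 1) / R" 1] True C0 by simp
    qed
  next
    case False
    then have "A > 0" using A0 by simp
    moreover have "0 \<le> A * (A * C - R\<^sup>2)"
      using quad[of R A] by (simp add: power2_eq_square algebra_simps)
    ultimately show ?thesis by (simp add: zero_le_mult_iff)
  qed
  moreover have "cmod (\<integral>z. f z * g z \<partial>circle_measure) \<le> R"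
    using integral_norm_bound[of circle_measure "\<lambda>z. f z * g z"] by (simp add: R_def norm_mult)
  then have "(cmod (\<integral>z. f z * g z \<partial>circle_measure))\<^sup>2 \<le> R\<^sup>2" by (intro power_mono) auto
  ultimately show ?thesis by (simp add: A_def C_def)
qed

section \<open>Absolutely convergent power series on the circle\<close>

definition power_sum :: "(nat \<Rightarrow> complex) \<Rightarrow> complex \<Rightarrow> complex" where
  "power_sum a z = (\<Sum>\<^sub>\<infinity>n. a n * z ^ n)"

lemma power_sum_summable:
  fixes a :: "nat \<Rightarrow> complex"
  assumes "a summable_on UNIV" "norm z \<le> 1" shows "(\<lambda>n. a n * z ^ n) summable_on UNIV"
  by (rule summable_on_mult_bounded[OF assms(1), where B = 1]) (use assms(2) in \<open>auto simp: norm_power power_le_one\<close>)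

lemma power_sum_suminf:
  assumes "a summable_on UNIV" "norm z \<le> 1" shows "power_sum a z = (\<Sum>n. a n * z ^ n)"
  unfolding power_sum_def by (intro sums_unique has_sum_imp_sums has_sum_infsum power_sum_summable assms)

lemma power_sum_continuous:
  assumes a: "a summable_on UNIV" shows "continuous_on (cball 0 1) (power_sum a)"
proof -
  have "uniform_limit (cball 0 1) (\<lambda>n z. \<Sum>i<n. a i * z ^ i) (\<lambda>z. \<Sum>i. a i * z ^ i) sequentially"
  proof (rule Weierstrass_m_test)
    show "norm (a n * z ^ n) \<le> norm (a n)" if "z \<in> cball 0 1" for n z
      using that by (auto simp: norm_mult norm_power intro!: mult_left_le power_le_one)
    show "summable (\<lambda>n. norm (a n))"
      by (intro summable_on_imp_summable summable_on_norm a)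
  qed
  then have "continuous_on (cball 0 1) (\<lambda>z. \<Sum>i. a i * z ^ i)"
    by (rule uniform_limit_theorem[rotated]) (auto intro!: always_eventually continuous_intros)
  then show ?thesis
    by (rule continuous_on_cong[THEN iffD1, rotated -1]) (auto simp: power_sum_suminf[OF a])
qed

lemma power_sum_continuous_circle: "a summable_on UNIV \<Longrightarrow> continuous_on (sphere 0 1) (power_sum a)"
  by (rule continuous_on_subset[OF power_sum_continuous]) auto

lemma integral_mult_power_sum:
  assumes a: "a summable_on UNIV" and g: "integrable circle_measure g"
  shows "(\<integral>z. g z * power_sum a z \<partial>circle_measure) = (\<Sum>\<^sub>\<infinity>n. a n * (\<integral>z. g z * z ^ n \<partial>circle_measure))"
    and "(\<lambda>n. a n * (\<integral>z. g z * z ^ n \<partial>circle_measure)) summable_on UNIV"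
proof -
  define I where "I = (\<integral>z. cmod (g z) \<partial>circle_measure)"
  have i: "integrable circle_measure (\<lambda>z. a n * (g z * z ^ n))" for n
    using integrable_mult_powi[OF g, of "int n"] by simp
  have nI: "(\<integral>z. norm (a n * (g z * z ^ n)) \<partial>circle_measure) = norm (a n) * I" for n
  proof -
    have "(\<integral>z. norm (a n * (g z * z ^ n)) \<partial>circle_measure) = (\<integral>z. norm (a n) * norm (g z) \<partial>circle_measure)"
      by (intro Bochner_Integration.integral_cong) (auto simp: norm_mult norm_power)
    then show ?thesis by (simp add: I_def)
  qed
  have sn: "summable (\<lambda>n. norm (a n))"
    by (intro summable_on_imp_summable summable_on_norm a)
  have "norm (\<integral>z. g z * z ^ n \<partial>circle_measure) \<le> I" for n
  proof -
    have "norm (\<integral>z. g z * z ^ n \<partial>circle_measure) \<le> (\<integral>z. norm (g z * z ^ n) \<partial>circle_measure)"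
      by (rule integral_norm_bound)
    also have "\<dots> = I" unfolding I_def
      by (intro Bochner_Integration.integral_cong) (auto simp: norm_mult norm_power)
    finally show ?thesis .
  qed
  then show s: "(\<lambda>n. a n * (\<integral>z. g z * z ^ n \<partial>circle_measure)) summable_on UNIV"
    by (intro summable_on_mult_bounded[OF a])
  have "(\<integral>z. g z * power_sum a z \<partial>circle_measure) = (\<integral>z. (\<Sum>n. a n * (g z * z ^ n)) \<partial>circle_measure)"
  proof (rule Bochner_Integration.integral_cong)
    fix z assume "z \<in> space circle_measure"
    then have z: "norm z \<le> 1" by simp
    have "(\<lambda>n. a n * z ^ n) sums power_sum a z"
      unfolding power_sum_def by (intro has_sum_imp_sums has_sum_infsum power_sum_summable[OF a z])
    from sums_mult[OF this, of "g z"] show "g z * power_sum a z = (\<Sum>n. a n * (g z * z ^ n))"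
      by (simp add: sums_iff mult_ac)
  qed simp
  also have "\<dots> = (\<Sum>n. \<integral>z. a n * (g z * z ^ n) \<partial>circle_measure)"
  proof (rule integral_suminf[OF i])
    show "AE z in circle_measure. summable (\<lambda>n. norm (a n * (g z * z ^ n)))"
    proof (intro AE_I2)
      fix z assume "z \<in> space circle_measure"
      then have "norm (a n * (g z * z ^ n)) = norm (a n) * norm (g z)" for n
        by (simp add: norm_mult norm_power)
      then show "summable (\<lambda>n. norm (a n * (g z * z ^ n)))" using summable_mult2[OF sn] by simp
    qed
    show "summable (\<lambda>n. \<integral>z. norm (a n * (g z * z ^ n)) \<partial>circle_measure)"
      unfolding nI by (rule summable_mult2[OF sn])
  qed
  also have "\<dots> = (\<Sum>n. a n * (\<integral>z. g z * z ^ n \<partial>circle_measure))" by simp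
  also have "\<dots> = (\<Sum>\<^sub>\<infinity>n. a n * (\<integral>z. g z * z ^ n \<partial>circle_measure))"
    by (rule sums_unique[OF has_sum_imp_sums[OF has_sum_infsum[OF s]], symmetric])
  finally show "(\<integral>z. g z * power_sum a z \<partial>circle_measure) = (\<Sum>\<^sub>\<infinity>n. a n * (\<integral>z. g z * z ^ n \<partial>circle_measure))" .
qed

lemma fourier_coeff_mult_power_sum:
  assumes a: "a summable_on UNIV" and g: "integrable circle_measure g"
  shows "fourier_coeff (\<lambda>z. g z * power_sum a z) k = (\<Sum>\<^sub>\<infinity>n. a n * fourier_coeff g (k - int n))"
proof -
  have "fourier_coeff (\<lambda>z. g z * power_sum a z) k = (\<integral>z. (g z * z powi (- k)) * power_sum a z \<partial>circle_measure)"
    unfolding fourier_coeff_def by (simp add: mult_ac)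
  also have "\<dots> = (\<Sum>\<^sub>\<infinity>n. a n * (\<integral>z. g z * z powi (- k) * z ^ n \<partial>circle_measure))"
    by (rule integral_mult_power_sum(1)[OF a integrable_mult_powi[OF g]])
  also have "(\<lambda>n. \<integral>z. g z * z powi (- k) * z ^ n \<partial>circle_measure) = (\<lambda>n. fourier_coeff g (k - int n))"
    unfolding fourier_coeff_def
  proof (intro ext Bochner_Integration.integral_cong)
    fix n :: nat and z assume "z \<in> space circle_measure"
    then have "z \<noteq> 0" by auto
    then have "z powi (- (k - int n)) = z powi (- k) * z powi (int n)"
      by (subst power_int_add[symmetric]) (auto simp: algebra_simps)
    then show "g z * z powi (- k) * z ^ n = g z * z powi - (k - int n)" by simp
  qed simp
  finally show ?thesis .
qed

lemma fourier_coeff_power_sum: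
  assumes a: "a summable_on UNIV"
  shows "fourier_coeff (power_sum a) k = (if k \<ge> 0 then a (nat k) else 0)"
proof -
  have "fourier_coeff (power_sum a) k = (\<Sum>\<^sub>\<infinity>n. a n * fourier_coeff (\<lambda>_. 1) (k - int n))"
    using fourier_coeff_mult_power_sum[OF a, of "\<lambda>_. 1" k] by simp
  also have "\<dots> = (\<Sum>\<^sub>\<infinity>n\<in>(if k \<ge> 0 then {nat k} else {}). a n * fourier_coeff (\<lambda>_. 1) (k - int n))"
    by (rule infsum_cong_neutral) (use fourier_coeff_monomial[of 0] in \<open>auto split: if_splits\<close>)
  finally show ?thesis using fourier_coeff_monomial[of 0 0] by (auto split: if_splits)
qed

lemma power_sum_rotation: "s * power_sum a (w * z) = power_sum (\<lambda>k. s * w ^ k * a k) z"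
  unfolding power_sum_def infsum_cmult_right'[symmetric] by (intro infsum_cong) (simp add: power_mult_distrib mult_ac)

lemma summable_of_exponential_bound:
  fixes a :: "nat \<Rightarrow> complex"
  assumes "r > 1" "summable (\<lambda>n. norm (a n) * r ^ n)" shows "a summable_on UNIV"
proof (rule norm_summable_imp_summable_on, rule summable_comparison_test'[OF assms(2)])
  show "norm (norm (a n)) \<le> norm (a n) * r ^ n" for n
    using assms(1) one_le_power[of r n] mult_left_mono[of 1 "r ^ n" "norm (a n)"] by simp
qed

text \<open>Each weight is paid with a square root of the rate: passing from \<open>r\<close> to its
  root frees a factor that outgrows \<open>Suc n\<close> up to a constant, by Bernoulli's
  inequality.\<close>

lemma weighted_l1_of_exponential_bound:
  fixes a :: "nat \<Rightarrow> complex"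
  assumes "r > 1" "summable (\<lambda>n. norm (a n) * r ^ n)" shows "weighted_l1 p a"
  using assms
proof (induction p arbitrary: a r)
  case 0
  then show ?case unfolding weighted_l1_0 by (rule summable_of_exponential_bound)
next
  case (Suc p)
  define s where "s = sqrt r"
  have s: "s > 1" "s ^ n * s ^ n = r ^ n" for n
    using Suc.prems(1) by (auto simp: s_def power_mult_distrib[symmetric])
  \<comment> \<open>The second entry gives \<open>C * (s - 1) \<ge> 1\<close>, which absorbs
    \<open>real n\<close>; the first absorbs the remaining 1 of \<open>Suc n\<close>.\<close>
  define C where "C = max 1 (1 / (s - 1))"
  have C: "C \<ge> 1" "C * (s - 1) \<ge> 1" using s(1) by (auto simp: C_def max_def field_simps)
  have "real (Suc n) \<le> C * s ^ n" for n
  proof -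
    have "real n * 1 \<le> real n * (C * (s - 1))" by (intro mult_left_mono C) auto
    then have "real (Suc n) \<le> C * (1 + real n * (s - 1))" using C(1) by (simp add: algebra_simps)
    also have "1 + real n * (s - 1) \<le> s ^ n" using Bernoulli_inequality[of "s - 1" n] s(1) by simp
    finally show ?thesis using C(1) by (simp add: mult_left_mono)
  qed
  then have "real (Suc n) * (norm (a n) * s ^ n) \<le> C * s ^ n * (norm (a n) * s ^ n)" for n
    using s(1) by (intro mult_right_mono) auto
  then have "norm (norm (of_nat (Suc n) * a n) * s ^ n) \<le> C * (norm (a n) * r ^ n)" for n
    unfolding s(2)[symmetric] using s(1) by (simp add: norm_mult norm_power mult_ac del: of_nat_Suc)
  then have "summable (\<lambda>n. norm (of_nat (Suc n) * a n) * s ^ n)"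
    by (intro summable_comparison_test'[OF summable_mult[OF Suc.prems(2)]])
  from Suc.IH[OF s(1) this] show ?case by (simp only: weighted_l1_Suc)
qed

lemma progression_sum:
  fixes f :: "nat \<Rightarrow> 'a :: {comm_monoid_add, t2_space}"
  assumes f: "\<And>k. k mod N \<noteq> l \<Longrightarrow> f k = 0" and l: "l < N"
  shows "f summable_on UNIV \<longleftrightarrow> (\<lambda>m. f (N * m + l)) summable_on UNIV"
    and "infsum f UNIV = (\<Sum>\<^sub>\<infinity>m. f (N * m + l))"
proof -
  have inj: "inj (\<lambda>m. N * m + l)" using l by (auto intro!: injI)
  have z: "f k = 0" if "k \<in> UNIV - range (\<lambda>m. N * m + l)" for k
  proof -
    have "k mod N \<noteq> l" using that by (metis DiffE mult_div_mod_eq rangeI)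
    then show ?thesis by (rule f)
  qed
  have "f summable_on UNIV \<longleftrightarrow> f summable_on range (\<lambda>m. N * m + l)"
    by (rule summable_on_cong_neutral) (use z in auto)
  then show "f summable_on UNIV \<longleftrightarrow> (\<lambda>m. f (N * m + l)) summable_on UNIV"
    by (simp add: summable_on_reindex[OF inj] o_def)
  have "infsum f UNIV = infsum f (range (\<lambda>m. N * m + l))"
    by (rule infsum_cong_neutral) (use z in auto)
  then show "infsum f UNIV = (\<Sum>\<^sub>\<infinity>m. f (N * m + l))"
    by (simp add: infsum_reindex[OF inj] o_def)
qed

lemma weighted_l1_progression:
  assumes b: "weighted_l1 p b" and l: "l < N"
  shows "weighted_l1 p (\<lambda>k. if k mod N = l then b (k div N) else 0)"
proof -
  define F where "F = (\<lambda>k. real (Suc k) ^ p * norm (if k mod N = l then b (k div N) else 0))"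
  have "(\<lambda>m. real N ^ p * (real (Suc m) ^ p * norm (b m))) summable_on UNIV"
    using b by (intro summable_on_cmult_right) (simp add: weighted_l1_def)
  then have "(\<lambda>m. F (N * m + l)) summable_on UNIV"
  proof (rule summable_on_comparison_test)
    fix m
    have "Suc (N * m + l) \<le> N * Suc m" using l by simp
    then have "real (Suc (N * m + l)) \<le> real N * real (Suc m)" by (simp only: of_nat_mult[symmetric] of_nat_le_iff)
    then have "real (Suc (N * m + l)) ^ p \<le> (real N * real (Suc m)) ^ p" by (rule power_mono) simp
    then have "real (Suc (N * m + l)) ^ p * norm (b m) \<le> (real N * real (Suc m)) ^ p * norm (b m)"
      by (rule mult_right_mono) simp
    then show "F (N * m + l) \<le> real N ^ p * (real (Suc m) ^ p * norm (b m))"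
      using l by (simp add: F_def power_mult_distrib mult.assoc)
  qed (simp add: F_def)
  then show ?thesis
    unfolding weighted_l1_def F_def[symmetric] by (subst progression_sum(1)[OF _ l]) (auto simp: F_def)
qed

lemma power_sum_progression:
  assumes l: "l < N"
  shows "power_sum (\<lambda>k. if k mod N = l then b (k div N) else 0) z = z ^ l * power_sum b (z ^ N)"
proof -
  define F where "F = (\<lambda>k. (if k mod N = l then b (k div N) else 0) * z ^ k)"
  have "infsum F UNIV = (\<Sum>\<^sub>\<infinity>m. F (N * m + l))"
    by (rule progression_sum(2)[OF _ l]) (simp add: F_def)
  also have "\<dots> = (\<Sum>\<^sub>\<infinity>m. z ^ l * (b m * (z ^ N) ^ m))"
  proof (rule infsum_cong)
    fix m
    have "z ^ (N * m + l) = z ^ l * (z ^ N) ^ m" by (simp add: power_add power_mult)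
    then show "F (N * m + l) = z ^ l * (b m * (z ^ N) ^ m)" using l by (simp add: F_def)
  qed
  also have "\<dots> = z ^ l * (\<Sum>\<^sub>\<infinity>m. b m * (z ^ N) ^ m)" by (rule infsum_cmult_right')
  finally show ?thesis unfolding power_sum_def F_def .
qed

lemma weighted_l1_geometric:
  assumes "norm q < 1" shows "weighted_l1 p (\<lambda>m. q ^ m)"
proof (rule weighted_l1_of_exponential_bound)
  define r where "r = 2 / (1 + norm q)"
  have pos: "1 + norm q > 0" using norm_ge_zero[of q] by linarith
  then show "r > 1" using assms by (simp add: r_def)
  have "norm q * r < 1" using assms pos by (simp add: r_def field_simps)
  moreover have "norm q * r \<ge> 0" using pos by (simp add: r_def)
  ultimately have "summable (\<lambda>m. (norm q * r) ^ m)" by (intro summable_geometric) simp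
  then show "summable (\<lambda>m. norm (q ^ m) * r ^ m)" by (simp add: norm_power power_mult_distrib)
qed

lemma power_sum_geometric:
  assumes q: "norm q < 1" and w: "norm w \<le> 1"
  shows "power_sum (\<lambda>m. q ^ m) w = 1 / (1 - q * w)"
    and "power_sum (\<lambda>m. of_nat (Suc m) * q ^ m) w = 1 / (1 - q * w)\<^sup>2"
proof -
  have qw: "norm (q * w) < 1"
    using mult_left_mono[OF w norm_ge_zero[of q]] q by (simp add: norm_mult)
  have s0: "(\<lambda>m. q ^ m) summable_on UNIV" using weighted_l1_geometric[OF q, of 0] by (simp only: weighted_l1_0)
  have s1: "(\<lambda>m. of_nat (Suc m) * q ^ m) summable_on UNIV"
    using weighted_l1_geometric[OF q, of "Suc 0"] by (simp only: weighted_l1_Suc weighted_l1_0)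
  show "power_sum (\<lambda>m. q ^ m) w = 1 / (1 - q * w)"
    unfolding power_sum_suminf[OF s0 w] power_mult_distrib[symmetric] by (rule suminf_geometric[OF qw])
  show "power_sum (\<lambda>m. of_nat (Suc m) * q ^ m) w = 1 / (1 - q * w)\<^sup>2"
    unfolding power_sum_suminf[OF s1 w] mult.assoc power_mult_distrib[symmetric]
    by (rule sums_unique[symmetric, OF geometric_deriv_sums[OF qw]])
qed

lemma geometric_power_sum:
  assumes a: "\<And>k. a k = (if k mod N = l then \<alpha> * q ^ (k div N) else 0)" and l: "l < N"
    and q: "norm q < 1" and z: "norm z = 1"
  shows "power_sum a z = \<alpha> * (z ^ l / (1 - q * z ^ N))"
proof -
  have zN: "norm (z ^ N) \<le> 1" using z by (simp add: norm_power)
  have "a = (\<lambda>k. if k mod N = l then \<alpha> * q ^ (k div N) else 0)" by (rule ext) (rule a)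
  then have "power_sum a z = z ^ l * power_sum (\<lambda>m. \<alpha> * q ^ m) (z ^ N)"
    by (simp only: power_sum_progression[OF l, of "\<lambda>m. \<alpha> * q ^ m"])
  also have "power_sum (\<lambda>m. \<alpha> * q ^ m) (z ^ N) = \<alpha> * (1 / (1 - q * z ^ N))"
    using power_sum_rotation[of \<alpha> "\<lambda>m. q ^ m" 1 "z ^ N"] power_sum_geometric(1)[OF q zN] by simp
  finally show ?thesis by simp
qed

section \<open>The stationary equation\<close>

lemma fourier_coeff_cnj: "fourier_coeff (\<lambda>z. cnj (f z)) k = cnj (fourier_coeff f (- k))"
proof -
  have "fourier_coeff (\<lambda>z. cnj (f z)) k = (\<integral>z. cnj (f z * z powi (- (- k))) \<partial>circle_measure)"
    unfolding fourier_coeff_def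
  proof (rule Bochner_Integration.integral_cong)
    fix z assume "z \<in> space circle_measure"
    then have "cnj (z powi k) = z powi (- k)" by (intro cnj_powi_circle) auto
    then show "cnj (f z) * z powi - k = cnj (f z * z powi - (- k))"
      unfolding complex_cnj_mult by simp
  qed simp
  also have "\<dots> = cnj (fourier_coeff f (- k))"
    unfolding fourier_coeff_def by (rule Bochner_Integration.integral_cnj)
  finally show ?thesis .
qed

lemma L2_plusD: "f \<in> L2_plus \<Longrightarrow> f \<in> L2_circle" "f \<in> L2_plus \<Longrightarrow> k < 0 \<Longrightarrow> fourier_coeff f k = 0"
  by (auto simp: L2_plus_def)

lemma H_half_plus_L2_plus: "f \<in> H_half_plus \<Longrightarrow> f \<in> L2_plus"
  by (auto simp: H_half_plus_def sobolev_def L2_plus_def)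

lemma L2_plus_power: "(\<lambda>z. z ^ n) \<in> L2_plus"
proof -
  have "(\<lambda>z::complex. z ^ n) \<in> L2_circle" by (intro L2_circle_continuous continuous_intros)
  moreover have "fourier_coeff (\<lambda>z. z ^ n) k = 0" if "k < 0" for k
    using fourier_coeff_monomial[of "int n" k] that by simp
  ultimately show ?thesis by (simp add: L2_plus_def)
qed

lemma szego_projection_coeff:
  assumes "szego_projection f g" "k \<ge> 0" shows "fourier_coeff f k = fourier_coeff g k"
proof -
  have f: "f \<in> L2_circle" and g: "g \<in> L2_circle"
    and orth: "L2_inner (\<lambda>z. f z - g z) (\<lambda>z. z ^ nat k) = 0"
    using assms(1) L2_plusD(1) L2_plus_power[of "nat k"] by (auto simp: szego_projection_def)
  have "L2_inner (\<lambda>z. f z - g z) (\<lambda>z. z ^ nat k) = fourier_coeff (\<lambda>z. 1 * f z + (- 1) * g z) k"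
    unfolding L2_inner_def fourier_coeff_def
  proof (rule Bochner_Integration.integral_cong)
    fix z assume "z \<in> space circle_measure"
    then have "cnj (z powi k) = z powi (- k)" by (intro cnj_powi_circle) auto
    moreover have "z powi k = z ^ nat k" using assms(2) by (simp add: power_int_def)
    ultimately show "(f z - g z) * cnj (z ^ nat k) = (1 * f z + - 1 * g z) * z powi - k" by simp
  qed simp
  also have "\<dots> = fourier_coeff f k - fourier_coeff g k"
    by (subst fourier_coeff_lincomb) (use f g L2_circle_integrable in auto)
  finally show ?thesis using orth by simp
qed

lemma exp_difference_quotient:
  "((\<lambda>h::real. (exp (- \<i> * of_real \<theta> * of_real h) - 1) / of_real h) \<longlongrightarrow> - \<i> * of_real \<theta>) (at 0)"
proof -
  have "((\<lambda>z. exp (- \<i> * of_real \<theta> * z)) has_field_derivative - \<i> * of_real \<theta>) (at 0)"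
    by (auto intro!: derivative_eq_intros)
  then have "((\<lambda>z. (exp (- \<i> * of_real \<theta> * z) - 1) / z) \<longlongrightarrow> - \<i> * of_real \<theta>) (at 0)"
    by (simp add: has_field_derivative_iff)
  moreover have "filterlim (\<lambda>h::real. complex_of_real h) (at 0) (at 0)"
    unfolding filterlim_at by (auto intro!: tendsto_eq_intros simp: eventually_at_filter)
  ultimately show ?thesis by (rule filterlim_compose)
qed

text \<open>The coefficient of order \<open>k\<close> of the wave evolves by
  \<open>exp (- \<i> * \<theta> * t)\<close> with \<open>\<theta> = \<omega> + c * k\<close>. The
  \<open>L2\<close> derivative at time 0 passes to coefficients, each being bounded by the
  \<open>L2\<close> norm.\<close>

lemma stationary_equation:
  assumes "traveling_wave_datum c u0"
  obtains \<omega> g where "u0 \<in> H_half_plus" "szego_projection (\<lambda>z. complex_of_real ((cmod (u0 z))\<^sup>2) * u0 z) g"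
    "\<And>k. fourier_coeff g k = (of_real \<omega> + of_real c * of_int k) * fourier_coeff u0 k"
proof -
  obtain u \<omega> where tw: "traveling_wave u \<omega> c" and u0: "u 0 = u0"
    using assms by (auto simp: traveling_wave_datum_def)
  have sol: "szego_solution u" using tw by (simp add: traveling_wave_def)
  have uH: "u t \<in> H_half_plus" for t using sol by (simp add: szego_solution_def)
  have uL: "u t \<in> L2_circle" for t using H_half_plus_L2_plus[OF uH] L2_plusD by blast
  obtain g where g: "szego_projection (\<lambda>z. complex_of_real ((cmod (u 0 z))\<^sup>2) * u 0 z) g"
    and lim: "((\<lambda>h. L2_norm (\<lambda>z. \<i> * ((u (0 + h) z - u 0 z) / complex_of_real h) - g z)) \<longlongrightarrow> 0) (at 0)"
    using sol unfolding szego_solution_def by meson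
  have gL: "g \<in> L2_circle" using g L2_plusD by (auto simp: szego_projection_def)
  have "fourier_coeff g k = (of_real \<omega> + of_real c * of_int k) * fourier_coeff u0 k" for k
  proof -
    define \<theta> where "\<theta> = \<omega> + c * of_int k"
    have coef: "fourier_coeff (u h) k = exp (- \<i> * of_real \<theta> * of_real h) * fourier_coeff u0 k" for h
    proof -
      define w where "w = exp (- \<i> * of_real c * of_real h)"
      have w: "norm w = 1" by (simp add: w_def norm_exp_eq_Re)
      have m: "(\<lambda>z. u 0 (w * z)) \<in> borel_measurable circle_measure"
        using measurable_comp[OF rotation_measurable[OF w] L2_circleD(1)[OF uL[of 0]]] by (simp add: o_def)
      have ir: "integrable circle_measure (\<lambda>z. u 0 (w * z))"
        by (rule integrable_rotation[OF w L2_circle_integrable[OF uL]])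
      have "AE z in circle_measure. u h z = exp (- \<i> * of_real \<omega> * of_real h) * u 0 (w * z)"
        using tw by (simp add: traveling_wave_def w_def)
      then have "fourier_coeff (u h) k = fourier_coeff (\<lambda>z. exp (- \<i> * of_real \<omega> * of_real h) * u 0 (w * z) + 0 * u 0 (w * z)) k"
        using m by (intro fourier_coeff_cong_AE[OF _ L2_circleD(1)[OF uL]]) auto
      also have "\<dots> = exp (- \<i> * of_real \<omega> * of_real h) * (w powi k * fourier_coeff (u 0) k)"
        unfolding fourier_coeff_lincomb[OF ir ir] by (simp add: fourier_coeff_rotation[OF w L2_circleD(1)[OF uL]])
      also have "w powi k = exp (of_int k * (- \<i> * of_real c * of_real h))"
        unfolding w_def by (rule exp_power_int)
      finally show ?thesis
        unfolding u0 mult.assoc[symmetric] exp_add[symmetric] by (simp add: \<theta>_def algebra_simps)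
    qed
    have diff: "fourier_coeff (\<lambda>z. \<i> * ((u (0 + h) z - u 0 z) / complex_of_real h) - g z) k =
        \<i> * ((exp (- \<i> * of_real \<theta> * of_real h) - 1) / of_real h) * fourier_coeff u0 k - fourier_coeff g k" 
      and L2d: "(\<lambda>z. \<i> * ((u (0 + h) z - u 0 z) / complex_of_real h) - g z) \<in> L2_circle" for h
    proof -
      have eq: "(\<lambda>z. \<i> * ((u (0 + h) z - u 0 z) / complex_of_real h) - g z) =
        (\<lambda>z. 1 * ((\<i> / of_real h) * u h z + (- \<i> / of_real h) * u 0 z) + (- 1) * g z)"
        by (simp add: fun_eq_iff diff_divide_distrib algebra_simps)
      have L2: "(\<lambda>z. (\<i> / of_real h) * u h z + (- \<i> / of_real h) * u 0 z) \<in> L2_circle"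
        by (intro L2_circle_add L2_circle_cmult uL)
      show "fourier_coeff (\<lambda>z. \<i> * ((u (0 + h) z - u 0 z) / complex_of_real h) - g z) k =
        \<i> * ((exp (- \<i> * of_real \<theta> * of_real h) - 1) / of_real h) * fourier_coeff u0 k - fourier_coeff g k"
        unfolding eq fourier_coeff_lincomb[OF L2_circle_integrable[OF L2] L2_circle_integrable[OF gL]]
          fourier_coeff_lincomb[OF L2_circle_integrable[OF uL] L2_circle_integrable[OF uL]] coef
        by (simp add: diff_divide_distrib algebra_simps)
      show "(\<lambda>z. \<i> * ((u (0 + h) z - u 0 z) / complex_of_real h) - g z) \<in> L2_circle"
        unfolding eq by (intro L2_circle_add L2_circle_cmult uL gL)
    qed
    have "((\<lambda>h. fourier_coeff (\<lambda>z. \<i> * ((u (0 + h) z - u 0 z) / complex_of_real h) - g z) k) \<longlongrightarrow> 0) (at 0)"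
      by (rule Lim_null_comparison[OF _ lim]) (intro always_eventually allI norm_fourier_coeff_le L2d)
    moreover have "((\<lambda>h. fourier_coeff (\<lambda>z. \<i> * ((u (0 + h) z - u 0 z) / complex_of_real h) - g z) k)
       \<longlongrightarrow> \<i> * (- \<i> * of_real \<theta>) * fourier_coeff u0 k - fourier_coeff g k) (at 0)"
      unfolding diff by (intro tendsto_intros exp_difference_quotient)
    ultimately have "0 = \<i> * (- \<i> * of_real \<theta>) * fourier_coeff u0 k - fourier_coeff g k"
      by (rule tendsto_unique[rotated]) simp
    then show ?thesis by (simp add: \<theta>_def algebra_simps)
  qed
  then show ?thesis using that[of g \<omega>] uH[of 0] g u0 by simp
qed

text \<open>Multiplication by an absolutely convergent series convolves the coefficients. This is
  done twice, the first time under a conjugation, and matches the definition of \<open>toep\<close>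
  for a merely summable symbol.\<close>

lemma cubic_coeff_power_sum:
  assumes a: "a summable_on UNIV"
  shows "fourier_coeff (\<lambda>z. of_real ((cmod (power_sum a z))\<^sup>2) * power_sum a z) (int k) = summable_symbol.toep_op a a k"
proof -
  interpret summable_symbol a by standard (simp add: weighted_l1_0 a)
  let ?v = "power_sum a"
  note vc = power_sum_continuous_circle[OF a]
  have iv: "integrable circle_measure (\<lambda>z. cnj (?v z))" "integrable circle_measure (\<lambda>z. ?v z * cnj (?v z))"
    by (intro integrable_continuous_circle continuous_intros vc)+
  have sq: "fourier_coeff (\<lambda>z. ?v z * cnj (?v z)) m = (\<Sum>\<^sub>\<infinity>n. cnj (a n) * fourier_coeff ?v (m + int n))" for m
  proof -
    have "fourier_coeff (\<lambda>z. ?v z * cnj (?v z)) m = fourier_coeff (\<lambda>z. cnj (cnj (?v z) * ?v z)) m" by simp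
    also have "\<dots> = cnj (\<Sum>\<^sub>\<infinity>n. a n * fourier_coeff (\<lambda>z. cnj (?v z)) (- m - int n))"
      unfolding fourier_coeff_cnj[of "\<lambda>z. cnj (?v z) * ?v z"] fourier_coeff_mult_power_sum[OF a iv(1)] ..
    finally show ?thesis by (simp add: fourier_coeff_cnj add.commute flip: infsum_cnj)
  qed
  have "fourier_coeff (\<lambda>z. of_real ((cmod (?v z))\<^sup>2) * ?v z) (int k) = fourier_coeff (\<lambda>z. (?v z * cnj (?v z)) * ?v z) (int k)"
    by (simp only: complex_norm_square)
  also have "\<dots> = (\<Sum>\<^sub>\<infinity>j. a j * fourier_coeff (\<lambda>z. ?v z * cnj (?v z)) (int k - int j))"
    by (rule fourier_coeff_mult_power_sum[OF a iv(2)])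
  also have "\<dots> = (\<Sum>\<^sub>\<infinity>j. toep k j * a j)"
  proof (rule infsum_cong)
    fix j
    have "fourier_coeff (\<lambda>z. ?v z * cnj (?v z)) (int k - int j) = toep k j"
      unfolding sq toep_def fourier_coeff_power_sum[OF a]
      by (rule infsum_cong) (auto simp: nat_diff_distrib' nat_int_add algebra_simps intro!: arg_cong[where f = a])
    then show "a j * fourier_coeff (\<lambda>z. ?v z * cnj (?v z)) (int k - int j) = toep k j * a j" by simp
  qed
  finally show ?thesis by (simp add: toep_op_def)
qed

lemma summable_on_int_nat: "f summable_on (UNIV :: int set) \<Longrightarrow> (\<lambda>k. f (int k) :: real) summable_on UNIV"
  using summable_on_reindex[of int UNIV f] by (auto simp: o_def intro: summable_on_subset)

text \<open>From some index on, the factor has modulus at least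
  \<open>t = \<bar>c\<bar> * k / 2\<close>, and the product of \<open>cmod (b k)\<close> and
  \<open>1 / t\<close> is at most the sum of their squares, which is summable.\<close>

lemma l1_of_affine_multiple:
  fixes a b :: "nat \<Rightarrow> complex"
  assumes c: "c \<noteq> 0" and b: "(\<lambda>k. (cmod (b k))\<^sup>2) summable_on UNIV"
    and eq: "\<And>k. (of_real \<omega> + of_real c * of_nat k) * a k = b k"
  shows "a summable_on UNIV"
proof (rule abs_summable_summable, subst summable_on_UNIV_nonneg_real_iff)
  have sb: "summable (\<lambda>k. (cmod (b k))\<^sup>2)" using b summable_on_UNIV_nonneg_real_iff by simp
  have sp: "summable (\<lambda>k. (4 / c\<^sup>2) * inverse (real k ^ 2))"
    using inverse_power_summable[of 2, where 'a = real] by (intro summable_mult) simp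
  show "summable (\<lambda>k. norm (a k))"
  proof (rule summable_comparison_test_ev[OF _ summable_add[OF sb sp]])
    obtain K :: nat where K: "2 * \<bar>\<omega>\<bar> / \<bar>c\<bar> < real K" using reals_Archimedean2 by blast
    show "eventually (\<lambda>k. norm (norm (a k)) \<le> (cmod (b k))\<^sup>2 + (4 / c\<^sup>2) * inverse (real k ^ 2)) sequentially"
      using eventually_ge_at_top[of K]
    proof eventually_elim
      case (elim k)
      define t where "t = \<bar>c\<bar> * real k / 2"
      have "2 * \<bar>\<omega>\<bar> < \<bar>c\<bar> * real K"
        using K c by (simp add: field_simps)
      also have "\<dots> \<le> \<bar>c\<bar> * real k"
        using elim by (intro mult_left_mono) auto
      finally have w: "\<bar>\<omega>\<bar> < t" "t > 0" by (auto simp: t_def)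
      have "\<bar>c * real k\<bar> = 2 * t" by (simp add: t_def abs_mult)
      then have "t \<le> \<bar>\<omega> + c * real k\<bar>" using w by linarith
      have nn: "0 \<le> norm (b k) * (1 / t)" using w by simp
      from \<open>t \<le> \<bar>\<omega> + c * real k\<bar>\<close> have "t * norm (a k) \<le> \<bar>\<omega> + c * real k\<bar> * norm (a k)" by (intro mult_right_mono) auto
      also have "\<dots> = norm (b k)"
      proof -
        have "complex_of_real \<omega> + of_real c * of_nat k = of_real (\<omega> + c * real k)" by simp
        then show ?thesis unfolding eq[symmetric] norm_mult by (simp only: norm_of_real)
      qed
      finally have "norm (a k) \<le> norm (b k) * (1 / t)" using w by (simp add: field_simps)
      also have "norm (b k) * (1 / t) \<le> (norm (b k))\<^sup>2 + (1 / t)\<^sup>2"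
        using two_mult_le_squares[of "norm (b k)" "1 / t"] nn by linarith
      also have "(1 / t)\<^sup>2 = (4 / c\<^sup>2) * inverse (real k ^ 2)"
        by (simp add: t_def power_divide power_mult_distrib field_simps)
      finally show ?case by simp
    qed
  qed
qed simp

text \<open>Regularity is gained in two rounds. Square summable coefficients on the right side make
  \<open>a\<close> absolutely summable; then the Toeplitz operator maps \<open>a\<close> to an
  absolutely summable sequence, and division by \<open>c\<close> yields weight one.\<close>

lemma traveling_wave_datum_nonzero_velocity:
  assumes tw: "traveling_wave_datum c u0" and c: "c \<noteq> 0"
  obtains \<alpha> p :: complex and N l :: nat where "N \<ge> 1" "l \<le> N - 1" "cmod p < 1"
    "AE z in circle_measure. u0 z = \<alpha> * (z ^ l / (1 - p ^ N * z ^ N))"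
proof -
  obtain \<omega> g where u0: "u0 \<in> H_half_plus" and proj: "szego_projection (\<lambda>z. complex_of_real ((cmod (u0 z))\<^sup>2) * u0 z) g"
    and coeff: "\<And>k. fourier_coeff g k = (of_real \<omega> + of_real c * of_int k) * fourier_coeff u0 k"
    using stationary_equation[OF tw] by blast
  have uL: "u0 \<in> L2_circle" and um: "u0 \<in> borel_measurable circle_measure"
    using H_half_plus_L2_plus[OF u0] L2_plusD L2_circleD by blast+
  have gL: "g \<in> L2_circle" using proj L2_plusD by (auto simp: szego_projection_def)
  define a where "a = (\<lambda>k. fourier_coeff u0 (int k))"
  have a1: "a summable_on UNIV"
  proof (rule l1_of_affine_multiple[OF c])
    show "(\<lambda>k. (cmod (fourier_coeff g (int k)))\<^sup>2) summable_on UNIV"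
      by (rule summable_on_int_nat[OF bessel_summable[OF gL]])
    show "(of_real \<omega> + of_real c * of_nat k) * a k = fourier_coeff g (int k)" for k
      by (simp add: coeff a_def)
  qed
  let ?v = "power_sum a"
  have vL: "?v \<in> L2_circle" by (intro L2_circle_continuous power_sum_continuous_circle a1)
  have "AE z in circle_measure. 1 * u0 z + (- 1) * ?v z = 0"
  proof (rule complex_L1_unique)
    show "integrable circle_measure (\<lambda>z. 1 * u0 z + - 1 * ?v z)"
      using L2_circle_integrable[OF uL] L2_circle_integrable[OF vL] by simp
    show "fourier_coeff (\<lambda>z. 1 * u0 z + - 1 * ?v z) k = 0" for k
      unfolding fourier_coeff_lincomb[OF L2_circle_integrable[OF uL] L2_circle_integrable[OF vL]] fourier_coeff_power_sum[OF a1]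
      using H_half_plus_L2_plus[OF u0] L2_plusD(2)[of u0 k] by (auto simp: a_def)
  qed
  then have uv: "AE z in circle_measure. u0 z = ?v z" by eventually_elim simp
  interpret summable_symbol a by standard (simp add: weighted_l1_0 a1)
  have te: "toep_op a k = (of_real \<omega> + of_real c * of_nat k) * a k" for k
  proof -
    have "(of_real \<omega> + of_real c * of_nat k) * a k = fourier_coeff g (int k)"
      by (simp add: coeff a_def)
    also have "\<dots> = fourier_coeff (\<lambda>z. of_real ((cmod (u0 z))\<^sup>2) * u0 z) (int k)"
      by (rule szego_projection_coeff[OF proj, symmetric]) simp
    also have "\<dots> = fourier_coeff (\<lambda>z. of_real ((cmod (?v z))\<^sup>2) * ?v z) (int k)"
    proof (rule fourier_coeff_cong_AE)
      show "AE z in circle_measure. of_real ((cmod (u0 z))\<^sup>2) * u0 z = of_real ((cmod (?v z))\<^sup>2) * ?v z"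
        using uv by eventually_elim simp
      have [measurable]: "u0 \<in> borel_measurable circle_measure" "?v \<in> borel_measurable circle_measure"
        using um L2_circleD(1)[OF vL] by auto
      show "(\<lambda>z. of_real ((cmod (u0 z))\<^sup>2) * u0 z) \<in> borel_measurable circle_measure"
        "(\<lambda>z. of_real ((cmod (?v z))\<^sup>2) * ?v z) \<in> borel_measurable circle_measure" by measurable
    qed
    also have "\<dots> = toep_op a k" by (rule cubic_coeff_power_sum[OF a1])
    finally show ?thesis by simp
  qed
  have "weighted_l1 0 (\<lambda>k. (1 / of_real c) * toep_op a k + (1 - of_real (\<omega> / c)) * a k)"
    by (intro weighted_l1_lincomb toep_op_l1 a0)
  also have "(\<lambda>k. (1 / of_real c) * toep_op a k + (1 - of_real (\<omega> / c)) * a k) = (\<lambda>k. of_nat (Suc k) * a k)"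
    using c by (auto simp: te field_simps)
  finally have w1: "weighted_l1 1 a" using weighted_l1_Suc[of 0 a] by simp
  interpret szego_sequence a \<omega> c
    by unfold_locales (rule w1, rule te)
  obtain l N q where l: "l < N" and ak0: "\<And>k. a k = (if k mod N = l then a l * q ^ (k div N) else 0)"
    by (rule classification[OF c], rule that)
  define \<alpha> where "\<alpha> = a l"
  have ak: "a k = (if k mod N = l then \<alpha> * q ^ (k div N) else 0)" for k
    unfolding \<alpha>_def by (rule ak0)
  show ?thesis
  proof (cases "\<alpha> = 0")
    case True
    then have "a k = 0" for k using ak[of k] by simp
    then have "?v z = 0" for z by (simp add: power_sum_def)
    \<comment> \<open>The zero function fits any admissible parameters; it is split off because it
      imposes nothing on \<open>q\<close>.\<close>
    then have "AE z in circle_measure. u0 z = 0 * (z ^ 0 / (1 - 0 ^ 1 * z ^ 1))" using uv by simp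
    then show ?thesis by (intro that[of 1 0 0 0]) auto
  next
    case False
    have inj: "inj (\<lambda>m. N * m + l)" using l by (auto intro!: injI)
    have "(a \<circ> (\<lambda>m. N * m + l)) summable_on UNIV"
      using a1 by (subst summable_on_reindex[OF inj, symmetric]) (auto intro: summable_on_subset)
    then have "(\<lambda>m. \<alpha> * q ^ m) summable_on UNIV"
      by (rule summable_on_cong[THEN iffD1, rotated]) (use l ak[of "N * _ + l"] in auto)
    then have "summable (\<lambda>m. \<alpha> * q ^ m)" by (rule summable_on_imp_summable)
    then have "summable (\<lambda>m. q ^ m)" using False by (simp add: summable_cmult_iff)
    \<comment> \<open>Summability of the coefficients is what forces the ratio into the open
      disc.\<close>
    then have q: "norm q < 1" by (simp add: summable_geometric_iff)
    have N: "N \<ge> 1" using l by simp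
    \<comment> \<open>The ratio is to be presented as an \<open>N\<close>-th power, for which any
      complex root serves.\<close>
    obtain p where p: "p ^ N = q"
      using exists_complex_root[of N q] N by (metis not_one_le_zero)
    have "norm p < 1"
    proof (rule ccontr)
      assume "\<not> norm p < 1"
      then have "1 \<le> norm p ^ N" by (intro one_le_power) simp
      then show False using p q by (simp flip: norm_power)
    qed
    moreover have "AE z in circle_measure. u0 z = \<alpha> * (z ^ l / (1 - p ^ N * z ^ N))"
      using uv AE_space
    proof eventually_elim
      case (elim z)
      then show ?case using geometric_power_sum[of a N l "\<alpha>" q z] ak l q p by simp
    qed
    ultimately show ?thesis using l by (intro that[of N l p "\<alpha>"]) auto
  qed
qed

section \<open>Stationary waves have constant modulus\<close>

lemma L2_plus_power_mult:
  assumes "u \<in> L2_plus" shows "(\<lambda>z. z ^ n * u z) \<in> L2_plus"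
proof -
  have "fourier_coeff (\<lambda>z. z ^ n * u z) k = 0" if "k < 0" for k
    using fourier_coeff_powi_mult[of "int n" u k] L2_plusD(2)[OF assms, of "k - int n"] that by simp
  then show ?thesis
    using L2_circle_powi_mult[OF L2_plusD(1)[OF assms], of "int n"] by (simp add: L2_plus_def)
qed

text \<open>
  Testing the equation against \<open>z ^ n * u\<close> shows that the real function
  \<open>(|u|\<^sup>2 - \<omega>) |u|\<^sup>2\<close> has no Fourier coefficient of nonnegative order.
\<close>

lemma stationary_modulus_values:
  assumes u: "u \<in> L2_plus" and proj: "szego_projection (\<lambda>z. complex_of_real ((cmod (u z))\<^sup>2) * u z) g"
    and coeff: "\<And>k. fourier_coeff g k = of_real \<omega> * fourier_coeff u k"
  shows "AE z in circle_measure. ((cmod (u z))\<^sup>2 - \<omega>) * (cmod (u z))\<^sup>2 = 0"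
proof -
  note uL = L2_plusD(1)[OF u]
  define f where "f = (\<lambda>z. complex_of_real ((cmod (u z))\<^sup>2) * u z)"
  have fL: "f \<in> L2_circle" and gL: "g \<in> L2_circle"
    and orth: "\<And>h. h \<in> L2_plus \<Longrightarrow> L2_inner (\<lambda>z. f z - g z) h = 0"
    using proj L2_plusD(1) by (auto simp: szego_projection_def f_def)
  have [measurable]: "u \<in> borel_measurable circle_measure" using L2_circleD(1)[OF uL] .
  have "AE z in circle_measure. 1 * g z + (- of_real \<omega>) * u z = 0"
  proof (rule complex_L1_unique)
    show "integrable circle_measure (\<lambda>z. 1 * g z + (- of_real \<omega>) * u z)"
      using L2_circle_integrable[OF gL] L2_circle_integrable[OF uL] by simp
    show "fourier_coeff (\<lambda>z. 1 * g z + (- of_real \<omega>) * u z) k = 0" for k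
      unfolding fourier_coeff_lincomb[OF L2_circle_integrable[OF gL] L2_circle_integrable[OF uL]] coeff by simp
  qed
  then have g: "AE z in circle_measure. g z = of_real \<omega> * u z"
    by eventually_elim simp
  define F where "F = (\<lambda>z. ((cmod (u z))\<^sup>2 - \<omega>) * (cmod (u z))\<^sup>2)"
  have Fm: "F \<in> borel_measurable circle_measure" unfolding F_def by measurable
  have pt: "(f z - g z) * cnj (u z) = of_real (F z)" if "g z = of_real \<omega> * u z" for z
  proof -
    have "u z * cnj (u z) = of_real ((cmod (u z))\<^sup>2)" by (simp only: complex_norm_square)
    moreover have "(f z - g z) * cnj (u z) = of_real ((cmod (u z))\<^sup>2 - \<omega>) * (u z * cnj (u z))"
      unfolding that f_def by (simp add: algebra_simps)
    ultimately show ?thesis by (simp add: F_def)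
  qed
  have iF: "integrable circle_measure (\<lambda>z. complex_of_real (F z))"
  proof (rule integrable_cong_AE_imp)
    show "integrable circle_measure (\<lambda>z. (f z - g z) * cnj (u z))"
      by (intro L2_circle_mult_integrable L2_circle_diff L2_circle_cnj fL gL uL)
    show "AE z in circle_measure. (f z - g z) * cnj (u z) = complex_of_real (F z)"
      using g by eventually_elim (rule pt)
  qed (use Fm in measurable)
  have "AE z in circle_measure. F z = 0"
  proof (rule real_L1_unique)
    show "integrable circle_measure F"
      using integrable_Re[OF iF] by simp
    fix n :: nat
    have "(\<integral>z. of_real (F z) * cnj (z ^ n) \<partial>circle_measure) = (\<integral>z. (f z - g z) * cnj (z ^ n * u z) \<partial>circle_measure)"
    proof (rule integral_cong_AE)
      have cm: "(\<lambda>z. cnj (z ^ n)) \<in> borel_measurable circle_measure"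
        by (intro continuous_borel_measurable_circle continuous_intros)
      show "(\<lambda>z. complex_of_real (F z) * cnj (z ^ n)) \<in> borel_measurable circle_measure"
        using Fm cm by measurable
      show "(\<lambda>z. (f z - g z) * cnj (z ^ n * u z)) \<in> borel_measurable circle_measure"
        by (intro borel_measurable_integrable L2_circle_mult_integrable L2_circle_diff L2_circle_cnj fL gL L2_plusD(1)[OF L2_plus_power_mult[OF u]])
      show "AE z in circle_measure. complex_of_real (F z) * cnj (z ^ n) = (f z - g z) * cnj (z ^ n * u z)"
        using g
      proof eventually_elim
        case (elim z)
        show ?case unfolding pt[OF elim, symmetric] by simp
      qed
    qed
    also have "\<dots> = 0"
      using orth[OF L2_plus_power_mult[OF u]] by (simp add: L2_inner_def)
    finally have "cnj (\<integral>z. of_real (F z) * cnj (z ^ n) \<partial>circle_measure) = 0" by simp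
    then show "(\<integral>z. of_real (F z) * z ^ n \<partial>circle_measure) = (0::complex)"
      by (simp flip: Bochner_Integration.integral_cnj)
  qed
  then show ?thesis by (simp add: F_def)
qed

lemma bounded_on_circle:
  fixes f :: "complex \<Rightarrow> complex"
  assumes "continuous_on (sphere 0 1) f"
  obtains B where "\<And>z. norm z = 1 \<Longrightarrow> norm (f z) \<le> B"
proof -
  have "bounded (f ` sphere 0 1)"
    by (intro compact_imp_bounded compact_continuous_image assms) simp
  then obtain B where "\<forall>w\<in>f ` sphere 0 1. norm w \<le> B" by (auto simp: bounded_iff)
  then show ?thesis by (intro that[of B]) auto
qed

section \<open>Hardy space functions are nonzero almost everywhere\<close>

lemma holomorphic_power_sum:
  assumes h: "h holomorphic_on ball 0 R" and R: "R > 1"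
  obtains a r where "r > 1" "summable (\<lambda>n. norm (a n) * r ^ n)" "\<And>z. norm z \<le> 1 \<Longrightarrow> power_sum a z = h z"
proof -
  define a where "a = (\<lambda>n. (deriv ^^ n) h 0 / fact n)"
  \<comment> \<open>Two radii between 1 and \<open>R\<close>: convergence at \<open>x\<close>
    entails absolute convergence at the smaller \<open>r\<close>.\<close>
  define r where "r = (1 + R) / 2"
  define x where "x = (r + R) / 2"
  have r: "1 < r" "r < x" "x < R" using R by (auto simp: r_def x_def field_simps)
  have sums: "(\<lambda>n. a n * z ^ n) sums h z" if "norm z < R" for z
    using holomorphic_power_series[OF h, of z] that by (simp add: a_def)
  have "summable (\<lambda>n. a n * complex_of_real x ^ n)"
    using sums[of "of_real x"] r by (simp add: sums_iff)
  then have sr: "summable (\<lambda>n. norm (a n * complex_of_real r ^ n))"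
    by (rule powser_insidea) (use r in auto)
  have "(\<lambda>n. norm (a n * complex_of_real r ^ n)) = (\<lambda>n. norm (a n) * r ^ n)"
    using r by (simp add: norm_mult norm_power)
  with sr have sr': "summable (\<lambda>n. norm (a n) * r ^ n)" by simp
  have "summable (\<lambda>n. norm (a n))"
  proof (rule summable_comparison_test'[OF sr'])
    show "norm (norm (a n)) \<le> norm (a n) * r ^ n" for n
      using r one_le_power[of r n] mult_left_mono[of 1 "r ^ n" "norm (a n)"] by simp
  qed
  then have as: "a summable_on UNIV" by (intro norm_summable_imp_summable_on)
  have "power_sum a z = h z" if "norm z \<le> 1" for z
    using sums[of z] r that by (simp add: power_sum_suminf[OF as that] sums_iff)
  then show ?thesis using that[OF r(1) sr'] by blast
qed

text \<open>The coefficients of \<open>w\<close> of negative order vanish, so against the power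
  series of \<open>h\<close> only the two constant terms meet.\<close>

lemma integral_holomorphic_mult_L2_plus:
  assumes w: "w \<in> L2_plus" and h: "h holomorphic_on UNIV"
  shows "(\<integral>z. w z * h z \<partial>circle_measure) = h 0 * fourier_coeff w 0"
proof -
  have "h holomorphic_on ball 0 2" using h holomorphic_on_subset by blast
  then obtain a r where ar: "r > 1" "summable (\<lambda>n. norm (a n) * r ^ n)" and ha: "\<And>z. norm z \<le> 1 \<Longrightarrow> power_sum a z = h z"
    by (rule holomorphic_power_sum[where R = 2]) auto
  have as: "a summable_on UNIV" by (rule summable_of_exponential_bound[OF ar])
  have "(\<integral>z. w z * h z \<partial>circle_measure) = (\<integral>z. w z * power_sum a z \<partial>circle_measure)"
    by (intro Bochner_Integration.integral_cong) (auto simp: ha)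
  also have "\<dots> = (\<Sum>\<^sub>\<infinity>n. a n * (\<integral>z. w z * z ^ n \<partial>circle_measure))"
    by (rule integral_mult_power_sum(1)[OF as L2_circle_integrable[OF L2_plusD(1)[OF w]]])
  also have "\<dots> = (\<Sum>\<^sub>\<infinity>n\<in>{0}. a n * fourier_coeff w (- int n))"
  proof (rule infsum_cong_neutral)
    fix n :: nat assume "n \<in> UNIV - {0}"
    then show "a n * (\<integral>z. w z * z ^ n \<partial>circle_measure) = 0"
      using L2_plusD(2)[OF w, of "- int n"] by (simp add: fourier_coeff_def)
  qed (auto simp: fourier_coeff_def)
  also have "\<dots> = a 0 * fourier_coeff w 0" by simp
  also have "a 0 = h 0"
  proof -
    have "power_sum a 0 = (\<Sum>\<^sub>\<infinity>n\<in>{0}. a n)"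
      unfolding power_sum_def by (rule infsum_cong_neutral) auto
    then show ?thesis using ha[of 0] by simp
  qed
  finally show ?thesis .
qed

text \<open>
  Jensen's inequality for \<open>w\<close>, tested against outer functions \<open>exp (poly p z)\<close> whose modulus
  on the circle is close to \<open>exp \<phi>\<close>.
\<close>

lemma exp_mean_bound:
  assumes w: "w \<in> L2_plus" and \<phi>: "continuous_on (sphere 0 1) \<phi>"
  shows "exp (\<integral>z. \<phi> z \<partial>circle_measure) * cmod (fourier_coeff w 0) \<le> exp 2 * (\<integral>z. exp (\<phi> z) * cmod (w z) \<partial>circle_measure)"
proof -
  obtain p :: "complex poly" where p: "\<And>z. norm z = 1 \<Longrightarrow> \<bar>\<phi> z - Re (poly p z)\<bar> < 1"
    using poly_Re_approximation[OF \<phi>, of 1] by auto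
  have wi: "integrable circle_measure w" by (rule L2_circle_integrable[OF L2_plusD(1)[OF w]])
  have Re_mean: "(\<integral>z. Re (poly p z) \<partial>circle_measure) = Re (poly p 0)"
  proof -
    have "(\<lambda>z. 1) \<in> L2_plus" using L2_plus_power[of 0] by simp
    from integral_holomorphic_mult_L2_plus[OF this, of "poly p"]
    have "(\<integral>z. poly p z \<partial>circle_measure) = poly p 0"
      using fourier_coeff_monomial[of 0 0] by (simp add: holomorphic_intros)
    moreover have "integrable circle_measure (poly p)"
      by (intro integrable_continuous_circle continuous_intros)
    ultimately show ?thesis by (simp add: integral_Re)
  qed
  have pc: "continuous_on (sphere 0 1) (\<lambda>z. Re (poly p z))" by (intro continuous_intros)
  have "(\<integral>z. \<phi> z \<partial>circle_measure) \<le> (\<integral>z. Re (poly p z) + 1 \<partial>circle_measure)"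
  proof (intro integral_mono)
    fix z assume "z \<in> space circle_measure"
    then show "\<phi> z \<le> Re (poly p z) + 1" using p[of z] by simp
  qed (auto intro!: integrable_continuous_circle continuous_intros \<phi>)
  also have "\<dots> = Re (poly p 0) + 1"
    using integrable_continuous_circle[OF pc] by (simp add: Re_mean)
  finally have 1: "exp (\<integral>z. \<phi> z \<partial>circle_measure) \<le> exp 1 * exp (Re (poly p 0))"
    by (simp add: add.commute flip: exp_add)
  have "exp (Re (poly p 0)) * cmod (fourier_coeff w 0) = cmod (exp (poly p 0) * fourier_coeff w 0)"
    by (simp add: norm_mult)
  also have "\<dots> = cmod (\<integral>z. w z * exp (poly p z) \<partial>circle_measure)"
    by (subst integral_holomorphic_mult_L2_plus[OF w]) (auto intro!: holomorphic_intros)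
  also have "\<dots> \<le> (\<integral>z. cmod (w z * exp (poly p z)) \<partial>circle_measure)"
    by (rule integral_norm_bound)
  also have "\<dots> \<le> (\<integral>z. exp 1 * (exp (\<phi> z) * cmod (w z)) \<partial>circle_measure)"
  proof (rule integral_mono)
    have pec: "continuous_on (sphere 0 1) (\<lambda>z. exp (poly p z))" by (intro continuous_intros)
    then obtain B where B: "\<And>z. norm z = 1 \<Longrightarrow> norm (exp (poly p z)) \<le> B"
      using bounded_on_circle by blast
    show "integrable circle_measure (\<lambda>z. cmod (w z * exp (poly p z)))"
      by (intro integrable_norm integrable_mult_bounded_circle[OF wi, where B = B] continuous_borel_measurable_circle pec B)
    have ec: "continuous_on (sphere 0 1) (\<lambda>z. complex_of_real (exp (\<phi> z)))" by (intro continuous_intros \<phi>)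
    then obtain C where C: "\<And>z. norm z = 1 \<Longrightarrow> norm (complex_of_real (exp (\<phi> z))) \<le> C"
      using bounded_on_circle by blast
    have "integrable circle_measure (\<lambda>z. cmod (w z * complex_of_real (exp (\<phi> z))))"
      by (intro integrable_norm integrable_mult_bounded_circle[OF wi, where B = C] continuous_borel_measurable_circle ec C)
    then show "integrable circle_measure (\<lambda>z. exp 1 * (exp (\<phi> z) * cmod (w z)))"
      by (simp add: norm_mult mult.commute)
    fix z assume "z \<in> space circle_measure"
    then have "Re (poly p z) \<le> 1 + \<phi> z" using p[of z] by simp
    then have "exp (Re (poly p z)) \<le> exp 1 * exp (\<phi> z)" by (simp flip: exp_add)
    then have "exp (Re (poly p z)) * cmod (w z) \<le> exp 1 * exp (\<phi> z) * cmod (w z)" by (intro mult_right_mono) auto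
    then show "cmod (w z * exp (poly p z)) \<le> exp 1 * (exp (\<phi> z) * cmod (w z))"
      by (simp add: norm_mult mult_ac)
  qed
  finally have 2: "exp (Re (poly p 0)) * cmod (fourier_coeff w 0) \<le> exp 1 * (\<integral>z. exp (\<phi> z) * cmod (w z) \<partial>circle_measure)"
    by simp
  \<comment> \<open>The constant \<open>exp 2\<close> arises because \<open>p\<close> is within
    distance 1: one factor \<open>exp 1\<close> for the mean of \<open>\<phi>\<close>, another for
    its values.\<close>
  have "exp (\<integral>z. \<phi> z \<partial>circle_measure) * cmod (fourier_coeff w 0) \<le> exp 1 * exp (Re (poly p 0)) * cmod (fourier_coeff w 0)"
    by (intro mult_right_mono 1) auto
  also have "\<dots> \<le> exp 1 * (exp 1 * (\<integral>z. exp (\<phi> z) * cmod (w z) \<partial>circle_measure))"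
    using 2 by (simp add: mult.assoc)
  also have "\<dots> = exp 2 * (\<integral>z. exp (\<phi> z) * cmod (w z) \<partial>circle_measure)"
    by (simp flip: mult.assoc exp_add)
  finally show ?thesis .
qed

text \<open>If \<open>w\<close> vanished on a compact \<open>K\<close> of positive measure, a weight
  \<open>exp M\<close> placed on \<open>K\<close> would in the limit leave the right side of
  \<open>exp_mean_bound\<close> unchanged, while the left side grows like
  \<open>exp (M * \<kappa>)\<close>.\<close>

lemma L2_plus_nonzero_AE_aux:
  assumes w: "w \<in> L2_plus" and w0: "fourier_coeff w 0 \<noteq> 0"
  shows "AE z in circle_measure. w z \<noteq> 0"
proof -
  have wi: "integrable circle_measure w" by (rule L2_circle_integrable[OF L2_plusD(1)[OF w]])
  then have [measurable]: "w \<in> borel_measurable circle_measure" by simp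
  define A where "A = {z \<in> space circle_measure. w z = 0}"
  have A: "A \<in> sets circle_measure" unfolding A_def by measurable
  have "emeasure circle_measure A = 0"
  proof (rule compact_inner_circle[OF A])
    fix K assume K: "compact K" "K \<subseteq> A"
    have Ks: "K \<in> sets circle_measure"
      unfolding circle_measure_sets_iff using K by (auto simp: A_def intro: borel_compact)
    show "emeasure circle_measure K = 0"
    proof (rule ccontr)
      assume "emeasure circle_measure K \<noteq> 0"
      then have pos: "measure circle_measure K > 0" and ne: "K \<noteq> {}"
        by (auto simp: circle.emeasure_eq_measure zero_less_measure_iff)
      define \<kappa> where "\<kappa> = measure circle_measure K"
      define I where "I = (\<integral>z. cmod (w z) \<partial>circle_measure)"
      define W where "W = cmod (fourier_coeff w 0)"
      have W: "W > 0" using w0 by (simp add: W_def)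
      have bound: "exp (M * \<kappa>) * W \<le> exp 2 * I" if M: "M \<ge> 0" for M
      proof -
        have bc: "continuous_on (sphere 0 1) (\<lambda>z. M * bump K n z)" for n
          by (intro continuous_intros bump_continuous)
        have low: "M * \<kappa> \<le> (\<integral>z. M * bump K n z \<partial>circle_measure)" for n
        proof -
          have "\<kappa> = (\<integral>z. indicator K z \<partial>circle_measure)"
            using Ks borel_set_circle[OF Ks] by (simp add: \<kappa>_def Int_absorb2 circle.emeasure_eq_measure)
          also have "\<dots> \<le> (\<integral>z. bump K n z \<partial>circle_measure)"
          proof (rule integral_mono)
            show "integrable circle_measure (indicator K :: complex \<Rightarrow> real)" using Ks by (auto simp: circle.emeasure_eq_measure)
            show "integrable circle_measure (bump K n)" by (intro integrable_continuous_circle bump_continuous)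
            show "indicator K z \<le> bump K n z" for z
              using bump_range[of K n z] by (cases "z \<in> K") (auto simp: bump_def)
          qed
          finally show ?thesis using M by (simp add: mult_left_mono)
        qed
        have "(\<lambda>n. \<integral>z. exp (M * bump K n z) * cmod (w z) \<partial>circle_measure) \<longlonglongrightarrow> I"
          unfolding I_def
        proof (rule integral_dominated_convergence[where w = "\<lambda>z. exp M * cmod (w z)"])
          show "(\<lambda>z. exp (M * bump K n z) * cmod (w z)) \<in> borel_measurable circle_measure" for n
            using continuous_borel_measurable_circle[OF bc[of n]] by measurable
          show "AE z in circle_measure. (\<lambda>n. exp (M * bump K n z) * cmod (w z)) \<longlonglongrightarrow> cmod (w z)"
          proof (intro AE_I2)
            fix z
            have "(\<lambda>n. exp (M * bump K n z) * cmod (w z)) \<longlonglongrightarrow> exp (M * indicator K z) * cmod (w z)"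
              by (intro tendsto_intros bump_tendsto compact_imp_closed K ne)
            also have "exp (M * indicator K z) * cmod (w z) = cmod (w z)"
              using K(2) by (cases "z \<in> K") (auto simp: A_def)
            finally show "(\<lambda>n. exp (M * bump K n z) * cmod (w z)) \<longlonglongrightarrow> cmod (w z)" .
          qed
          show "AE z in circle_measure. norm (exp (M * bump K n z) * cmod (w z)) \<le> exp M * cmod (w z)" for n
            using bump_range[of K n] M by (intro AE_I2) (auto intro!: mult_right_mono mult_left_le)
        qed (use wi in auto)
        then have c1: "(\<lambda>n. exp 2 * (\<integral>z. exp (M * bump K n z) * cmod (w z) \<partial>circle_measure)) \<longlonglongrightarrow> exp 2 * I"
          by (intro tendsto_intros)
        have c2: "exp (M * \<kappa>) * W \<le> exp 2 * (\<integral>z. exp (M * bump K n z) * cmod (w z) \<partial>circle_measure)" for n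
        proof -
          have "exp (M * \<kappa>) * W \<le> exp (\<integral>z. M * bump K n z \<partial>circle_measure) * W"
            using low[of n] W by (intro mult_right_mono) auto
          also have "\<dots> \<le> exp 2 * (\<integral>z. exp (M * bump K n z) * cmod (w z) \<partial>circle_measure)"
            unfolding W_def by (rule exp_mean_bound[OF w bc])
          finally show ?thesis .
        qed
        show ?thesis by (rule LIMSEQ_le_const[OF c1]) (use c2 in auto)
      qed
      have I0: "I \<ge> 0" by (simp add: I_def)
      \<comment> \<open>With \<open>1 + x \<le> exp x\<close> the bound at this \<open>M\<close>
        becomes \<open>W + exp 2 * I \<le> exp 2 * I\<close>.\<close>
      define M where "M = exp 2 * I / W / \<kappa>"
      have M: "M \<ge> 0" "M * \<kappa> = exp 2 * I / W" using I0 W pos by (auto simp: M_def \<kappa>_def)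
      have "(1 + M * \<kappa>) * W \<le> exp (M * \<kappa>) * W" using W by (intro mult_right_mono exp_ge_add_one_self) auto
      also have "\<dots> \<le> exp 2 * I" by (rule bound[OF M(1)])
      finally have "(1 + exp 2 * I / W) * W \<le> exp 2 * I" unfolding M(2) .
      moreover have "(1 + exp 2 * I / W) * W = W + exp 2 * I" using W by (simp add: distrib_right)
      ultimately show False using W by linarith
    qed
  qed
  moreover have "{z \<in> space circle_measure. \<not> w z \<noteq> 0} = A" by (auto simp: A_def)
  ultimately show ?thesis using A by (subst AE_iff_measurable) auto
qed

text \<open>Dividing by the power of \<open>z\<close> belonging to the first nonzero coefficient
  moves that coefficient to order 0 without leaving \<open>L2_plus\<close>.\<close>

lemma L2_plus_nonzero_AE:
  assumes u: "u \<in> L2_plus" and nz: "fourier_coeff u k \<noteq> 0"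
  shows "AE z in circle_measure. u z \<noteq> 0"
proof -
  have "k \<ge> 0" using L2_plusD(2)[OF u, of k] nz by linarith
  then have ex: "fourier_coeff u (int (nat k)) \<noteq> 0" using nz by simp
  define m where "m = (LEAST m. fourier_coeff u (int m) \<noteq> 0)"
  have m: "fourier_coeff u (int m) \<noteq> 0" unfolding m_def by (rule LeastI[of _ "nat k"]) (rule ex)
  have less: "fourier_coeff u (int j) = 0" if "j < m" for j
    using not_less_Least[of j "\<lambda>m. fourier_coeff u (int m) \<noteq> 0"] that unfolding m_def by blast
  define w where "w = (\<lambda>z. z powi (- int m) * u z)"
  have wc: "fourier_coeff w j = fourier_coeff u (j + int m)" for j
    unfolding w_def fourier_coeff_powi_mult by simp
  have "fourier_coeff w j = 0" if "j < 0" for j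
  proof (cases "j + int m < 0")
    case True
    then show ?thesis using L2_plusD(2)[OF u] by (simp add: wc)
  next
    case False
    then have "j + int m = int (nat (j + int m))" "nat (j + int m) < m" using that by auto
    then show ?thesis unfolding wc using less by metis
  qed
  then have "w \<in> L2_plus"
    using L2_circle_powi_mult[OF L2_plusD(1)[OF u], of "- int m"] by (simp add: L2_plus_def w_def)
  then have "AE z in circle_measure. w z \<noteq> 0"
    by (rule L2_plus_nonzero_AE_aux) (simp add: wc m)
  then show ?thesis by eventually_elim (auto simp: w_def)
qed

section \<open>Constant modulus and finite Sobolev norm force a rational function\<close>

lemma underdetermined_system:
  fixes m :: "'e \<Rightarrow> 'i \<Rightarrow> 'a :: field"
  assumes "finite E" "finite I" "card E < card I"
  shows "\<exists>x. (\<exists>i\<in>I. x i \<noteq> 0) \<and> (\<forall>e\<in>E. (\<Sum>i\<in>I. x i * m e i) = 0)"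
  using assms
proof (induction E arbitrary: I m rule: finite_induct)
  case empty
  then have "I \<noteq> {}" by auto
  then show ?case by (intro exI[of _ "\<lambda>_. 1"]) auto
next
  case (insert e E)
  show ?case
  proof (cases "\<forall>i\<in>I. m e i = 0")
    case True
    obtain x where "\<exists>i\<in>I. x i \<noteq> 0" "\<forall>e\<in>E. (\<Sum>i\<in>I. x i * m e i) = 0"
      using insert.IH[of I m] insert.prems insert.hyps by auto
    then show ?thesis using True by (intro exI[of _ x]) auto
  next
    case False
    then obtain p where p: "p \<in> I" "m e p \<noteq> 0" by blast
    \<comment> \<open>Elimination of the unknown \<open>p\<close> by means of the equation
      \<open>e\<close>.\<close>
    define m' where "m' = (\<lambda>e' i. m e' i - m e' p * m e i / m e p)"
    have "card E < card (I - {p})"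
      using insert.prems insert.hyps p by (simp add: card_Diff_singleton)
    then obtain x where x: "\<exists>i\<in>I - {p}. x i \<noteq> 0" "\<forall>e'\<in>E. (\<Sum>i\<in>I - {p}. x i * m' e' i) = 0"
      using insert.IH[of "I - {p}" m'] insert.prems by auto
    define xp where "xp = - (\<Sum>i\<in>I - {p}. x i * m e i) / m e p"
    define y where "y = x(p := xp)"
    have sum: "(\<Sum>i\<in>I. y i * m e' i) = xp * m e' p + (\<Sum>i\<in>I - {p}. x i * m e' i)" for e'
    proof -
      have "(\<Sum>i\<in>I. y i * m e' i) = y p * m e' p + (\<Sum>i\<in>I - {p}. y i * m e' i)"
        using insert.prems p by (intro sum.remove) auto
      also have "(\<Sum>i\<in>I - {p}. y i * m e' i) = (\<Sum>i\<in>I - {p}. x i * m e' i)"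
        by (rule sum.cong) (auto simp: y_def)
      finally show ?thesis by (simp add: y_def)
    qed
    have "(\<Sum>i\<in>I. y i * m e' i) = 0" if "e' \<in> insert e E" for e'
    proof (cases "e' = e")
      case True
      then show ?thesis unfolding sum using p by (simp add: xp_def)
    next
      case False
      then have "0 = (\<Sum>i\<in>I - {p}. x i * m' e' i)" using x(2) that by auto
      also have "\<dots> = (\<Sum>i\<in>I - {p}. x i * m e' i) - (\<Sum>i\<in>I - {p}. x i * m e i) * (m e' p / m e p)"
        unfolding m'_def sum_distrib_right sum_subtractf[symmetric] by (intro sum.cong) (auto simp: field_simps)
      also have "\<dots> = xp * m e' p + (\<Sum>i\<in>I - {p}. x i * m e' i)"
        by (simp add: xp_def)
      finally show ?thesis unfolding sum by simp
    qed
    moreover have "\<exists>i\<in>I. y i \<noteq> 0" using x(1) by (auto simp: y_def)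
    ultimately show ?thesis by blast
  qed
qed

lemma L2_circle_sum:
  assumes "\<And>j. f j \<in> L2_circle" "finite J"
  shows "(\<lambda>z. \<Sum>j\<in>J. c j * f j z) \<in> L2_circle"
  using assms(2)
proof (induction J rule: finite_induct)
  case empty
  then show ?case by (simp add: L2_circle_continuous)
next
  case (insert j J)
  then show ?case using L2_circle_add[OF L2_circle_cmult[OF assms(1)] insert.IH] by simp
qed

text \<open>
  The functions \<open>y\<close> below are orthogonal to \<open>u * L2_plus\<close>, so \<open>y * cnj u\<close> has only negative
  frequencies. If the first \<open>N\<close> coefficients of \<open>y\<close> vanish, the smallness of the tails of \<open>u\<close>
  forces \<open>y = 0\<close>, which is a linear recurrence for the coefficients of \<open>u\<close>.
\<close>

proposition constant_modulus_rational:
  assumes u: "u \<in> L2_plus" and mod: "AE z in circle_measure. (cmod (u z))\<^sup>2 = \<omega>" and \<omega>: "\<omega> > 0"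
    and sob: "(\<lambda>k. real k * (cmod (fourier_coeff u (int k)))\<^sup>2) summable_on UNIV"
  obtains P Q :: "complex poly" where "Q \<noteq> 0" "AE z in circle_measure. poly Q z * u z = poly P z"
proof -
  note uL = L2_plusD(1)[OF u] and uneg = L2_plusD(2)[OF u]
  note ui = L2_circle_integrable[OF uL]
  have um: "u \<in> borel_measurable circle_measure" by (rule L2_circleD(1)[OF uL])
  define a where "a = (\<lambda>k. fourier_coeff u (int k))"
  define b where "b = (\<lambda>k. (cmod (a k))\<^sup>2)"
  have u_bd: "AE z in circle_measure. cmod (u z) \<le> sqrt \<omega>"
    using mod by eventually_elim (auto simp: real_le_rsqrt)
  have int_u: "(\<integral>z. (cmod (u z))\<^sup>2 \<partial>circle_measure) = \<omega>"
  proof -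
    have "(\<integral>z. (cmod (u z))\<^sup>2 \<partial>circle_measure) = (\<integral>z. \<omega> \<partial>circle_measure)"
      by (rule integral_cong_AE) (use um mod in auto)
    then show ?thesis by simp
  qed
  have nat_sum: "((\<lambda>k. (cmod (fourier_coeff f (int k)))\<^sup>2) has_sum S) UNIV"
    if "((\<lambda>k. (cmod (fourier_coeff f k))\<^sup>2) has_sum S) UNIV" "\<And>k. k < 0 \<Longrightarrow> fourier_coeff f k = 0" for f S
  proof -
    have neg: "fourier_coeff f k = 0" if "k \<notin> range int" for k
      using that nonneg_int_cases[of k] \<open>\<And>k. k < 0 \<Longrightarrow> fourier_coeff f k = 0\<close>[of k] by (cases "k < 0") auto
    have "((\<lambda>k. (cmod (fourier_coeff f k))\<^sup>2) has_sum S) (range int)"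
      by (rule has_sum_cong_neutral[THEN iffD1, OF _ _ _ that(1)]) (auto simp: neg)
    then have "((\<lambda>k. (cmod (fourier_coeff f k))\<^sup>2) \<circ> int has_sum S) UNIV"
      by (subst (asm) has_sum_reindex) auto
    then show ?thesis by (simp add: o_def)
  qed
  have b_sum: "(b has_sum \<omega>) UNIV"
    using nat_sum[OF parseval_has_sum[OF uL u_bd] uneg] by (simp add: b_def a_def int_u)
  have b_sums: "b sums \<omega>" by (rule has_sum_imp_sums[OF b_sum])
  have b_nonneg: "b k \<ge> 0" for k by (simp add: b_def)
  \<comment> \<open>The half derivative gives weight one to the squared moduli \<open>b\<close>, so
    the row sums of \<open>hankel\<close> are available for \<open>b\<close>:
    \<open>B.tail (Suc k)\<close> is the squared \<open>L2\<close> distance of \<open>u\<close> to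
    its partial sum of order \<open>k\<close>, and these distances are summable.\<close>
  interpret B: hankel "\<lambda>k. complex_of_real (b k)"
  proof
    have "(\<lambda>k. real k * b k + b k) summable_on UNIV"
      using sob b_sum by (intro summable_on_add) (auto simp: b_def a_def summable_on_def)
    then show "weighted_l1 1 (\<lambda>k. complex_of_real (b k))"
      by (simp add: weighted_l1_def b_nonneg algebra_simps)
  qed
  have tail_eq: "B.tail (Suc k) = \<omega> - (\<Sum>i\<le>k. b i)" for k
  proof -
    have "(\<lambda>j. b (Suc k + j)) summable_on UNIV"
      using summable_on_reindex[of "\<lambda>j. Suc k + j" UNIV b] b_sum
      by (auto simp: o_def inj_on_def summable_on_def intro: summable_on_subset[of b UNIV, unfolded summable_on_def])
    then have "(\<lambda>j. b (Suc k + j)) sums B.tail (Suc k)"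
      unfolding B.tail_def using b_nonneg by (intro has_sum_imp_sums) simp
    then have "B.tail (Suc k) = (\<Sum>j. b (j + Suc k))" by (simp add: sums_iff add.commute)
    also have "\<dots> = \<omega> - (\<Sum>i<Suc k. b i)"
      using suminf_minus_initial_segment[OF sums_summable[OF b_sums], of "Suc k"] b_sums by (simp add: sums_iff)
    finally show ?thesis by (simp add: lessThan_Suc_atMost)
  qed
  have tail_s: "summable (\<lambda>k. B.tail (Suc k))"
    using summable_on_imp_summable[OF B.tail_summable] by (simp add: summable_Suc_iff)
  \<comment> \<open>The strict inequality below \<open>\<omega>\<close> is the contraction that
    finally forces \<open>Y = 0\<close>.\<close>
  obtain N where N: "(\<Sum>i. B.tail (Suc (i + N))) < \<omega>"
    using suminf_exist_split[OF \<omega> tail_s] B.tail_nonneg by (metis abs_of_nonneg real_norm_def order_refl abs_le_D1 le_less_trans)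
  \<comment> \<open>One more unknown than equations, so some nontrivial combination of Hankel rows
    of \<open>u\<close> starts with \<open>N\<close> zeros.\<close>
  obtain x where x: "\<exists>j\<in>{..N}. x j \<noteq> 0" "\<forall>k\<in>{..<N}. (\<Sum>j\<in>{..N}. x j * a (k + j + 1)) = 0"
    using underdetermined_system[of "{..<N}" "{..N}" "\<lambda>k j. a (k + j + 1)"] by auto
  define S where "S = (\<lambda>j::int. trig_sum {0..j} (fourier_coeff u))"
  define D where "D = (\<lambda>j z. u z - S j z)"
  have Sc: "continuous_on (sphere 0 1) (S j)" for j unfolding S_def by (rule trig_sum_continuous)
  have SL: "S j \<in> L2_circle" for j by (intro L2_circle_continuous Sc)
  have DL: "D j \<in> L2_circle" for j unfolding D_def by (intro L2_circle_diff uL SL)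
  have Dc: "fourier_coeff (D j) k = (if 0 \<le> k \<and> k \<le> j then 0 else fourier_coeff u k)" for j k
  proof -
    have "D j = (\<lambda>z. 1 * u z + (- 1) * S j z)" by (simp add: D_def)
    then have "fourier_coeff (D j) k = 1 * fourier_coeff u k + (- 1) * fourier_coeff (S j) k"
      using fourier_coeff_lincomb[OF ui L2_circle_integrable[OF SL[of j]], of 1 "- 1" k] by simp
    then show ?thesis by (simp add: S_def fourier_coeff_trig_sum)
  qed
  \<comment> \<open>Each summand is the part of nonnegative order of \<open>u\<close> shifted down
    by \<open>j + 1\<close>, so the coefficients of \<open>y\<close> are the chosen combination of
    Hankel rows.\<close>
  define y where "y = (\<lambda>z. \<Sum>j\<le>N. x j * (z powi (- int (Suc j)) * D (int j) z))"
  have y_eq: "y = (\<lambda>z. (\<Sum>j\<le>N. x j * z powi (- int (Suc j))) * u z - (\<Sum>j\<le>N. x j * (z powi (- int (Suc j)) * S (int j) z)))"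
    by (simp add: y_def D_def sum_subtractf sum_distrib_left sum_distrib_right algebra_simps)
  have Gc: "continuous_on (sphere 0 1) (\<lambda>z. \<Sum>j\<le>N. x j * z powi (- int (Suc j)))"
    and Tc: "continuous_on (sphere 0 1) (\<lambda>z. \<Sum>j\<le>N. x j * (z powi (- int (Suc j)) * S (int j) z))"
    by (intro continuous_intros Sc continuous_on_powi_circle)+
  obtain BG where BG: "\<And>z. norm z = 1 \<Longrightarrow> norm (\<Sum>j\<le>N. x j * z powi (- int (Suc j))) \<le> BG"
    using bounded_on_circle[OF Gc] by blast
  obtain BT where BT: "\<And>z. norm z = 1 \<Longrightarrow> norm (\<Sum>j\<le>N. x j * (z powi (- int (Suc j)) * S (int j) z)) \<le> BT"
    using bounded_on_circle[OF Tc] by blast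
  have yL: "y \<in> L2_circle"
    unfolding y_eq
    by (intro L2_circle_diff L2_circle_mult_bounded[OF uL continuous_borel_measurable_circle[OF Gc] BG] L2_circle_continuous Tc)
  have y_bd: "AE z in circle_measure. cmod (y z) \<le> BG * sqrt \<omega> + BT"
    using u_bd AE_space
  proof eventually_elim
    case (elim z)
    then have z: "norm z = 1" by simp
    have "cmod (y z) \<le> cmod ((\<Sum>j\<le>N. x j * z powi (- int (Suc j))) * u z) + cmod (\<Sum>j\<le>N. x j * (z powi (- int (Suc j)) * S (int j) z))"
      unfolding y_eq by (rule norm_triangle_ineq4)
    also have "\<dots> \<le> BG * sqrt \<omega> + BT"
      unfolding norm_mult using BG[OF z] BT[OF z] elim norm_ge_zero order_trans
      by (intro add_mono mult_mono) blast+
    finally show ?case .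
  qed
  have y_coeff: "fourier_coeff y k = (\<Sum>j\<le>N. x j * fourier_coeff (D (int j)) (k + int (Suc j)))" for k
    unfolding y_def
  proof (subst fourier_coeff_sum)
    show "integrable circle_measure (\<lambda>z. z powi (- int (Suc j)) * D (int j) z)" for j
      by (intro L2_circle_integrable L2_circle_powi_mult DL)
    show "(\<Sum>j\<le>N. x j * fourier_coeff (\<lambda>z. z powi (- int (Suc j)) * D (int j) z) k) =
        (\<Sum>j\<le>N. x j * fourier_coeff (D (int j)) (k + int (Suc j)))"
      by (simp only: fourier_coeff_powi_mult diff_minus_eq_add)
  qed
  have y_neg: "fourier_coeff y k = 0" if "k < 0" for k
    unfolding y_coeff using that uneg by (intro sum.neutral) (auto simp: Dc)
  have y_pos: "fourier_coeff y (int k) = (\<Sum>j\<le>N. x j * a (k + j + 1))" for k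
    unfolding y_coeff Dc by (intro sum.cong) (auto simp: a_def algebra_simps)
  \<comment> \<open>Almost everywhere this is \<open>y * cnj u\<close> with \<open>u * cnj u\<close>
    replaced by \<open>\<omega>\<close>. In the expanded form every term visibly has only negative
    frequencies.\<close>
  define F where "F = (\<lambda>z. \<Sum>j\<le>N. x j * (of_real \<omega> * z powi (- int (Suc j)) +
      (- 1) * (\<Sum>i\<in>{0..int j}. fourier_coeff u i * (z powi (i - int (Suc j)) * cnj (u z)))))"
  have cuL: "(\<lambda>z. cnj (u z)) \<in> L2_circle" by (rule L2_circle_cnj[OF uL])
  have mL: "(\<lambda>z. z powi k) \<in> L2_circle" for k by (intro L2_circle_continuous continuous_on_powi_circle)
  have innerL: "(\<lambda>z. \<Sum>i\<in>{0..int j}. fourier_coeff u i * (z powi (i - int (Suc j)) * cnj (u z))) \<in> L2_circle" for j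
    by (intro L2_circle_sum L2_circle_powi_mult cuL) auto
  have termL: "(\<lambda>z. of_real \<omega> * z powi (- int (Suc j)) +
      (- 1) * (\<Sum>i\<in>{0..int j}. fourier_coeff u i * (z powi (i - int (Suc j)) * cnj (u z)))) \<in> L2_circle" for j
    by (intro L2_circle_add L2_circle_cmult mL innerL)
  have FL: "F \<in> L2_circle"
    unfolding F_def by (intro L2_circle_sum termL) auto
  have Fc: "fourier_coeff F k = 0" if k: "k \<ge> 0" for k
  proof -
    have inner: "fourier_coeff (\<lambda>z. \<Sum>i\<in>{0..int j}. fourier_coeff u i * (z powi (i - int (Suc j)) * cnj (u z))) k = 0" for j
    proof (subst fourier_coeff_sum)
      show "integrable circle_measure (\<lambda>z. z powi (i - int (Suc j)) * cnj (u z))" for i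
        by (intro L2_circle_integrable L2_circle_powi_mult cuL)
      show "(\<Sum>i\<in>{0..int j}. fourier_coeff u i * fourier_coeff (\<lambda>z. z powi (i - int (Suc j)) * cnj (u z)) k) = 0"
        unfolding fourier_coeff_powi_mult fourier_coeff_cnj using k uneg by (intro sum.neutral) auto
    qed
    show ?thesis
      unfolding F_def
    proof (subst fourier_coeff_sum)
      show "integrable circle_measure (\<lambda>z. of_real \<omega> * z powi (- int (Suc j)) +
        (- 1) * (\<Sum>i\<in>{0..int j}. fourier_coeff u i * (z powi (i - int (Suc j)) * cnj (u z))))" for j
        by (rule L2_circle_integrable[OF termL])
      show "(\<Sum>j\<le>N. x j * fourier_coeff (\<lambda>z. of_real \<omega> * z powi (- int (Suc j)) +
        (- 1) * (\<Sum>i\<in>{0..int j}. fourier_coeff u i * (z powi (i - int (Suc j)) * cnj (u z)))) k) = 0"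
        unfolding fourier_coeff_lincomb[OF L2_circle_integrable[OF mL] L2_circle_integrable[OF innerL]] inner fourier_coeff_monomial
        using k by (intro sum.neutral) auto
    qed
  qed
  have uF: "AE z in circle_measure. u z * F z = of_real \<omega> * y z"
    using mod AE_space
  proof eventually_elim
    case (elim z)
    then have z0: "z \<noteq> 0" by auto
    have uu: "u z * cnj (u z) = of_real \<omega>"
      using elim(1) by (simp only: complex_norm_square[symmetric])
    have "u z * (x j * (of_real \<omega> * z powi (- int (Suc j)) +
        (- 1) * (\<Sum>i\<in>{0..int j}. fourier_coeff u i * (z powi (i - int (Suc j)) * cnj (u z))))) =
        of_real \<omega> * (x j * (z powi (- int (Suc j)) * D (int j) z))" for j
    proof -
      have pw: "z powi (i - int (Suc j)) = z powi (- int (Suc j)) * z powi i" for i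
        by (subst power_int_add[symmetric]) (use z0 in \<open>auto simp: algebra_simps\<close>)
      have "u z * (\<Sum>i\<in>{0..int j}. fourier_coeff u i * (z powi (i - int (Suc j)) * cnj (u z))) =
          (\<Sum>i\<in>{0..int j}. (u z * cnj (u z)) * (z powi (- int (Suc j)) * (fourier_coeff u i * z powi i)))"
        unfolding sum_distrib_left pw by (intro sum.cong) (auto simp: mult_ac)
      also have "\<dots> = of_real \<omega> * (z powi (- int (Suc j)) * S (int j) z)"
        unfolding uu S_def trig_sum_def sum_distrib_left ..
      finally have *: "u z * (\<Sum>i\<in>{0..int j}. fourier_coeff u i * (z powi (i - int (Suc j)) * cnj (u z))) = 
        of_real \<omega> * (z powi (- int (Suc j)) * S (int j) z)" .
      have "u z * (x j * (of_real \<omega> * z powi (- int (Suc j)) +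
        (- 1) * (\<Sum>i\<in>{0..int j}. fourier_coeff u i * (z powi (i - int (Suc j)) * cnj (u z))))) = 
        x j * (of_real \<omega> * z powi (- int (Suc j)) * u z - u z * (\<Sum>i\<in>{0..int j}. fourier_coeff u i * (z powi (i - int (Suc j)) * cnj (u z))))"
        by (simp add: algebra_simps)
      then show ?thesis unfolding * D_def by (simp add: algebra_simps)
    qed
    then show ?case unfolding F_def y_def sum_distrib_left by (intro sum.cong) auto
  qed
  define Y where "Y = (\<integral>z. (cmod (y z))\<^sup>2 \<partial>circle_measure)"
  have Y0: "Y \<ge> 0" by (simp add: Y_def)
  have F_norm: "(\<integral>z. (cmod (F z))\<^sup>2 \<partial>circle_measure) = \<omega> * Y"
  proof -
    have "(\<integral>z. (cmod (F z))\<^sup>2 \<partial>circle_measure) = (\<integral>z. \<omega> * (cmod (y z))\<^sup>2 \<partial>circle_measure)"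
    proof (rule integral_cong_AE)
      show "AE z in circle_measure. (cmod (F z))\<^sup>2 = \<omega> * (cmod (y z))\<^sup>2"
        using uF mod
      proof eventually_elim
        case (elim z)
        have "(cmod (u z))\<^sup>2 * (cmod (F z))\<^sup>2 = \<omega>\<^sup>2 * (cmod (y z))\<^sup>2"
          using arg_cong[OF elim(1), of "\<lambda>w. (cmod w)\<^sup>2"] by (simp add: norm_mult power_mult_distrib)
        then show ?case unfolding elim(2) using \<omega> by (simp add: power2_eq_square)
      qed
    qed (use L2_circleD[OF FL] L2_circleD[OF yL] in auto)
    then show ?thesis by (simp add: Y_def)
  qed
  have D_norm: "(\<integral>z. (cmod (D (int k) z))\<^sup>2 \<partial>circle_measure) = B.tail (Suc k)" for k
  proof -
    have "(\<Sum>i\<in>{0..int k}. (cmod (fourier_coeff u i))\<^sup>2) = (\<Sum>i\<le>k. b i)"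
      by (rule sum.reindex_bij_witness[of _ int nat]) (auto simp: b_def a_def)
    then show ?thesis
      unfolding D_def S_def by (subst L2_dist_trig_sum[OF uL]) (auto simp: int_u tail_eq)
  qed
  \<comment> \<open>\<open>S (int k)\<close> has frequencies at most \<open>k\<close> and
    \<open>F\<close> only negative ones, so their product has no coefficient of order
    \<open>k\<close>. In \<open>\<omega> * y = u * F\<close> the factor \<open>u\<close> may
    therefore be replaced by the remainder \<open>D (int k)\<close>, and Cauchy-Schwarz brings in
    the tail.\<close>
  have bound: "(cmod (fourier_coeff y (int k)))\<^sup>2 \<le> (Y / \<omega>) * B.tail (Suc k)" for k
  proof -
    have SF: "(\<lambda>z. S (int k) z * F z) \<in> L2_circle"
    proof -
      obtain BS where "\<And>z. norm z = 1 \<Longrightarrow> norm (S (int k) z) \<le> BS" using bounded_on_circle[OF Sc] by blast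
      then show ?thesis by (intro L2_circle_mult_bounded[OF FL continuous_borel_measurable_circle[OF Sc]])
    qed
    have SF0: "fourier_coeff (\<lambda>z. S (int k) z * F z) (int k) = 0"
    proof -
      have "(\<lambda>z. S (int k) z * F z) = (\<lambda>z. \<Sum>i\<in>{0..int k}. fourier_coeff u i * (z powi i * F z))"
        by (simp add: S_def trig_sum_def sum_distrib_right mult.assoc)
      then show ?thesis
        by (simp add: fourier_coeff_sum L2_circle_integrable L2_circle_powi_mult FL fourier_coeff_powi_mult Fc)
    qed
    have iDF: "integrable circle_measure (\<lambda>z. D (int k) z * F z)" by (rule L2_circle_mult_integrable[OF DL FL])
    have "of_real \<omega> * fourier_coeff y (int k) = fourier_coeff (\<lambda>z. of_real \<omega> * y z + 0 * y z) (int k)"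
      by (subst fourier_coeff_lincomb) (auto intro: L2_circle_integrable yL)
    also have "\<dots> = fourier_coeff (\<lambda>z. 1 * (D (int k) z * F z) + 1 * (S (int k) z * F z)) (int k)"
    proof (rule fourier_coeff_cong_AE)
      show "AE z in circle_measure. of_real \<omega> * y z + 0 * y z = 1 * (D (int k) z * F z) + 1 * (S (int k) z * F z)"
        using uF by eventually_elim (simp add: D_def algebra_simps)
      show "(\<lambda>z. of_real \<omega> * y z + 0 * y z) \<in> borel_measurable circle_measure"
        using L2_circleD(1)[OF yL] by measurable
      show "(\<lambda>z. 1 * (D (int k) z * F z) + 1 * (S (int k) z * F z)) \<in> borel_measurable circle_measure"
        using borel_measurable_integrable[OF iDF] L2_circleD(1)[OF SF] by measurable
    qed
    also have "\<dots> = fourier_coeff (\<lambda>z. D (int k) z * F z) (int k)"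
      unfolding fourier_coeff_lincomb[OF iDF L2_circle_integrable[OF SF]] SF0 by simp
    also have "\<dots> = (\<integral>z. D (int k) z * (z powi (- int k) * F z) \<partial>circle_measure)"
      by (simp add: fourier_coeff_def mult_ac)
    finally have "(cmod (of_real \<omega> * fourier_coeff y (int k)))\<^sup>2 \<le>
      (\<integral>z. (cmod (D (int k) z))\<^sup>2 \<partial>circle_measure) * (\<integral>z. (cmod (z powi (- int k) * F z))\<^sup>2 \<partial>circle_measure)"
      using cauchy_schwarz_circle[OF DL L2_circle_powi_mult[OF FL]] by simp
    also have "(\<integral>z. (cmod (z powi (- int k) * F z))\<^sup>2 \<partial>circle_measure) = \<omega> * Y"
      unfolding F_norm[symmetric] by (intro Bochner_Integration.integral_cong) (auto simp: norm_mult norm_power_int)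
    finally have "\<omega>\<^sup>2 * (cmod (fourier_coeff y (int k)))\<^sup>2 \<le> B.tail (Suc k) * (\<omega> * Y)"
      by (simp add: D_norm norm_mult power_mult_distrib)
    then have "\<omega> * (\<omega> * (cmod (fourier_coeff y (int k)))\<^sup>2) \<le> \<omega> * (B.tail (Suc k) * Y)"
      by (simp add: power2_eq_square mult_ac)
    then have "\<omega> * (cmod (fourier_coeff y (int k)))\<^sup>2 \<le> B.tail (Suc k) * Y"
      using \<omega> by (simp only: mult_le_cancel_left_pos)
    then show ?thesis using \<omega> by (simp add: field_simps)
  qed
  \<comment> \<open>The first \<open>N\<close> coefficients of \<open>y\<close> vanish, so
    \<open>Y\<close> is the sum of the others. Their bounds add up to less than \<open>Y\<close>
    unless \<open>Y = 0\<close>.\<close>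
  have Y_zero: "Y = 0"
  proof -
    have ysums: "(\<lambda>k. (cmod (fourier_coeff y (int k)))\<^sup>2) sums Y"
      using has_sum_imp_sums[OF nat_sum[OF parseval_has_sum[OF yL y_bd] y_neg]] by (simp add: Y_def)
    have "(\<Sum>k<N. (cmod (fourier_coeff y (int k)))\<^sup>2) = 0"
      using x(2) by (intro sum.neutral) (auto simp: y_pos)
    then have ysums': "(\<lambda>k. (cmod (fourier_coeff y (int (k + N))))\<^sup>2) sums Y"
      using sums_split_initial_segment[OF ysums, of N] by simp
    have ts: "summable (\<lambda>k. B.tail (Suc (k + N)))"
      using summable_ignore_initial_segment[OF tail_s, of N] by simp
    have "Y = (\<Sum>k. (cmod (fourier_coeff y (int (k + N))))\<^sup>2)" using ysums' by (simp add: sums_iff)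
    also have "\<dots> \<le> (\<Sum>k. (Y / \<omega>) * B.tail (Suc (k + N)))"
    proof (rule suminf_le)
      show "(cmod (fourier_coeff y (int (k + N))))\<^sup>2 \<le> (Y / \<omega>) * B.tail (Suc (k + N))" for k
        by (rule bound)
      show "summable (\<lambda>k. (cmod (fourier_coeff y (int (k + N))))\<^sup>2)" by (rule sums_summable[OF ysums'])
      show "summable (\<lambda>k. (Y / \<omega>) * B.tail (Suc (k + N)))" by (rule summable_mult[OF ts])
    qed
    also have "\<dots> = (Y / \<omega>) * (\<Sum>k. B.tail (Suc (k + N)))" by (rule suminf_mult[OF ts])
    finally have le: "Y \<le> (Y / \<omega>) * (\<Sum>k. B.tail (Suc (k + N)))" .
    show ?thesis
    proof (rule ccontr)
      assume "Y \<noteq> 0"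
      then have "Y / \<omega> > 0" using Y0 \<omega> by simp
      then have "(Y / \<omega>) * (\<Sum>k. B.tail (Suc (k + N))) < (Y / \<omega>) * \<omega>" using N by (intro mult_strict_left_mono)
      then show False using le \<omega> by simp
    qed
  qed
  have rec: "(\<Sum>j\<le>N. x j * a (k + j + 1)) = 0" for k
    using bound[of k] unfolding Y_zero y_pos by simp
  \<comment> \<open>The coefficients appear in reverse order, so that in \<open>Q * u\<close> the
    recurrence \<open>rec\<close> becomes the vanishing of all coefficients above
    \<open>N\<close>.\<close>
  define Q where "Q = (\<Sum>j\<le>N. Polynomial.monom (x j) (N - j))"
  define W where "W = (\<lambda>z. poly Q z * u z)"
  have Q_poly: "poly Q z = (\<Sum>j\<le>N. x j * z ^ (N - j))" for z
    by (simp add: Q_def poly_sum poly_monom)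
  obtain j0 where j0: "j0 \<le> N" "x j0 \<noteq> 0" using x(1) by auto
  have "coeff Q (N - j0) = (\<Sum>j\<le>N. if j = j0 then x j else 0)"
    unfolding Q_def coeff_sum coeff_monom using j0(1) by (intro sum.cong) auto
  then have Q0: "Q \<noteq> 0" using j0 by auto
  have W_eq: "W = (\<lambda>z. \<Sum>j\<le>N. x j * (z powi int (N - j) * u z))"
    by (simp only: W_def Q_poly sum_distrib_right mult.assoc power_int_of_nat)
  have W_coeff: "fourier_coeff W n = (\<Sum>j\<le>N. x j * fourier_coeff u (n - int (N - j)))" for n
    unfolding W_eq
  proof (subst fourier_coeff_sum)
    show "integrable circle_measure (\<lambda>z. z powi int (N - j) * u z)" for j
      by (intro L2_circle_integrable L2_circle_powi_mult uL)
  qed (simp only: fourier_coeff_powi_mult)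
  have W_high: "fourier_coeff W n = 0" if "n > int N" for n
  proof -
    define k where "k = nat (n - int N - 1)"
    have "fourier_coeff u (n - int (N - j)) = a (k + j + 1)" if "j \<le> N" for j
      unfolding a_def using \<open>n > int N\<close> that by (intro arg_cong[where f = "fourier_coeff u"]) (simp add: k_def)
    then have "fourier_coeff W n = (\<Sum>j\<le>N. x j * a (k + j + 1))" unfolding W_coeff by (intro sum.cong) auto
    then show ?thesis by (simp only: rec)
  qed
  have W_low: "fourier_coeff W n = 0" if "n < 0" for n
    unfolding W_coeff using that uneg by (intro sum.neutral) auto
  have Qc: "continuous_on (sphere 0 1) (poly Q)" by (intro continuous_intros)
  have WL: "W \<in> L2_circle"
  proof -
    obtain BQ where "\<And>z. norm z = 1 \<Longrightarrow> norm (poly Q z) \<le> BQ" using bounded_on_circle[OF Qc] by blast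
    then show ?thesis unfolding W_def by (intro L2_circle_mult_bounded[OF uL continuous_borel_measurable_circle[OF Qc]])
  qed
  define T where "T = trig_sum {0..int N} (fourier_coeff W)"
  have TL: "T \<in> L2_circle" unfolding T_def by (intro L2_circle_continuous trig_sum_continuous)
  have "AE z in circle_measure. 1 * W z + (- 1) * T z = 0"
  proof (rule complex_L1_unique)
    show "integrable circle_measure (\<lambda>z. 1 * W z + - 1 * T z)"
      using L2_circle_integrable[OF WL] L2_circle_integrable[OF TL] by simp
    show "fourier_coeff (\<lambda>z. 1 * W z + - 1 * T z) k = 0" for k
      unfolding fourier_coeff_lincomb[OF L2_circle_integrable[OF WL] L2_circle_integrable[OF TL]]
      using W_high[of k] W_low[of k] by (auto simp: T_def fourier_coeff_trig_sum not_le)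
  qed
  moreover define P where "P = (\<Sum>n\<le>N. Polynomial.monom (fourier_coeff W (int n)) n)"
  have "T z = poly P z" for z
    unfolding T_def trig_sum_def P_def poly_sum poly_monom
    by (rule sum.reindex_bij_witness[of _ int nat]) (auto simp: power_int_def)
  ultimately have "AE z in circle_measure. poly Q z * u z = poly P z"
    by (auto simp: W_def elim!: eventually_mono)
  then show ?thesis using that[OF Q0] by blast
qed

section \<open>Rational functions of constant modulus\<close>

lemma fourier_coeff_poly: "fourier_coeff (poly P) k = (if k \<ge> 0 then coeff P (nat k) else 0)"
proof -
  have "poly P = (\<lambda>z. \<Sum>n\<le>degree P. coeff P n * z powi int n)"
    by (simp add: poly_altdef fun_eq_iff)
  then have "fourier_coeff (poly P) k = (\<Sum>n\<le>degree P. coeff P n * (if int n = k then 1 else 0))"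
    by (simp only: fourier_coeff_monomial[symmetric])
       (intro fourier_coeff_sum integrable_continuous_circle continuous_on_powi_circle)
  also have "\<dots> = (\<Sum>n\<le>degree P. if k \<ge> 0 \<and> n = nat k then coeff P n else 0)"
    by (intro sum.cong) auto
  also have "\<dots> = (if k \<ge> 0 then coeff P (nat k) else 0)"
    by (cases "k \<ge> 0") (auto simp: coeff_eq_0 not_le)
  finally show ?thesis .
qed

lemma poly_mult_L2_plus:
  assumes u: "u \<in> L2_plus" shows "(\<lambda>z. poly Q z * u z) \<in> L2_plus"
proof -
  have Qc: "continuous_on (sphere 0 1) (poly Q)" by (intro continuous_intros)
  obtain B where "\<And>z. norm z = 1 \<Longrightarrow> norm (poly Q z) \<le> B" using bounded_on_circle[OF Qc] by blast
  then have L: "(\<lambda>z. poly Q z * u z) \<in> L2_circle"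
    by (intro L2_circle_mult_bounded[OF L2_plusD(1)[OF u] continuous_borel_measurable_circle[OF Qc]])
  have "(\<lambda>z. poly Q z * u z) = (\<lambda>z. \<Sum>n\<le>degree Q. coeff Q n * (z ^ n * u z))"
    by (simp add: poly_altdef sum_distrib_right mult.assoc)
  then have "fourier_coeff (\<lambda>z. poly Q z * u z) k = (\<Sum>n\<le>degree Q. coeff Q n * fourier_coeff (\<lambda>z. z ^ n * u z) k)" for k
    by (simp add: fourier_coeff_sum L2_circle_integrable L2_plusD(1) L2_plus_power_mult[OF u])
  then show ?thesis
    using L L2_plusD(2)[OF L2_plus_power_mult[OF u]] by (simp add: L2_plus_def)
qed

lemma fourier_coeff_tendsto_0:
  assumes "f \<in> L2_circle" shows "(\<lambda>n. fourier_coeff f (int n)) \<longlonglongrightarrow> 0"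
proof -
  have "summable (\<lambda>n. (cmod (fourier_coeff f (int n)))\<^sup>2)"
    by (intro summable_on_imp_summable summable_on_int_nat bessel_summable assms)
  then have "(\<lambda>n. (cmod (fourier_coeff f (int n)))\<^sup>2) \<longlonglongrightarrow> 0" by (rule summable_LIMSEQ_zero)
  then have "(\<lambda>n. sqrt ((cmod (fourier_coeff f (int n)))\<^sup>2)) \<longlonglongrightarrow> sqrt 0" by (intro tendsto_real_sqrt)
  then show ?thesis by (simp add: tendsto_norm_zero_iff)
qed

lemma fourier_coeff_linear_factor:
  assumes f: "f \<in> L2_circle"
  shows "fourier_coeff (\<lambda>z. (z - b) * f z) n = fourier_coeff f (n - 1) - b * fourier_coeff f n"
proof -
  have "(\<lambda>z. (z - b) * f z) = (\<lambda>z. 1 * (z powi 1 * f z) + (- b) * f z)" by (simp add: algebra_simps)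
  then show ?thesis
    using fourier_coeff_lincomb[OF L2_circle_integrable[OF L2_circle_powi_mult[OF f, of 1]] L2_circle_integrable[OF f], of 1 "- b" n]
    unfolding fourier_coeff_powi_mult by simp
qed

text \<open>
  A linear factor with zero in the closed disc can be cancelled: the recursion for the Fourier
  coefficients telescopes, and Fourier coefficients tend to zero.
\<close>

lemma cancel_linear_factor:
  assumes f: "f \<in> L2_plus" and b: "norm b \<le> 1"
    and eq: "AE z in circle_measure. (z - b) * f z = poly P z"
  obtains P1 where "AE z in circle_measure. f z = poly P1 z"
proof -
  note fL = L2_plusD(1)[OF f]
  have linL: "(\<lambda>z. (z - b) * g z) \<in> L2_circle" if g: "g \<in> L2_circle" for g
  proof -
    have c: "continuous_on (sphere 0 1) (\<lambda>z. z - b)" by (intro continuous_intros)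
    obtain B where "\<And>z. norm z = 1 \<Longrightarrow> norm (z - b) \<le> B" using bounded_on_circle[OF c] by blast
    then show ?thesis by (intro L2_circle_mult_bounded[OF g continuous_borel_measurable_circle[OF c]])
  qed
  have pm: "poly R \<in> borel_measurable circle_measure" for R
    by (intro continuous_borel_measurable_circle continuous_intros)
  have rec: "coeff P n = fourier_coeff f (int n - 1) - b * fourier_coeff f (int n)" for n
    using fourier_coeff_cong_AE[OF eq L2_circleD(1)[OF linL[OF fL]] pm, of "int n"]
    by (simp add: fourier_coeff_linear_factor[OF fL] fourier_coeff_poly)
  \<comment> \<open>The telescoping starts without a boundary term because the coefficient of order
    \<open>-1\<close> is zero.\<close>
  have tel: "(\<Sum>n\<le>M. coeff P n * b ^ n) = - (b ^ Suc M * fourier_coeff f (int M))" for M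
  proof (induction M)
    case 0
    then show ?case using L2_plusD(2)[OF f, of "-1"] by (simp add: rec)
  qed (simp add: rec algebra_simps)
  have "norm (poly P b) \<le> norm (fourier_coeff f (int M))" if "M \<ge> degree P" for M
  proof -
    have "poly P b = (\<Sum>n\<le>M. coeff P n * b ^ n)"
      unfolding poly_altdef by (rule sum.mono_neutral_left) (use that in \<open>auto simp: coeff_eq_0\<close>)
    then have "norm (poly P b) = norm b ^ Suc M * norm (fourier_coeff f (int M))"
      unfolding tel by (simp add: norm_mult norm_power)
    also have "\<dots> \<le> 1 * norm (fourier_coeff f (int M))"
      by (intro mult_right_mono power_le_one b) auto
    finally show ?thesis by simp
  qed
  then have "norm (poly P b) \<le> norm (0::complex)"
    by (intro LIMSEQ_le_const[OF tendsto_norm[OF fourier_coeff_tendsto_0[OF fL]]]) blast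
  then have "poly P b = 0" by simp
  then obtain P1 where P1: "P = [:- b, 1:] * P1" by (metis poly_eq_0_iff_dvd dvdE)
  \<comment> \<open>The difference obeys the homogeneous recursion: the moduli of its coefficients
    are nondecreasing in the index and tend to 0, so all of them vanish.\<close>
  define G where "G = (\<lambda>z. 1 * f z + (- 1) * poly P1 z)"
  have P1L: "poly P1 \<in> L2_circle" by (intro L2_circle_continuous continuous_intros)
  have GL: "G \<in> L2_circle" unfolding G_def by (intro L2_circle_add L2_circle_cmult fL P1L)
  have "AE z in circle_measure. (z - b) * G z = 0"
    using eq by eventually_elim (simp add: G_def P1 algebra_simps)
  then have "fourier_coeff (\<lambda>z. (z - b) * G z) n = fourier_coeff (\<lambda>z. 0) n" for n
    by (intro fourier_coeff_cong_AE L2_circleD(1)[OF linL[OF GL]]) auto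
  then have Grec: "fourier_coeff G (n - 1) = b * fourier_coeff G n" for n
    unfolding fourier_coeff_linear_factor[OF GL] by (simp add: fourier_coeff_def)
  have Gmono: "norm (fourier_coeff G n) \<le> norm (fourier_coeff G (n + int m))" for n m
  proof (induction m)
    case (Suc m)
    have "norm (fourier_coeff G (n + int m)) = norm b * norm (fourier_coeff G (n + int (Suc m)))"
      using Grec[of "n + int (Suc m)"] by (simp add: norm_mult)
    also have "\<dots> \<le> 1 * norm (fourier_coeff G (n + int (Suc m)))" by (intro mult_right_mono b) auto
    finally show ?case using Suc by simp
  qed simp
  have "fourier_coeff G n = 0" for n
  proof -
    have "norm (fourier_coeff G n) \<le> norm (0::complex)"
    proof (rule LIMSEQ_le_const[OF tendsto_norm[OF fourier_coeff_tendsto_0[OF GL]]], intro exI allI impI)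
      fix M assume "M \<ge> nat (max n 0)"
      then show "norm (fourier_coeff G n) \<le> norm (fourier_coeff G (int M))"
        using Gmono[of n "nat (int M - n)"] by (simp split: if_splits)
    qed
    then show ?thesis by simp
  qed
  then have "AE z in circle_measure. G z = 0"
    by (intro complex_L1_unique L2_circle_integrable GL)
  then have "AE z in circle_measure. f z = poly P1 z"
    by eventually_elim (simp add: G_def)
  then show ?thesis by (rule that)
qed

text \<open>A denominator of least degree cannot have a zero in the closed disc, since
  \<open>cancel_linear_factor\<close> would remove it.\<close>

lemma rational_without_poles:
  fixes P0 Q0 :: "complex poly"
  assumes u: "u \<in> L2_plus" and Q0: "Q0 \<noteq> 0" and eq: "AE z in circle_measure. poly Q0 z * u z = poly P0 z"
  obtains P Q where "AE z in circle_measure. poly Q z * u z = poly P z" "\<And>z. norm z \<le> 1 \<Longrightarrow> poly Q z \<noteq> 0"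
proof -
  define good where "good = (\<lambda>Q. Q \<noteq> 0 \<and> (\<exists>P. AE z in circle_measure. poly Q z * u z = poly P z))"
  have "good Q0" using Q0 eq by (auto simp: good_def)
  then obtain Q where Q: "good Q" and min: "\<And>R. good R \<Longrightarrow> degree Q \<le> degree R"
    using ex_has_least_nat[of good Q0 degree] by blast
  obtain P where P: "AE z in circle_measure. poly Q z * u z = poly P z" and Qnz: "Q \<noteq> 0"
    using Q by (auto simp: good_def)
  have "poly Q b \<noteq> 0" if b: "norm b \<le> 1" for b
  proof
    assume "poly Q b = 0"
    then obtain Q1 where Q1: "Q = [:- b, 1:] * Q1" by (metis poly_eq_0_iff_dvd dvdE)
    then have Q1nz: "Q1 \<noteq> 0" using Qnz by auto
    have "degree Q = degree [:- b, 1:] + degree Q1"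
      unfolding Q1 by (rule degree_mult_eq) (use Q1nz in auto)
    then have deg: "degree Q = Suc (degree Q1)" by simp
    have "AE z in circle_measure. (z - b) * (poly Q1 z * u z) = poly P z"
      using P by eventually_elim (simp add: Q1 algebra_simps)
    from cancel_linear_factor[OF poly_mult_L2_plus[OF u] b this]
    obtain P1 where "AE z in circle_measure. poly Q1 z * u z = poly P1 z" by blast
    then have "good Q1" using Q1nz by (auto simp: good_def)
    then show False using min[of Q1] deg by simp
  qed
  then show ?thesis using that P by blast
qed

lemma trig_poly_sum:
  assumes "finite A" "\<And>i. i \<in> A \<Longrightarrow> trig_poly (f i)" shows "trig_poly (\<lambda>z. \<Sum>i\<in>A. f i z)"
  using assms by (induction A rule: finite_induct) (auto intro: trig_poly_const trig_poly.add)

lemma trig_poly_poly: "trig_poly (poly P)"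
proof -
  have *: "poly P = (\<lambda>z. \<Sum>n\<le>degree P. coeff P n * z powi int n)"
    by (simp add: poly_altdef fun_eq_iff)
  show ?thesis unfolding * by (intro trig_poly_sum trig_poly.monom) auto
qed

lemma trig_poly_cnj:
  assumes "trig_poly f" shows "\<exists>h. trig_poly h \<and> (\<forall>z\<in>sphere 0 1. h z = cnj (f z))"
  using assms
proof (induction rule: trig_poly.induct)
  case (monom c k)
  have "\<forall>z\<in>sphere 0 1. cnj c * z powi (- k) = cnj (c * z powi k)"
    using cnj_powi_circle[of _ k] by (simp only: complex_cnj_mult) auto
  then show ?case using trig_poly.monom by blast
next
  case (add f g)
  then obtain h1 h2 where h: "trig_poly h1" "\<forall>z\<in>sphere 0 1. h1 z = cnj (f z)"
     "trig_poly h2" "\<forall>z\<in>sphere 0 1. h2 z = cnj (g z)" by blast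
  then show ?case by (intro exI[of _ "\<lambda>z. h1 z + h2 z"]) (simp add: trig_poly.add)
qed

lemma trig_poly_AE_zero:
  assumes f: "trig_poly f" and z: "AE z in circle_measure. f z = 0" and w: "norm w = 1" shows "f w = 0"
proof -
  obtain F c where F: "finite F" "\<forall>z\<in>sphere 0 1. f z = trig_sum F c z"
    using trig_poly_trig_sum[OF f] by blast
  have "AE z in circle_measure. trig_sum F c z = 0"
    using z AE_space by eventually_elim (use F in auto)
  then have "fourier_coeff (trig_sum F c) k = fourier_coeff (\<lambda>_. 0) k" for k
    by (intro fourier_coeff_cong_AE continuous_borel_measurable_circle trig_sum_continuous) auto
  then have "c k = 0" if "k \<in> F" for k
    using fourier_coeff_trig_sum[OF F(1), of c k] that by (simp add: fourier_coeff_def)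
  then have "trig_sum F c w = 0" by (simp add: trig_sum_def)
  then show ?thesis using F(2) w by simp
qed

text \<open>On the circle both sides are trigonometric polynomials, so equality almost everywhere is
  equality at every point; the maximum principle needs all boundary points.\<close>

lemma constant_modulus_everywhere:
  fixes P Q :: "complex poly"
  assumes eq: "AE z in circle_measure. poly Q z * u z = poly P z"
    and mod: "AE z in circle_measure. (cmod (u z))\<^sup>2 = \<omega>" and w: "norm w = 1"
  shows "(cmod (poly P w))\<^sup>2 = \<omega> * (cmod (poly Q w))\<^sup>2"
proof -
  have sq: "\<exists>h. trig_poly h \<and> (\<forall>z\<in>sphere 0 1. h z = of_real ((cmod (poly R z))\<^sup>2))" for R :: "complex poly"
  proof -
    obtain h1 where h1: "trig_poly h1" "\<forall>z\<in>sphere 0 1. h1 z = cnj (poly R z)"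
      using trig_poly_cnj[OF trig_poly_poly] by blast
    obtain h where "trig_poly h" "\<forall>z\<in>sphere 0 1. h z = poly R z * h1 z"
      using trig_poly_mult[OF trig_poly_poly h1(1)] by blast
    then show ?thesis using h1(2) by (intro exI[of _ h]) (simp only: complex_norm_square, simp)
  qed
  obtain hP where hP: "trig_poly hP" "\<forall>z\<in>sphere 0 1. hP z = of_real ((cmod (poly P z))\<^sup>2)" using sq by blast
  obtain hQ where hQ: "trig_poly hQ" "\<forall>z\<in>sphere 0 1. hQ z = of_real ((cmod (poly Q z))\<^sup>2)" using sq by blast
  have t: "trig_poly (\<lambda>z. hP z + (- of_real \<omega>) * hQ z)"
    by (intro trig_poly.add trig_poly_cmult hP hQ)
  have "AE z in circle_measure. hP z + (- of_real \<omega>) * hQ z = 0"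
    using eq mod AE_space
  proof eventually_elim
    case (elim z)
    have "(cmod (poly P z))\<^sup>2 = \<omega> * (cmod (poly Q z))\<^sup>2"
      unfolding elim(1)[symmetric] by (simp add: norm_mult power_mult_distrib elim(2))
    then have "complex_of_real ((cmod (poly P z))\<^sup>2) = of_real \<omega> * of_real ((cmod (poly Q z))\<^sup>2)"
      by (simp only: of_real_mult)
    then show ?case using hP(2) hQ(2) elim(3) by (simp del: of_real_power)
  qed
  from trig_poly_AE_zero[OF t this w] have "complex_of_real ((cmod (poly P w))\<^sup>2) = of_real (\<omega> * (cmod (poly Q w))\<^sup>2)"
    using hP(2) hQ(2) w by simp
  then show ?thesis using of_real_eq_iff by blast
qed

text \<open>Zeros on the circle stay in \<open>P2\<close>; the application excludes them through the
  modulus, which is positive there.\<close>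

lemma factor_roots_in_disc:
  fixes P :: "complex poly"
  assumes "P \<noteq> 0"
  shows "\<exists>(n::nat) r P2. P = (\<Prod>j=1..n. [:- r j, 1:]) * P2 \<and> (\<forall>j\<in>{1..n}. norm (r j) < 1) \<and> (\<forall>z. norm z < 1 \<longrightarrow> poly P2 z \<noteq> 0)"
  using assms
proof (induction "degree P" arbitrary: P rule: less_induct)
  case less
  show ?case
  proof (cases "\<exists>b. norm b < 1 \<and> poly P b = 0")
    case False
    then show ?thesis by (intro exI[of _ 0] exI[of _ "\<lambda>_. 0"] exI[of _ P]) auto
  next
    case True
    then obtain b where b: "norm b < 1" "poly P b = 0" by blast
    then obtain P1 where P1: "P = [:- b, 1:] * P1" by (metis poly_eq_0_iff_dvd dvdE)
    then have P1nz: "P1 \<noteq> 0" using less.prems by auto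
    have "degree P = degree [:- b, 1:] + degree P1"
      unfolding P1 by (rule degree_mult_eq) (use P1nz in auto)
    then have deg: "degree P = Suc (degree P1)" by simp
    obtain n :: nat and r P2 where IH: "P1 = (\<Prod>j=1..n. [:- r j, 1:]) * P2" "\<forall>j\<in>{1..n}. norm (r j) < 1" "\<forall>z. norm z < 1 \<longrightarrow> poly P2 z \<noteq> 0"
      using less.hyps[OF _ P1nz] deg by auto
    define r' where "r' = r(Suc n := b)"
    have "(\<Prod>j=1..Suc n. [:- r' j, 1:]) = (\<Prod>j=1..n. [:- r' j, 1:]) * [:- b, 1:]"
      by (simp add: r'_def)
    also have "(\<Prod>j=1..n. [:- r' j, 1:]) = (\<Prod>j=1..n. [:- r j, 1:])"
      by (intro prod.cong) (auto simp: r'_def)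
    finally have "P = (\<Prod>j=1..Suc n. [:- r' j, 1:]) * P2"
      unfolding P1 IH(1) by (simp only: mult_ac)
    moreover have "\<forall>j\<in>{1..Suc n}. norm (r' j) < 1" using IH(2) b by (auto simp: r'_def)
    ultimately show ?thesis using IH(3) by blast
  qed
qed

lemma norm_blaschke_factor:
  assumes "norm z = 1" shows "norm (z - r) = norm (1 - cnj r * z)"
proof -
  have "1 - cnj r * z = z * cnj (z - r)"
    using complex_norm_square[of z] assms by (simp add: algebra_simps)
  then show ?thesis using assms by (simp add: norm_mult flip: complex_cnj_diff)
qed

lemma one_minus_nonzero:
  assumes "norm p < 1" "norm z \<le> 1" shows "1 - p * z \<noteq> (0::complex)"
proof
  assume "1 - p * z = 0"
  then have "norm p * norm z = 1" by (metis eq_iff_diff_eq_0 norm_mult norm_one)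
  moreover have "norm p * norm z \<le> norm p * 1" using assms by (intro mult_left_mono) auto
  ultimately show False using assms by simp
qed

text \<open>
  Dividing out the Blaschke factors of the zeros in the disc leaves a zero-free function of constant
  modulus on the circle, which is constant by the maximum principle.
\<close>

proposition constant_modulus_blaschke:
  fixes P Q :: "complex poly"
  assumes mod: "\<And>z. norm z = 1 \<Longrightarrow> (cmod (poly P z))\<^sup>2 = \<omega> * (cmod (poly Q z))\<^sup>2" and \<omega>: "\<omega> > 0"
    and Q: "\<And>z. norm z \<le> 1 \<Longrightarrow> poly Q z \<noteq> 0"
  obtains \<alpha> and n :: nat and p where "\<forall>j\<in>{1..n}. cmod (p j) < 1"
    "\<And>z. norm z = 1 \<Longrightarrow> poly P z / poly Q z = \<alpha> * (\<Prod>j=1..n. (z - cnj (p j)) / (1 - p j * z))"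
proof -
  have Pc: "poly P z \<noteq> 0" if "norm z = 1" for z
    using mod[OF that] \<omega> Q[of z] that by auto
  have "poly P 1 \<noteq> 0" by (rule Pc) simp
  then have "P \<noteq> 0" by auto
  then obtain n :: nat and r P2 where P: "P = (\<Prod>j=1..n. [:- r j, 1:]) * P2" and r: "\<forall>j\<in>{1..n}. norm (r j) < 1"
    and P2: "\<forall>z. norm z < 1 \<longrightarrow> poly P2 z \<noteq> 0"
    using factor_roots_in_disc by blast
  have Pz: "poly P z = (\<Prod>j=1..n. z - r j) * poly P2 z" for z
    by (simp add: P poly_prod)
  define p where "p = (\<lambda>j. cnj (r j))"
  have p: "\<forall>j\<in>{1..n}. cmod (p j) < 1" using r by (simp add: p_def)
  define h where "h = (\<lambda>z. poly P2 z * (\<Prod>j=1..n. 1 - p j * z) / poly Q z)"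
  have den: "(\<Prod>j=1..n. 1 - p j * z) \<noteq> 0" if "norm z \<le> 1" for z
    using one_minus_nonzero[OF _ that] p by (simp add: prod_zero_iff)
  have h_nz: "h z \<noteq> 0" if "norm z \<le> 1" for z
  proof -
    have "poly P2 z \<noteq> 0" using P2 Pc[of z] Pz[of z] that by (cases "norm z = 1") auto
    then show ?thesis using den[OF that] Q[OF that] by (simp add: h_def)
  qed
  have h_cont: "continuous_on (cball 0 1) h"
    unfolding h_def by (intro continuous_intros) (use Q in auto)
  have h_hol: "h holomorphic_on ball 0 1"
    unfolding h_def by (intro holomorphic_intros) (use Q in auto)
  have h_mod: "norm (h z) = sqrt \<omega>" if z: "norm z = 1" for z
  proof -
    have "norm (\<Prod>j=1..n. 1 - p j * z) = norm (\<Prod>j=1..n. z - r j)"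
      using norm_blaschke_factor[OF z] by (simp add: p_def prod_norm[symmetric])
    then have "norm (h z) = norm (poly P z) / norm (poly Q z)"
      by (simp add: h_def Pz norm_mult norm_divide)
    moreover have "norm (poly P z) = sqrt \<omega> * norm (poly Q z)"
      using mod[OF z] \<omega> by (metis abs_norm_cancel real_sqrt_abs real_sqrt_mult)
    ultimately show ?thesis using Q[of z] z by simp
  qed
  have up: "norm (h z) \<le> sqrt \<omega>" if "z \<in> ball 0 1" for z
    by (rule maximum_modulus_frontier[of h "ball 0 1"]) (use h_hol h_cont h_mod that in auto)
  \<comment> \<open>The maximum principle for \<open>1 / h\<close> bounds the modulus from below.
    With the upper bound it is constant inside, so an interior maximum is attained.\<close>
  have low: "norm (inverse (h z)) \<le> inverse (sqrt \<omega>)" if "z \<in> ball 0 1" for z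
  proof (rule maximum_modulus_frontier[of "\<lambda>z. inverse (h z)" "ball 0 1"])
    show "(\<lambda>z. inverse (h z)) holomorphic_on interior (ball 0 1)"
      using h_hol h_nz by (auto intro!: holomorphic_intros)
    show "continuous_on (closure (ball 0 1)) (\<lambda>z. inverse (h z))"
      using h_cont h_nz by (auto intro!: continuous_intros)
  qed (use h_mod that in \<open>auto simp: norm_inverse\<close>)
  have h_const_mod: "norm (h z) = sqrt \<omega>" if "z \<in> ball 0 1" for z
  proof -
    have "sqrt \<omega> \<le> norm (h z)"
      using low[OF that] h_nz[of z] \<omega> that by (simp add: norm_inverse)
    then show ?thesis using up[OF that] by simp
  qed
  have "h constant_on ball 0 1"
    by (rule maximum_modulus_principle[OF h_hol, where U = "ball 0 1" and \<xi> = 0]) (use h_const_mod in auto)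
  then obtain \<alpha> where \<alpha>: "\<And>z. z \<in> ball 0 1 \<Longrightarrow> h z = \<alpha>" by (auto simp: constant_on_def)
  have \<alpha>c: "h z = \<alpha>" if "z \<in> cball 0 1" for z
    by (rule continuous_constant_on_closure[of "ball 0 1" h]) (use h_cont \<alpha> that in auto)
  have "poly P z / poly Q z = \<alpha> * (\<Prod>j=1..n. (z - cnj (p j)) / (1 - p j * z))" if z: "norm z = 1" for z
  proof -
    have "poly P2 z * (\<Prod>j=1..n. 1 - p j * z) / poly Q z = \<alpha>" using \<alpha>c[of z] z by (simp add: h_def)
    then have "poly P2 z / poly Q z = \<alpha> / (\<Prod>j=1..n. 1 - p j * z)"
      using den[of z] z by (simp add: field_simps)
    then have "poly P z / poly Q z = (\<Prod>j=1..n. z - r j) * (\<alpha> / (\<Prod>j=1..n. 1 - p j * z))"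
      unfolding Pz times_divide_eq_right[symmetric] by (simp only:)
    then show ?thesis by (simp add: p_def prod_dividef)
  qed
  then show ?thesis using that[OF p] by blast
qed

text \<open>The last alternative is the Blaschke product without factors; it also covers the zero
  function.\<close>

theorem traveling_wave_datum_zero_velocity:
  assumes tw: "traveling_wave_datum 0 u0"
  shows "(\<exists>\<alpha> (N::nat) p. N \<ge> 1 \<and> (\<forall>j\<in>{1..N}. cmod (p j) < 1) \<and>
            (AE z in circle_measure. u0 z = \<alpha> * (\<Prod>j=1..N. (z - cnj (p j)) / (1 - p j * z))))
        \<or> (\<exists>\<alpha>. AE z in circle_measure. u0 z = \<alpha>)"
proof -
  obtain \<omega> g where u0: "u0 \<in> H_half_plus" and proj: "szego_projection (\<lambda>z. complex_of_real ((cmod (u0 z))\<^sup>2) * u0 z) g"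
    and coeff0: "\<And>k. fourier_coeff g k = (of_real \<omega> + of_real 0 * of_int k) * fourier_coeff u0 k"
    using stationary_equation[OF tw] by blast
  have coeff: "fourier_coeff g k = of_real \<omega> * fourier_coeff u0 k" for k using coeff0[of k] by simp
  have u: "u0 \<in> L2_plus" by (rule H_half_plus_L2_plus[OF u0])
  note uL = L2_plusD(1)[OF u]
  have val: "AE z in circle_measure. ((cmod (u0 z))\<^sup>2 - \<omega>) * (cmod (u0 z))\<^sup>2 = 0"
    by (rule stationary_modulus_values[OF u proj coeff])
  show ?thesis
  proof (cases "\<forall>k. fourier_coeff u0 k = 0")
    case True
    then have "AE z in circle_measure. u0 z = 0"
      by (intro complex_L1_unique L2_circle_integrable uL) auto
    then show ?thesis by blast
  next
    case False
    then obtain k where "fourier_coeff u0 k \<noteq> 0" by blast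
    from L2_plus_nonzero_AE[OF u this] have nz: "AE z in circle_measure. u0 z \<noteq> 0" .
    have mod: "AE z in circle_measure. (cmod (u0 z))\<^sup>2 = \<omega>"
      using val nz by eventually_elim auto
    have \<omega>: "\<omega> > 0"
    proof (rule ccontr)
      assume "\<not> \<omega> > 0"
      have "AE z in circle_measure. False"
        using mod nz
      proof eventually_elim
        case (elim z)
        from elim(2) have "0 < (cmod (u0 z))\<^sup>2" by simp
        then show ?case using \<open>\<not> \<omega> > 0\<close> by (simp only: elim(1))
      qed
      then have "emeasure circle_measure (space circle_measure) = 0"
        unfolding ae_filter_eq_bot_iff[symmetric] eventually_False .
      then show False by (simp add: emeasure_circle_measure)
    qed
    have "(\<lambda>k::int. (1 + (real_of_int k)\<^sup>2) powr (1 / 2) * (cmod (fourier_coeff u0 k))\<^sup>2) summable_on UNIV"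
      using u0 by (simp add: H_half_plus_def sobolev_def)
    then have s: "(\<lambda>k::nat. (1 + (real_of_int (int k))\<^sup>2) powr (1 / 2) * (cmod (fourier_coeff u0 (int k)))\<^sup>2) summable_on UNIV"
      by (rule summable_on_int_nat)
    have sob: "(\<lambda>k. real k * (cmod (fourier_coeff u0 (int k)))\<^sup>2) summable_on UNIV"
    proof (rule summable_on_comparison_test[OF s])
      fix k :: nat
      have "real k = sqrt ((real k)\<^sup>2)" by simp
      also have "\<dots> \<le> sqrt (1 + (real k)\<^sup>2)" by (intro real_sqrt_le_mono) simp
      also have "\<dots> = (1 + (real_of_int (int k))\<^sup>2) powr (1 / 2)"
        by (simp add: powr_half_sqrt add_nonneg_nonneg)
      finally show "real k * (cmod (fourier_coeff u0 (int k)))\<^sup>2 \<le> (1 + (real_of_int (int k))\<^sup>2) powr (1 / 2) * (cmod (fourier_coeff u0 (int k)))\<^sup>2"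
        by (intro mult_right_mono) auto
    qed auto
    obtain P0 Q0 :: "complex poly" where PQ0: "Q0 \<noteq> 0" "AE z in circle_measure. poly Q0 z * u0 z = poly P0 z"
      by (rule constant_modulus_rational[OF u mod \<omega> sob], rule that)
    obtain P Q :: "complex poly" where PQ: "AE z in circle_measure. poly Q z * u0 z = poly P z" and Q: "\<And>z. norm z \<le> 1 \<Longrightarrow> poly Q z \<noteq> 0"
      by (rule rational_without_poles[OF u PQ0], rule that)
    obtain \<alpha> and n :: nat and p where p: "\<forall>j\<in>{1..n}. cmod (p j) < 1"
      and eq: "\<And>z. norm z = 1 \<Longrightarrow> poly P z / poly Q z = \<alpha> * (\<Prod>j=1..n. (z - cnj (p j)) / (1 - p j * z))"
      by (rule constant_modulus_blaschke[of P \<omega> Q], erule constant_modulus_everywhere[OF PQ mod],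
          rule \<omega>, erule Q, rule that)
    have form: "AE z in circle_measure. u0 z = \<alpha> * (\<Prod>j=1..n. (z - cnj (p j)) / (1 - p j * z))"
      using PQ AE_space
    proof eventually_elim
      case (elim z)
      then have z: "norm z = 1" by simp
      have "u0 z = poly P z / poly Q z" using elim(1) Q[of z] z by (simp add: field_simps)
      then show ?case using eq[OF z] by simp
    qed
    show ?thesis
    proof (cases "n \<ge> 1")
      case True
      then show ?thesis using p form by blast
    next
      case False
      then have "AE z in circle_measure. u0 z = \<alpha>" using form by simp
      then show ?thesis by blast
    qed
  qed
qed

section \<open>The converse direction\<close>

lemma norm_exp_imaginary [simp]: "cmod (exp (- \<i> * complex_of_real x * complex_of_real t)) = 1"
  by (simp add: norm_exp_eq_Re)

text \<open>Taylor remainders on the imaginary axis: the first serves continuity in time, the second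
  the time derivative.\<close>

lemma exp_imaginary_bounds:
  "cmod (exp (- \<i> * of_real x) - 1) \<le> \<bar>x\<bar>"
  "cmod (exp (- \<i> * of_real x) - 1 + \<i> * of_real x) \<le> x\<^sup>2"
  using Taylor_exp[of "- \<i> * of_real x" 0] Taylor_exp[of "- \<i> * of_real x" 1]
  by (simp_all add: norm_mult power2_eq_square algebra_simps)

lemma L2_circle_rotation:
  assumes w: "norm w = 1" and f: "f \<in> L2_circle" shows "(\<lambda>z. s * f (w * z)) \<in> L2_circle"
proof -
  have "(\<lambda>z. f (w * z)) \<in> L2_circle"
    unfolding L2_circle_def
    using measurable_compose[OF rotation_measurable[OF w] L2_circleD(1)[OF f]]
      integrable_rotation[OF w, of "\<lambda>z. (cmod (f z))\<^sup>2"] f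
    by (simp add: L2_circle_def)
  then show ?thesis by (rule L2_circle_cmult)
qed

lemma fourier_coeff_scaled_rotation:
  assumes w: "norm w = 1" and f: "f \<in> borel_measurable circle_measure"
  shows "fourier_coeff (\<lambda>z. s * f (w * z)) k = s * (w powi k * fourier_coeff f k)"
  unfolding fourier_coeff_rotation[OF assms, symmetric] by (simp add: fourier_coeff_def mult.assoc)

lemma L2_plus_rotation:
  assumes w: "norm w = 1" and f: "f \<in> L2_plus" shows "(\<lambda>z. s * f (w * z)) \<in> L2_plus"
  using L2_circle_rotation[OF w L2_plusD(1)[OF f]] L2_plusD(2)[OF f]
    fourier_coeff_scaled_rotation[OF w L2_circleD(1)[OF L2_plusD(1)[OF f]]]
  by (simp add: L2_plus_def)

lemma szego_projection_rotation:
  assumes fg: "szego_projection f g" and w: "norm w = 1"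
  shows "szego_projection (\<lambda>z. s * f (w * z)) (\<lambda>z. s * g (w * z))"
  unfolding szego_projection_def
proof (intro conjI ballI)
  have fL: "f \<in> L2_circle" and gP: "g \<in> L2_plus" and orth: "\<And>h. h \<in> L2_plus \<Longrightarrow> L2_inner (\<lambda>z. f z - g z) h = 0"
    using fg by (auto simp: szego_projection_def)
  show "(\<lambda>z. s * f (w * z)) \<in> L2_circle" by (rule L2_circle_rotation[OF w fL])
  show "(\<lambda>z. s * g (w * z)) \<in> L2_plus" by (rule L2_plus_rotation[OF w gP])
  fix h assume h: "h \<in> L2_plus"
  have w': "norm (cnj w) = 1" "cnj w * (w * z) = z" for z
    using w complex_norm_square[of w] by (auto simp: mult.assoc[symmetric] mult.commute)
  \<comment> \<open>The test function is rotated backwards, so that both factors of the inner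
    product can be rotated together.\<close>
  define h' where "h' = (\<lambda>z. h (cnj w * z))"
  have h'P: "h' \<in> L2_plus" using L2_plus_rotation[OF w'(1) h, of 1] by (simp add: h'_def)
  have "L2_inner (\<lambda>z. s * f (w * z) - s * g (w * z)) h = (\<integral>z. s * ((f (w * z) - g (w * z)) * cnj (h' (w * z))) \<partial>circle_measure)"
    unfolding L2_inner_def h'_def w'(2) by (simp add: algebra_simps)
  also have "\<dots> = s * (\<integral>z. (f (w * z) - g (w * z)) * cnj (h' (w * z)) \<partial>circle_measure)"
    by (rule Bochner_Integration.integral_mult_right_zero)
  also have "(\<integral>z. (f (w * z) - g (w * z)) * cnj (h' (w * z)) \<partial>circle_measure) = L2_inner (\<lambda>z. f z - g z) h'"
    unfolding L2_inner_def
  proof (rule integral_rotation[OF w])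
    show "(\<lambda>z. (f z - g z) * cnj (h' z)) \<in> borel_measurable circle_measure"
      using L2_circleD(1)[OF fL] L2_circleD(1)[OF L2_plusD(1)[OF gP]] L2_circleD(1)[OF L2_circle_cnj[OF L2_plusD(1)[OF h'P]]]
      by measurable
  qed
  also have "\<dots> = 0" by (rule orth[OF h'P])
  finally show "L2_inner (\<lambda>z. s * f (w * z) - s * g (w * z)) h = 0" by simp
qed

lemma szego_projection_AE_cong:
  assumes fg: "szego_projection f g" and m: "f' \<in> borel_measurable circle_measure" and eq: "AE z in circle_measure. f z = f' z"
  shows "szego_projection f' g"
  unfolding szego_projection_def
proof (intro conjI ballI)
  have fL: "f \<in> L2_circle" and gP: "g \<in> L2_plus" and orth: "\<And>h. h \<in> L2_plus \<Longrightarrow> L2_inner (\<lambda>z. f z - g z) h = 0"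
    using fg by (auto simp: szego_projection_def)
  show "f' \<in> L2_circle" by (rule L2_circle_AE_cong[OF fL m eq])
  show "g \<in> L2_plus" by (rule gP)
  fix h assume h: "h \<in> L2_plus"
  note ms = m L2_circleD(1)[OF fL] L2_circleD(1)[OF L2_plusD(1)[OF gP]] L2_circleD(1)[OF L2_circle_cnj[OF L2_plusD(1)[OF h]]]
  have "L2_inner (\<lambda>z. f' z - g z) h = L2_inner (\<lambda>z. f z - g z) h"
    unfolding L2_inner_def
  proof (rule integral_cong_AE)
    show "(\<lambda>z. (f' z - g z) * cnj (h z)) \<in> borel_measurable circle_measure"
      "(\<lambda>z. (f z - g z) * cnj (h z)) \<in> borel_measurable circle_measure"
      using ms by measurable
    show "AE z in circle_measure. (f' z - g z) * cnj (h z) = (f z - g z) * cnj (h z)"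
      using eq by eventually_elim simp
  qed
  then show "L2_inner (\<lambda>z. f' z - g z) h = 0" using orth[OF h] by simp
qed

lemma power_sum_L2_plus:
  assumes "b summable_on UNIV" shows "power_sum b \<in> L2_plus"
  using L2_circle_continuous[OF power_sum_continuous_circle[OF assms]] fourier_coeff_power_sum[OF assms]
  by (simp add: L2_plus_def)

text \<open>The difference is the conjugate of a power series without constant term, hence
  orthogonal to all of \<open>L2_plus\<close>. A projection is thereby certified by one pointwise
  identity on the circle.\<close>

lemma szego_projection_antianalytic:
  assumes f: "continuous_on (sphere 0 1) f" and b: "b summable_on UNIV" and e: "e summable_on UNIV"
    and eq: "\<And>z. norm z = 1 \<Longrightarrow> f z - power_sum b z = cnj (z * power_sum e z)"
  shows "szego_projection f (power_sum b)"
  unfolding szego_projection_def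
proof (intro conjI ballI)
  show "f \<in> L2_circle" by (rule L2_circle_continuous[OF f])
  show "power_sum b \<in> L2_plus" by (rule power_sum_L2_plus[OF b])
  fix h assume h: "h \<in> L2_plus"
  have hz: "integrable circle_measure (\<lambda>z. z powi 1 * h z)"
    by (intro L2_circle_integrable L2_circle_powi_mult L2_plusD(1)[OF h])
  have "L2_inner (\<lambda>z. f z - power_sum b z) h = (\<integral>z. cnj ((z powi 1 * h z) * power_sum e z) \<partial>circle_measure)"
    unfolding L2_inner_def by (rule Bochner_Integration.integral_cong) (auto simp: eq mult_ac)
  also have "\<dots> = cnj (\<integral>z. (z powi 1 * h z) * power_sum e z \<partial>circle_measure)"
    by (rule Bochner_Integration.integral_cnj)
  also have "(\<integral>z. (z powi 1 * h z) * power_sum e z \<partial>circle_measure) = (\<Sum>\<^sub>\<infinity>n. e n * (\<integral>z. (z powi 1 * h z) * z ^ n \<partial>circle_measure))"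
    by (rule integral_mult_power_sum(1)[OF e hz])
  also have "\<dots> = (\<Sum>\<^sub>\<infinity>n::nat. 0 :: complex)"
  proof (rule infsum_cong)
    fix n
    have "(\<integral>z. (z powi 1 * h z) * z ^ n \<partial>circle_measure) = fourier_coeff (\<lambda>z. z powi 1 * h z) (- int n)"
      by (simp add: fourier_coeff_def)
    also have "\<dots> = 0"
      unfolding fourier_coeff_powi_mult by (rule L2_plusD(2)[OF h]) simp
    finally show "e n * (\<integral>z. (z powi 1 * h z) * z ^ n \<partial>circle_measure) = 0" by simp
  qed
  finally show "L2_inner (\<lambda>z. f z - power_sum b z) h = 0" by simp
qed

lemma L2_norm_le_of_AE_bound:
  assumes f: "f \<in> borel_measurable circle_measure" and bd: "AE z in circle_measure. cmod (f z) \<le> B" and B: "B \<ge> 0"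
  shows "L2_norm f \<le> B"
proof -
  have sq: "AE z in circle_measure. (cmod (f z))\<^sup>2 \<le> B\<^sup>2"
    using bd by eventually_elim (intro power_mono, auto)
  have "integrable circle_measure (\<lambda>z. (cmod (f z))\<^sup>2)"
    by (rule circle.integrable_const_bound[of _ "B\<^sup>2"]) (use sq f in auto)
  then have "(\<integral>z. (cmod (f z))\<^sup>2 \<partial>circle_measure) \<le> (\<integral>z. B\<^sup>2 \<partial>circle_measure)"
    by (intro integral_mono_AE sq) auto
  then show ?thesis using B by (simp add: L2_norm_def real_le_lsqrt)
qed

lemma power_sum_lincomb:
  assumes "a summable_on UNIV" "b summable_on UNIV" "norm z \<le> 1"
  shows "power_sum (\<lambda>k. x * a k + y * b k) z = x * power_sum a z + y * power_sum b z"
proof -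
  have "power_sum (\<lambda>k. x * a k + y * b k) z = (\<Sum>\<^sub>\<infinity>k. x * (a k * z ^ k) + y * (b k * z ^ k))"
    unfolding power_sum_def by (intro infsum_cong) (simp add: algebra_simps)
  also have "\<dots> = (\<Sum>\<^sub>\<infinity>k. x * (a k * z ^ k)) + (\<Sum>\<^sub>\<infinity>k. y * (b k * z ^ k))"
    by (intro infsum_add summable_on_cmult_right power_sum_summable assms)
  also have "\<dots> = x * power_sum a z + y * power_sum b z"
    unfolding power_sum_def infsum_cmult_right' ..
  finally show ?thesis .
qed

lemma norm_power_sum_le:
  fixes b d :: "nat \<Rightarrow> complex"
  assumes b: "b summable_on UNIV" and d: "\<And>k. norm (d k) \<le> C * norm (b k)" and z: "norm z \<le> 1"
  shows "norm (power_sum d z) \<le> C * (\<Sum>\<^sub>\<infinity>k. norm (b k))"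
proof -
  have le: "norm (d k * z ^ k) \<le> C * norm (b k)" for k
  proof -
    have "norm (d k * z ^ k) \<le> norm (d k) * 1"
      unfolding norm_mult norm_power by (intro mult_left_mono power_le_one z) auto
    then show ?thesis using d[of k] by simp
  qed
  have s: "(\<lambda>k. C * norm (b k)) summable_on UNIV" by (intro summable_on_cmult_right summable_on_norm b)
  have s': "(\<lambda>k. norm (d k * z ^ k)) summable_on UNIV"
    by (rule summable_on_comparison_test[OF s]) (use le in auto)
  have "norm (power_sum d z) \<le> (\<Sum>\<^sub>\<infinity>k. norm (d k * z ^ k))"
    unfolding power_sum_def by (rule norm_infsum_bound[OF s'])
  also have "\<dots> \<le> (\<Sum>\<^sub>\<infinity>k. C * norm (b k))" by (rule infsum_mono[OF s' s le])
  also have "\<dots> = C * (\<Sum>\<^sub>\<infinity>k. norm (b k))" by (rule infsum_cmult_right')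
  finally show ?thesis .
qed

lemma int_sum_of_nat_sum:
  fixes f :: "int \<Rightarrow> real"
  assumes "\<And>k. k < 0 \<Longrightarrow> f k = 0"
  shows "f summable_on UNIV \<longleftrightarrow> (\<lambda>n. f (int n)) summable_on UNIV" "infsum f UNIV = (\<Sum>\<^sub>\<infinity>n. f (int n))"
proof -
  have z: "f k = 0" if "k \<in> UNIV - range int" for k
    using that assms[of k] nonneg_int_cases[of k] by (cases "k < 0") auto
  have "f summable_on UNIV \<longleftrightarrow> f summable_on range int"
    by (rule summable_on_cong_neutral) (use z in auto)
  also have "\<dots> \<longleftrightarrow> (\<lambda>n. f (int n)) summable_on UNIV"
    by (subst summable_on_reindex) (auto simp: o_def)
  finally show "f summable_on UNIV \<longleftrightarrow> (\<lambda>n. f (int n)) summable_on UNIV" .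
  have "infsum f UNIV = infsum f (range int)"
    by (rule infsum_cong_neutral) (use z in auto)
  also have "\<dots> = (\<Sum>\<^sub>\<infinity>n. f (int n))"
    by (subst infsum_reindex) (auto simp: o_def)
  finally show "infsum f UNIV = (\<Sum>\<^sub>\<infinity>n. f (int n))" .
qed

text \<open>Weight two is spent on the factor \<open>Suc n\<close> allowed in \<open>bd\<close> and
  on the Sobolev weight, crudely bounded by the square of \<open>Suc n\<close>. The allowance in
  \<open>bd\<close> is for differences in time, which bring down one frequency.\<close>

lemma sobolev_half_bound:
  assumes b: "weighted_l1 2 a" and C: "C \<ge> 0" and neg: "\<And>k. k < 0 \<Longrightarrow> fourier_coeff f k = 0"
    and bd: "\<And>n. cmod (fourier_coeff f (int n)) \<le> C * (real (Suc n) * cmod (a n))"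
  shows "(\<lambda>k::int. (1 + (real_of_int k)\<^sup>2) powr (1/2) * (cmod (fourier_coeff f k))\<^sup>2) summable_on UNIV"
    and "sobolev_norm (1/2) f \<le> C * seq_norm (\<lambda>k. of_nat (Suc k) ^ 2 * a k)"
proof -
  define b where "b = (\<lambda>k. of_nat (Suc k) ^ 2 * a k)"
  have nb: "norm (b k) = real (Suc k) ^ 2 * norm (a k)" for k
    unfolding b_def norm_mult norm_power norm_of_nat ..
  have "weighted_l1 0 b" using b unfolding weighted_l1_def nb by simp
  then have s: "(\<lambda>k. C\<^sup>2 * (norm (b k))\<^sup>2) summable_on UNIV"
    by (intro summable_on_cmult_right summable_norm_square)
  define F where "F = (\<lambda>k::int. (1 + (real_of_int k)\<^sup>2) powr (1/2) * (cmod (fourier_coeff f k))\<^sup>2)"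
  have F0: "F k = 0" if "k < 0" for k using neg[OF that] by (simp add: F_def)
  have Fle: "F (int n) \<le> C\<^sup>2 * (norm (b n))\<^sup>2" for n
  proof -
    have "(1 + (real n)\<^sup>2) powr (1/2) = sqrt (1 + (real n)\<^sup>2)" by (simp add: powr_half_sqrt add_nonneg_nonneg)
    also have "\<dots> \<le> real (Suc n)" by (intro real_le_lsqrt) (auto simp: power2_eq_square algebra_simps)
    also have "\<dots> \<le> (real (Suc n))\<^sup>2" by (rule self_le_power) auto
    finally have 1: "(1 + (real n)\<^sup>2) powr (1/2) \<le> (real (Suc n))\<^sup>2" .
    have 2: "(cmod (fourier_coeff f (int n)))\<^sup>2 \<le> (C * (real (Suc n) * cmod (a n)))\<^sup>2"
      by (intro power_mono bd) auto
    have "F (int n) \<le> (real (Suc n))\<^sup>2 * (C * (real (Suc n) * cmod (a n)))\<^sup>2"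
      unfolding F_def of_int_of_nat_eq by (intro mult_mono 1 2) auto
    also have "\<dots> = C\<^sup>2 * (norm (b n))\<^sup>2" unfolding nb by (simp only: power_mult_distrib power2_eq_square mult_ac)
    finally show ?thesis .
  qed
  have Fs: "(\<lambda>n. F (int n)) summable_on UNIV"
    by (rule summable_on_comparison_test[OF s Fle]) (simp add: F_def)
  then show "(\<lambda>k::int. (1 + (real_of_int k)\<^sup>2) powr (1/2) * (cmod (fourier_coeff f k))\<^sup>2) summable_on UNIV"
    using int_sum_of_nat_sum(1)[OF F0] unfolding F_def by simp
  have "infsum F UNIV \<le> (\<Sum>\<^sub>\<infinity>n. C\<^sup>2 * (norm (b n))\<^sup>2)"
    by (subst int_sum_of_nat_sum(2)) (auto intro: F0 infsum_mono[OF Fs s Fle])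
  also have "\<dots> = C\<^sup>2 * (\<Sum>\<^sub>\<infinity>n. (norm (b n))\<^sup>2)" by (rule infsum_cmult_right')
  finally have "sqrt (infsum F UNIV) \<le> sqrt (C\<^sup>2 * (\<Sum>\<^sub>\<infinity>n. (norm (b n))\<^sup>2))" by (rule real_sqrt_le_mono)
  also have "\<dots> = C * seq_norm b" using C by (simp add: real_sqrt_mult seq_norm_def)
  finally show "sobolev_norm (1/2) f \<le> C * seq_norm (\<lambda>k. of_nat (Suc k) ^ 2 * a k)"
    unfolding sobolev_norm_def F_def b_def .
qed

text \<open>Each mode evolves by its own phase, and the projection commutes with rotations, so the
  stationary equation propagates to all times. Weight two pays for the Taylor remainder, which is
  quadratic in the frequency.\<close>

proposition traveling_wave_datumI:
  fixes a :: "nat \<Rightarrow> complex"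
  assumes um: "u0 \<in> borel_measurable circle_measure" and eq: "AE z in circle_measure. u0 z = power_sum a z"
    and a: "weighted_l1 2 a"
    and proj: "szego_projection (\<lambda>z. of_real ((cmod (power_sum a z))\<^sup>2) * power_sum a z)
      (power_sum (\<lambda>k. of_real (\<omega> + c * real k) * a k))"
  shows "traveling_wave_datum c u0"
proof -
  define \<theta> where "\<theta> = (\<lambda>k. \<omega> + c * real k)"
  define S where "S = (\<lambda>t. exp (- \<i> * complex_of_real \<omega> * complex_of_real t))"
  define W where "W = (\<lambda>t. exp (- \<i> * complex_of_real c * complex_of_real t))"
  define E where "E = (\<lambda>t k. exp (- \<i> * complex_of_real (\<theta> k) * complex_of_real t))"
  \<comment> \<open>Built from \<open>u0\<close> itself rather than from its power series, so that
    \<open>u 0 = u0\<close> holds exactly and not just almost everywhere.\<close>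
  define u where "u = (\<lambda>t z. S t * u0 (W t * z))"
  define G where "G = power_sum (\<lambda>k. of_real (\<theta> k) * a k)"
  have nS: "norm (S t) = 1" and nW: "norm (W t) = 1" and nE: "norm (E t k) = 1" for t k
    unfolding S_def W_def E_def by (rule norm_exp_imaginary)+
  have E_eq: "E t k = S t * W t ^ k" for t k
    unfolding E_def S_def W_def \<theta>_def exp_of_nat_mult[symmetric] exp_add[symmetric]
    by (rule arg_cong[where f = exp]) (simp add: algebra_simps)
  define M where "M = \<bar>\<omega>\<bar> + \<bar>c\<bar>"
  have M: "M \<ge> 0" by (simp add: M_def)
  have \<theta>_le: "\<bar>\<theta> k\<bar> \<le> M * real (Suc k)" for k
  proof -
    have "\<bar>\<theta> k\<bar> \<le> \<bar>\<omega>\<bar> + \<bar>c\<bar> * real k"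
      using abs_triangle_ineq[of \<omega> "c * real k"] by (simp add: \<theta>_def abs_mult)
    also have "\<dots> \<le> \<bar>\<omega>\<bar> * real (Suc k) + \<bar>c\<bar> * real (Suc k)"
      by (intro add_mono mult_left_mono) (auto simp: mult_le_cancel_left1)
    finally show ?thesis by (simp add: M_def distrib_right)
  qed
  have a1: "weighted_l1 1 a" and a0: "weighted_l1 0 a" using weighted_l1_mono[OF a] by auto
  have as: "a summable_on UNIV" using a0 by (simp only: weighted_l1_0)
  have Eas: "(\<lambda>k. E t k * a k) summable_on UNIV" for t
    using weighted_l1_comparison[OF a0, of "\<lambda>k. E t k * a k" 1] by (simp add: norm_mult nE weighted_l1_0)
  have "weighted_l1 0 (\<lambda>k. of_real (\<theta> k) * a k)"
  proof (rule weighted_l1_comparison)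
    show "weighted_l1 0 (\<lambda>k. of_nat (Suc k) * a k)" using a1 weighted_l1_Suc[of 0 a] by simp
    show "cmod (of_real (\<theta> k) * a k) \<le> M * cmod (of_nat (Suc k) * a k)" for k
      using mult_right_mono[OF \<theta>_le norm_ge_zero, of k "a k"] unfolding norm_mult norm_of_nat by (simp add: mult.assoc)
  qed
  then have \<theta>as: "(\<lambda>k. of_real (\<theta> k) * a k) summable_on UNIV" by (simp only: weighted_l1_0)
  have U_eq: "S t * power_sum a (W t * z) = power_sum (\<lambda>k. E t k * a k) z" for t z
    unfolding power_sum_rotation E_eq ..
  have E\<theta>as: "(\<lambda>k. E t k * (of_real (\<theta> k) * a k)) summable_on UNIV" for t
    using weighted_l1_comparison[of 0 "\<lambda>k. of_real (\<theta> k) * a k" "\<lambda>k. E t k * (of_real (\<theta> k) * a k)" 1] \<theta>as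
    by (simp add: norm_mult nE weighted_l1_0)
  have G_eq: "S t * G (W t * z) = power_sum (\<lambda>k. E t k * (of_real (\<theta> k) * a k)) z" for t z
    unfolding G_def power_sum_rotation E_eq ..
  have u_AE: "AE z in circle_measure. u t z = power_sum (\<lambda>k. E t k * a k) z" for t
    using AE_rotation[OF nW[of t] eq] by eventually_elim (simp add: u_def U_eq)
  have umt: "u t \<in> borel_measurable circle_measure" for t
    unfolding u_def using measurable_compose[OF rotation_measurable[OF nW[of t]] um] by measurable
  have PL: "power_sum (\<lambda>k. E t k * a k) \<in> L2_plus" for t by (rule power_sum_L2_plus[OF Eas])
  have uL: "u t \<in> L2_circle" for t
  proof (rule L2_circle_AE_cong[OF L2_plusD(1)[OF PL] umt])
    show "AE z in circle_measure. power_sum (\<lambda>k. E t k * a k) z = u t z"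
      using u_AE[of t] by eventually_elim simp
  qed
  have uc: "fourier_coeff (u t) k = (if k \<ge> 0 then E t (nat k) * a (nat k) else 0)" for t k
    using fourier_coeff_cong_AE[OF u_AE umt L2_circleD(1)[OF L2_plusD(1)[OF PL]]] fourier_coeff_power_sum[OF Eas] by simp
  have uH: "u t \<in> H_half_plus" for t
  proof -
    have "cmod (fourier_coeff (u t) (int n)) \<le> 1 * (real (Suc n) * cmod (a n))" for n
      using mult_right_mono[of 1 "real (Suc n)" "cmod (a n)"] by (simp add: uc norm_mult nE)
    from sobolev_half_bound(1)[OF a _ _ this] show ?thesis
      using uL[of t] uc[of t] by (simp add: H_half_plus_def sobolev_def)
  qed
  have Elip: "cmod (E s k - E t k) \<le> \<bar>s - t\<bar> * (M * real (Suc k))" for s t k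
  proof -
    have "E s k - E t k = E t k * (exp (- \<i> * of_real (\<theta> k * (s - t))) - 1)"
      unfolding E_def right_diff_distrib exp_add[symmetric] by (simp add: algebra_simps)
    then have "cmod (E s k - E t k) \<le> \<bar>\<theta> k * (s - t)\<bar>"
      using exp_imaginary_bounds(1)[of "\<theta> k * (s - t)"] by (simp add: norm_mult nE)
    also have "\<dots> \<le> \<bar>s - t\<bar> * (M * real (Suc k))"
      unfolding abs_mult mult.commute[of _ "\<bar>s - t\<bar>"] by (intro mult_left_mono \<theta>_le) auto
    finally show ?thesis .
  qed
  have cont: "((\<lambda>s. sobolev_norm (1/2) (\<lambda>z. u s z - u t z)) \<longlongrightarrow> 0) (at t)" for t
  proof (rule tendsto_sandwich)
    define K where "K = seq_norm (\<lambda>k. of_nat (Suc k) ^ 2 * a k)"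
    have dc: "fourier_coeff (\<lambda>z. u s z - u t z) k = fourier_coeff (u s) k - fourier_coeff (u t) k" for s k
      using fourier_coeff_lincomb[OF L2_circle_integrable[OF uL[of s]] L2_circle_integrable[OF uL[of t]], of 1 "- 1" k] by simp
    have "sobolev_norm (1/2) (\<lambda>z. u s z - u t z) \<le> (\<bar>s - t\<bar> * M) * K" for s
      unfolding K_def
    proof (rule sobolev_half_bound(2)[OF a])
      fix n
      have "cmod (fourier_coeff (\<lambda>z. u s z - u t z) (int n)) = cmod (E s n - E t n) * cmod (a n)"
        unfolding dc uc norm_mult[symmetric] by (simp add: left_diff_distrib)
      also have "\<dots> \<le> (\<bar>s - t\<bar> * (M * real (Suc n))) * cmod (a n)"
        by (intro mult_right_mono Elip) auto
      finally show "cmod (fourier_coeff (\<lambda>z. u s z - u t z) (int n)) \<le> \<bar>s - t\<bar> * M * (real (Suc n) * cmod (a n))"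
        by (simp only: mult.assoc)
    qed (use M in \<open>auto simp: dc uc\<close>)
    then show "\<forall>\<^sub>F s in at t. sobolev_norm (1/2) (\<lambda>z. u s z - u t z) \<le> (\<bar>s - t\<bar> * M) * K" by simp
    show "\<forall>\<^sub>F s in at t. 0 \<le> sobolev_norm (1/2) (\<lambda>z. u s z - u t z)"
      unfolding sobolev_norm_def by (intro always_eventually allI real_sqrt_ge_zero infsum_nonneg) auto
    show "((\<lambda>s. (\<bar>s - t\<bar> * M) * K) \<longlongrightarrow> 0) (at t)"
      by (rule tendsto_eq_intros refl | simp)+
  qed simp
  have proj_t: "szego_projection (\<lambda>z. complex_of_real ((cmod (u t z))\<^sup>2) * u t z) (\<lambda>z. S t * G (W t * z))" for t
  proof -
    have p: "szego_projection (\<lambda>z. S t * (of_real ((cmod (power_sum a (W t * z)))\<^sup>2) * power_sum a (W t * z))) (\<lambda>z. S t * G (W t * z))"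
      using szego_projection_rotation[OF proj nW] by (simp add: G_def \<theta>_def)
    have AE_eq: "AE z in circle_measure. S t * (of_real ((cmod (power_sum a (W t * z)))\<^sup>2) * power_sum a (W t * z)) =
      complex_of_real ((cmod (u t z))\<^sup>2) * u t z"
      using AE_rotation[OF nW[of t] eq] by eventually_elim (simp add: u_def norm_mult nS)
    show ?thesis by (rule szego_projection_AE_cong[OF p _ AE_eq]) (use umt[of t] in measurable)
  qed
  have deriv: "((\<lambda>h. L2_norm (\<lambda>z. \<i> * ((u (t + h) z - u t z) / complex_of_real h) - S t * G (W t * z))) \<longlongrightarrow> 0) (at 0)" for t
  proof (rule tendsto_sandwich)
    define b where "b = (\<lambda>k. of_nat (Suc k) ^ 2 * a k)"
    define K where "K = (\<Sum>\<^sub>\<infinity>k. norm (b k))"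
    have nb: "norm (b k) = real (Suc k) ^ 2 * norm (a k)" for k
      unfolding b_def norm_mult norm_power norm_of_nat ..
    have "weighted_l1 0 b" using a unfolding weighted_l1_def nb by simp
    then have bs: "b summable_on UNIV" by (simp only: weighted_l1_0)
    have K: "K \<ge> 0" unfolding K_def by (intro infsum_nonneg) auto
    have "L2_norm (\<lambda>z. \<i> * ((u (t + h) z - u t z) / complex_of_real h) - S t * G (W t * z)) \<le> (\<bar>h\<bar> * M\<^sup>2) * K" if h: "h \<noteq> 0" for h
    proof (rule L2_norm_le_of_AE_bound)
      have "(\<lambda>z. S t * G (W t * z)) \<in> borel_measurable circle_measure"
        using proj_t[of t] L2_plusD(1) L2_circleD(1) by (auto simp: szego_projection_def)
      then show "(\<lambda>z. \<i> * ((u (t + h) z - u t z) / complex_of_real h) - S t * G (W t * z)) \<in> borel_measurable circle_measure"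
        using umt[of "t + h"] umt[of t] by measurable
      \<comment> \<open>Coefficients of the error in the difference quotient; the terms of first
        order cancel, leaving the quadratic remainder of the exponential.\<close>
      define d where "d = (\<lambda>k. \<i> / of_real h * (E (t + h) k * a k) + (- 1) * ((\<i> / of_real h) * (E t k * a k) + 1 * (E t k * (of_real (\<theta> k) * a k))))"
      have d_le: "norm (d k) \<le> (\<bar>h\<bar> * M\<^sup>2) * norm (b k)" for k
      proof -
        have Et: "E (t + h) k = E t k * exp (- \<i> * of_real (\<theta> k * h))"
          unfolding E_def exp_add[symmetric] by (simp add: algebra_simps)
        have "d k = (\<i> / of_real h) * (E t k * a k) * (exp (- \<i> * of_real (\<theta> k * h)) - 1 + \<i> * of_real (\<theta> k * h))"
          unfolding d_def Et using h by (simp add: field_simps)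
        then have "norm (d k) = norm (a k) / \<bar>h\<bar> * cmod (exp (- \<i> * of_real (\<theta> k * h)) - 1 + \<i> * of_real (\<theta> k * h))"
          by (simp only: norm_mult norm_divide nE norm_of_real norm_ii) simp
        also have "\<dots> \<le> norm (a k) / \<bar>h\<bar> * (\<theta> k * h)\<^sup>2"
          by (intro mult_left_mono exp_imaginary_bounds) auto
        also have "\<dots> = \<bar>h\<bar> * (\<bar>\<theta> k\<bar>\<^sup>2 * norm (a k))"
          using h by (cases "h > 0") (auto simp: power2_eq_square field_simps)
        also have "\<dots> \<le> \<bar>h\<bar> * ((M * real (Suc k))\<^sup>2 * norm (a k))"
          by (intro mult_left_mono mult_right_mono power_mono \<theta>_le) auto
        finally show ?thesis unfolding nb by (simp only: power_mult_distrib mult_ac)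
      qed
      show "AE z in circle_measure. cmod (\<i> * ((u (t + h) z - u t z) / complex_of_real h) - S t * G (W t * z)) \<le> (\<bar>h\<bar> * M\<^sup>2) * K"
        using u_AE[of "t + h"] u_AE[of t] AE_space
      proof eventually_elim
        case (elim z)
        then have z: "norm z \<le> 1" by simp
        have s: "(\<lambda>k. (\<i> / of_real h) * (E t k * a k) + 1 * (E t k * (of_real (\<theta> k) * a k))) summable_on UNIV"
          by (intro summable_on_add summable_on_cmult_right Eas E\<theta>as)
        have "power_sum d z = \<i> / of_real h * u (t + h) z + (- 1) * ((\<i> / of_real h) * u t z + 1 * (S t * G (W t * z)))"
          unfolding d_def power_sum_lincomb[OF Eas s z] power_sum_lincomb[OF Eas E\<theta>as z] elim G_eq ..
        also have "\<dots> = \<i> * ((u (t + h) z - u t z) / complex_of_real h) - S t * G (W t * z)"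
          using h by (simp add: field_simps)
        finally show ?case using norm_power_sum_le[OF bs d_le z] unfolding K_def by simp
      qed
      show "0 \<le> (\<bar>h\<bar> * M\<^sup>2) * K" using K by simp
    qed
    then show "\<forall>\<^sub>F h in at 0. L2_norm (\<lambda>z. \<i> * ((u (t + h) z - u t z) / complex_of_real h) - S t * G (W t * z)) \<le> (\<bar>h\<bar> * M\<^sup>2) * K"
      by (auto simp: eventually_at_filter)
    show "\<forall>\<^sub>F h in at 0. 0 \<le> L2_norm (\<lambda>z. \<i> * ((u (t + h) z - u t z) / complex_of_real h) - S t * G (W t * z))"
      unfolding L2_norm_def by (intro always_eventually allI real_sqrt_ge_zero Bochner_Integration.integral_nonneg) auto
    show "((\<lambda>h. (\<bar>h\<bar> * M\<^sup>2) * K) \<longlongrightarrow> 0) (at 0)"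
      by (rule tendsto_eq_intros refl | simp)+
  qed simp
  have u0: "u 0 = u0" by (simp add: u_def S_def W_def)
  have "szego_solution u"
    unfolding szego_solution_def using uH cont proj_t deriv by blast
  moreover have "AE z in circle_measure. u t z = exp (- \<i> * of_real \<omega> * of_real t) * u 0 (exp (- \<i> * of_real c * of_real t) * z)" for t
    unfolding u0 by (simp add: u_def S_def W_def)
  ultimately have "traveling_wave u \<omega> c" unfolding traveling_wave_def by blast
  then show ?thesis unfolding traveling_wave_datum_def using u0 by blast
qed

section \<open>The two families satisfy the stationary equation\<close>

lemma blaschke_traveling_wave:
  assumes um: "u0 \<in> borel_measurable circle_measure" and p: "\<forall>j\<in>{1..n::nat}. cmod (p j) < 1"
    and eq: "AE z in circle_measure. u0 z = \<alpha> * (\<Prod>j=1..n. (z - cnj (p j)) / (1 - p j * z))"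
  shows "traveling_wave_datum 0 u0"
proof -
  define h where "h = (\<lambda>z. \<alpha> * (\<Prod>j=1..n. (z - cnj (p j)) / (1 - p j * z)))"
  define m where "m = Max (insert 0 ((\<lambda>j. cmod (p j)) ` {1..n}))"
  have m: "0 \<le> m" "m < 1" using p by (auto simp: m_def)
  have pm: "cmod (p j) \<le> m" if "j \<in> {1..n}" for j
    unfolding m_def by (rule Max_ge) (use that in auto)
  \<comment> \<open>A radius above 1 that still satisfies \<open>m * R < 1\<close>, so that no pole
    \<open>1 / p j\<close> lies in the ball.\<close>
  define R where "R = 2 / (1 + m)"
  have R: "R > 1" "m * R < 1" using m by (auto simp: R_def field_simps)
  have den: "1 - p j * z \<noteq> 0" if j: "j \<in> {1..n}" and z: "z \<in> ball 0 R" for j z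
  proof
    assume "1 - p j * z = 0"
    then have "cmod (p j) * cmod z = 1" by (metis eq_iff_diff_eq_0 norm_mult norm_one)
    moreover have "cmod (p j) * cmod z \<le> m * R" using m pm[OF j] z by (intro mult_mono) auto
    ultimately show False using R by simp
  qed
  have hol: "h holomorphic_on ball 0 R"
    unfolding h_def by (intro holomorphic_intros den)
  obtain a r where r: "r > 1" "summable (\<lambda>n. norm (a n) * r ^ n)" and ah: "\<And>z. norm z \<le> 1 \<Longrightarrow> power_sum a z = h z"
    by (rule holomorphic_power_sum[OF hol R(1)], rule that)
  have as: "a summable_on UNIV" by (rule summable_of_exponential_bound[OF r])
  have h_mod: "cmod (h z) = cmod \<alpha>" if z: "norm z = 1" for z
  proof -
    have "cmod (\<Prod>j=1..n. (z - cnj (p j)) / (1 - p j * z)) = (\<Prod>j=1..n. cmod ((z - cnj (p j)) / (1 - p j * z)))"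
      by (rule prod_norm[symmetric])
    also have "\<dots> = 1"
    proof (rule prod.neutral, rule ballI)
      fix j assume j: "j \<in> {1..n}"
      show "cmod ((z - cnj (p j)) / (1 - p j * z)) = 1"
        using norm_blaschke_factor[OF z, of "cnj (p j)"] one_minus_nonzero[of "p j" z] p j z by (simp add: norm_divide)
    qed
    finally show ?thesis by (simp add: h_def norm_mult)
  qed
  show ?thesis
  proof (rule traveling_wave_datumI[OF um _ weighted_l1_of_exponential_bound[OF r]])
    show "AE z in circle_measure. u0 z = power_sum a z"
      using eq AE_space by eventually_elim (simp add: ah h_def)
    have pc: "continuous_on (sphere 0 1) (power_sum a)" by (rule power_sum_continuous_circle[OF as])
    \<comment> \<open>The modulus on the circle is \<open>cmod \<alpha>\<close>, so the cubic term
      is already a multiple of the function: the pulsation is \<open>(cmod \<alpha>)\<^sup>2\<close>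
      and the antianalytic part is zero.\<close>
    show "szego_projection (\<lambda>z. of_real ((cmod (power_sum a z))\<^sup>2) * power_sum a z)
      (power_sum (\<lambda>k. of_real ((cmod \<alpha>)\<^sup>2 + 0 * real k) * a k))"
    proof (rule szego_projection_antianalytic)
      show "continuous_on (sphere 0 1) (\<lambda>z. of_real ((cmod (power_sum a z))\<^sup>2) * power_sum a z)"
        by (intro continuous_intros pc)
      show "(\<lambda>k. of_real ((cmod \<alpha>)\<^sup>2 + 0 * real k) * a k) summable_on UNIV"
        using summable_on_cmult_right[OF as, of "of_real ((cmod \<alpha>)\<^sup>2)"] by simp
      show "(\<lambda>_. 0 :: complex) summable_on (UNIV :: nat set)" by simp
      fix z :: complex assume z: "norm z = 1"
      have "power_sum (\<lambda>k. of_real ((cmod \<alpha>)\<^sup>2 + 0 * real k) * a k) z = of_real ((cmod \<alpha>)\<^sup>2) * power_sum a z"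
        using power_sum_rotation[of "of_real ((cmod \<alpha>)\<^sup>2)" a 1 z] by simp
      moreover have "cmod (power_sum a z) = cmod \<alpha>" using ah[of z] h_mod[OF z] z by simp
      ultimately show "of_real ((cmod (power_sum a z))\<^sup>2) * power_sum a z - power_sum (\<lambda>k. of_real ((cmod \<alpha>)\<^sup>2 + 0 * real k) * a k) z =
        cnj (z * power_sum (\<lambda>_. 0) z)"
        by (simp add: power_sum_def)
    qed
  qed
qed

text \<open>In the application \<open>W = q * z ^ N\<close> and \<open>V\<close> is its conjugate,
  so on the circle \<open>W * V\<close> is a constant. The first fraction is the cubic term up to a
  factor; its poles at \<open>W = 1\<close> give the part in \<open>L2_plus\<close>, the pole at
  \<open>V = 1\<close> the antianalytic remainder.\<close>

lemma szego_partial_fractions: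
  fixes V W :: complex
  assumes "1 - V \<noteq> 0" "1 - W \<noteq> 0" "1 - W * V \<noteq> 0"
  shows "1 / ((1 - W)\<^sup>2 * (1 - V)) - (1 / (1 - W * V) * (1 / (1 - W)\<^sup>2) + W * V / (1 - W * V)\<^sup>2 * (1 / (1 - W))) =
    V / (1 - W * V)\<^sup>2 * (1 / (1 - V))"
proof -
  define A B C where "A = 1 - W" and "B = 1 - V" and "C = 1 - W * V"
  have ABC: "A \<noteq> 0" "B \<noteq> 0" "C \<noteq> 0" using assms by (auto simp: A_def B_def C_def)
  have "C\<^sup>2 - (C * B + W * V * A * B) = V * A\<^sup>2"
    by (simp add: A_def B_def C_def power2_eq_square algebra_simps)
  then have "(C\<^sup>2 - (C * B + W * V * A * B)) / (A\<^sup>2 * B * C\<^sup>2) = V * A\<^sup>2 / (A\<^sup>2 * B * C\<^sup>2)" by simp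
  moreover have "(C\<^sup>2 - (C * B + W * V * A * B)) / (A\<^sup>2 * B * C\<^sup>2) =
      1 / (A\<^sup>2 * B) - (1 / C * (1 / A\<^sup>2) + W * V / C\<^sup>2 * (1 / A))"
    using ABC by (simp add: field_simps power2_eq_square)
  moreover have "V * A\<^sup>2 / (A\<^sup>2 * B * C\<^sup>2) = V / C\<^sup>2 * (1 / B)"
    using ABC by (simp add: field_simps)
  ultimately show ?thesis unfolding A_def B_def C_def by simp
qed

lemma geometric_traveling_wave:
  assumes um: "u0 \<in> borel_measurable circle_measure" and l: "l < N" and q: "cmod q < 1"
    and eq: "AE z in circle_measure. u0 z = \<alpha> * (z ^ l / (1 - q * z ^ N))"
  shows "\<exists>c. c \<noteq> 0 \<and> traveling_wave_datum c u0"
proof -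
  define A where "A = (cmod \<alpha>)\<^sup>2"
  define r where "r = (cmod q)\<^sup>2"
  have r: "0 \<le> r" "r < 1" using q by (auto simp: r_def power_less_one_iff)
  have N: "N > 0" using l by simp
  \<comment> \<open>At \<open>k = N * m + l\<close> the projected cubic term has a coefficient ratio
    affine in \<open>m\<close>. Matching it with \<open>\<omega> + c * k\<close> determines
    \<open>c\<close> from the slope and \<open>\<omega>\<close> from the rest; for
    \<open>\<alpha> = 0\<close> any nonzero velocity will do.\<close>
  define c where "c = (if \<alpha> = 0 then 1 else A / (real N * (1 - r)))"
  have c: "c \<noteq> 0" using N r by (simp add: c_def A_def)
  define \<omega> where "\<omega> = A * (1 / (1 - r) + r / (1 - r)\<^sup>2) - c * real l"
  define a where "a = (\<lambda>k. if k mod N = l then \<alpha> * q ^ (k div N) else 0)"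
  define x where "x = of_real A * \<alpha> / (1 - of_real r)"
  define y where "y = of_real A * \<alpha> * of_real r / (1 - of_real r)\<^sup>2"
  define \<beta> where "\<beta> = (\<lambda>m. x * (of_nat (Suc m) * q ^ m) + y * q ^ m)"
  define K where "K = cnj \<alpha> * of_real A * q / (1 - of_real r)\<^sup>2"
  \<comment> \<open>The conjugated antianalytic remainder divided by \<open>z\<close>: its leading
    power is \<open>N - 1 - l\<close>, because on the circle the conjugate of
    \<open>z ^ (N - l)\<close> is \<open>cnj (z ^ N)\<close> times \<open>z ^ l\<close>.\<close>
  define e where "e = (\<lambda>k. if k mod N = N - 1 - l then K * q ^ (k div N) else 0)"
  have l': "N - 1 - l < N" using l by simp
  have g0: "(\<lambda>m. q ^ m) summable_on UNIV" using weighted_l1_geometric[OF q, of 0] by (simp only: weighted_l1_0)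
  have g1: "(\<lambda>m. of_nat (Suc m) * q ^ m) summable_on UNIV"
    using weighted_l1_geometric[OF q, of "Suc 0"] by (simp only: weighted_l1_Suc weighted_l1_0)
  have aw: "weighted_l1 2 a"
    unfolding a_def by (intro weighted_l1_progression[OF _ l] weighted_l1_cmult weighted_l1_geometric q)
  have as: "a summable_on UNIV" using weighted_l1_summable[OF aw] .
  have es: "e summable_on UNIV"
    using weighted_l1_progression[OF weighted_l1_cmult[OF weighted_l1_geometric[OF q, of 0]] l', of K]
    unfolding e_def weighted_l1_0 .
  have \<beta>s: "(\<lambda>k. if k mod N = l then \<beta> (k div N) else 0) summable_on UNIV"
  proof -
    have "weighted_l1 0 \<beta>" unfolding \<beta>_def weighted_l1_0 by (intro summable_on_add summable_on_cmult_right g0 g1)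
    from weighted_l1_progression[OF this l] show ?thesis unfolding weighted_l1_0 .
  qed
  have \<theta>a: "of_real (\<omega> + c * real k) * a k = (if k mod N = l then \<beta> (k div N) else 0)" for k
  proof (cases "k mod N = l \<and> \<alpha> \<noteq> 0")
    case True
    define m where "m = k div N"
    have k: "k = N * m + l" unfolding m_def using True mult_div_mod_eq[of N k] by linarith
    have cN: "c * real N = A / (1 - r)" using True N r by (simp add: c_def)
    have "\<omega> + c * real k = A * (1 / (1 - r) + r / (1 - r)\<^sup>2) + (c * real N) * real m"
      by (simp add: \<omega>_def k algebra_simps)
    also have "\<dots> = A / (1 - r) * real (Suc m) + A * r / (1 - r)\<^sup>2"
      unfolding cN by (simp add: add_divide_distrib algebra_simps)
    finally have \<theta>: "\<omega> + c * real k = A / (1 - r) * real (Suc m) + A * r / (1 - r)\<^sup>2" .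
    have "of_real (\<omega> + c * real k) * (\<alpha> * q ^ m) = \<beta> m"
      unfolding \<theta> \<beta>_def x_def y_def by (simp add: algebra_simps add_divide_distrib)
    then show ?thesis using True by (simp add: a_def m_def)
  next
    case False
    then show ?thesis by (auto simp: a_def \<beta>_def x_def y_def)
  qed
  have pa: "power_sum a z = \<alpha> * (z ^ l / (1 - q * z ^ N))" if z: "norm z = 1" for z
    by (rule geometric_power_sum[OF _ l q z]) (simp add: a_def)
  have pe: "z * power_sum e z = z ^ (N - l) * (K * (1 / (1 - q * z ^ N)))" if z: "norm z = 1" for z
  proof -
    have "power_sum e z = K * (z ^ (N - 1 - l) / (1 - q * z ^ N))"
      by (rule geometric_power_sum[OF _ l' q z]) (simp add: e_def)
    then have "z * power_sum e z = z ^ Suc (N - 1 - l) * (K * (1 / (1 - q * z ^ N)))" by simp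
    also have "Suc (N - 1 - l) = N - l" using l by simp
    finally show ?thesis .
  qed
  have pb: "power_sum (\<lambda>k. if k mod N = l then \<beta> (k div N) else 0) z =
      z ^ l * (x * (1 / (1 - q * z ^ N)\<^sup>2) + y * (1 / (1 - q * z ^ N)))" if z: "norm z = 1" for z
  proof -
    have zN: "norm (z ^ N) \<le> 1" using z by (simp add: norm_power)
    have "power_sum \<beta> (z ^ N) = x * (1 / (1 - q * z ^ N)\<^sup>2) + y * (1 / (1 - q * z ^ N))"
      unfolding \<beta>_def power_sum_lincomb[OF g1 g0 zN] power_sum_geometric[OF q zN] ..
    then show ?thesis by (simp only: power_sum_progression[OF l])
  qed
  have "traveling_wave_datum c u0"
  proof (rule traveling_wave_datumI[OF um _ aw])
    show "AE z in circle_measure. u0 z = power_sum a z"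
      using eq AE_space by eventually_elim (simp add: pa)
    have pc: "continuous_on (sphere 0 1) (power_sum a)" by (rule power_sum_continuous_circle[OF as])
    show "szego_projection (\<lambda>z. of_real ((cmod (power_sum a z))\<^sup>2) * power_sum a z)
      (power_sum (\<lambda>k. of_real (\<omega> + c * real k) * a k))"
      unfolding \<theta>a
    proof (rule szego_projection_antianalytic[OF _ \<beta>s es])
      show "continuous_on (sphere 0 1) (\<lambda>z. of_real ((cmod (power_sum a z))\<^sup>2) * power_sum a z)"
        by (intro continuous_intros pc)
      fix z :: complex assume z: "norm z = 1"
      define W where "W = q * z ^ N"
      define V where "V = cnj W"
      have WV: "W * V = of_real r"
        unfolding V_def complex_norm_square[symmetric] W_def r_def using z by (simp add: norm_mult norm_power)
      have nz: "1 - W \<noteq> 0" "1 - V \<noteq> 0"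
      proof -
        show W1: "1 - W \<noteq> 0" unfolding W_def by (rule one_minus_nonzero[OF q]) (use z in \<open>simp add: norm_power\<close>)
        have "1 - V = cnj (1 - W)" by (simp add: V_def)
        then show "1 - V \<noteq> 0" using W1 by (metis complex_cnj_zero_iff)
      qed
      have nz3: "1 - W * V \<noteq> 0" unfolding WV using r(2) by (metis eq_iff_diff_eq_0 less_irrefl of_real_1 of_real_eq_iff)
      have zz: "z ^ k * cnj (z ^ k) = 1" for k
        unfolding complex_norm_square[symmetric] using z by (simp add: norm_power)
      have P: "power_sum a z = \<alpha> * z ^ l / (1 - W)" using pa[OF z] by (simp add: W_def)
      have "of_real ((cmod (power_sum a z))\<^sup>2) = power_sum a z * cnj (power_sum a z)" by (rule complex_norm_square)
      also have "\<dots> = (\<alpha> * cnj \<alpha>) * (z ^ l * cnj (z ^ l)) / ((1 - W) * (1 - V))"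
        unfolding P V_def by (simp add: mult_ac)
      also have "\<dots> = of_real A / ((1 - W) * (1 - V))"
        unfolding zz A_def complex_norm_square by simp
      finally have mod2: "of_real ((cmod (power_sum a z))\<^sup>2) = complex_of_real A / ((1 - W) * (1 - V))" .
      have lhs: "of_real ((cmod (power_sum a z))\<^sup>2) * power_sum a z = of_real A * \<alpha> * z ^ l * (1 / ((1 - W)\<^sup>2 * (1 - V)))"
        unfolding mod2 unfolding P by (simp add: power2_eq_square mult_ac)
      have "cnj (z * power_sum e z) = cnj (z ^ (N - l)) * (cnj K * (1 / (1 - V)))"
        unfolding pe[OF z] V_def W_def by simp
      also have "cnj K = of_real A * \<alpha> * cnj q / (1 - W * V)\<^sup>2"
        unfolding K_def WV by (simp add: mult_ac)
      also have "cnj (z ^ (N - l)) = cnj (z ^ N) * z ^ l"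
      proof -
        have "cnj (z ^ N) * z ^ l = cnj (z ^ (N - l)) * (z ^ l * cnj (z ^ l))"
          using l power_add[of z "N - l" l] by simp
        then show ?thesis unfolding zz by simp
      qed
      also have "cnj (z ^ N) * z ^ l * (of_real A * \<alpha> * cnj q / (1 - W * V)\<^sup>2 * (1 / (1 - V))) =
          of_real A * \<alpha> * z ^ l * (V / (1 - W * V)\<^sup>2 * (1 / (1 - V)))"
        by (simp add: V_def W_def)
      finally have rhs: "cnj (z * power_sum e z) = of_real A * \<alpha> * z ^ l * (V / (1 - W * V)\<^sup>2 * (1 / (1 - V)))" .
      have mid: "z ^ l * (x * (1 / (1 - q * z ^ N)\<^sup>2) + y * (1 / (1 - q * z ^ N))) =
          of_real A * \<alpha> * z ^ l * (1 / (1 - W * V) * (1 / (1 - W)\<^sup>2) + W * V / (1 - W * V)\<^sup>2 * (1 / (1 - W)))"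
        unfolding x_def y_def W_def[symmetric] WV by (simp add: algebra_simps)
      show "of_real ((cmod (power_sum a z))\<^sup>2) * power_sum a z -
          power_sum (\<lambda>k. if k mod N = l then \<beta> (k div N) else 0) z = cnj (z * power_sum e z)"
        unfolding lhs rhs pb[OF z] mid right_diff_distrib[symmetric] szego_partial_fractions[OF nz(2) nz(1) nz3] ..
    qed
  qed
  then show ?thesis using c by blast
qed

text \<open>Nonzero constants are stationary but are no Blaschke products with
  \<open>N \<ge> 1\<close>, hence the separate alternative. In the second part the velocity is
  existential, because a given datum need not admit every nonzero velocity.\<close>

theorem theorem1p4:
  fixes u0 :: "complex \<Rightarrow> complex"
  assumes "u0 \<in> borel_measurable circle_measure"
  shows
    "(traveling_wave_datum 0 u0 \<longleftrightarrow>
        (\<exists>(\<alpha>::complex) (N::nat) (p::nat \<Rightarrow> complex).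
            N \<ge> 1 \<and> (\<forall>j\<in>{1..N}. cmod (p j) < 1) \<and>
            (AE z in circle_measure. u0 z = \<alpha> * (\<Prod>j=1..N. (z - cnj (p j)) / (1 - p j * z))))
        \<or> (\<exists>\<alpha>::complex. AE z in circle_measure. u0 z = \<alpha>))
     \<and> ((\<exists>c. c \<noteq> 0 \<and> traveling_wave_datum c u0) \<longleftrightarrow>
        (\<exists>(\<alpha>::complex) (p::complex) (N::nat) (l::nat).
            N \<ge> 1 \<and> l \<le> N - 1 \<and> cmod p < 1 \<and>
            (AE z in circle_measure. u0 z = \<alpha> * (z ^ l / (1 - p ^ N * z ^ N)))))"
proof (intro conjI iffI)
  assume "traveling_wave_datum 0 u0"
  then show "(\<exists>(\<alpha>::complex) (N::nat) (p::nat \<Rightarrow> complex).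
            N \<ge> 1 \<and> (\<forall>j\<in>{1..N}. cmod (p j) < 1) \<and>
            (AE z in circle_measure. u0 z = \<alpha> * (\<Prod>j=1..N. (z - cnj (p j)) / (1 - p j * z))))
        \<or> (\<exists>\<alpha>::complex. AE z in circle_measure. u0 z = \<alpha>)"
    by (rule traveling_wave_datum_zero_velocity)
next
  assume "(\<exists>(\<alpha>::complex) (N::nat) (p::nat \<Rightarrow> complex).
            N \<ge> 1 \<and> (\<forall>j\<in>{1..N}. cmod (p j) < 1) \<and>
            (AE z in circle_measure. u0 z = \<alpha> * (\<Prod>j=1..N. (z - cnj (p j)) / (1 - p j * z))))
        \<or> (\<exists>\<alpha>::complex. AE z in circle_measure. u0 z = \<alpha>)"
  then show "traveling_wave_datum 0 u0"
  proof (elim disjE exE conjE)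
    fix \<alpha> and N :: nat and p
    assume "\<forall>j\<in>{1..N}. cmod (p j) < 1"
      "AE z in circle_measure. u0 z = \<alpha> * (\<Prod>j=1..N. (z - cnj (p j)) / (1 - p j * z))"
    then show ?thesis by (rule blaschke_traveling_wave[OF assms])
  next
    fix \<alpha> assume "AE z in circle_measure. u0 z = \<alpha>"
    then show ?thesis by (intro blaschke_traveling_wave[OF assms, where n = 0 and p = "\<lambda>_. 0" and \<alpha> = \<alpha>]) auto
  qed
next
  assume "\<exists>c. c \<noteq> 0 \<and> traveling_wave_datum c u0"
  then obtain c where c: "c \<noteq> 0" "traveling_wave_datum c u0" by blast
  show "\<exists>(\<alpha>::complex) (p::complex) (N::nat) (l::nat).
            N \<ge> 1 \<and> l \<le> N - 1 \<and> cmod p < 1 \<and>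
            (AE z in circle_measure. u0 z = \<alpha> * (z ^ l / (1 - p ^ N * z ^ N)))"
    by (rule traveling_wave_datum_nonzero_velocity[OF c(2,1)]) (intro exI conjI)
next
  assume "\<exists>(\<alpha>::complex) (p::complex) (N::nat) (l::nat).
            N \<ge> 1 \<and> l \<le> N - 1 \<and> cmod p < 1 \<and>
            (AE z in circle_measure. u0 z = \<alpha> * (z ^ l / (1 - p ^ N * z ^ N)))"
  then obtain \<alpha> p :: complex and N l :: nat where N: "N \<ge> 1" "l \<le> N - 1" and p: "cmod p < 1"
    and eq: "AE z in circle_measure. u0 z = \<alpha> * (z ^ l / (1 - p ^ N * z ^ N))" by blast
  have "cmod (p ^ N) < 1" using p N by (simp add: norm_power power_less_one_iff)
  then show "\<exists>c. c \<noteq> 0 \<and> traveling_wave_datum c u0"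
    using N by (intro geometric_traveling_wave[OF assms _ _ eq]) auto
qed

end
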